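(* Let $(M,F)$ be a compact Finsler manifold of dimension $d$ with Busemann-Hausdorff measure $m_F$. Then for every integer $k\ge 1$, every constant $c$ with $0<c\le m_F(M)$ and every $f\in L^2(M,m_F)$, each of the following two problems has a solution: $$\min\Big\{\lambda_k(\Omega)\ :\ \Omega\subset M\text{ quasi-open},\ m_F(\Omega)\le c\Big\},$$ $$\min\Big\{E_f(\Omega)\ :\ \Omega\subset M\text{ quasi-open},\ m_F(\Omega)\le c\Big\}.$$
   Context: Finsler structure: $M$ is a differentiable manifold of dimension $d$ with a map $F:TM\to[0,+\infty)$ that is smooth on $TM\setminus\{0\}$, 1-homogeneous ($F(x,\lambda X)=|\lambda|F(x,X)$ for all $\lambda\in\mathbb{R}$), and strictly convex in the sense that the matrix $\frac12\frac{\partial^2}{\partial X^i\partial X^j}[F^2](x,X)$ is positive definite for every $(x,X)$ with $X\neq0$; thus $F(x,\cdot)$ is a norm on $T_xM$. The co-Finsler metric is $F^*(x,\xi)=\sup_{y\in T_xM,\,y\ne0}\frac{\xi(y)}{F(x,y)}$ for $\xi\in T_x^*M$. For $u\in C^\infty(M)$ put $Du(x)=F^*(x,du_x)$, where $du_x$ is the differential of $u$ at $x$. The distance is $d_F(x,y)=\inf\{\int_0^1F(\gamma(t),\dot\gamma(t))\,dt:\ \gamma:[0,1]\to M,\ \gamma(0)=x,\ \gamma(1)=y\}$, and the Busemann-Hausdorff measure $m_F$ is the $d$-dimensional Hausdorff measure with respect to $d_F$. Let $m=m_F$ and let $H$ be the closure of $C_c^\infty(M)$ with respect to the norm $\|u\|_H=(\|u\|_{L^2(m)}^2+\|Du\|_{L^2(m)}^2)^{1/2}$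 (with $Du$ extended to $H$ by density, i.e. $Du=F^*(x,du_x)$ with $du$ the weak differential). Capacity: for $E\subset M$, $\operatorname{cap}(E)=\inf\{\|u\|_H^2:\ u\in H,\ u\ge0\text{ on }M,\ u\ge1\text{ in a neighbourhood of }E\}$. Functions in $H$ are identified with their quasi-continuous representatives (defined up to sets of zero capacity). A set is quasi-open if (up to a set of zero capacity) it is of the form $\{u>0\}$ for some $u\in H$. For $\Omega\subset M$, $H_0(\Omega)=\{u\in H:\ \operatorname{cap}(\{u\ne0\}\setminus\Omega)=0\}$. Eigenvalues: $\lambda_k(\Omega)=\inf_{K}\sup\{\int_\Omega|Du|^2\,dm:\ u\in K,\ \int_\Omega u^2\,dm=1\}$, the infimum being over all $k$-dimensional linear subspaces $K$ of $H_0(\Omega)$ (infimum over the empty family is $+\infty$). Dirichlet energy: $E_f(\Omega)=\inf\{\frac12\int_\Omega|Du|^2\,dm+\frac12\int_\Omega u^2\,dm-\int_\Omega uf\,dm:\ u\in H_0(\Omega)\}$. *)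

theory Defs
  imports "HOL-Analysis.Analysis"
begin

section \<open>Smooth functions on open subsets of Euclidean space\<close>

fun Ck_on :: "nat \<Rightarrow> 'a::real_normed_vector set \<Rightarrow> ('a \<Rightarrow> 'b::real_normed_vector) \<Rightarrow> bool" where
  "Ck_on 0 S f \<longleftrightarrow> continuous_on S f"
| "Ck_on (Suc n) S f \<longleftrightarrow>
     (\<forall>x\<in>S. f differentiable (at x)) \<and> (\<forall>v. Ck_on n S (\<lambda>x. frechet_derivative f (at x) v))"

text \<open>Only used for open \<open>S\<close>.\<close>

definition smooth_on :: "'a::real_normed_vector set \<Rightarrow> ('a \<Rightarrow> 'b::real_normed_vector) \<Rightarrow> bool" where
  "smooth_on S f \<longleftrightarrow> (\<forall>n. Ck_on n S f)"

definition test_functions :: "'e::euclidean_space set \<Rightarrow> ('e \<Rightarrow> real) set" where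
  "test_functions V =
     {\<psi>. smooth_on UNIV \<psi> \<and> compact (closure {p. \<psi> p \<noteq> 0}) \<and> closure {p. \<psi> p \<noteq> 0} \<subseteq> V}"

section \<open>Hausdorff measure of an extended distance\<close>

definition ediam :: "('m \<Rightarrow> 'm \<Rightarrow> ennreal) \<Rightarrow> 'm set \<Rightarrow> ennreal" where
  "ediam \<rho> S = (SUP x\<in>S. SUP y\<in>S. \<rho> x y)"

text \<open>Normalised by the volume of the Euclidean unit ball, as is customary for the
  Busemann-Hausdorff measure. Only used for \<open>d \<ge> 1\<close>, where the empty set contributes \<open>0\<close>.\<close>

definition hausdorff_content ::
  "'m set \<Rightarrow> ('m \<Rightarrow> 'm \<Rightarrow> ennreal) \<Rightarrow> nat \<Rightarrow> ennreal \<Rightarrow> 'm set \<Rightarrow> ennreal" where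
  "hausdorff_content M \<rho> d \<delta> E =
     (INF S \<in> {S :: nat \<Rightarrow> 'm set. (\<forall>n. S n \<subseteq> M \<and> ediam \<rho> (S n) \<le> \<delta>) \<and> E \<subseteq> (\<Union>n. S n)}.
        (\<Sum>n. ennreal (unit_ball_vol (real d)) * (ediam \<rho> (S n) / 2) ^ d))"

definition hausdorff_outer ::
  "'m set \<Rightarrow> ('m \<Rightarrow> 'm \<Rightarrow> ennreal) \<Rightarrow> nat \<Rightarrow> 'm set \<Rightarrow> ennreal" where
  "hausdorff_outer M \<rho> d E = (SUP \<delta>\<in>{0<..}. hausdorff_content M \<rho> d \<delta> E)"

text \<open>The measure lives on all Caratheodory-measurable sets, so it is complete.\<close>

definition hausdorff_measure :: "'m set \<Rightarrow> ('m \<Rightarrow> 'm \<Rightarrow> ennreal) \<Rightarrow> nat \<Rightarrow> 'm measure" where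
  "hausdorff_measure M \<rho> d =
     measure_of M (lambda_system M (Pow M) (hausdorff_outer M \<rho> d)) (hausdorff_outer M \<rho> d)"

lemma hausdorff_content_mono:
  "E \<subseteq> E' \<Longrightarrow> hausdorff_content M \<rho> d \<delta> E \<le> hausdorff_content M \<rho> d \<delta> E'"
  unfolding hausdorff_content_def by (rule INF_superset_mono) auto

lemma hausdorff_content_empty:
  assumes "d \<ge> 1"
  shows "hausdorff_content M \<rho> d \<delta> {} = 0"
proof -
  have "hausdorff_content M \<rho> d \<delta> {} \<le>
      (\<Sum>n. ennreal (unit_ball_vol (real d)) * (ediam \<rho> ((\<lambda>_. {}) (n::nat)) / 2) ^ d)"
    unfolding hausdorff_content_def by (rule INF_lower) (auto simp: ediam_def bot_ennreal)
  also have "\<dots> = 0"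
    using assms by (simp add: ediam_def bot_ennreal zero_power)
  finally show ?thesis by simp
qed

lemma hausdorff_content_UN:
  fixes B :: "nat \<Rightarrow> 'm set"
  shows "hausdorff_content M \<rho> d \<delta> (\<Union>i. B i) \<le> (\<Sum>i. hausdorff_content M \<rho> d \<delta> (B i))"
proof (rule ennreal_le_epsilon)
  let ?w = "\<lambda>S. ennreal (unit_ball_vol (real d)) * (ediam \<rho> S / 2) ^ d"
  let ?h = "hausdorff_content M \<rho> d \<delta>"
  let ?cov = "\<lambda>E. {S :: nat \<Rightarrow> 'm set. (\<forall>n. S n \<subseteq> M \<and> ediam \<rho> (S n) \<le> \<delta>) \<and> E \<subseteq> (\<Union>n. S n)}"
  fix e :: real assume e: "0 < e" and fin: "(\<Sum>i. ?h (B i)) < top"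
  have "\<exists>S. S \<in> ?cov (B i) \<and> (\<Sum>n. ?w (S n)) \<le> ?h (B i) + ennreal (e * (1/2) ^ Suc i)" for i
  proof -
    have "?h (B i) \<noteq> top"
      using ennreal_suminf_lessD[OF fin, of i] by simp
    then have "?h (B i) < ?h (B i) + ennreal (e * (1/2) ^ Suc i)"
      using e by simp
    then obtain S where "S \<in> ?cov (B i)"
        "(\<Sum>n. ?w (S n)) < ?h (B i) + ennreal (e * (1/2) ^ Suc i)"
      unfolding hausdorff_content_def INF_less_iff by blast
    then show ?thesis by (intro exI[of _ S] conjI less_imp_le)
  qed
  then obtain S where *: "\<forall>i. S i \<in> ?cov (B i) \<and>
      (\<Sum>n. ?w (S i n)) \<le> ?h (B i) + ennreal (e * (1/2) ^ Suc i)"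
    using choice[of "\<lambda>i S. S \<in> ?cov (B i) \<and>
      (\<Sum>n. ?w (S n)) \<le> ?h (B i) + ennreal (e * (1/2) ^ Suc i)"] by iprover
  note S = *[rule_format, THEN conjunct1] *[rule_format, THEN conjunct2]
  let ?S = "\<lambda>k. case prod_decode k of (i, n) \<Rightarrow> S i n"
  have "?S \<in> ?cov (\<Union>i. B i)"
  proof -
    have "x \<in> (\<Union>k. ?S k)" if x: "x \<in> B i" for x i
    proof -
      obtain n where "x \<in> S i n" using S(1)[of i] x by auto
      then have "x \<in> ?S (prod_encode (i, n))" by simp
      then show ?thesis by (rule UN_I[OF UNIV_I])
    qed
    then have "(\<Union>i. B i) \<subseteq> (\<Union>k. ?S k)" by (intro UN_least subsetI)
    moreover have "?S k \<subseteq> M \<and> ediam \<rho> (?S k) \<le> \<delta>" for k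
      using S(1)[of "fst (prod_decode k)"] by (simp add: case_prod_beta)
    ultimately show ?thesis by (intro CollectI conjI allI) simp_all
  qed
  then have "?h (\<Union>i. B i) \<le> (\<Sum>k. ?w (?S k))"
    unfolding hausdorff_content_def by (rule INF_lower)
  also have "\<dots> = (\<Sum>k. (\<lambda>(i, n). ?w (S i n)) (prod_decode k))"
    by (simp add: case_prod_beta)
  also have "\<dots> = (\<Sum>i. \<Sum>n. ?w (S i n))"
    by (rule suminf_ennreal_2dimen) simp
  also have "\<dots> \<le> (\<Sum>i. ?h (B i) + ennreal (e * (1/2) ^ Suc i))"
    by (intro suminf_le S(2)) auto
  also have "\<dots> = (\<Sum>i. ?h (B i)) + (\<Sum>i. ennreal (e * (1/2) ^ Suc i))"
    by (intro suminf_add[symmetric]) auto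
  also have "(\<Sum>i. ennreal (e * (1/2) ^ Suc i)) = ennreal e"
    using e sums_mult[OF power_half_series, of e] by (intro suminf_ennreal_eq) auto
  finally show "?h (\<Union>i. B i) \<le> (\<Sum>i. ?h (B i)) + ennreal e" .
qed

lemma outer_measure_space_hausdorff_outer:
  assumes "d \<ge> 1"
  shows "outer_measure_space (Pow M) (hausdorff_outer M \<rho> d)"
  unfolding outer_measure_space_def
proof (intro conjI)
  show "positive (Pow M) (hausdorff_outer M \<rho> d)"
    unfolding positive_def hausdorff_outer_def hausdorff_content_empty[OF assms]
    by (intro antisym SUP_least zero_le order_refl)
  show "increasing (Pow M) (hausdorff_outer M \<rho> d)"
    unfolding increasing_def hausdorff_outer_def
    by (intro ballI impI SUP_mono') (rule hausdorff_content_mono)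
  show "countably_subadditive (Pow M) (hausdorff_outer M \<rho> d)"
    unfolding countably_subadditive_def
  proof (intro allI impI)
    fix B :: "nat \<Rightarrow> 'a set"
    show "hausdorff_outer M \<rho> d (\<Union>i. B i) \<le> (\<Sum>i. hausdorff_outer M \<rho> d (B i))"
      unfolding hausdorff_outer_def
      by (rule SUP_least, rule order_trans[OF hausdorff_content_UN])
        (auto intro!: suminf_le SUP_upper)
  qed
qed

lemma
  assumes "d \<ge> 1"
  shows space_hausdorff_measure: "space (hausdorff_measure M \<rho> d) = M"
    and sets_hausdorff_measure:
      "sets (hausdorff_measure M \<rho> d) = lambda_system M (Pow M) (hausdorff_outer M \<rho> d)"
    and emeasure_hausdorff_measure:
      "E \<in> sets (hausdorff_measure M \<rho> d) \<Longrightarrow>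
        emeasure (hausdorff_measure M \<rho> d) E = hausdorff_outer M \<rho> d E"
proof -
  interpret sigma_algebra M "Pow M" by (rule sigma_algebra_Pow)
  have ms: "measure_space M (lambda_system M (Pow M) (hausdorff_outer M \<rho> d)) (hausdorff_outer M \<rho> d)"
    by (rule caratheodory_lemma[OF outer_measure_space_hausdorff_outer[OF assms]])
  then interpret L: sigma_algebra M "lambda_system M (Pow M) (hausdorff_outer M \<rho> d)"
    by (simp add: measure_space_def)
  show "space (hausdorff_measure M \<rho> d) = M"
    unfolding hausdorff_measure_def using L.space_closed by (rule space_measure_of)
  show s: "sets (hausdorff_measure M \<rho> d) = lambda_system M (Pow M) (hausdorff_outer M \<rho> d)"
    unfolding hausdorff_measure_def by (rule L.sets_measure_of_eq)
  show "emeasure (hausdorff_measure M \<rho> d) E = hausdorff_outer M \<rho> d E"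
    if "E \<in> sets (hausdorff_measure M \<rho> d)"
    using ms that unfolding hausdorff_measure_def
    by (intro emeasure_measure_of_sigma) (auto simp: measure_space_def L.sets_measure_of_eq)
qed

section \<open>Square-integrable functions\<close>

definition L2_space :: "'m measure \<Rightarrow> ('m \<Rightarrow> real) set" where
  "L2_space \<mu> = {u \<in> borel_measurable \<mu>. integrable \<mu> (\<lambda>x. (u x)\<^sup>2)}"

definition L2_norm :: "'m measure \<Rightarrow> ('m \<Rightarrow> real) \<Rightarrow> real" where
  "L2_norm \<mu> u = sqrt (\<integral>x. (u x)\<^sup>2 \<partial>\<mu>)"

text \<open>Linear subspaces of dimension \<open>k\<close>, where functions that agree almost everywhere are identified:
  \<open>b 0, \<dots>, b (k - 1)\<close> represent a basis of the space of equivalence classes.\<close>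

definition subspace_mod_AE :: "'m measure \<Rightarrow> nat \<Rightarrow> ('m \<Rightarrow> real) set \<Rightarrow> bool" where
  "subspace_mod_AE \<mu> k K \<longleftrightarrow>
     (\<lambda>x. 0) \<in> K \<and> (\<forall>u\<in>K. \<forall>v\<in>K. (\<lambda>x. u x + v x) \<in> K) \<and> (\<forall>a. \<forall>u\<in>K. (\<lambda>x. a * u x) \<in> K) \<and>
     (\<exists>b :: nat \<Rightarrow> 'm \<Rightarrow> real. (\<forall>i<k. b i \<in> K) \<and>
        (\<forall>a :: nat \<Rightarrow> real. (AE x in \<mu>. (\<Sum>i<k. a i * b i x) = 0) \<longrightarrow> (\<forall>i<k. a i = 0)) \<and>
        (\<forall>u\<in>K. \<exists>a :: nat \<Rightarrow> real. AE x in \<mu>. u x = (\<Sum>i<k. a i * b i x)))"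

section \<open>Smooth manifolds\<close>

text \<open>A chart is a pair of a domain and a coordinate map, whose values off the domain are irrelevant.
  A tangent vector is the family of its coordinate vectors in all the charts of the atlas;
  it is \<open>0\<close> by convention at charts that do not contain the base point.\<close>

type_synonym ('m, 'e) chart = "'m set \<times> ('m \<Rightarrow> 'e)"
type_synonym ('m, 'e) tangent = "('m, 'e) chart \<Rightarrow> 'e"

definition coords :: "('m, 'e) chart \<Rightarrow> 'e set" where
  "coords c = snd c ` fst c"

definition param :: "('m, 'e) chart \<Rightarrow> 'e \<Rightarrow> 'm" where
  "param c = inv_into (fst c) (snd c)"

locale smooth_manifold =
  fixes T :: "'m topology" and A :: "('m, 'e::euclidean_space) chart set"
  assumes Hausdorff: "Hausdorff_space T"
    and second_countable: "second_countable T"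
    and cover: "(\<Union>c\<in>A. fst c) = topspace T"
    and chart_domain: "c \<in> A \<Longrightarrow> openin T (fst c)"
    and chart_open: "c \<in> A \<Longrightarrow> open (coords c)"
    and chart_homeo:
      "c \<in> A \<Longrightarrow> homeomorphic_map (subtopology T (fst c)) (top_of_set (coords c)) (snd c)"
    and chart_compat:
      "c \<in> A \<Longrightarrow> c' \<in> A \<Longrightarrow> smooth_on (snd c ` (fst c \<inter> fst c')) (snd c' \<circ> param c)"
begin

abbreviation M :: "'m set" where "M \<equiv> topspace T"

definition tangent_space :: "'m \<Rightarrow> ('m, 'e) tangent set" where
  "tangent_space x =
     {X. (\<forall>c. \<not> (c \<in> A \<and> x \<in> fst c) \<longrightarrow> X c = 0) \<and>
         (\<forall>c\<in>A. \<forall>c'\<in>A. x \<in> fst c \<and> x \<in> fst c' \<longrightarrow>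
            X c' = frechet_derivative (snd c' \<circ> param c) (at (snd c x)) (X c))}"

text \<open>The tangent vector at \<open>x\<close> whose coordinates in the chart \<open>c\<close> are \<open>v\<close>.\<close>

definition tangent_of :: "('m, 'e) chart \<Rightarrow> 'm \<Rightarrow> 'e \<Rightarrow> ('m, 'e) tangent" where
  "tangent_of c x v = (\<lambda>c'. if c' \<in> A \<and> x \<in> fst c'
     then frechet_derivative (snd c' \<circ> param c) (at (snd c x)) v else 0)"

definition cotangent_space :: "'m \<Rightarrow> (('m, 'e) tangent \<Rightarrow> real) set" where
  "cotangent_space x =
     {\<xi>. (\<forall>X\<in>tangent_space x. \<forall>Y\<in>tangent_space x. \<xi> (\<lambda>c. X c + Y c) = \<xi> X + \<xi> Y) \<and>
         (\<forall>a. \<forall>X\<in>tangent_space x. \<xi> (\<lambda>c. a *\<^sub>R X c) = a * \<xi> X)}"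

definition smooth_compact_support :: "('m \<Rightarrow> real) set" where
  "smooth_compact_support =
     {u. (\<forall>c\<in>A. smooth_on (coords c) (u \<circ> param c)) \<and> compactin T (T closure_of {x\<in>M. u x \<noteq> 0})}"

definition piecewise_C1_curve :: "(real \<Rightarrow> 'm) \<Rightarrow> bool" where
  "piecewise_C1_curve \<gamma> \<longleftrightarrow>
     continuous_map (top_of_set {0..1}) T \<gamma> \<and>
     (\<exists>S. finite S \<and> (\<forall>c\<in>A. (snd c \<circ> \<gamma>) C1_differentiable_on ({t\<in>{0..1}. \<gamma> t \<in> fst c} - S)))"

definition velocity :: "(real \<Rightarrow> 'm) \<Rightarrow> real \<Rightarrow> ('m, 'e) tangent" where
  "velocity \<gamma> t =
     (\<lambda>c. if c \<in> A \<and> \<gamma> t \<in> fst c then vector_derivative (snd c \<circ> \<gamma>) (at t) else 0)"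

text \<open>The weak differential is a field of covectors whose components in every chart are the weak
  (distributional) partial derivatives of the coordinate expression of \<open>u\<close>.\<close>

definition weak_differential :: "('m \<Rightarrow> real) \<Rightarrow> ('m \<Rightarrow> ('m, 'e) tangent \<Rightarrow> real) \<Rightarrow> bool" where
  "weak_differential u \<omega> \<longleftrightarrow>
     (\<forall>x\<in>M. \<omega> x \<in> cotangent_space x) \<and>
     (\<forall>c\<in>A.
        (\<forall>C. compact C \<and> C \<subseteq> coords c \<longrightarrow> set_integrable lebesgue C (\<lambda>p. u (param c p))) \<and>
        (\<forall>i\<in>Basis.
           (\<forall>C. compact C \<and> C \<subseteq> coords c \<longrightarrow>
              set_integrable lebesgue C (\<lambda>p. \<omega> (param c p) (tangent_of c (param c p) i))) \<and>
           (\<forall>\<psi>\<in>test_functions (coords c).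
              (LINT p:coords c|lebesgue. u (param c p) * frechet_derivative \<psi> (at p) i) =
              - (LINT p:coords c|lebesgue. \<omega> (param c p) (tangent_of c (param c p) i) * \<psi> p))))"

end

section \<open>Finsler manifolds\<close>

locale finsler_manifold = smooth_manifold T A
  for T :: "'m topology" and A :: "('m, 'e::euclidean_space) chart set" +
  fixes F :: "'m \<Rightarrow> ('m, 'e) tangent \<Rightarrow> real"
  assumes F_nonneg: "x \<in> topspace T \<Longrightarrow> X \<in> tangent_space x \<Longrightarrow> 0 \<le> F x X"
    and F_homogeneous:
      "x \<in> topspace T \<Longrightarrow> X \<in> tangent_space x \<Longrightarrow> F x (\<lambda>c. a *\<^sub>R X c) = \<bar>a\<bar> * F x X"
    and F_smooth:
      "c \<in> A \<Longrightarrow> smooth_on (coords c \<times> (UNIV - {0}))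
         (\<lambda>(p, v). F (param c p) (tangent_of c (param c p) v))"
    and F_strictly_convex:
      "c \<in> A \<Longrightarrow> p \<in> coords c \<Longrightarrow> v \<noteq> 0 \<Longrightarrow> w \<noteq> 0 \<Longrightarrow>
         0 < (\<Sum>i\<in>Basis. \<Sum>j\<in>Basis. (w \<bullet> i) * (w \<bullet> j) *
           (1/2 * frechet_derivative (\<lambda>y. frechet_derivative
              (\<lambda>z. (F (param c p) (tangent_of c (param c p) z))\<^sup>2) (at y) j) (at v) i))"
begin

definition co_finsler :: "'m \<Rightarrow> (('m, 'e) tangent \<Rightarrow> real) \<Rightarrow> real" where
  "co_finsler x \<xi> = (SUP X \<in> tangent_space x - {\<lambda>c. 0}. \<xi> X / F x X)"

text \<open>The distance is \<open>\<infinity>\<close> between points of different components.\<close>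

definition finsler_dist :: "'m \<Rightarrow> 'm \<Rightarrow> ennreal" where
  "finsler_dist x y = (INF \<gamma> \<in> {\<gamma>. piecewise_C1_curve \<gamma> \<and> \<gamma> 0 = x \<and> \<gamma> 1 = y}.
     (\<integral>\<^sup>+t\<in>{0..1}. ennreal (F (\<gamma> t) (velocity \<gamma> t)) \<partial>lborel))"

definition BH_measure :: "'m measure" where
  "BH_measure = hausdorff_measure M finsler_dist DIM('e)"

text \<open>The weak differential is unique up to null sets, and for smooth \<open>u\<close> it is the classical
  differential almost everywhere.\<close>

definition D :: "('m \<Rightarrow> real) \<Rightarrow> 'm \<Rightarrow> real" where
  "D u x = co_finsler x ((SOME \<omega>. weak_differential u \<omega>) x)"

definition H_norm :: "('m \<Rightarrow> real) \<Rightarrow> real" where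
  "H_norm u = sqrt ((L2_norm BH_measure u)\<^sup>2 + (L2_norm BH_measure (D u))\<^sup>2)"

text \<open>The functions on which \<open>H_norm\<close> is meaningful, in which the closure below is taken.\<close>

definition finite_H_norm :: "('m \<Rightarrow> real) set" where
  "finite_H_norm =
     {u \<in> L2_space BH_measure. (\<exists>\<omega>. weak_differential u \<omega>) \<and> D u \<in> L2_space BH_measure}"

text \<open>\<open>H\<close> consists of functions, and contains with each function everything equal to it almost
  everywhere.\<close>

definition H :: "('m \<Rightarrow> real) set" where
  "H = {u \<in> finite_H_norm. \<exists>s. (\<forall>n::nat. s n \<in> smooth_compact_support) \<and>
          (\<lambda>n. H_norm (\<lambda>x. u x - s n x)) \<longlonglongrightarrow> 0}"

definition cap :: "'m set \<Rightarrow> ennreal" where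
  "cap E = (INF u \<in> {u \<in> H. (\<forall>x\<in>M. 0 \<le> u x) \<and> (\<exists>G. openin T G \<and> E \<subseteq> G \<and> (\<forall>x\<in>G. 1 \<le> u x))}.
     ennreal ((H_norm u)\<^sup>2))"

definition quasi_continuous :: "('m \<Rightarrow> real) \<Rightarrow> bool" where
  "quasi_continuous u \<longleftrightarrow>
     (\<forall>\<epsilon>>0. \<exists>G. openin T G \<and> cap G < \<epsilon> \<and> continuous_map (subtopology T (M - G)) euclideanreal u)"

definition H_qc :: "('m \<Rightarrow> real) set" where
  "H_qc = {u \<in> H. quasi_continuous u}"

definition quasi_open :: "'m set \<Rightarrow> bool" where
  "quasi_open \<Omega> \<longleftrightarrow> \<Omega> \<subseteq> M \<and>
     (\<exists>u\<in>H_qc. cap ((\<Omega> - {x\<in>M. 0 < u x}) \<union> ({x\<in>M. 0 < u x} - \<Omega>)) = 0)"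

definition H0 :: "'m set \<Rightarrow> ('m \<Rightarrow> real) set" where
  "H0 \<Omega> = {u \<in> H_qc. cap ({x\<in>M. u x \<noteq> 0} - \<Omega>) = 0}"

definition eigenvalue :: "nat \<Rightarrow> 'm set \<Rightarrow> ereal" where
  "eigenvalue k \<Omega> =
     (INF K \<in> {K. K \<subseteq> H0 \<Omega> \<and> subspace_mod_AE BH_measure k K}.
        SUP u \<in> {u \<in> K. (LINT x:\<Omega>|BH_measure. (u x)\<^sup>2) = 1}.
          ereal (LINT x:\<Omega>|BH_measure. (D u x)\<^sup>2))"

definition dirichlet_energy :: "('m \<Rightarrow> real) \<Rightarrow> 'm set \<Rightarrow> ereal" where
  "dirichlet_energy f \<Omega> =
     (INF u \<in> H0 \<Omega>. ereal (1/2 * (LINT x:\<Omega>|BH_measure. (D u x)\<^sup>2)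
        + 1/2 * (LINT x:\<Omega>|BH_measure. (u x)\<^sup>2) - (LINT x:\<Omega>|BH_measure. u x * f x)))"

text \<open>Quasi-open sets are measurable: sets of zero capacity are null for the outer measure, and
  the measure is complete.\<close>

definition admissible :: "real \<Rightarrow> 'm set \<Rightarrow> bool" where
  "admissible c \<Omega> \<longleftrightarrow> quasi_open \<Omega> \<and> emeasure BH_measure \<Omega> \<le> ennreal c"

end

end

theory Submission
  imports Defs "HOL-Complex_Analysis.Great_Picard"
begin

text \<open>
The proof is the direct method. In charts the Busemann-Hausdorff measure is comparable to Lebesgue
measure and \<open>F\<close> to the Euclidean norm, so Poincare's inequality on the cells of a fine grid makes
every bounded sequence in \<open>H\<close> precompact in \<open>L\<^sup>2\<close>. The energy of \<open>u\<close> is not quadratic, but it is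
convex and equivalent to a quadratic form; minimising that form over shrinking convex sets produces
strongly convergent sequences, which gives lower semicontinuity of the energy under \<open>L\<^sup>2\<close> limits.
A minimising sequence of domains is replaced by orthonormal frames (for the eigenvalue) or almost
minimisers (for the energy) supported in them; the set where the quasi-continuous representatives
of the limit functions do not all vanish is quasi-open, its measure is at most \<open>c\<close> by almost
everywhere convergence, and it is optimal.\<close>

text \<open>The comparability of measures has a hard half: curves of short Finsler length may leave
  a chart, so coordinates are controlled through cut-off coordinate functions that are Lipschitz for
  the distance on all of \<open>M\<close>. Superlevel sets of such functions also make chart images
  measurable, by Caratheodory's criterion. The quadratic form serves only to extract a strongly
  convergent sequence; the sharp bound on the energy comes from the convex sets over which it is
  minimised, all of whose members obey that bound up to a small error. Orthonormality of the frames
  is what keeps the dimension from dropping in the limit. The functionals integrate over a domain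
  and compactness works on \<open>M\<close>; the two agree because the gradient norm carries no mass
  on the zero set of a function. Capacity speaks about every point of an open set while the
  functions are determined almost everywhere, so the constructions there fix values pointwise. The
  chain rule is available for composition with smooth functions only, whence
  \<open>sqrt (1 + t^2) - 1\<close> in place of the absolute value and
  \<open>t - e * arctan (t / e)\<close> in place of a truncation.\<close>

abbreviation fderiv where "fderiv == frechet_derivative"

abbreviation (input) tends :: "(nat => 'a::topological_space) => 'a => bool" (infix "---->" 60)
  where "X ----> L == X \<longlonglongrightarrow> L"

section \<open>Smooth functions and test functions\<close>

lemma Ck_on_cong:
 assumes "open S" "!!x. x : S ==> f x = g x"
 shows "Ck_on n S f \<longleftrightarrow> Ck_on n S g" using assms(2)
proof (induction n arbitrary: f g)
 case 0
 thus ?case by(auto intro: continuous_on_eq)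
next
 case (Suc n)
 have d: "(f has_derivative f') (at x) \<longleftrightarrow> (g has_derivative f') (at x)" if "x : S" for x f'
  using has_derivative_transform_within_open[OF _ assms(1) that] Suc.prems by metis
 \<comment> \<open>Both choices in \<open>frechet_derivative\<close> run over the same predicate, so
   the chosen derivatives agree even at points where none exists.\<close>
 have eq: "fderiv f (at x) = fderiv g (at x)" if "x : S" for x unfolding frechet_derivative_def using d[OF that] by simp
 show ?case using d eq Suc.IH[of "%x. fderiv f (at x) v" "%x. fderiv g (at x) v" for v] by(simp add: differentiable_def)
qed

lemma Ck_on_imp_continuous_on: "Ck_on n S f ==> continuous_on S f" by(cases n) (auto simp: continuous_at_imp_continuous_on differentiable_imp_continuous_within)

lemma Ck_on_Suc_D: "Ck_on (Suc n) S f ==> Ck_on n S f"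
proof (induction n arbitrary: f)
 case 0
 thus ?case using Ck_on_imp_continuous_on[of 1] by auto
qed auto

text \<open>Lets every closure property below be proved with an explicit formula for the derivative
  instead of the choice term \<open>frechet_derivative\<close>; openness of the set makes the two
  interchangeable to all orders.\<close>

lemma Ck_on_SucI:
 assumes "open S" "!!x. x : S ==> (f has_derivative f' x) (at x)" "!!v. Ck_on n S (%x. f' x v)"
 shows "Ck_on (Suc n) S f"
proof -
 have "Ck_on n S (%x. fderiv f (at x) v)" for v using Ck_on_cong[OF assms(1), of "%x. fderiv f (at x) v" "%x. f' x v" n]
   assms(2,3) frechet_derivative_at by metis
 thus ?thesis using assms(2) by(auto simp: differentiable_def)
qed

lemma Ck_on_derivative:
 assumes "Ck_on (Suc n) S f" "x : S"
 shows "(f has_derivative fderiv f (at x)) (at x)" using assms frechet_derivative_works by auto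

lemma Ck_on_const [simp]: "Ck_on n S (%x. c)" by(induction n arbitrary: c) auto

lemma Ck_on_add:
 assumes "open S" "Ck_on n S f" "Ck_on n S g"
 shows "Ck_on n S (%x. f x + g x)" using assms(2,3)
proof (induction n arbitrary: f g)
 case (Suc n)
 show ?case by(rule Ck_on_SucI[OF assms(1) has_derivative_add])
   (use Suc in \<open>auto intro: Ck_on_derivative Suc.IH\<close>)
qed (auto intro: continuous_intros)

lemma Ck_on_mult:
 fixes f g :: "_ => real"
 assumes "open S" "Ck_on n S f" "Ck_on n S g"
 shows "Ck_on n S (%x. f x * g x)" using assms(2,3)
proof (induction n arbitrary: f g)
 case (Suc n)
 have *: "Ck_on n S f" "Ck_on n S g" using Suc.prems by(auto intro: Ck_on_Suc_D simp del: Ck_on.simps)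
 show ?case by(rule Ck_on_SucI[OF assms(1) has_derivative_mult])
   (use Suc * in \<open>auto intro!: Ck_on_derivative Ck_on_add Suc.IH assms(1)\<close>)
qed (auto intro: continuous_intros)

lemma Ck_on_cmult: "open S ==> Ck_on n S f ==> Ck_on n S (%x. c * f x :: real)" by(rule Ck_on_mult) auto

lemma Ck_on_diff:
 fixes f g :: "_ => real"
 shows "open S ==> Ck_on n S f ==> Ck_on n S g ==> Ck_on n S (%x. f x - g x)" using Ck_on_add[of S n f "%x. -1 * g x"] Ck_on_cmult[of S n g "-1"] by simp

lemma Ck_on_prod:
 fixes f :: "_ => _ => real"
 assumes "open S" "finite I" "!!i. i : I ==> Ck_on n S (f i)"
 shows "Ck_on n S (%x. \<Prod>i\<in>I. f i x)" using assms(2,3) by(induction I) (auto intro: Ck_on_mult assms(1))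

text \<open>By the chain rule the derivative is the derivative of the outer function composed with
  \<open>u\<close>, times the derivative of \<open>u\<close>: again a composition with the same
  \<open>u\<close>, so the induction generalises over the outer function alone.\<close>

lemma Ck_on_compose_real:
 fixes u :: "'a::real_normed_vector => real" and \<phi> :: "real => real"
 assumes "open S" "Ck_on n UNIV \<phi>" "Ck_on n S u"
 shows "Ck_on n S (%x. \<phi> (u x))" using assms(2,3)
proof (induction n arbitrary: \<phi>)
 case 0
 thus ?case by(auto intro: continuous_on_compose2)
next
 case (Suc n)
 have u: "Ck_on n S u" using Suc.prems by(auto intro: Ck_on_Suc_D simp del: Ck_on.simps)
 have "linear (fderiv \<phi> (at t))" for t using Ck_on_derivative[OF Suc.prems(1), of t] has_derivative_linear by auto
 \<comment> \<open>A linear map on the line is multiplication by its value at 1, which turns the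
   composite of derivatives into a product of scalar functions.\<close>
 hence lin: "fderiv \<phi> (at t) v = fderiv \<phi> (at t) 1 * v" for t v using linear_scale[of "fderiv \<phi> (at t)" v 1] by(simp add: mult.commute)
 show ?case
 proof (rule Ck_on_SucI[OF assms(1)])
  fix x assume "x : S"
  have "((%x. \<phi> (u x)) has_derivative
    (%v. fderiv \<phi> (at (u x)) (fderiv u (at x) v))) (at x)" by(rule has_derivative_compose[OF Ck_on_derivative[OF Suc.prems(2) \<open>x : S\<close>]
      Ck_on_derivative[OF Suc.prems(1) UNIV_I]])
  thus "((%x. \<phi> (u x)) has_derivative
    (%v. fderiv \<phi> (at (u x)) 1 * fderiv u (at x) v)) (at x)" by(subst (asm) lin)
 next
  show "Ck_on n S (%x. fderiv \<phi> (at (u x)) 1 * fderiv u (at x) v)" for v by(rule Ck_on_mult[OF assms(1) Suc.IH[OF _ u]]) (use Suc.prems in simp_all)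
 qed
qed

lemma Ck_on_real_SucI:
 fixes \<phi> :: "real => real"
 assumes "!!t. (\<phi> has_real_derivative \<phi>' t) (at t)" "Ck_on n UNIV \<phi>'"
 shows "Ck_on (Suc n) UNIV \<phi>" by(rule Ck_on_SucI[OF _ assms(1)[unfolded has_field_derivative_def]])
  (auto intro: Ck_on_mult assms(2))

text \<open>Smoothness passes to primitives: order n follows from order n + 1, and that only asks
  for n derivatives of the derivative.\<close>

lemma smooth_on_real_derivI:
 fixes \<phi> :: "real => real"
 assumes "!!t. (\<phi> has_real_derivative \<phi>' t) (at t)" "smooth_on UNIV \<phi>'"
 shows "smooth_on UNIV \<phi>" unfolding smooth_on_def
proof
 fix n show "Ck_on n UNIV \<phi>" using Ck_on_Suc_D[OF Ck_on_real_SucI[OF assms(1)]] assms(2) by(auto simp: smooth_on_def)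
qed

lemma smooth_on_add: "open S ==> smooth_on S f ==> smooth_on S g ==> smooth_on S (%x. f x + g x)"
 and smooth_on_mult: "open S ==> smooth_on S f' ==> smooth_on S g' ==> smooth_on S (%x. f' x * g' x :: real)"
 and smooth_on_diff: "open S ==> smooth_on S f' ==> smooth_on S g' ==> smooth_on S (%x. f' x - g' x :: real)"
 and smooth_on_const: "smooth_on S (%x. c)"
 and smooth_on_prod: "open S ==> finite I ==> (!!i. i : I ==> smooth_on S (h i)) ==>
   smooth_on S (%x. \<Prod>i\<in>I. h i x :: real)" unfolding smooth_on_def by(simp_all add: Ck_on_add Ck_on_mult Ck_on_diff Ck_on_prod)

lemma smooth_on_compose_real:
 fixes \<phi> :: "real => real"
 assumes "open S" "smooth_on UNIV \<phi>" "smooth_on S u"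
 shows "smooth_on S (%x. \<phi> (u x))" using Ck_on_compose_real[OF assms(1), of _ \<phi> u] assms(2,3) by(simp add: smooth_on_def)

lemma smooth_on_linear:
 assumes "bounded_linear f"
 shows "smooth_on UNIV f" unfolding smooth_on_def
proof
 fix n show "Ck_on n UNIV f"
 proof (cases n)
  case 0
  thus ?thesis using assms by(auto intro: linear_continuous_on)
 next
  case (Suc m)
  thus ?thesis by(simp only:, intro Ck_on_SucI[where f'="%x. f"])
    (auto intro: bounded_linear_imp_has_derivative assms)
 qed
qed

text \<open>Derivatives of \<open>t\<^sup>-\<^sup>j exp (-1/t)\<close> are combinations of functions of the same form.\<close>

definition flat :: "nat => real => real" where
 "flat j t = (if t <= 0 then 0 else exp (- (1/t)) / t ^ j)"

text \<open>Substituting \<open>x = 1/t\<close> turns the quotient into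
  \<open>x ^ Suc j / exp x\<close>. This is the difference quotient at the origin, the only point
  where differentiability of \<open>flat\<close> is not elementary.\<close>

lemma flat_div_tendsto_0: "((%t. flat j t / t) \<longlongrightarrow> 0) (at 0)"
proof -
 have "((%x::real. x ^ Suc j / exp x) \<longlongrightarrow> 0) at_top" by(rule tendsto_power_div_exp_0)
 hence "((%t::real. (1/t) ^ Suc j / exp (1/t)) \<longlongrightarrow> 0) (at_right 0)"
  using filterlim_compose[OF _ filterlim_inverse_at_top_right, of "%x. x ^ Suc j / exp x"] by(simp only: inverse_eq_divide)
 hence "((%t. flat j t / t) \<longlongrightarrow> 0) (at_right 0)" by(rule filterlim_cong[THEN iffD1, rotated -1])
   (auto simp: flat_def eventually_at_right_field exp_minus field_simps intro!: exI[of _ 1])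
 moreover have "((%t. flat j t / t) \<longlongrightarrow> 0) (at_left 0)"
  by(rule tendsto_eventually) (auto simp: flat_def eventually_at_left_field intro!: exI[of _ "-1"])
 ultimately show ?thesis by(rule filterlim_split_at[rotated])
qed

lemma flat_deriv: "(flat j has_real_derivative (flat (j + 2) t - real j * flat (Suc j) t)) (at t)"
proof -
 consider "t < 0" | "t = 0" | "t > 0" by linarith
 thus ?thesis
 proof cases
  case 1
  have "((%t. 0) has_real_derivative 0) (at t)" by simp
  hence "(flat j has_real_derivative 0) (at t)" by(rule has_field_derivative_transform_within_open[of _ _ _ "{..<0}"]) (use 1 in \<open>auto simp: flat_def\<close>)
  thus ?thesis using 1 by(simp add: flat_def)
 next
  case 2
  thus ?thesis using flat_div_tendsto_0[of j] by(simp add: has_field_derivative_iff flat_def)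
 next
  case 3
  have "((%t. exp (- (1/t)) / t ^ j) has_real_derivative (flat (j + 2) t - real j * flat (Suc j) t)) (at t)"
   using 3 by(auto intro!: derivative_eq_intros simp: flat_def field_simps power2_eq_square)
    (cases j; simp add: field_simps)
  thus ?thesis by(rule has_field_derivative_transform_within_open[of _ _ _ "{0<..}"]) (use 3 in \<open>auto simp: flat_def\<close>)
 qed
qed

lemma smooth_on_flat: "smooth_on UNIV (flat j)" unfolding smooth_on_def
proof
 fix n show "Ck_on n UNIV (flat j)"
 proof (induction n arbitrary: j)
  case 0
  thus ?case using DERIV_continuous_on[OF has_field_derivative_at_within[OF flat_deriv]] by simp
 next
  case (Suc n)
  show ?case by(rule Ck_on_real_SucI[OF flat_deriv]) (intro Ck_on_diff Ck_on_cmult Suc open_UNIV)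
 qed
qed

lemma smooth_on_exp: "smooth_on UNIV (exp :: real => real)" unfolding smooth_on_def
proof
 fix n show "Ck_on n UNIV (exp :: real => real)"
 proof (induction n)
  case (Suc n)
  thus ?case by(intro Ck_on_real_SucI[where \<phi>'=exp]) auto
 qed (auto intro: continuous_intros)
qed

text \<open>With g the function in question, its derivative \<open>- t * g ^ 3\<close> is a
  polynomial in t and g, so the induction on the order closes. The square of g is the derivative of
  arctan, and \<open>t * g\<close> that of \<open>sqrt (1 + t^2)\<close>, the two functions later
  composed with elements of \<open>H\<close>.\<close>

lemma smooth_on_inverse_sqrt: "smooth_on UNIV (%t::real. 1 / sqrt (1 + t^2))" unfolding smooth_on_def
proof
 have pos: "1 + t^2 > (0::real)" for t by(simp add: add_pos_nonneg)
 have d: "((%t. 1 / sqrt (1 + t^2)) has_real_derivative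
   (-1) * (t * (1 / sqrt (1 + t^2) * (1 / sqrt (1 + t^2) * (1 / sqrt (1 + t^2)))))) (at t)" for t :: real using pos[of t]
  by(auto intro!: derivative_eq_intros simp: field_simps power2_eq_square)
 have "smooth_on UNIV (%t::real. t)" by(rule smooth_on_linear) (rule bounded_linear_ident)
 hence t: "Ck_on n UNIV (%t::real. t)" for n by(simp add: smooth_on_def)
 fix n show "Ck_on n UNIV (%t::real. 1 / sqrt (1 + t^2))"
 proof (induction n)
  case 0
  thus ?case using pos by(auto intro!: continuous_intros simp: add_nonneg_eq_0_iff less_imp_neq)
 next
  case (Suc n)
  show ?case by(rule Ck_on_real_SucI[OF d]) (intro Ck_on_cmult Ck_on_mult t Suc open_UNIV)
 qed
qed

lemma sqrt_one_plus_square_deriv: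
 "((%t. sqrt (1 + t^2)) has_real_derivative t / sqrt (1 + t^2)) (at t)" using add_pos_nonneg[of 1 "t^2"] by(auto intro!: derivative_eq_intros simp: field_simps)

lemma smooth_on_sqrt_one_plus_square: "smooth_on UNIV (%t::real. sqrt (1 + t^2))" by(rule smooth_on_real_derivI[OF sqrt_one_plus_square_deriv])
  (use smooth_on_mult[OF open_UNIV smooth_on_linear[OF bounded_linear_ident] smooth_on_inverse_sqrt] in simp)

lemma smooth_on_arctan: "smooth_on UNIV (arctan :: real => real)"
proof (rule smooth_on_real_derivI[OF DERIV_arctan])
 have "inverse (1 + t^2) = 1 / sqrt (1 + t^2) * (1 / sqrt (1 + t^2))" for t :: real using add_pos_nonneg[of 1 "t^2"] by(simp add: field_simps)
 thus "smooth_on UNIV (%t::real. inverse (1 + t^2))" using smooth_on_mult[OF open_UNIV smooth_on_inverse_sqrt smooth_on_inverse_sqrt] by simp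
qed

text \<open>A product over the coordinates of one-dimensional bumps, each flat at both end points.
  Positivity exactly on the box is what makes the exponential approximation of its indicator
  work.\<close>

lemma box_bump:
 fixes a b :: "'e::euclidean_space"
 obtains \<beta> :: "'e => real" where "smooth_on UNIV \<beta>" "!!x. \<beta> x >= 0" "!!x. \<beta> x > 0 \<longleftrightarrow> x : box a b"
proof
 define \<beta> where "\<beta> x = (\<Prod>i\<in>Basis. flat 0 (x \<bullet> i - a \<bullet> i) * flat 0 (b \<bullet> i - x \<bullet> i))" for x :: 'e
 have nonneg: "flat 0 t >= 0" and pos: "flat 0 t > 0 \<longleftrightarrow> t > 0"
  and nz: "flat 0 t ~= 0 \<longleftrightarrow> t > 0" for t by(auto simp: flat_def)
 have lin: "smooth_on UNIV (%x::'e. x \<bullet> i)" for i by(rule smooth_on_linear) (rule bounded_linear_inner_left)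
 show "smooth_on UNIV \<beta>" unfolding \<beta>_def by(intro smooth_on_prod smooth_on_mult smooth_on_compose_real[OF _ smooth_on_flat] smooth_on_diff
    smooth_on_const lin finite_Basis open_UNIV)
 show "\<beta> x >= 0" for x unfolding \<beta>_def by(intro prod_nonneg mult_nonneg_nonneg nonneg ballI)
 show "\<beta> x > 0 \<longleftrightarrow> x : box a b" for x
 proof
  assume "x : box a b"
  hence "flat 0 (x \<bullet> i - a \<bullet> i) * flat 0 (b \<bullet> i - x \<bullet> i) > 0" if "i : Basis" for i
   using that by(intro mult_pos_pos) (simp_all add: pos mem_box)
  thus "\<beta> x > 0" unfolding \<beta>_def by(rule prod_pos)
 next
  assume "\<beta> x > 0"
  hence "(\<Prod>i\<in>Basis. flat 0 (x \<bullet> i - a \<bullet> i) * flat 0 (b \<bullet> i - x \<bullet> i)) ~= 0"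
   unfolding \<beta>_def by(rule less_imp_neq[symmetric])
  hence "ALL i:Basis. flat 0 (x \<bullet> i - a \<bullet> i) * flat 0 (b \<bullet> i - x \<bullet> i) ~= 0"
   by(simp only: prod_zero_iff[OF finite_Basis] bex_simps not_False_eq_True simp_thms)
  hence "x \<bullet> i - a \<bullet> i > 0 & b \<bullet> i - x \<bullet> i > 0" if "i : Basis" for i
   using bspec[OF _ that] unfolding nz mult_eq_0_iff de_Morgan_disj by blast
  thus "x : box a b" unfolding mem_box by simp
 qed
qed

text \<open>The functions \<open>1 - exp (- n * \<beta>)\<close> increase to 1 where the bump
  \<open>\<beta>\<close> is positive and vanish elsewhere. Their supports lie in the closed box,
  hence the hypothesis on \<open>cbox a b\<close>.\<close>

lemma test_functions_box:
 fixes a b :: "'e::euclidean_space"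
 assumes "cbox a b <= V"
 obtains ps :: "nat => 'e => real" where "!!n. ps n : test_functions V" "!!n x. 0 <= ps n x" "!!n x. ps n x <= indicator (box a b) x"
  "!!x. (%n. ps n x) ----> indicator (box a b) x"
proof -
 obtain \<beta> :: "'e => real" where \<beta>: "smooth_on UNIV \<beta>" "!!x. \<beta> x >= 0" "!!x. \<beta> x > 0 \<longleftrightarrow> x : box a b"
  by(rule box_bump[of a b]) (rule that)
 define ps where "ps n x = 1 - exp (- (real n) * \<beta> x)" for n x
 have z: "x : box a b" if "ps n x ~= 0" for n x using that \<beta>(2)[of x] unfolding \<beta>(3)[symmetric] ps_def less_le by force
 show ?thesis
 proof (rule that[of ps])
  fix n
  have "closure {p. ps n p ~= 0} <= cbox a b"
  proof (rule closure_minimal)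
   show "{p. ps n p ~= 0} <= cbox a b" using z[of n] box_subset_cbox[of a b] by blast
  qed (rule closed_cbox)
  moreover have "smooth_on UNIV (ps n)" unfolding ps_def
   by(intro smooth_on_diff smooth_on_const smooth_on_compose_real[OF _ smooth_on_exp] smooth_on_mult \<beta>(1) open_UNIV)
  moreover have "compact (closure {p. ps n p ~= 0})" using bounded_subset[OF bounded_cbox calculation(1)] by(simp add: compact_eq_bounded_closed)
  ultimately show "ps n : test_functions V" using assms by(auto simp: test_functions_def)
 next
  fix n x
  show "0 <= ps n x" using \<beta>(2)[of x] by(simp add: ps_def)
  show "ps n x <= indicator (box a b) x"
  proof (cases "x : box a b")
   case False
   hence "ps n x = 0" using z[of n x] by blast
   thus ?thesis by simp
  qed (simp add: ps_def)
 next
  fix x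
  show "(%n. ps n x) ----> indicator (box a b) x"
  proof (cases "x : box a b")
   case True
   hence "(%n. exp (- \<beta> x) ^ n) ----> 0" using \<beta>(3)[of x] by(intro LIMSEQ_power_zero) simp
   hence "(%n. 1 - exp (- \<beta> x) ^ n) ----> 1 - 0" by(intro tendsto_diff tendsto_const)
   moreover have "ps n x = 1 - exp (- \<beta> x) ^ n" for n unfolding ps_def exp_of_nat_mult[symmetric] by simp
   ultimately show ?thesis using True by simp
  next
   case False
   hence "ps n x = 0" for n using z[of n x] by blast
   thus ?thesis using False by simp
  qed
 qed
qed

section \<open>Integration by parts and the fundamental lemma\<close>

lemma integrable_continuous_compact_support:
 fixes f :: "'e::euclidean_space => real"
 assumes "continuous_on UNIV f" "compact K" "!!x. x \<notin> K ==> f x = 0"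
 shows "integrable lborel f"
proof -
 have "integrable lborel (%x. indicator K x *\<^sub>R f x)" using assms(1,2) by(intro borel_integrable_compact) (auto intro: continuous_on_subset)
 moreover have "(%x. indicator K x *\<^sub>R f x) = f" using assms(3) by(auto simp: fun_eq_iff indicator_def)
 ultimately show ?thesis by simp
qed

lemma lborel_integral_translation:
 fixes f :: "'e::euclidean_space => real"
 assumes [measurable]: "f : borel_measurable borel"
 shows "(LINT x|lborel. f (c + x)) = (LINT x|lborel. f x)" using integral_distr[of "(+) c" lborel borel f] by(simp add: lborel_distr_plus)

text \<open>The difference quotients in direction \<open>v\<close> have integral zero by translation
  invariance of Lebesgue measure; the mean value theorem provides a bounded majorant of compact
  support, so dominated convergence carries the zero to the derivative.\<close>

lemma integral_directional_derivative_eq_0: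
 fixes \<phi> :: "'e::euclidean_space => real"
 assumes d: "!!x. (\<phi> has_derivative \<phi>' x) (at x)" and cont: "continuous_on UNIV (%x. \<phi>' x v)"
  and K: "compact K" "!!x. x \<notin> K ==> \<phi> x = 0"
 shows "(LINT x|lborel. \<phi>' x v) = 0"
proof -
 obtain R where R: "!!x. x : K ==> norm x <= R" using compact_imp_bounded[OF K(1)] by(auto simp: bounded_iff)
 \<comment> \<open>Margin for the segments: a step of length at most \<open>norm v\<close> from a
   point of norm at most \<open>R + norm v\<close> stays in \<open>C\<close>, while outside that
   radius neither end of the step meets \<open>K\<close>.\<close>
 define C where "C = cball (0::'e) (R + 2 * norm v)"
 have "bounded ((%x. \<phi>' x v) ` C)" unfolding C_def by(intro compact_imp_bounded compact_continuous_image continuous_on_subset[OF cont]) auto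
 then obtain B where B: "!!x. x : C ==> \<bar>\<phi>' x v\<bar> <= B" by(auto simp: bounded_iff)
 have cont\<phi>: "continuous_on UNIV \<phi>" using has_derivative_continuous[OF d] by(simp add: continuous_on_eq_continuous_within)
 have [measurable]: "\<phi> : borel_measurable borel" "(%x. \<phi>' x v) : borel_measurable borel" using cont cont\<phi> by(auto intro: borel_measurable_continuous_onI)
 define h where "h n = 1 / real (Suc n)" for n
 have h: "0 < h n" "h n <= 1" for n by(auto simp: h_def)
 define q where "q n x = (\<phi> (h n *\<^sub>R v + x) - \<phi> x) / h n" for n x
 have int\<phi>: "integrable lborel \<phi>" by(rule integrable_continuous_compact_support[OF cont\<phi> K])
 have int\<phi>h: "integrable lborel (%x. \<phi> (c + x))" for c using integrable_distr[of "(+) c" lborel borel \<phi>] int\<phi> by(simp add: lborel_distr_plus)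
 have q0: "(LINT x|lborel. q n x) = 0" for n unfolding q_def using int\<phi> int\<phi>h[of "h n *\<^sub>R v"] by(simp add: lborel_integral_translation)
 have dom: "norm (q n x) <= indicator (cball 0 (R + norm v)) x * B" for n x
 proof (cases "x : cball 0 (R + norm v)")
  case True
  have seg: "((%s. \<phi> (s *\<^sub>R v + x)) has_real_derivative \<phi>' (s *\<^sub>R v + x) v) (at s)" for s :: real
  proof -
   have "((%s. \<phi> (s *\<^sub>R v + x)) has_derivative (%t. \<phi>' (s *\<^sub>R v + x) (t *\<^sub>R v + 0))) (at s)"
    by(rule has_derivative_compose[OF _ d]) (auto intro!: derivative_eq_intros)
   moreover have "\<phi>' (s *\<^sub>R v + x) (t *\<^sub>R v + 0) = \<phi>' (s *\<^sub>R v + x) v * t" for t using linear_scale[OF has_derivative_linear[OF d]] by simp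
   ultimately show ?thesis by(simp add: has_field_derivative_def)
  qed
  obtain s where s: "0 < s" "s < h n"
    "\<phi> (h n *\<^sub>R v + x) - \<phi> (0 *\<^sub>R v + x) = (h n - 0) * \<phi>' (s *\<^sub>R v + x) v"
   using MVT2[OF h(1)[of n], of "%s. \<phi> (s *\<^sub>R v + x)" "%s. \<phi>' (s *\<^sub>R v + x) v"] seg by blast
  have "norm (s *\<^sub>R v + x) <= s * norm v + norm x" using s(1) norm_triangle_ineq[of "s *\<^sub>R v" x] by simp
  also have "... <= 1 * norm v + (R + norm v)" using s h(2)[of n] True by(intro add_mono mult_right_mono) auto
  finally have "s *\<^sub>R v + x : C" by(simp add: C_def)
  hence "\<bar>q n x\<bar> <= B" using B s(3) h(1)[of n] by(simp add: q_def)
  thus ?thesis using True by simp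
 next
  case False
  hence "x \<notin> K" using R[of x] norm_ge_zero[of v] by(auto simp: not_le)
  have "norm x <= norm (h n *\<^sub>R v + x) + norm (h n *\<^sub>R v)" using norm_triangle_ineq4[of "h n *\<^sub>R v + x" "h n *\<^sub>R v"] by simp
  also have "norm (h n *\<^sub>R v) <= 1 * norm v" using h[of n] by(simp add: mult_left_le_one_le)
  finally have "norm (h n *\<^sub>R v + x) > R" using False by simp
  hence "h n *\<^sub>R v + x \<notin> K" using R[of "h n *\<^sub>R v + x"] by linarith
  thus ?thesis using K(2) \<open>x \<notin> K\<close> False by(simp add: q_def)
 qed
 have lim: "(%n. q n x) ----> \<phi>' x v" for x
 proof -
  have "((%s. \<phi> (s *\<^sub>R v + x)) has_derivative (%t. \<phi>' (0 *\<^sub>R v + x) (t *\<^sub>R v + 0))) (at 0)"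
   by(rule has_derivative_compose[OF _ d]) (auto intro!: derivative_eq_intros)
  moreover have "\<phi>' (0 *\<^sub>R v + x) (t *\<^sub>R v + 0) = \<phi>' x v * t" for t using linear_scale[OF has_derivative_linear[OF d]] by simp
  ultimately have "((%s. \<phi> (s *\<^sub>R v + x)) has_real_derivative \<phi>' x v) (at 0)" by(simp add: has_field_derivative_def)
  hence "((%s. (\<phi> (s *\<^sub>R v + x) - \<phi> x) / s) \<longlongrightarrow> \<phi>' x v) (at 0)" by(simp add: has_field_derivative_iff)
  moreover have "filterlim h (at 0) sequentially" unfolding filterlim_at using h LIMSEQ_inverse_real_of_nat by(auto simp: h_def[abs_def] inverse_eq_divide)
  ultimately show ?thesis unfolding q_def by(rule filterlim_compose)
 qed
 have "(%n. LINT x|lborel. q n x) ----> (LINT x|lborel. \<phi>' x v)"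
 proof (rule integral_dominated_convergence)
  have "integrable lborel (%x. indicator (cball 0 (R + norm v)) x *\<^sub>R B)" by(rule borel_integrable_compact) auto
  thus "integrable lborel (%x. indicator (cball 0 (R + norm v)) x * B)" by simp
  show "AE x in lborel. norm (q n x) <= indicator (cball 0 (R + norm v)) x * B" for n using dom by auto
  show "AE x in lborel. (%n. q n x) ----> \<phi>' x v" using lim by auto
  show "q n : borel_measurable lborel" for n unfolding q_def by measurable
 qed measurable
 thus ?thesis unfolding q0 by(simp add: LIMSEQ_const_iff)
qed

text \<open>The product \<open>s * ps\<close>, extended by zero, is differentiable on the whole
  space, and its directional derivative integrates to zero. Continuity across the boundary of
  \<open>V\<close> comes from the open cover by \<open>V\<close> and the complement of the
  support.\<close>

lemma integration_by_parts_test_function: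
 fixes s :: "'e::euclidean_space => real"
 assumes V: "open V" and s: "Ck_on (Suc 0) V s" and ps: "ps : test_functions V"
 shows "(LINT p:V|lebesgue. s p * fderiv ps (at p) i) =
   - (LINT p:V|lebesgue. fderiv s (at p) i * ps p)"
proof -
 define K where "K = closure {p. ps p ~= 0}"
 have K: "compact K" "K <= V" "!!p. p \<notin> K ==> ps p = 0" using ps closure_subset[of "{p. ps p ~= 0}"] by(auto simp: K_def test_functions_def)
 have "Ck_on (Suc 0) UNIV ps" using ps by(auto simp: test_functions_def smooth_on_def simp del: Ck_on.simps)
 hence dps: "(ps has_derivative fderiv ps (at p)) (at p)"
  and cps: "continuous_on UNIV (%p. fderiv ps (at p) v)" "continuous_on UNIV ps" for p v
  using Ck_on_derivative[of 0 UNIV ps p] Ck_on_imp_continuous_on[of "Suc 0" UNIV ps] by auto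
 have ds: "p : V ==> (s has_derivative fderiv s (at p)) (at p)"
  and cs: "continuous_on V (%p. fderiv s (at p) v)" "continuous_on V s" for p v using Ck_on_derivative[OF s] Ck_on_imp_continuous_on[OF s] s by auto
 have oK: "open (- K)" using K(1) by(simp add: compact_imp_closed open_Compl)
 have zps: "fderiv ps (at p) v = 0" if "p \<notin> K" for p v
 proof -
  have "((%p. 0) has_derivative (%v. 0)) (at p)" by simp
  hence "(ps has_derivative (%v. 0)) (at p)" by(rule has_derivative_transform_within_open[OF _ oK]) (use that K(3) in auto)
  hence "fderiv ps (at p) = (%v. 0)" by(rule frechet_derivative_at[symmetric])
  thus ?thesis by simp
 qed
 define f g \<phi> where "f p = indicator V p * (s p * fderiv ps (at p) i)"
  and "g p = indicator V p * (fderiv s (at p) i * ps p)"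
  and "\<phi> p = indicator V p * (s p * ps p)" for p
 have cont: "continuous_on UNIV F"
  if "!!p. p : V ==> F p = G p" "continuous_on V G" "!!p. p \<notin> K ==> F p = 0" for F G :: "'e => real"
 proof -
  have "continuous_on V F" using that(1,2) by(metis continuous_on_cong)
  moreover have "continuous_on (- K) F" using that(3) continuous_on_const[of "- K" "0::real"] by(metis ComplD continuous_on_cong)
  ultimately have "continuous_on (V Un - K) F" using V oK continuous_on_open_Un by blast
  moreover have "V Un - K = UNIV" using K(2) by auto
  ultimately show ?thesis by simp
 qed
 have cf: "continuous_on UNIV f" by(rule cont[of _ "%p. s p * fderiv ps (at p) i"])
   (auto simp: f_def zps intro!: continuous_intros cs continuous_on_subset[OF cps(1)])
 have cg: "continuous_on UNIV g" by(rule cont[of _ "%p. fderiv s (at p) i * ps p"])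
   (auto simp: g_def K(3) intro!: continuous_intros cs continuous_on_subset[OF cps(2)])
 have fK: "f p = 0" "g p = 0" if "p \<notin> K" for p using that by(auto simp: f_def g_def zps K(3))
 have int: "integrable lborel f" "integrable lborel g" using cf cg fK by(auto intro: integrable_continuous_compact_support[OF _ K(1)])
 have "(\<phi> has_derivative (%v. indicator V p * (s p * fderiv ps (at p) v + fderiv s (at p) v * ps p))) (at p)" for p
 proof (cases "p : V")
  case True
  have "((%p. s p * ps p) has_derivative (%v. s p * fderiv ps (at p) v + fderiv s (at p) v * ps p)) (at p)" by(rule has_derivative_mult[OF ds[OF True] dps])
  hence "(\<phi> has_derivative (%v. s p * fderiv ps (at p) v + fderiv s (at p) v * ps p)) (at p)"
   by(rule has_derivative_transform_within_open[OF _ V True]) (auto simp: \<phi>_def)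
  thus ?thesis using True by simp
 next
  case False
  have "((%p. 0) has_derivative (%v. 0)) (at p)" by simp
  hence "(\<phi> has_derivative (%v. 0)) (at p)" by(rule has_derivative_transform_within_open[OF _ oK]) (use False K(2,3) in \<open>auto simp: \<phi>_def\<close>)
  thus ?thesis using False by simp
 qed
 moreover have "indicator V p * (s p * fderiv ps (at p) i + fderiv s (at p) i * ps p) = f p + g p" for p by(simp add: f_def g_def algebra_simps)
 ultimately have "(LINT p|lborel. f p + g p) = 0" using integral_directional_derivative_eq_0[of \<phi>
    "%p v. indicator V p * (s p * fderiv ps (at p) v + fderiv s (at p) v * ps p)" i K]
   K continuous_on_add[OF cf cg] by(simp add: \<phi>_def)
 hence "integral\<^sup>L lborel f = - integral\<^sup>L lborel g" using int by simp
 moreover have "integral\<^sup>L lebesgue f = integral\<^sup>L lborel f" "integral\<^sup>L lebesgue g = integral\<^sup>L lborel g"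
  using cf cg by(auto intro!: integral_completion borel_measurable_continuous_onI)
 ultimately show ?thesis unfolding set_lebesgue_integral_def real_scaleR_def f_def[abs_def, symmetric] g_def[abs_def, symmetric] by simp
qed

text \<open>Dynkin's argument: open boxes are stable under intersection and generate the Borel sets,
  and the sets with vanishing integral are closed under complements and disjoint unions. Since only
  Borel sets are generated, \<open>h\<close> is replaced by a Borel version
  \<open>g\<close>.\<close>

lemma AE_zero_if_box_integrals_zero:
 fixes h :: "'e::euclidean_space => real"
 assumes h: "integrable lebesgue h" and h0: "!!x. x \<notin> box a b ==> h x = 0"
  and z: "!!c d. box c d <= box a b ==> (LINT x:box c d|lebesgue. h x) = 0"
 shows "AE x in lebesgue. h x = 0"
proof -
 have "h : borel_measurable (completion lborel)" using h by auto
 then obtain g where g[measurable]: "g : borel_measurable lborel" and hg: "AE x in lborel. h x = g x" using completion_ex_borel_measurable_real by blast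
 have hg': "AE x in lebesgue. h x = g x" using hg by(rule AE_completion)
 have gm: "g : borel_measurable lebesgue" by(rule measurable_completion) measurable
 have hm: "h : borel_measurable lebesgue" using h by auto
 have "integrable lebesgue g" using h integrable_cong_AE[OF hm gm hg'] by simp
 hence int: "integrable lborel g" by(simp add: integrable_completion)
 have sint: "set_integrable lborel A g" if "A : sets borel" for A using int that unfolding set_integrable_def by(intro integrable_mult_indicator) auto
 have eq: "(LINT x:A|lborel. g x) = (LINT x:A|lebesgue. h x)" if [measurable]: "A : sets borel" for A
 proof -
  have "(LINT x:A|lborel. g x) = (LINT x:A|lebesgue. g x)" unfolding set_lebesgue_integral_def by(rule integral_completion[symmetric]) measurable
  also have "... = (LINT x:A|lebesgue. h x)" unfolding set_lebesgue_integral_def real_scaleR_def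
   using hg' hm gm by(intro integral_cong_AE borel_measurable_times borel_measurable_indicator) auto
  finally show ?thesis .
 qed
 have box: "(LINT x:box c d|lborel. g x) = 0" for c d
 proof -
  obtain c' d' where cd: "box c d Int box a b = box c' d'" by(rule that[OF box_Int_box])
  have "(LINT x:box c d|lebesgue. h x) = (LINT x:box c d Int box a b|lebesgue. h x)" unfolding set_lebesgue_integral_def
   by(rule Bochner_Integration.integral_cong) (auto simp: indicator_def h0)
  thus ?thesis using z[of c' d'] cd by(subst eq) auto
 qed
 have UNIV0: "(LINT x:UNIV|lborel. g x) = 0"
 proof -
  have "(LINT x:UNIV|lebesgue. h x) = (LINT x:box a b|lebesgue. h x)" unfolding set_lebesgue_integral_def
   by(rule Bochner_Integration.integral_cong) (auto simp: indicator_def h0)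
  thus ?thesis using z[of a b] by(subst eq) auto
 qed
 have stable: "Int_stable (range (%(a, b). box a b :: 'e set))" by(auto simp: Int_stable_def box_Int_box)
 have Pow: "range (%(a, b). box a b :: 'e set) <= Pow UNIV" by simp
 have "(LINT x:A|lborel. g x) = 0" if "A : sets borel" for A
 proof -
  have "A : sigma_sets UNIV (range (%(a, b). box a b :: 'e set))" using that by(simp add: borel_eq_box)
  from stable Pow this show ?thesis
  proof (induction rule: sigma_sets_induct_disjoint)
   case (basic A) thus ?case using box by auto
  next
   case empty thus ?case by(simp add: set_lebesgue_integral_def)
  next
   case (compl A)
   hence A: "A : sets borel" by(simp add: borel_eq_box)
   have "(LINT x:A Un (UNIV - A)|lborel. g x) = (LINT x:A|lborel. g x) + (LINT x:UNIV - A|lborel. g x)" using A by(intro set_integral_Un sint) auto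
   thus ?case using compl UNIV0 by simp
  next
   case (union A)
   hence A: "A i : sets borel" for i by(auto simp: borel_eq_box)
   have "(LINT x:(\<Union>i. A i)|lborel. g x) = (\<Sum>i. LINT x:A i|lborel. g x)"
    using A union(1) by(intro lebesgue_integral_countable_add sint) (auto simp: disjoint_family_on_def)
   thus ?case using union by simp
  qed
 qed
 hence "AE x in lborel. g x = 0" using int by(intro density_unique_real) auto
 hence "AE x in lebesgue. g x = 0" by(rule AE_completion)
 with hg' show ?thesis by eventually_elim simp
qed

text \<open>Testing with the smooth approximations of box indicators shows that all integrals over
  boxes inside \<open>V\<close> vanish; countably many such boxes cover \<open>V\<close>, so the
  exceptional null sets can be united.\<close>

lemma fundamental_lemma_calculus_of_variations:
 fixes g :: "'e::euclidean_space => real"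
 assumes V: "open V" and g: "!!C. compact C ==> C <= V ==> set_integrable lebesgue C g"
  and z: "!!ps. ps : test_functions V ==> (LINT p:V|lebesgue. g p * ps p) = 0"
 shows "AE p in lebesgue. p : V --> g p = 0"
proof -
 have box0: "(LINT p:box a b|lebesgue. g p) = 0" if ab: "cbox a b <= V" for a b
 proof -
  obtain ps where ps: "!!n. ps n : test_functions V" "!!n x. 0 <= ps n x" "!!n x. ps n x <= indicator (box a b) x"
   "!!x. (%n. ps n x) ----> indicator (box a b) x" by(rule test_functions_box[OF ab]) (rule that)
  have gi: "integrable lebesgue (%x. indicator (cbox a b) x * g x)" using g[of "cbox a b"] ab by(simp add: set_integrable_def)
  have psbox: "ps n p = indicator (cbox a b) p * ps n p" for n p
  proof (cases "p : cbox a b")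
   case False
   hence "p \<notin> box a b" using box_subset_cbox[of a b] by blast
   thus ?thesis using ps(2,3)[of n p] by simp
  qed simp
  have psm: "ps n : borel_measurable lebesgue" for n using ps(1)[of n] Ck_on_imp_continuous_on[of 0 UNIV "ps n"] by(auto simp: test_functions_def smooth_on_def
     intro!: measurable_completion borel_measurable_continuous_onI simp del: Ck_on.simps)
  have eq: "indicator V p *\<^sub>R (g p * ps n p) = (indicator (cbox a b) p * g p) * ps n p" for n p using psbox[of n p] ab by(auto simp: indicator_def)
  have "(%n. LINT p|lebesgue. indicator V p *\<^sub>R (g p * ps n p)) ----> (LINT p|lebesgue. indicator (box a b) p *\<^sub>R g p)"
  proof (rule integral_dominated_convergence)
   show "integrable lebesgue (%x. \<bar>indicator (cbox a b) x * g x\<bar>)" using gi by(rule integrable_abs)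
   show m: "(%p. indicator V p *\<^sub>R (g p * ps n p)) : borel_measurable lebesgue" for n
    unfolding eq using borel_measurable_integrable[OF gi] psm by(rule borel_measurable_times)
   have psle: "\<bar>ps n p\<bar> <= 1" for n p using ps(2,3)[of n p] indicator_le_1[of "box a b" p, where ?'a=real] by linarith
   show "AE p in lebesgue. norm (indicator V p *\<^sub>R (g p * ps n p)) <= \<bar>indicator (cbox a b) p * g p\<bar>" for n
    unfolding eq using psle[of n] by(intro always_eventually allI) (simp add: abs_mult mult_left_le)
   show "AE p in lebesgue. (%n. indicator V p *\<^sub>R (g p * ps n p)) ----> indicator (box a b) p *\<^sub>R g p"
   proof (intro always_eventually allI)
    fix p
    have "(%n. (indicator (cbox a b) p * g p) * ps n p) ----> (indicator (cbox a b) p * g p) * indicator (box a b) p" by(intro tendsto_intros ps(4))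
    moreover have "(indicator (cbox a b) p * g p) * indicator (box a b) p = indicator (box a b) p *\<^sub>R g p"
     using box_subset_cbox[of a b] by(auto simp: indicator_def)
    ultimately show "(%n. indicator V p *\<^sub>R (g p * ps n p)) ----> indicator (box a b) p *\<^sub>R g p" unfolding eq by simp
   qed
   have "(%p. indicator (box a b) p * (indicator (cbox a b) p * g p)) : borel_measurable lebesgue"
    by(rule borel_measurable_times[OF borel_measurable_indicator borel_measurable_integrable[OF gi]]) simp
   moreover have "indicator (box a b) p * (indicator (cbox a b) p * g p) = indicator (box a b) p *\<^sub>R g p" for p
    using box_subset_cbox[of a b] by(auto simp: indicator_def)
   ultimately show "(%p. indicator (box a b) p *\<^sub>R g p) : borel_measurable lebesgue" by simp
  qed
  moreover have "(LINT p|lebesgue. indicator V p *\<^sub>R (g p * ps n p)) = 0" for n using z[OF ps(1)] by(simp add: set_lebesgue_integral_def)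
  ultimately show ?thesis by(simp add: set_lebesgue_integral_def LIMSEQ_const_iff)
 qed
 have box: "AE p in lebesgue. p : box a b --> g p = 0" if ab: "cbox a b <= V" for a b
 proof -
  have "AE x in lebesgue. indicator (box a b) x * g x = 0"
  proof (rule AE_zero_if_box_integrals_zero[of _ a b])
   have "integrable lebesgue (%x. indicator (box a b) x *\<^sub>R (indicator (cbox a b) x *\<^sub>R g x))"
    by(rule integrable_mult_indicator[OF _ g[of "cbox a b", unfolded set_integrable_def]]) (use ab in auto)
   moreover have "indicator (box a b) x *\<^sub>R (indicator (cbox a b) x *\<^sub>R g x) = indicator (box a b) x * g x" for x
    using box_subset_cbox[of a b] by(auto simp: indicator_def)
   ultimately show "integrable lebesgue (%x. indicator (box a b) x * g x)" by(simp only:)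
   fix c d assume cd: "box c d <= box a b"
   have "(LINT x:box c d|lebesgue. indicator (box a b) x * g x) = (LINT x:box c d|lebesgue. g x)" unfolding set_lebesgue_integral_def
    by(rule Bochner_Integration.integral_cong) (use cd in \<open>auto simp: indicator_def\<close>)
   also have "... = 0"
   proof (cases "box c d = {}")
    case True thus ?thesis by(simp add: set_lebesgue_integral_def)
   next
    case False
    \<comment> \<open>Closures are compared: a nonempty open box is dense in its closed box.\<close>
    hence "cbox c d <= cbox a b" using cd by(metis closure_box closure_mono box_eq_empty(1) order_trans box_subset_cbox closed_cbox closure_minimal)
    thus ?thesis using ab by(intro box0) auto
   qed
   finally show "(LINT x:box c d|lebesgue. indicator (box a b) x * g x) = 0" .
  qed auto
  thus ?thesis by eventually_elim (auto simp: indicator_def split: if_splits)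
 qed
 obtain \<D> where \<D>: "countable \<D>" "!!X. X : \<D> ==> EX a b. X = box a b & cbox a b <= V" "\<Union>\<D> = V"
 proof -
  have "EX a b. x : box a b & cbox a b <= V" if "x : V" for x using open_contains_cbox[OF V that] by(metis)
  hence "\<Union>{box a b | a b. cbox a b <= V} = V" using box_subset_cbox by fast
  thus ?thesis using Lindelof[of "{box a b | a b. cbox a b <= V}"] that by(smt (verit) mem_Collect_eq open_box subset_iff)
 qed
 have "AE p in lebesgue. ALL X:\<D>. p : X --> g p = 0" using \<D>(1) by(subst AE_ball_countable) (use \<D>(2) box in blast)+
 thus ?thesis by eventually_elim (use \<D>(3) in auto)
qed

text \<open>The infima of \<open>q\<close> over the shrinking sets increase to a limit
  \<open>L\<close>. If x and y lie in \<open>S N\<close> with q-values at most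
  \<open>L + 1/(N+1)\<close>, their midpoint still costs at least the infimum over
  \<open>S N\<close>, and the parallelogram inequality leaves no room for \<open>dq x y\<close>. No
  linear structure enters, so \<open>mid\<close> can act on pairs of a function and its
  differential.\<close>

lemma midpoint_minimizing_Cauchy:
 fixes S :: "nat => 'x set" and q :: "'x => real"
 assumes ne: "!!n. S n ~= {}" and dec: "!!n. S (Suc n) <= S n"
  and mid: "!!n x y. x : S n ==> y : S n ==> mid x y : S n"
  and q: "!!x. x : S 0 ==> 0 <= q x" "!!x. x : S 0 ==> q x <= B"
  and par: "!!x y. x : S 0 ==> y : S 0 ==> q (mid x y) <= (q x + q y) / 2 - dq x y / 4"
 shows "EX h. (ALL n. h n : S n) & (ALL e>0. EX N. ALL m>=N. ALL n>=N. dq (h m) (h n) < (e::real))"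
proof -
 have anti: "S n <= S m" if "m <= n" for m n using dec that by(rule lift_Suc_antimono_le)
 have S0: "S n <= S 0" for n using anti by simp
 define d where "d n = Inf (q ` S n)" for n
 have bdd: "bdd_below (q ` S n)" for n using q(1) S0[of n] by(intro bdd_belowI2[of _ 0]) auto
 have d_le: "d n <= q x" if "x : S n" for n x unfolding d_def using bdd that by(intro cINF_lower) auto
 have dmono: "d m <= d n" if "m <= n" for m n unfolding d_def using anti[OF that] bdd ne by(intro cInf_superset_mono) auto
 have dB: "d n <= B" for n
 proof -
  obtain x where "x : S n" using ne by blast
  thus ?thesis using d_le[of x n] q(2)[of x] S0[of n] by fastforce
 qed
 obtain L where L: "d ----> L" "!!n. d n <= L" using incseq_convergent[of d B] dmono dB by(auto simp: incseq_def)
 have "EX x:S n. q x < d n + 1 / real (Suc n)" for n using cInf_lessD[of "q ` S n" "d n + 1 / real (Suc n)"] ne by(auto simp: d_def)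
 then obtain h where h: "!!n. h n : S n" "!!n. q (h n) < d n + 1 / real (Suc n)" by metis
 have "EX N. ALL m>=N. ALL n>=N. dq (h m) (h n) < e" if e: "e > 0" for e
 proof -
  have "(%n. 4 * (L + inverse (real (Suc n)) - d n)) ----> 4 * (L + 0 - L)" by(intro tendsto_intros L(1) LIMSEQ_inverse_real_of_nat)
  hence "eventually (%n. 4 * (L + inverse (real (Suc n)) - d n) < e) sequentially" using order_tendstoD(2)[of _ _ _ e] e by simp
  then obtain N where N: "4 * (L + 1 / real (Suc N) - d N) < e" by(auto simp: eventually_sequentially inverse_eq_divide)
  have "dq (h m) (h n) < e" if "m >= N" "n >= N" for m n
  proof -
   have hN: "h m : S N" "h n : S N" using h(1) anti that by blast+
   hence "d N <= q (mid (h m) (h n))" using mid d_le by blast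
   also have "... <= (q (h m) + q (h n)) / 2 - dq (h m) (h n) / 4" using hN S0 by(intro par) auto
   finally have *: "dq (h m) (h n) <= 4 * ((q (h m) + q (h n)) / 2 - d N)" by argo
   have "q (h k) <= L + 1 / real (Suc N)" if "k >= N" for k
   proof -
    have "1 / real (Suc k) <= 1 / real (Suc N)" using that by(intro divide_left_mono) auto
    thus ?thesis using h(2)[of k] L(2)[of k] by linarith
   qed
   hence "q (h m) <= L + 1 / real (Suc N)" "q (h n) <= L + 1 / real (Suc N)" using that by auto
   thus ?thesis using * N by argo
  qed
  thus ?thesis by blast
 qed
 thus ?thesis using h(1) by blast
qed

section \<open>Square-integrable functions\<close>

lemma L2_spaceI: "u : borel_measurable mu ==> integrable mu (%x. (u x)^2) ==> u : L2_space mu" by(simp add: L2_space_def)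

lemma L2_spaceD:
 assumes "u : L2_space mu"
 shows "u : borel_measurable mu" "integrable mu (%x. (u x)^2)" using assms by(auto simp: L2_space_def)

lemma L2_norm_nonneg [simp]: "0 <= L2_norm mu u" by(simp add: L2_norm_def)

lemma L2_norm_power2: "(L2_norm mu u)^2 = (LINT x|mu. (u x)^2)" by(simp add: L2_norm_def)

lemma L2_norm_cong_AE:
 assumes "AE x in mu. \<bar>u x\<bar> = \<bar>v x\<bar>" "u : borel_measurable mu" "v : borel_measurable mu"
 shows "L2_norm mu u = L2_norm mu v"
proof -
 have "AE x in mu. (u x)^2 = (v x)^2" using assms(1) by eventually_elim (metis power2_abs)
 thus ?thesis unfolding L2_norm_def using assms(2,3) by(subst integral_cong_AE[of _ _ "%x. (v x)^2"]) auto
qed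

lemma L2_space_mono:
 assumes "g : L2_space mu" "f : borel_measurable mu" "AE x in mu. \<bar>f x\<bar> <= \<bar>g x\<bar>"
 shows "f : L2_space mu" "L2_norm mu f <= L2_norm mu g"
proof -
 note [measurable] = L2_spaceD(1)[OF assms(1)] assms(2)
 have le: "AE x in mu. (f x)^2 <= (g x)^2" using assms(3) by eventually_elim (simp add: abs_le_square_iff)
 have "integrable mu (%x. (f x)^2)" by(rule Bochner_Integration.integrable_bound[OF L2_spaceD(2)[OF assms(1)]]) (use le in auto)
 thus "f : L2_space mu" by(auto intro: L2_spaceI)
 show "L2_norm mu f <= L2_norm mu g" unfolding L2_norm_def using le L2_spaceD(2)[OF assms(1)] \<open>integrable mu (%x. (f x)^2)\<close>
  by(intro real_sqrt_le_mono integral_mono_AE) auto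
qed

lemma L2_space_cmult: "u : L2_space mu ==> (%x. c * u x) : L2_space mu" by(auto intro!: L2_spaceI dest: L2_spaceD simp: power_mult_distrib)

lemma L2_norm_cmult: "L2_norm mu (%x. c * u x) = \<bar>c\<bar> * L2_norm mu u" by(simp add: L2_norm_def power_mult_distrib real_sqrt_mult)

lemma L2_product_integrable:
 assumes "u : L2_space mu" "v : L2_space mu"
 shows "integrable mu (%x. u x * v x)"
proof (rule Bochner_Integration.integrable_bound)
 note [measurable] = L2_spaceD(1)[OF assms(1)] L2_spaceD(1)[OF assms(2)]
 show "integrable mu (%x. (u x)^2 + (v x)^2)" using L2_spaceD(2)[OF assms(1)] L2_spaceD(2)[OF assms(2)] by simp
 show "(%x. u x * v x) : borel_measurable mu" by measurable
 have "\<bar>a * b\<bar> <= a^2 + b^2" for a b :: real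
  using sum_squares_bound[of "\<bar>a\<bar>" "\<bar>b\<bar>"] mult_nonneg_nonneg[OF abs_ge_zero[of a] abs_ge_zero[of b]] unfolding abs_mult power2_abs by linarith
 thus "AE x in mu. norm (u x * v x) <= norm ((u x)^2 + (v x)^2)" by auto
qed

lemma L2_space_add:
 assumes "u : L2_space mu" "v : L2_space mu"
 shows "(%x. u x + v x) : L2_space mu"
proof (rule L2_spaceI)
 note [measurable] = L2_spaceD(1)[OF assms(1)] L2_spaceD(1)[OF assms(2)]
 show "(%x. u x + v x) : borel_measurable mu" by measurable
 have "(u x + v x)^2 = (u x)^2 + (v x)^2 + 2 * (u x * v x)" for x by(simp add: power2_sum)
 thus "integrable mu (%x. (u x + v x)^2)" using L2_spaceD(2)[OF assms(1)] L2_spaceD(2)[OF assms(2)] L2_product_integrable[OF assms] by simp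
qed

lemma L2_space_diff: "u : L2_space mu ==> v : L2_space mu ==> (%x. u x - v x) : L2_space mu"
 using L2_space_add[of u mu "%x. -1 * v x"] L2_space_cmult[of v mu "-1"] by simp

lemma L2_space_zero [simp]: "(%x. 0) : L2_space mu" by(rule L2_spaceI) auto

lemma L2_space_sum: "(!!i. i : I ==> u i : L2_space mu) ==> (%x. \<Sum>i\<in>I. u i x) : L2_space mu"
 by(induction I rule: infinite_finite_induct) (auto intro: L2_space_add)

lemma L2_Cauchy_Schwarz:
 assumes "u : L2_space mu" "v : L2_space mu"
 shows "\<bar>LINT x|mu. u x * v x\<bar> <= L2_norm mu u * L2_norm mu v"
proof -
 let ?a = "LINT x|mu. (u x)^2" and ?b = "LINT x|mu. u x * v x" and ?c = "LINT x|mu. (v x)^2"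
 have *: "0 <= ?a - 2 * t * ?b + t^2 * ?c" for t
 proof -
  have "0 <= (LINT x|mu. (u x - t * v x)^2)" by simp
  also have "... = (LINT x|mu. (u x)^2 - 2 * t * (u x * v x) + t^2 * (v x)^2)" by(rule Bochner_Integration.integral_cong) (auto simp: power2_diff power_mult_distrib)
  also have "... = ?a - 2 * t * ?b + t^2 * ?c" using L2_spaceD(2)[OF assms(1)] L2_spaceD(2)[OF assms(2)] L2_product_integrable[OF assms] by simp
  finally show ?thesis .
 qed
 have c: "0 <= ?c" by simp
 have "?b^2 <= ?a * ?c"
 proof (cases "?c = 0")
  case True
  have "?b = 0"
  proof (rule ccontr)
   assume "?b ~= 0"
   \<comment> \<open>At this \<open>t\<close> the quadratic, now affine in \<open>t\<close>, takes
     the value -1.\<close>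
   thus False using *[of "(?a + 1) / (2 * ?b)"] True by simp
  qed
  thus ?thesis using True by simp
 next
  case False
  have "?a - 2 * (?b / ?c) * ?b + (?b / ?c)^2 * ?c = ?a - ?b^2 / ?c" using False by(simp add: power2_eq_square field_simps)
  hence "?b^2 / ?c <= ?a" using *[of "?b / ?c"] by linarith
  thus ?thesis using False c by(simp add: pos_divide_le_eq)
 qed
 hence "sqrt (?b^2) <= sqrt (?a * ?c)" by(rule real_sqrt_le_mono)
 thus ?thesis by(simp add: L2_norm_def real_sqrt_mult)
qed

lemma L2_norm_triangle:
 assumes "u : L2_space mu" "v : L2_space mu"
 shows "L2_norm mu (%x. u x + v x) <= L2_norm mu u + L2_norm mu v"
proof (rule power2_le_imp_le)
 have "(L2_norm mu (%x. u x + v x))^2 = (LINT x|mu. (u x)^2 + (v x)^2 + 2 * (u x * v x))" unfolding L2_norm_power2 by(simp add: power2_sum mult.assoc)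
 also have "... = (L2_norm mu u)^2 + (L2_norm mu v)^2 + 2 * (LINT x|mu. u x * v x)" unfolding L2_norm_power2
  using L2_spaceD(2)[OF assms(1)] L2_spaceD(2)[OF assms(2)] L2_product_integrable[OF assms] by simp
 also have "... <= (L2_norm mu u)^2 + (L2_norm mu v)^2 + 2 * (L2_norm mu u * L2_norm mu v)" using L2_Cauchy_Schwarz[OF assms] by simp
 also have "... = (L2_norm mu u + L2_norm mu v)^2" by(simp add: power2_sum mult.assoc)
 finally show "(L2_norm mu (%x. u x + v x))^2 <= (L2_norm mu u + L2_norm mu v)^2" .
qed simp

lemma L2_norm_triangle3:
 assumes "u : L2_space mu" "v : L2_space mu" "w : L2_space mu"
 shows "L2_norm mu (%x. u x - w x) <= L2_norm mu (%x. u x - v x) + L2_norm mu (%x. v x - w x)"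
 using L2_norm_triangle[OF L2_space_diff[OF assms(1,2)] L2_space_diff[OF assms(2,3)]] by simp

lemma L2_norm_commute: "L2_norm mu (%x. u x - v x) = L2_norm mu (%x. v x - u x)" by(simp add: L2_norm_def power2_commute)

lemma L2_norm_diff_le:
 assumes "u : L2_space mu" "v : L2_space mu"
 shows "\<bar>L2_norm mu u - L2_norm mu v\<bar> <= L2_norm mu (%x. u x - v x)"
 using L2_norm_triangle3[OF assms(1,2) L2_space_zero] L2_norm_triangle3[OF assms(2,1) L2_space_zero]
  L2_norm_commute[of mu u v] by auto

lemma L2_norm_tendsto:
 assumes "!!n. u n : L2_space mu" "v : L2_space mu" "(%n. L2_norm mu (%x. u n x - v x)) ----> 0"
 shows "(%n. L2_norm mu (u n)) ----> L2_norm mu v" by(rule LIM_zero_cancel, rule Lim_null_comparison[OF _ assms(3)])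
  (use L2_norm_diff_le[OF assms(1,2)] in auto)

lemma L2_inner_tendsto:
 assumes "!!n. u n : L2_space mu" "!!n. v n : L2_space mu" "u' : L2_space mu" "v' : L2_space mu"
  and "(%n. L2_norm mu (%x. u n x - u' x)) ----> 0" "(%n. L2_norm mu (%x. v n x - v' x)) ----> 0"
 shows "(%n. LINT x|mu. u n x * v n x) ----> (LINT x|mu. u' x * v' x)"
proof (rule LIM_zero_cancel, rule Lim_null_comparison)
 have "\<bar>(LINT x|mu. u n x * v n x) - (LINT x|mu. u' x * v' x)\<bar> <=
   L2_norm mu (%x. u n x - u' x) * L2_norm mu (v n) + L2_norm mu u' * L2_norm mu (%x. v n x - v' x)" for n
 proof -
  have "(LINT x|mu. u n x * v n x) - (LINT x|mu. u' x * v' x) =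
   (LINT x|mu. (u n x - u' x) * v n x) + (LINT x|mu. u' x * (v n x - v' x))" using assms(1-4) by(simp add: L2_product_integrable algebra_simps)
  thus ?thesis using L2_Cauchy_Schwarz[OF L2_space_diff[OF assms(1,3)] assms(2), of n n]
    L2_Cauchy_Schwarz[OF assms(3) L2_space_diff[OF assms(2,4)], of n] by linarith
 qed
 thus "\<forall>\<^sub>F n in sequentially. norm ((LINT x|mu. u n x * v n x) - (LINT x|mu. u' x * v' x)) <=
   L2_norm mu (%x. u n x - u' x) * L2_norm mu (v n) + L2_norm mu u' * L2_norm mu (%x. v n x - v' x)" by simp
 have "(%n. L2_norm mu (%x. u n x - u' x) * L2_norm mu (v n) + L2_norm mu u' * L2_norm mu (%x. v n x - v' x))
   ----> 0 * L2_norm mu v' + L2_norm mu u' * 0" by(intro tendsto_intros assms L2_norm_tendsto[OF assms(2,4,6)])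
 thus "(%n. L2_norm mu (%x. u n x - u' x) * L2_norm mu (v n) + L2_norm mu u' * L2_norm mu (%x. v n x - v' x))
   ----> 0" by simp
qed

lemma nn_integral_L2_norm:
 assumes "u : L2_space mu"
 shows "(\<integral>\<^sup>+x. ennreal ((u x)^2) \<partial>mu) = ennreal ((L2_norm mu u)^2)"
 unfolding L2_norm_power2 using L2_spaceD(2)[OF assms] by(intro nn_integral_eq_integral) auto

lemma L2_spaceI_nn_integral:
 assumes "u : borel_measurable mu" "(\<integral>\<^sup>+x. ennreal ((u x)^2) \<partial>mu) <= ennreal (B^2)" "0 <= B"
 shows "u : L2_space mu" "L2_norm mu u <= B"
proof -
 note [measurable] = assms(1)
 have "integrable mu (%x. (u x)^2)" using assms(2) by(intro integrableI_nonneg) (auto intro: le_less_trans)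
 thus u: "u : L2_space mu" using assms(1) by(rule L2_spaceI[rotated])
 have "(L2_norm mu u)^2 <= B^2" using assms(2) nn_integral_L2_norm[OF u] by simp
 thus "L2_norm mu u <= B" using assms(3) by(rule power2_le_imp_le)
qed

text \<open>Fatou's lemma for the squares, giving membership and the bound at once when the limit is
  known only almost everywhere. The bound may start at an index \<open>N\<close>, which the shift by
  \<open>N\<close> absorbs.\<close>

lemma L2_Fatou:
 assumes u: "!!n. u n : L2_space mu" and v: "v : borel_measurable mu"
  and lim: "AE x in mu. (%n. u n x) ----> v x" and B: "!!n. n >= N ==> L2_norm mu (u n) <= B"
 shows "v : L2_space mu" "L2_norm mu v <= B"
proof -
 have B0: "0 <= B" using B[of N] L2_norm_nonneg[of mu "u N"] by linarith
 note [measurable] = v L2_spaceD(1)[OF u]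
 have "AE x in mu. ennreal ((v x)^2) = liminf (%n. ennreal ((u (n + N) x)^2))" using lim
 proof eventually_elim
  case (elim x)
  hence "(%n. ennreal ((u (n + N) x)^2)) ----> ennreal ((v x)^2)" by(intro tendsto_ennrealI tendsto_power LIMSEQ_ignore_initial_segment)
  thus ?case using lim_imp_Liminf[OF trivial_limit_sequentially] by metis
 qed
 hence "(\<integral>\<^sup>+x. ennreal ((v x)^2) \<partial>mu) = (\<integral>\<^sup>+x. liminf (%n. ennreal ((u (n + N) x)^2)) \<partial>mu)" by(rule nn_integral_cong_AE)
 also have "... <= liminf (%n. \<integral>\<^sup>+x. ennreal ((u (n + N) x)^2) \<partial>mu)" by(rule nn_integral_liminf) measurable
 also have "... <= liminf (%n. ennreal (B^2))" by(intro Liminf_mono always_eventually allI)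
   (auto simp: nn_integral_L2_norm[OF u] intro!: ennreal_leI power_mono B)
 also have "... = ennreal (B^2)" by(simp add: Liminf_const)
 finally show "v : L2_space mu" "L2_norm mu v <= B" using L2_spaceI_nn_integral[OF v _ B0] by auto
qed

lemma L2_tendsto_AE_subseq:
 assumes "!!n. u n : L2_space mu" "v : L2_space mu" "(%n. L2_norm mu (%x. u n x - v x)) ----> 0"
 shows "EX r::nat=>nat. strict_mono r & (AE x in mu. (%n. u (r n) x) ----> v x)"
proof -
 have "(%n. (L2_norm mu (%x. u n x - v x))^2) ----> 0^2" by(intro tendsto_power assms)
 hence "(%n. LINT x|mu. norm ((u n x - v x)^2)) ----> 0" by(simp add: L2_norm_power2)
 then obtain r :: "nat => nat" where r: "strict_mono r" "AE x in mu. (%n. (u (r n) x - v x)^2) ----> 0"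
  using tendsto_L1_AE_subseq[of mu "%n x. (u n x - v x)^2"] L2_spaceD(2)[OF L2_space_diff[OF assms(1,2)]] by blast
 have "AE x in mu. (%n. u (r n) x) ----> v x" using r(2)
 proof eventually_elim
  case (elim x)
  hence "(%n. sqrt ((u (r n) x - v x)^2)) ----> sqrt 0" by(rule tendsto_real_sqrt)
  thus ?case by(simp add: tendsto_rabs_zero_iff LIM_zero_iff)
 qed
 with r(1) show ?thesis by blast
qed

lemma L2_const: "finite_measure mu ==> (%x. c) : L2_space mu" by(rule L2_spaceI) (auto simp: finite_measure.integrable_const)

lemma L1_le_L2:
 assumes "finite_measure mu" "u : L2_space mu"
 shows "integrable mu u" "(LINT x|mu. \<bar>u x\<bar>) <= L2_norm mu (%x. 1) * L2_norm mu u"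
proof -
 show "integrable mu u" using L2_product_integrable[OF L2_const[OF assms(1), of 1] assms(2)] by simp
 have "(%x. \<bar>u x\<bar>) : L2_space mu" using assms(2) L2_spaceD(1)[OF assms(2)] by(intro L2_space_mono(1)[OF assms(2)]) auto
 from L2_Cauchy_Schwarz[OF L2_const[OF assms(1), of 1] this]
 show "(LINT x|mu. \<bar>u x\<bar>) <= L2_norm mu (%x. 1) * L2_norm mu u" by(simp add: L2_norm_def)
qed

text \<open>On a finite space the L1 norm is at most a multiple of the L2 norm, so the sum of the
  absolute values has a finite integral and is finite almost everywhere.\<close>

lemma L2_summable_AE:
 assumes "finite_measure mu" "!!k. g k : L2_space mu" "!!k. L2_norm mu (g k) <= b k" "summable b"
 shows "AE x in mu. summable (%k. \<bar>g k x\<bar>)"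
proof -
 let ?C = "L2_norm mu (%x. 1)"
 have [measurable]: "g k : borel_measurable mu" for k using L2_spaceD(1)[OF assms(2)] .
 have "(\<integral>\<^sup>+x. ennreal \<bar>g k x\<bar> \<partial>mu) <= ennreal (?C * b k)" for k
 proof -
  have "(\<integral>\<^sup>+x. ennreal \<bar>g k x\<bar> \<partial>mu) = ennreal (LINT x|mu. \<bar>g k x\<bar>)"
   using L1_le_L2(1)[OF assms(1,2)] by(intro nn_integral_eq_integral) auto
  also have "... <= ennreal (?C * b k)" using L1_le_L2(2)[OF assms(1,2), of k] mult_left_mono[OF assms(3)[of k], of ?C] by(intro ennreal_leI) simp
  finally show ?thesis .
 qed
 hence "(\<Sum>k. \<integral>\<^sup>+x. ennreal \<bar>g k x\<bar> \<partial>mu) <= (\<Sum>k. ennreal (?C * b k))" by(intro suminf_le) auto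
 also have "... = ennreal (\<Sum>k. ?C * b k)" using assms(4) order_trans[OF L2_norm_nonneg assms(3)] by(intro suminf_ennreal2 summable_mult) auto
 finally have "(\<integral>\<^sup>+x. (\<Sum>k. ennreal \<bar>g k x\<bar>) \<partial>mu) < \<infinity>" by(subst nn_integral_suminf) (auto intro: le_less_trans)
 hence "AE x in mu. (\<Sum>k. ennreal \<bar>g k x\<bar>) ~= \<infinity>" by(intro nn_integral_noteq_infinite) auto
 thus ?thesis by eventually_elim (rule summable_suminf_not_top, auto simp: top.not_eq_extremum)
qed

text \<open>Stated for an arbitrary function of two indices so that it serves the L2 distance as
  well as the energy of differences.\<close>

lemma fast_Cauchy_subseq:
 fixes d :: "nat => nat => real"
 assumes "ALL e>0. EX N. ALL m>=N. ALL n>=N. d m n < e" "!!k. \<epsilon> k > 0"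
 obtains r :: "nat => nat" where "strict_mono r" "!!k m n. m >= r k ==> n >= r k ==> d m n < \<epsilon> k"
proof -
 obtain N where N: "!!k m n. m >= N k ==> n >= N k ==> d m n < \<epsilon> k" using assms(1)[rule_format, OF assms(2)] by metis
 \<comment> \<open>The \<open>max\<close> takes \<open>Suc rk\<close> for strict growth and
   \<open>N (Suc k)\<close> for the Cauchy rate.\<close>
 define r where "r = rec_nat (N 0) (%k rk. max (Suc rk) (N (Suc k)))"
 have r: "r (Suc k) = max (Suc (r k)) (N (Suc k))" "r 0 = N 0" for k by(simp_all add: r_def)
 have "strict_mono r" by(rule strict_monoI_Suc) (simp add: r)
 moreover have "N k <= r k" for k by(cases k) (auto simp: r)
 ultimately show ?thesis using N that[of r] by(meson order_trans)
qed

text \<open>Riesz-Fischer: consecutive differences of a fast subsequence are summable almost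
  everywhere, and Fatou's lemma turns the pointwise limit into a limit in norm, since the rate holds
  between any two late indices. The limit is an actual function, as members of
  \<open>L2_space\<close> are not equivalence classes.\<close>

lemma L2_complete:
 assumes fin: "finite_measure mu" and u: "!!n. u n : L2_space mu"
  and C: "ALL e>0. EX N. ALL m>=N. ALL n>=N. L2_norm mu (%x. u m x - u n x) < e"
 shows "EX v:L2_space mu. (%n. L2_norm mu (%x. u n x - v x)) ----> 0"
proof -
 note [measurable] = L2_spaceD(1)[OF u]
 obtain r :: "nat => nat" where r: "strict_mono r"
   "!!k m n. m >= r k ==> n >= r k ==> L2_norm mu (%x. u m x - u n x) < (1/2) ^ k" by(rule fast_Cauchy_subseq[OF C, of "%k. (1/2) ^ k"]) auto
 have "AE x in mu. summable (%k. \<bar>u (r (Suc k)) x - u (r k) x\<bar>)" using r strict_monoD[OF r(1)]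
  by(intro L2_summable_AE[OF fin, where b="%k. (1/2) ^ k"] L2_space_diff u)
   (auto intro!: less_imp_le[OF r(2)] simp: less_imp_le summable_geometric)
 define v where "v x = lim (%k. u (r k) x)" for x
 have lim: "AE x in mu. (%k. u (r k) x) ----> v x" using \<open>AE x in mu. summable (%k. \<bar>u (r (Suc k)) x - u (r k) x\<bar>)\<close>
 proof eventually_elim
  case (elim x)
  hence "summable (%k. u (r (Suc k)) x - u (r k) x)" by(rule summable_rabs_cancel)
  hence "convergent (%n. \<Sum>k<n. u (r (Suc k)) x - u (r k) x)" by(simp add: summable_iff_convergent)
  hence "convergent (%n. (u (r n) x - u (r 0) x) + u (r 0) x)" unfolding sum_lessThan_telescope[of "%k. u (r k) x"] by(intro convergent_add convergent_const)
  thus ?case by(simp add: v_def convergent_LIMSEQ_iff)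
 qed
 have [measurable]: "v : borel_measurable mu" unfolding v_def by measurable
 have F: "(%x. u n x - v x) : L2_space mu" "L2_norm mu (%x. u n x - v x) <= (1/2) ^ k" if n: "n >= r k" for n k
 proof -
  have "AE x in mu. (%j. u n x - u (r j) x) ----> u n x - v x" using lim by eventually_elim (intro tendsto_intros)
  note * = L2_Fatou[OF L2_space_diff[OF u u] _ this, of k "(1/2)^k"]
  have "L2_norm mu (%x. u n x - u (r j) x) <= (1/2) ^ k" if "j >= k" for j using n strict_mono_less_eq[OF r(1), of k j] that by(intro less_imp_le[OF r(2)]) simp_all
  with * show "(%x. u n x - v x) : L2_space mu" "L2_norm mu (%x. u n x - v x) <= (1/2) ^ k" by auto
 qed
 have "v : L2_space mu" using L2_space_diff[OF u F(1)[of 0], of "r 0" "r 0"] by simp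
 moreover have "(%n. L2_norm mu (%x. u n x - v x)) ----> 0"
 proof (rule LIMSEQ_I)
  fix e :: real assume "e > 0"
  then obtain k where "(1/2) ^ k < e" using real_arch_pow_inv[of e "1/2"] by auto
  thus "EX N. ALL n>=N. norm (L2_norm mu (%x. u n x - v x) - 0) < e" using F(2)[of k] by(intro exI[of _ "r k"]) fastforce
 qed
 ultimately show ?thesis by blast
qed

section \<open>Poincare's inequality on a grid\<close>

lemma nn_set_integral_eq_set_integral:
 fixes f :: "'a => real"
 assumes "set_integrable M A f" "!!x. x : A ==> 0 <= f x"
 shows "(\<integral>\<^sup>+x\<in>A. ennreal (f x) \<partial>M) = ennreal (LINT x:A|M. f x)"
proof -
 have "(\<integral>\<^sup>+x\<in>A. ennreal (f x) \<partial>M) = (\<integral>\<^sup>+x. ennreal (indicator A x *\<^sub>R f x) \<partial>M)"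
  by(rule nn_integral_cong) (simp add: indicator_def)
 also have "... = ennreal (LINT x:A|M. f x)" unfolding set_lebesgue_integral_def
  using assms by(intro nn_integral_eq_integral) (auto simp: set_integrable_def indicator_def)
 finally show ?thesis .
qed

lemma nn_integral_lborel_affine:
 fixes f :: "'e::euclidean_space => ennreal"
 assumes [measurable]: "f : borel_measurable borel" and c: "c ~= 0"
 shows "(\<integral>\<^sup>+x. f x \<partial>lborel) = ennreal (\<bar>c\<bar> ^ DIM('e)) * (\<integral>\<^sup>+x. f (t + c *\<^sub>R x) \<partial>lborel)"
 by(subst lborel_affine[OF c, of t])
  (simp add: nn_integral_density nn_integral_distr nn_integral_cmult)

text \<open>The change of variables costs c to the power minus the dimension, at most 2 to the
  dimension.\<close>

lemma nn_integral_lborel_affine_le: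
 fixes f :: "'e::euclidean_space => ennreal"
 assumes [measurable]: "f : borel_measurable borel" and c: "1/2 <= c"
 shows "(\<integral>\<^sup>+x. f (t + c *\<^sub>R x) \<partial>lborel) <= ennreal (2 ^ DIM('e)) * (\<integral>\<^sup>+x. f x \<partial>lborel)"
proof -
 have "(\<integral>\<^sup>+x. f (t + c *\<^sub>R x) \<partial>lborel) = ennreal (2 ^ DIM('e) * (1/2) ^ DIM('e)) * (\<integral>\<^sup>+x. f (t + c *\<^sub>R x) \<partial>lborel)"
  by(simp add: power_mult_distrib[symmetric])
 also have "... = ennreal (2 ^ DIM('e)) * (ennreal ((1/2) ^ DIM('e)) * (\<integral>\<^sup>+x. f (t + c *\<^sub>R x) \<partial>lborel))"
  by(subst ennreal_mult) (auto simp: mult.assoc)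
 also have "... <= ennreal (2 ^ DIM('e)) * (ennreal (\<bar>c\<bar> ^ DIM('e)) * (\<integral>\<^sup>+x. f (t + c *\<^sub>R x) \<partial>lborel))"
  using c by(intro mult_left_mono mult_right_mono ennreal_leI power_mono) auto
 also have "... = ennreal (2 ^ DIM('e)) * (\<integral>\<^sup>+x. f x \<partial>lborel)" using c by(subst nn_integral_lborel_affine[of f c t]) auto
 finally show ?thesis .
qed

text \<open>Nonnegativity of the variance: the integral of the square of \<open>f\<close> minus its
  mean is nonnegative.\<close>

lemma square_integral_unit_interval_le:
 fixes f :: "real => real"
 assumes "continuous_on {0..1} f"
 shows "ennreal ((integral {0..1} f)^2) <= (\<integral>\<^sup>+t\<in>{0..1}. ennreal ((f t)^2) \<partial>lborel)"
proof -
 let ?c = "integral {0..1} f"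
 have i: "f integrable_on {0..1}" "(%t. (f t)^2) integrable_on {0..1}" using assms by(auto intro!: integrable_continuous_interval continuous_intros)
 have "((%t. (f t)^2 - (2 * ?c) * f t + ?c^2) has_integral
   integral {0..1} (%t. (f t)^2) - (2 * ?c) * ?c + ?c^2) {0..1}" using has_integral_add[OF has_integral_diff[OF integrable_integral[OF i(2)]
    has_integral_mult_right[OF integrable_integral[OF i(1)], of "2 * ?c"]] has_integral_const_real[of "?c^2" 0 1]] by simp
 hence "0 <= integral {0..1} (%t. (f t)^2) - (2 * ?c) * ?c + ?c^2"
 proof (rule has_integral_nonneg)
  fix t
  have "(f t)^2 - (2 * ?c) * f t + ?c^2 = (f t - ?c)^2" by(simp add: power2_diff)
  thus "0 <= (f t)^2 - (2 * ?c) * f t + ?c^2" by simp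
 qed
 hence "?c^2 <= integral {0..1} (%t. (f t)^2)" by(simp add: power2_eq_square)
 moreover have "(\<integral>\<^sup>+t\<in>{0..1}. ennreal ((f t)^2) \<partial>lborel) = ennreal (integral {0..1} (%t. (f t)^2))"
 proof -
  have "set_integrable lborel {0..1} (%t. (f t)^2)" unfolding set_integrable_def using assms by(intro borel_integrable_compact continuous_intros) auto
  thus ?thesis by(subst nn_set_integral_eq_set_integral) (auto simp: set_borel_integral_eq_integral(2))
 qed
 ultimately show ?thesis by(simp add: ennreal_leI)
qed

definition grad_sq :: "('e::euclidean_space => real) => 'e => real" where
 "grad_sq s p = (\<Sum>i\<in>Basis. (fderiv s (at p) i)^2)"

lemma grad_sq_nonneg: "0 <= grad_sq s p" by(simp add: grad_sq_def sum_nonneg)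

lemma continuous_on_grad_sq: "Ck_on (Suc 0) U s ==> continuous_on U (grad_sq s)" unfolding grad_sq_def by(auto intro!: continuous_intros)

lemma linear_square_le:
 fixes f :: "'e::euclidean_space => real"
 assumes "linear f"
 shows "(f v)^2 <= (\<Sum>i\<in>Basis. (f i)^2) * (norm v)^2"
proof -
 have "f v = (\<Sum>i\<in>Basis. (v \<bullet> i) * f i)" using linear_sum[OF assms, of "%i. (v \<bullet> i) *\<^sub>R i" Basis] linear_scale[OF assms]
  by(simp add: euclidean_representation)
 hence "(f v)^2 <= (\<Sum>i\<in>Basis. (v \<bullet> i)^2) * (\<Sum>i\<in>Basis. (f i)^2)" using Cauchy_Schwarz_ineq_sum[of "%i. v \<bullet> i" f Basis] by simp
 also have "(\<Sum>i\<in>Basis. (v \<bullet> i)^2) = (norm v)^2" unfolding power2_norm_eq_inner by(subst (2) euclidean_inner) (simp add: power2_eq_square)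
 finally show ?thesis by(simp add: mult.commute)
qed

text \<open>\<open>s x - s y\<close> is the integral of the directional derivative along the
  segment; its square is bounded by the integral of squares, and each square by Cauchy-Schwarz on
  the components of the gradient.\<close>

lemma square_diff_le_segment_integral:
 fixes s :: "'e::euclidean_space => real"
 assumes s: "Ck_on (Suc 0) U s" and seg: "closed_segment x y <= U"
 shows "ennreal ((s x - s y)^2) <=
   ennreal ((norm (x - y))^2) * (\<integral>\<^sup>+t\<in>{0..1}. ennreal (grad_sq s (y + t *\<^sub>R (x - y))) \<partial>lborel)"
proof -
 define ga where "ga t = y + t *\<^sub>R (x - y)" for t
 have ga: "ga t : U" if "t : {0..1}" for t
 proof -
  have "ga t = (1 - (1 - t)) *\<^sub>R x + (1 - t) *\<^sub>R y" by(simp add: ga_def algebra_simps)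
  hence "ga t : closed_segment x y" using that unfolding closed_segment_def by(intro CollectI exI[of _ "1 - t"]) (auto simp: algebra_simps)
  thus ?thesis using seg by auto
 qed
 define f where "f t = fderiv s (at (ga t)) (x - y)" for t
 have "(f has_integral (s (ga 1) - s (ga 0))) {0..1}" unfolding f_def
 proof (rule fundamental_theorem_of_calculus)
  fix t :: real assume t: "t : {0..1}"
  have d: "(s has_derivative fderiv s (at (ga t))) (at (ga t))" using Ck_on_derivative[OF s ga[OF t]] .
  have "((%t. s (ga t)) has_derivative (%h. fderiv s (at (ga t)) (h *\<^sub>R (x - y)))) (at t within {0..1})" by(rule has_derivative_compose[where f=ga and g=s, OF _ d])
    (auto simp: ga_def[abs_def] intro!: derivative_eq_intros)
  thus "((%t. s (ga t)) has_vector_derivative fderiv s (at (ga t)) (x - y)) (at t within {0..1})"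
   using linear_scale[OF has_derivative_linear[OF d]] by(simp add: has_vector_derivative_def)
 qed simp
 hence I: "integral {0..1} f = s x - s y" by(auto simp: ga_def integral_unique)
 have "continuous_on {0..1} f" unfolding f_def by(rule continuous_on_compose2[of U "%p. fderiv s (at p) (x - y)"])
   (use s ga in \<open>auto simp: ga_def intro!: continuous_intros\<close>)
 from square_integral_unit_interval_le[OF this]
 have "ennreal ((s x - s y)^2) <= (\<integral>\<^sup>+t\<in>{0..1}. ennreal ((f t)^2) \<partial>lborel)" unfolding I .
 also have "... <= (\<integral>\<^sup>+t. ennreal ((norm (x - y))^2) * (ennreal (grad_sq s (ga t)) * indicator {0..1} t) \<partial>lborel)"
 proof (rule nn_integral_mono)
  fix t :: real
  show "ennreal ((f t)^2) * indicator {0..1} t <= ennreal ((norm (x - y))^2) * (ennreal (grad_sq s (ga t)) * indicator {0..1} t)"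
  proof (cases "t : {0..1}")
   case True
   have "linear (fderiv s (at (ga t)))" using Ck_on_derivative[OF s ga[OF True]] by(rule has_derivative_linear)
   hence "(f t)^2 <= (norm (x - y))^2 * grad_sq s (ga t)" using linear_square_le[of "fderiv s (at (ga t))" "x - y"] by(simp add: f_def grad_sq_def mult.commute)
   thus ?thesis using True ennreal_leI by(simp add: ennreal_mult[OF zero_le_power2 grad_sq_nonneg, symmetric])
  qed auto
 qed
 also have "... = ennreal ((norm (x - y))^2) * (\<integral>\<^sup>+t. (ennreal (grad_sq s (ga t)) * indicator {0..1} t) \<partial>lborel)"
 proof (rule nn_integral_cmult)
  have "continuous_on {0..1} (%t. grad_sq s (ga t))" by(rule continuous_on_compose2[OF continuous_on_grad_sq[OF s]])
    (use ga in \<open>auto simp: ga_def intro!: continuous_intros\<close>)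
  hence "(%t. indicator {0..1} t *\<^sub>R grad_sq s (ga t)) : borel_measurable borel" by(intro borel_measurable_continuous_on_indicator) auto
  hence "(%t. ennreal (indicator {0..1} t *\<^sub>R grad_sq s (ga t))) : borel_measurable lborel" by simp
  moreover have "ennreal (indicator {0..1} t *\<^sub>R grad_sq s (ga t)) = ennreal (grad_sq s (ga t)) * indicator {0..1} t" for t by(auto simp: indicator_def)
  ultimately show "(%t. ennreal (grad_sq s (ga t)) * indicator {0..1} t) : borel_measurable lborel" by simp
 qed
 finally show ?thesis by(simp add: ga_def)
qed

text \<open>The segment estimate is integrated over x and y in \<open>Q\<close> and t in the unit
  interval. The point on the segment depends on x with coefficient t and on y with coefficient 1 -
  t; one of them is at least 1/2, and substituting in that variable costs at most
  \<open>2 ^ DIM('e)\<close>. Convexity keeps the segment in \<open>Q\<close>, and nonnegative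
  integrals allow Tonelli without integrability questions.\<close>

lemma Poincare_convex_nn:
 fixes s :: "'e::euclidean_space => real"
 assumes s: "Ck_on (Suc 0) U s" and U: "open U" and Q[measurable]: "Q : sets borel" and "convex Q" "Q <= U"
  and de: "!!x y. x : Q ==> y : Q ==> norm (x - y) <= de"
 shows "(\<integral>\<^sup>+x\<in>Q. (\<integral>\<^sup>+y\<in>Q. ennreal ((s x - s y)^2) \<partial>lborel) \<partial>lborel) <=
   ennreal (de^2) * (ennreal (2 ^ DIM('e)) * (emeasure lborel Q * (\<integral>\<^sup>+z\<in>Q. ennreal (grad_sq s z) \<partial>lborel)))"
proof -
 define h where "h z = ennreal (grad_sq s z) * indicator Q z" for z
 have h[measurable]: "h : borel_measurable borel"
 proof -
  have "(%z. indicator U z *\<^sub>R grad_sq s z) : borel_measurable borel" using U continuous_on_grad_sq[OF s] by(intro borel_measurable_continuous_on_indicator) auto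
  hence [measurable]: "(%z. ennreal (indicator U z *\<^sub>R grad_sq s z)) : borel_measurable borel" by simp
  have "h z = ennreal (indicator U z *\<^sub>R grad_sq s z) * indicator Q z" for z using \<open>Q <= U\<close> by(auto simp: h_def indicator_def)
  hence "h = (%z. ennreal (indicator U z *\<^sub>R grad_sq s z) * indicator Q z)" by(rule ext)
  thus ?thesis by(simp only:) measurable
 qed
 \<comment> \<open>The integrand of the triple integral, cut off to \<open>Q\<close>,
   \<open>Q\<close> and the unit interval so that the integrals can be exchanged over whole
   spaces.\<close>
 define k where "k t x y = h (y + t *\<^sub>R (x - y)) * (indicator {0..1} t * (indicator Q x * indicator Q y))" for t :: real and x y
 have [measurable]: "(%(t, x, y). k t x y) : borel_measurable (lborel \<Otimes>\<^sub>M lborel \<Otimes>\<^sub>M lborel)" unfolding k_def by measurable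
 have kt: "(\<integral>\<^sup>+x. \<integral>\<^sup>+y. k t x y \<partial>lborel \<partial>lborel) <=
   indicator {0..1} t * (ennreal (2 ^ DIM('e)) * (emeasure lborel Q * (\<integral>\<^sup>+z. h z \<partial>lborel)))" (is "?L <= ?R") for t
 proof (cases "t : {0..1}")
  case False thus ?thesis by(simp add: k_def)
 next
  case t: True
  have eq: "y + t *\<^sub>R (x - y) = t *\<^sub>R x + (1 - t) *\<^sub>R y" for x y :: 'e by(simp add: algebra_simps)
  show ?thesis
  proof (cases "t >= 1/2")
   case True
   have "?L = (\<integral>\<^sup>+y. \<integral>\<^sup>+x. k t x y \<partial>lborel \<partial>lborel)" by(rule lborel_pair.Fubini'[symmetric]) measurable
   also have "... <= (\<integral>\<^sup>+y. (ennreal (2 ^ DIM('e)) * (\<integral>\<^sup>+z. h z \<partial>lborel)) * indicator Q y \<partial>lborel)"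
   proof (rule nn_integral_mono)
    fix y :: 'e
    have "(\<integral>\<^sup>+x. k t x y \<partial>lborel) <= (\<integral>\<^sup>+x. h ((1 - t) *\<^sub>R y + t *\<^sub>R x) * indicator Q y \<partial>lborel)"
     by(rule nn_integral_mono) (auto simp: k_def eq add.commute indicator_def)
    also have "... = (\<integral>\<^sup>+x. h ((1 - t) *\<^sub>R y + t *\<^sub>R x) \<partial>lborel) * indicator Q y" by(rule nn_integral_multc) measurable
    also have "... <= (ennreal (2 ^ DIM('e)) * (\<integral>\<^sup>+z. h z \<partial>lborel)) * indicator Q y"
     by(intro mult_right_mono nn_integral_lborel_affine_le h True) auto
    finally show "(\<integral>\<^sup>+x. k t x y \<partial>lborel) <= ..." .
   qed
   also have "... = ennreal (2 ^ DIM('e)) * (\<integral>\<^sup>+z. h z \<partial>lborel) * emeasure lborel Q" by(subst nn_integral_cmult_indicator) auto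
   finally show ?thesis using t by(simp add: ac_simps)
  next
   case False
   have "?L <= (\<integral>\<^sup>+x. (ennreal (2 ^ DIM('e)) * (\<integral>\<^sup>+z. h z \<partial>lborel)) * indicator Q x \<partial>lborel)"
   proof (rule nn_integral_mono)
    fix x :: 'e
    have "(\<integral>\<^sup>+y. k t x y \<partial>lborel) <= (\<integral>\<^sup>+y. h (t *\<^sub>R x + (1 - t) *\<^sub>R y) * indicator Q x \<partial>lborel)"
     by(rule nn_integral_mono) (auto simp: k_def eq indicator_def)
    also have "... = (\<integral>\<^sup>+y. h (t *\<^sub>R x + (1 - t) *\<^sub>R y) \<partial>lborel) * indicator Q x" by(rule nn_integral_multc) measurable
    also have "... <= (ennreal (2 ^ DIM('e)) * (\<integral>\<^sup>+z. h z \<partial>lborel)) * indicator Q x"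
     using False by(intro mult_right_mono nn_integral_lborel_affine_le h) auto
    finally show "(\<integral>\<^sup>+y. k t x y \<partial>lborel) <= ..." .
   qed
   also have "... = ennreal (2 ^ DIM('e)) * (\<integral>\<^sup>+z. h z \<partial>lborel) * emeasure lborel Q" by(subst nn_integral_cmult_indicator) auto
   finally show ?thesis using t by(simp add: ac_simps)
  qed
 qed
 have "(\<integral>\<^sup>+x\<in>Q. (\<integral>\<^sup>+y\<in>Q. ennreal ((s x - s y)^2) \<partial>lborel) \<partial>lborel) <=
   (\<integral>\<^sup>+x. \<integral>\<^sup>+y. ennreal (de^2) * (\<integral>\<^sup>+t. k t x y \<partial>lborel) \<partial>lborel \<partial>lborel)"
 proof (rule nn_integral_mono)
  fix x :: 'e
  show "(\<integral>\<^sup>+y\<in>Q. ennreal ((s x - s y)^2) \<partial>lborel) * indicator Q x <= (\<integral>\<^sup>+y. ennreal (de^2) * (\<integral>\<^sup>+t. k t x y \<partial>lborel) \<partial>lborel)"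
  proof (cases "x : Q")
   case x: True
   have "ennreal ((s x - s y)^2) * indicator Q y <= ennreal (de^2) * (\<integral>\<^sup>+t. k t x y \<partial>lborel)" for y
   proof (cases "y : Q")
    case y: True
    have seg: "closed_segment x y <= Q" using x y \<open>convex Q\<close> by(simp add: closed_segment_subset)
    have inQ: "y + t *\<^sub>R (x - y) : Q" if "t : {0..1}" for t using convexD[OF \<open>convex Q\<close> x y, of t "1 - t"] that by(simp add: algebra_simps)
    have "ennreal ((s x - s y)^2) <= ennreal ((norm (x - y))^2) * (\<integral>\<^sup>+t\<in>{0..1}. ennreal (grad_sq s (y + t *\<^sub>R (x - y))) \<partial>lborel)"
     using seg \<open>Q <= U\<close> by(intro square_diff_le_segment_integral[OF s]) auto
    also have "(\<integral>\<^sup>+t\<in>{0..1}. ennreal (grad_sq s (y + t *\<^sub>R (x - y))) \<partial>lborel) = (\<integral>\<^sup>+t. k t x y \<partial>lborel)"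
     by(rule nn_integral_cong) (use x y inQ in \<open>auto simp: k_def h_def indicator_def\<close>)
    also have "ennreal ((norm (x - y))^2) * (\<integral>\<^sup>+t. k t x y \<partial>lborel) <= ennreal (de^2) * (\<integral>\<^sup>+t. k t x y \<partial>lborel)"
     using de[OF x y] by(intro mult_right_mono ennreal_leI power_mono) auto
    finally show ?thesis using y by simp
   qed simp
   thus ?thesis using x by(simp add: nn_integral_mono)
  qed simp
 qed
 also have "... = ennreal (de^2) * (\<integral>\<^sup>+x. \<integral>\<^sup>+y. \<integral>\<^sup>+t. k t x y \<partial>lborel \<partial>lborel \<partial>lborel)"
 proof -
  have "(\<integral>\<^sup>+y. ennreal (de^2) * (\<integral>\<^sup>+t. k t x y \<partial>lborel) \<partial>lborel) =
    ennreal (de^2) * (\<integral>\<^sup>+y. \<integral>\<^sup>+t. k t x y \<partial>lborel \<partial>lborel)" for x by(rule nn_integral_cmult) (unfold k_def, measurable)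
  moreover have "(\<integral>\<^sup>+x. ennreal (de^2) * (\<integral>\<^sup>+y. \<integral>\<^sup>+t. k t x y \<partial>lborel \<partial>lborel) \<partial>lborel) =
    ennreal (de^2) * (\<integral>\<^sup>+x. \<integral>\<^sup>+y. \<integral>\<^sup>+t. k t x y \<partial>lborel \<partial>lborel \<partial>lborel)"
   by(rule nn_integral_cmult) (unfold k_def, measurable)
  ultimately show ?thesis by simp
 qed
 also have "(\<integral>\<^sup>+x. \<integral>\<^sup>+y. \<integral>\<^sup>+t. k t x y \<partial>lborel \<partial>lborel \<partial>lborel) = (\<integral>\<^sup>+x. \<integral>\<^sup>+t. \<integral>\<^sup>+y. k t x y \<partial>lborel \<partial>lborel \<partial>lborel)"
  by(rule nn_integral_cong, rule lborel_pair.Fubini') (unfold k_def, measurable)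
 also have "... = (\<integral>\<^sup>+t. \<integral>\<^sup>+x. \<integral>\<^sup>+y. k t x y \<partial>lborel \<partial>lborel \<partial>lborel)"
  by(rule lborel_pair.Fubini') (unfold k_def, measurable)
 also have "... <= (\<integral>\<^sup>+t. (ennreal (2 ^ DIM('e)) * (emeasure lborel Q * (\<integral>\<^sup>+z. h z \<partial>lborel))) * indicator {0..1::real} t \<partial>lborel)"
  using kt by(intro nn_integral_mono) (simp add: mult.commute)
 also have "... = ennreal (2 ^ DIM('e)) * (emeasure lborel Q * (\<integral>\<^sup>+z. h z \<partial>lborel))" by(subst nn_integral_cmult_indicator) auto
 finally show ?thesis by(simp add: h_def mult_left_mono)
qed

text \<open>The double integral of \<open>(s x - s y)^2\<close> over \<open>Q\<close> equals
  \<open>2 * (V * B - A^2)\<close> with \<open>V\<close> the volume, \<open>A\<close> and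
  \<open>B\<close> the integrals of \<open>s\<close> and of its square; dividing by \<open>V\<close>
  separates the mean from the gradient. The mean is kept because it will act as a functional of
  \<open>s\<close>.\<close>

lemma Poincare_convex:
 fixes s :: "'e::euclidean_space => real"
 assumes s: "Ck_on (Suc 0) U s" and U: "open U" and K: "compact K" "K <= U"
  and Q[measurable]: "Q : sets borel" and "convex Q" "Q <= K"
  and de: "!!x y. x : Q ==> y : Q ==> norm (x - y) <= de"
 shows "(LINT x:Q|lborel. (s x)^2) <=
  (LINT x:Q|lborel. s x)^2 / measure lborel Q + 2 ^ DIM('e) * de^2 * (LINT x:Q|lborel. grad_sq s x)"
proof -
 have fK: "emeasure lborel K < \<infinity>" using K(1) by(rule emeasure_compact_finite)
 have fQ: "emeasure lborel Q < \<infinity>" using emeasure_mono[OF \<open>Q <= K\<close>, of lborel] K(1) fK by(auto intro: borel_compact le_less_trans)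
 have int: "set_integrable lborel Q g" if "continuous_on U g" for g :: "'e => real"
 proof (rule set_integrable_subset)
  show "set_integrable lborel K g" unfolding set_integrable_def using K that by(intro borel_integrable_compact) (auto intro: continuous_on_subset)
 qed (use \<open>Q <= K\<close> in auto)
 have cs: "continuous_on U s" using Ck_on_imp_continuous_on[OF s] .
 note is1 = int[OF cs] and is2 = int[OF continuous_on_power[OF cs, of 2]] and ig = int[OF continuous_on_grad_sq[OF s]]
 define A B G V where "A = (LINT x:Q|lborel. s x)" and "B = (LINT x:Q|lborel. (s x)^2)"
  and "G = (LINT x:Q|lborel. grad_sq s x)" and "V = measure lborel Q"
 have ic: "set_integrable lborel Q (%x. c)" for c :: real unfolding set_integrable_def using fQ by simp
 have inner: "(\<integral>\<^sup>+y\<in>Q. ennreal ((s x - s y)^2) \<partial>lborel) = ennreal (V * (s x)^2 - 2 * A * s x + B)"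
  "0 <= V * (s x)^2 - 2 * A * s x + B" for x
 proof -
  have e: "(s x - s y)^2 = (s x)^2 - (2 * s x) * s y + (s y)^2" for y by(simp add: power2_diff)
  have i: "set_integrable lborel Q (%y. (s x - s y)^2)" unfolding e by(intro set_integral_add set_integral_diff set_integrable_mult_right impI ic is1 is2)
  have v: "(LINT y:Q|lborel. (s x - s y)^2) = V * (s x)^2 - 2 * A * s x + B" unfolding e by(subst set_integral_add set_integral_diff,
     (intro set_integral_add set_integral_diff set_integrable_mult_right impI ic is1 is2)+)+
    (simp add: A_def B_def V_def set_lebesgue_integral_def)
  have "(\<integral>\<^sup>+y\<in>Q. ennreal ((s x - s y)^2) \<partial>lborel) = ennreal (LINT y:Q|lborel. (s x - s y)^2)"
   using i by(intro nn_set_integral_eq_set_integral) auto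
  thus "(\<integral>\<^sup>+y\<in>Q. ennreal ((s x - s y)^2) \<partial>lborel) = ennreal (V * (s x)^2 - 2 * A * s x + B)" using v by simp
  have "0 <= (LINT y:Q|lborel. (s x - s y)^2)" unfolding set_lebesgue_integral_def by(rule integral_nonneg_AE) auto
  thus "0 <= V * (s x)^2 - 2 * A * s x + B" using v by simp
 qed
 have i: "set_integrable lborel Q (%x. V * (s x)^2 - 2 * A * s x + B)" by(intro set_integral_add set_integral_diff set_integrable_mult_right impI ic is1 is2)
 have v: "(LINT x:Q|lborel. V * (s x)^2 - 2 * A * s x + B) = 2 * (V * B - A^2)" by(subst set_integral_add set_integral_diff,
     (intro set_integral_add set_integral_diff set_integrable_mult_right impI ic is1 is2)+)+
   (simp add: A_def[symmetric] B_def[symmetric] V_def[symmetric] power2_eq_square[of A] set_lebesgue_integral_def[of _ _ "%_. B"])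
 have "(\<integral>\<^sup>+x\<in>Q. (\<integral>\<^sup>+y\<in>Q. ennreal ((s x - s y)^2) \<partial>lborel) \<partial>lborel) = ennreal (2 * (V * B - A^2))"
  unfolding inner using i v inner(2) by(subst nn_set_integral_eq_set_integral) auto
 moreover have "(\<integral>\<^sup>+z\<in>Q. ennreal (grad_sq s z) \<partial>lborel) = ennreal G"
  unfolding G_def using ig grad_sq_nonneg by(intro nn_set_integral_eq_set_integral) auto
 moreover have G0: "0 <= G" unfolding G_def set_lebesgue_integral_def by(rule integral_nonneg_AE) (auto simp: grad_sq_nonneg)
 moreover have "emeasure lborel Q = ennreal V" unfolding V_def using fQ by(simp add: emeasure_eq_ennreal_measure)
 ultimately have "ennreal (2 * (V * B - A^2)) <= ennreal (de^2 * (2 ^ DIM('e) * (V * G)))"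
  using Poincare_convex_nn[OF s U Q \<open>convex Q\<close> _ de] K(2) \<open>Q <= K\<close>
  by(simp add: ennreal_mult V_def)
 hence ineq: "2 * (V * B - A^2) <= de^2 * (2 ^ DIM('e) * (V * G))" using G0 by(subst (asm) ennreal_le_iff) (auto simp: V_def)
 have "B <= A^2 / V + 2 ^ DIM('e) * de^2 * G"
 proof (cases "V = 0")
  \<comment> \<open>Degenerate cells of the grid may have volume 0: then \<open>B = 0\<close>, and
    the quotient by \<open>V\<close> is 0 by the convention for division by zero.\<close>
  case True
  hence "Q : null_sets lborel" using fQ by(auto simp: V_def measure_def null_sets_def enn2real_eq_0_iff)
  hence "AE x in lborel. x \<notin> Q" by(rule AE_not_in)
  hence "AE x in lborel. indicator Q x *\<^sub>R (s x)^2 = 0" by eventually_elim simp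
  hence "B = 0" unfolding B_def set_lebesgue_integral_def by(rule integral_eq_zero_AE)
  thus ?thesis using G0 True by simp
 next
  case False
  hence V: "V > 0" by(simp add: V_def zero_less_measure_iff)
  have "0 <= de^2 * (2 ^ DIM('e) * (V * G))" using V G0 by simp
  moreover have "x <= y + P" if "2 * (x - y) <= P" "0 <= P" for x y P :: real using that by argo
  ultimately have "V * B <= A^2 + de^2 * (2 ^ DIM('e) * (V * G))" using ineq by blast
  also have "... = V * (A^2 / V + 2 ^ DIM('e) * de^2 * G)" using V by(simp add: field_simps)
  finally have "V * B <= V * (A^2 / V + 2 ^ DIM('e) * de^2 * G)" .
  thus ?thesis using V by simp
 qed
 thus ?thesis by(simp add: A_def B_def G_def V_def)
qed

text \<open>Cells are the cubes of a grid of side 1/N cut with the box: convex Borel sets of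
  diameter at most \<open>DIM('e) / N\<close>, so for large N the constant of Poincare's inequality
  drops below \<open>\<epsilon>\<close>. The cells depend on \<open>\<epsilon>\<close> and the box
  only, not on \<open>s\<close>, which makes the averages finitely many fixed functionals.\<close>

lemma grid_estimate:
 fixes a b :: "'e::euclidean_space"
 assumes \<epsilon>: "\<epsilon> > 0"
 obtains \<Q> :: "'e set set" where "finite \<Q>" "!!Q. Q : \<Q> ==> Q : sets borel" "!!Q. Q : \<Q> ==> Q <= cbox a b"
  "!!U s. open U ==> cbox a b <= U ==> Ck_on (Suc 0) U s ==>
    (LINT x:cbox a b|lborel. (s x)^2) <=
    (\<Sum>Q\<in>\<Q>. (LINT x:Q|lborel. s x)^2 / measure lborel Q) + \<epsilon> * (LINT x:cbox a b|lborel. grad_sq s x)"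
proof -
 let ?d = "real DIM('e)"
 define K where "K = cbox a b"
 have "(%n. 2 ^ DIM('e) * (?d * inverse (real (Suc n)))^2) ----> 2 ^ DIM('e) * (?d * 0)^2" by(intro tendsto_intros LIMSEQ_inverse_real_of_nat)
 hence "eventually (%n. 2 ^ DIM('e) * (?d * inverse (real (Suc n)))^2 < \<epsilon>) sequentially" using \<epsilon> by(intro order_tendstoD) auto
 then obtain n where n: "2 ^ DIM('e) * (?d * inverse (real (Suc n)))^2 < \<epsilon>" by(auto simp: eventually_sequentially)
 define N where "N = real (Suc n)"
 have N: "N > 0" by(simp add: N_def)
 \<comment> \<open>The label of a cell is extended by 0 off \<open>Basis\<close>, so that the labels
   of points in a bounded set form a finite set of functions.\<close>
 define g where "g x i = (if i : Basis then \<lfloor>N * (x \<bullet> i)\<rfloor> else 0)" for x i :: 'e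
 define cell where "cell f = {x : K. g x = f}" for f
 define \<Q> where "\<Q> = cell ` g ` K"
 obtain R where R: "!!x. x : K ==> norm x <= R" using bounded_cbox[of a b] by(auto simp: bounded_iff K_def)
 have "g ` K <= {f. ALL i. (i : Basis --> f i : {\<lfloor>N * (- R)\<rfloor>..\<lfloor>N * R\<rfloor>}) & (i \<notin> Basis --> f i = 0)}"
 proof clarify
  fix x i assume x: "x : K"
  have "- R <= x \<bullet> i & x \<bullet> i <= R" if "i : Basis" using R[OF x] Basis_le_norm[OF that, of x] by linarith
  thus "(i : Basis --> g x i : {\<lfloor>N * (- R)\<rfloor>..\<lfloor>N * R\<rfloor>}) & (i \<notin> Basis --> g x i = 0)"
   using mult_left_mono[of "- R" "x \<bullet> i" N] mult_left_mono[of "x \<bullet> i" R N] N by(auto simp: g_def intro!: floor_mono)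
 qed
 moreover have "finite {f. ALL i. (i : Basis --> f i : {\<lfloor>N * (- R)\<rfloor>..\<lfloor>N * R\<rfloor>}) & ((i::'e) \<notin> Basis --> f i = 0)}"
  by(rule finite_set_of_finite_funs) auto
 ultimately have fin: "finite \<Q>" unfolding \<Q>_def by(auto intro: finite_subset)
 have cell: "cell f : sets borel & convex (cell f)" for f
 proof (cases "EX i. i \<notin> Basis & f i ~= 0")
  case True
  hence "cell f = {}" by(auto simp: cell_def g_def)
  thus ?thesis by simp
 next
  case False
  have "cell f = K Int (\<Inter>i\<in>Basis. {x. real_of_int (f i) <= (N *\<^sub>R i) \<bullet> x} Int {x. (N *\<^sub>R i) \<bullet> x < real_of_int (f i) + 1})"
   using False by(auto simp: cell_def g_def fun_eq_iff floor_eq_iff inner_commute)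
  moreover have "convex ..." unfolding K_def by(intro convex_Int convex_INT convex_box convex_halfspace_lt) (rule convex_halfspace_ge)
  moreover have "K Int (\<Inter>i\<in>Basis. {x. real_of_int (f i) <= (N *\<^sub>R i) \<bullet> x} Int {x. (N *\<^sub>R i) \<bullet> x < real_of_int (f i) + 1}) : sets borel"
   unfolding K_def by(intro sets.Int sets.finite_INT) auto
  ultimately show ?thesis by simp
 qed
 have diam: "norm (x - y) <= ?d * (1 / N)" if "x : cell f" "y : cell f" for x y f
 proof -
  have "\<bar>(x - y) \<bullet> i\<bar> <= 1 / N" if "i : Basis" for i
  proof -
   have "g x i = g y i" using \<open>x : cell f\<close> \<open>y : cell f\<close> by(simp add: cell_def)
   hence "\<lfloor>N * (x \<bullet> i)\<rfloor> = \<lfloor>N * (y \<bullet> i)\<rfloor>" using that by(simp add: g_def)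
   hence "\<bar>N * (x \<bullet> i) - N * (y \<bullet> i)\<bar> <= 1" by linarith
   hence "N * \<bar>(x - y) \<bullet> i\<bar> <= 1" using N by(simp add: inner_diff_left abs_mult right_diff_distrib[symmetric])
   thus ?thesis using N by(simp add: field_simps)
  qed
  hence "(\<Sum>i\<in>Basis. \<bar>(x - y) \<bullet> i\<bar>) <= ?d * (1 / N)" using sum_bounded_above[of Basis "%i. \<bar>(x - y) \<bullet> i\<bar>" "1 / N"] by simp
  thus ?thesis using norm_le_l1[of "x - y"] by linarith
 qed
 have UQ: "K = (\<Union>Q\<in>\<Q>. Q)" by(auto simp: \<Q>_def cell_def)
 have dQ: "disjoint_family_on (%Q. Q) \<Q>" by(auto simp: \<Q>_def cell_def disjoint_family_on_def)
 have QK: "Q : sets borel" "Q <= K" if "Q : \<Q>" for Q using that cell by(auto simp: \<Q>_def cell_def)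
 show ?thesis
 proof (rule that[of \<Q>])
  fix U and s :: "'e => real" assume U: "open U" "cbox a b <= U" and s: "Ck_on (Suc 0) U s"
  have split: "(LINT x:K|lborel. h x) = (\<Sum>Q\<in>\<Q>. LINT x:Q|lborel. h x)" if "continuous_on U h" for h :: "'e => real"
  proof -
   have K: "set_integrable lborel K h" unfolding set_integrable_def K_def using U that by(intro borel_integrable_compact) (auto intro: continuous_on_subset)
   show ?thesis unfolding UQ by(rule set_integral_finite_Union[OF fin dQ]) (rule set_integrable_subset[OF K], simp_all add: QK)
  qed
  have "(LINT x:K|lborel. (s x)^2) = (\<Sum>Q\<in>\<Q>. LINT x:Q|lborel. (s x)^2)" by(intro split continuous_intros Ck_on_imp_continuous_on[OF s])
  also have "... <= (\<Sum>Q\<in>\<Q>. (LINT x:Q|lborel. s x)^2 / measure lborel Q +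
    2 ^ DIM('e) * (?d * (1 / N))^2 * (LINT x:Q|lborel. grad_sq s x))"
  proof (rule sum_mono)
   fix Q assume Q: "Q : \<Q>"
   then obtain f where "Q = cell f" by(auto simp: \<Q>_def)
   thus "(LINT x:Q|lborel. (s x)^2) <= (LINT x:Q|lborel. s x)^2 / measure lborel Q +
    2 ^ DIM('e) * (?d * (1 / N))^2 * (LINT x:Q|lborel. grad_sq s x)" using cell diam QK[OF Q] U by(intro Poincare_convex[OF s U(1), of K]) (auto simp: K_def)
  qed
  also have "... = (\<Sum>Q\<in>\<Q>. (LINT x:Q|lborel. s x)^2 / measure lborel Q) +
    2 ^ DIM('e) * (?d * (1 / N))^2 * (LINT x:K|lborel. grad_sq s x)" unfolding split[OF continuous_on_grad_sq[OF s]] by(simp add: sum.distrib sum_distrib_left)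
  also have "2 ^ DIM('e) * (?d * (1 / N))^2 * (LINT x:K|lborel. grad_sq s x) <= \<epsilon> * (LINT x:K|lborel. grad_sq s x)" using n by(intro mult_right_mono)
    (auto simp: N_def inverse_eq_divide set_lebesgue_integral_def grad_sq_nonneg intro!: integral_nonneg_AE)
  finally show "(LINT x:cbox a b|lborel. (s x)^2) <=
    (\<Sum>Q\<in>\<Q>. (LINT x:Q|lborel. s x)^2 / measure lborel Q) + \<epsilon> * (LINT x:cbox a b|lborel. grad_sq s x)" by(simp add: K_def)
 qed (use fin QK in \<open>auto simp: K_def\<close>)
qed

section \<open>Charts, tangent vectors and the co-Finsler metric\<close>

context smooth_manifold
begin

lemma chart_subset: "c : A ==> fst c <= M" using chart_domain openin_subset by blast

lemma inj_chart: "c : A ==> inj_on (snd c) (fst c)" using homeomorphic_imp_injective_map[OF chart_homeo] chart_subset by(simp add: Int_absorb1)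

lemma param_in: "p : coords c ==> param c p : fst c" unfolding coords_def param_def by(rule inv_into_into)

lemma param_in_M: "c : A ==> p : coords c ==> param c p : M" using param_in[of p c] chart_subset[of c] by blast

lemma chart_param [simp]: "p : coords c ==> snd c (param c p) = p" unfolding coords_def param_def by(rule f_inv_into_f)

lemma param_chart [simp]: "c : A ==> x : fst c ==> param c (snd c x) = x" unfolding param_def by(simp add: inj_chart)

lemma chart_in_coords: "x : fst c ==> snd c x : coords c" by(simp add: coords_def)

lemma param_image_iff: "c : A ==> S <= coords c ==> x : param c ` S \<longleftrightarrow> x : fst c & snd c x : S"
proof
 assume c: "c : A" and S: "S <= coords c" and x: "x : param c ` S"
 then obtain p where "p : S" "x = param c p" by blast
 thus "x : fst c & snd c x : S" using S param_in[of p c] chart_param[of p c] by auto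
next
 assume "c : A" "S <= coords c" "x : fst c & snd c x : S"
 thus "x : param c ` S" by(intro image_eqI[of _ _ "snd c x"]) simp_all
qed

lemma continuous_map_chart: "c : A ==> continuous_map (subtopology T (fst c)) euclidean (snd c)"
 using homeomorphic_imp_continuous_map[OF chart_homeo] continuous_map_in_subtopology by blast

lemma continuous_map_param: "c : A ==> continuous_map (top_of_set (coords c)) T (param c)"
proof -
 assume c: "c : A"
 obtain g where g: "homeomorphic_maps (subtopology T (fst c)) (top_of_set (coords c)) (snd c) g" using chart_homeo[OF c] homeomorphic_map_maps by blast
 hence "continuous_map (top_of_set (coords c)) (subtopology T (fst c)) g" by(simp add: homeomorphic_maps_def)
 hence cg: "continuous_map (top_of_set (coords c)) T g" using continuous_map_in_subtopology by blast
 have "g p = param c p" if "p : coords c" for p using g param_in[OF that] chart_subset[OF c] that unfolding homeomorphic_maps_def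
  by(auto dest!: bspec[where x="param c p"])
 thus ?thesis using continuous_map_eq[OF cg] by simp
qed

lemma open_chart_image: "c : A ==> openin T G ==> open (snd c ` (G Int fst c))"
proof -
 assume c: "c : A" and G: "openin T G"
 have "openin (subtopology T (fst c)) (G Int fst c)" using G by(auto simp: openin_subtopology)
 hence "openin (top_of_set (coords c)) (snd c ` (G Int fst c))" using homeomorphic_imp_open_map[OF chart_homeo[OF c]] by(auto simp: open_map_def)
 thus ?thesis using chart_open[OF c] openin_open_trans by blast
qed

lemma openin_param_image: "c : A ==> open U ==> U <= coords c ==> openin T (param c ` U)"
proof -
 assume c: "c : A" and U: "open U" "U <= coords c"
 have "openin (subtopology T (fst c)) {x : topspace (subtopology T (fst c)). snd c x : U}"
  by(rule openin_continuous_map_preimage[OF continuous_map_chart[OF c]]) (use U in auto)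
 moreover have "{x : topspace (subtopology T (fst c)). snd c x : U} = param c ` U" using chart_subset[OF c] param_image_iff[OF c U(2)] by auto
 ultimately show ?thesis using chart_domain[OF c] openin_trans_full by metis
qed

lemma compactin_param_image: "c : A ==> compact K ==> K <= coords c ==> compactin T (param c ` K)"
 by(rule image_compactin[OF _ continuous_map_param]) (simp_all add: compactin_subtopology)

lemma closedin_param_image: "c : A ==> compact K ==> K <= coords c ==> closedin T (param c ` K)" by(rule compactin_imp_closedin[OF Hausdorff compactin_param_image])

lemma open_transition_domain: "c : A ==> c' : A ==> open (snd c ` (fst c Int fst c'))" using open_chart_image[OF _ chart_domain, of c c'] by(simp add: Int_commute)

lemma transition_C1: "c : A ==> c' : A ==> Ck_on (Suc 0) (snd c ` (fst c Int fst c')) (snd c' \<circ> param c)" using chart_compat unfolding smooth_on_def by blast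

lemma transition_derivative:
 assumes "c : A" "c' : A" "x : fst c" "x : fst c'"
 shows "(snd c' \<circ> param c has_derivative fderiv (snd c' \<circ> param c) (at (snd c x))) (at (snd c x))"
 by(rule Ck_on_derivative[OF transition_C1]) (use assms in auto)

text \<open>The composite is known to be the identity on \<open>coords c\<close> only; openness of
  that set is enough for the derivative.\<close>

lemma transition_id:
 assumes "c : A" "x : fst c"
 shows "fderiv (snd c \<circ> param c) (at (snd c x)) = (%v. v)"
proof -
 have "((%v. v) has_derivative (%v. v)) (at (snd c x))" by(rule has_derivative_ident)
 hence "(snd c \<circ> param c has_derivative (%v. v)) (at (snd c x))" by(rule has_derivative_transform_within_open[OF _ chart_open[OF assms(1)]])
   (use assms in \<open>auto simp: chart_in_coords\<close>)
 thus ?thesis by(rule frechet_derivative_at[symmetric])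
qed

lemma change_of_chart:
 fixes g :: "'m => 'b::real_normed_vector"
 assumes c: "c : A" "c' : A" "x : fst c" "x : fst c'"
  and d: "(g \<circ> param c') differentiable (at (snd c' x))"
 shows "(g \<circ> param c has_derivative (%v. fderiv (g \<circ> param c') (at (snd c' x))
   (fderiv (snd c' \<circ> param c) (at (snd c x)) v))) (at (snd c x))"
proof -
 have eq: "(snd c' \<circ> param c) (snd c x) = snd c' x" using c by simp
 have "((g \<circ> param c') \<circ> (snd c' \<circ> param c) has_derivative
   fderiv (g \<circ> param c') (at (snd c' x)) \<circ> fderiv (snd c' \<circ> param c) (at (snd c x))) (at (snd c x))"
  by(rule diff_chain_at[OF transition_derivative[OF c]])
   (use d in \<open>simp only: eq frechet_derivative_works\<close>)
 hence "(g \<circ> param c has_derivative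
   fderiv (g \<circ> param c') (at (snd c' x)) \<circ> fderiv (snd c' \<circ> param c) (at (snd c x))) (at (snd c x))"
  by(rule has_derivative_transform_within_open[OF _ open_transition_domain[OF c(1,2)]]) (use c in auto)
 thus ?thesis by(simp add: o_def)
qed

text \<open>The cocycle identity for transition derivatives; it is what puts
  \<open>tangent_of c x v\<close> into \<open>tangent_space x\<close>.\<close>

lemma transition_chain:
 assumes "c : A" "c' : A" "c'' : A" "x : fst c" "x : fst c'" "x : fst c''"
 shows "fderiv (snd c'' \<circ> param c) (at (snd c x)) v =
   fderiv (snd c'' \<circ> param c') (at (snd c' x)) (fderiv (snd c' \<circ> param c) (at (snd c x)) v)"
proof -
 have "(snd c'' \<circ> param c') differentiable (at (snd c' x))" using transition_derivative[OF assms(2,3,5,6)] unfolding differentiable_def by blast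
 from frechet_derivative_at[OF change_of_chart[OF assms(1,2,4,5) this], symmetric]
 show ?thesis by(rule fun_cong)
qed

lemma tangent_of_chart: "c : A ==> x : fst c ==> tangent_of c x v c = v" by(simp add: tangent_of_def transition_id)

lemma tangent_of_in: "c : A ==> x : fst c ==> tangent_of c x v : tangent_space x"
proof -
 assume c: "c : A" "x : fst c"
 have "tangent_of c x v c'' = fderiv (snd c'' \<circ> param c') (at (snd c' x)) (tangent_of c x v c')"
  if "c' : A" "c'' : A" "x : fst c'" "x : fst c''" for c' c'' using transition_chain[OF c(1) that(1,2) c(2) that(3,4), of v] that by(simp add: tangent_of_def)
 moreover have "tangent_of c x v c' = 0" if "~ (c' : A & x : fst c')" for c' using that by(simp only: tangent_of_def if_False)
 ultimately show ?thesis unfolding tangent_space_def by blast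
qed

lemma tangent_of_coord: "c : A ==> x : fst c ==> X : tangent_space x ==> tangent_of c x (X c) = X"
proof
 fix c'
 assume c: "c : A" "x : fst c" and X: "X : tangent_space x"
 show "tangent_of c x (X c) c' = X c'"
 proof (cases "c' : A & x : fst c'")
  case True
  hence "X c' = fderiv (snd c' \<circ> param c) (at (snd c x)) (X c)" using X c unfolding tangent_space_def by blast
  thus ?thesis using True by(simp add: tangent_of_def)
 next
  case False
  hence "X c' = 0" using X unfolding tangent_space_def by blast
  thus ?thesis using False by(simp only: tangent_of_def if_False)
 qed
qed

lemma linear_transition:
 "c : A ==> c' : A ==> x : fst c ==> x : fst c' ==> linear (fderiv (snd c' \<circ> param c) (at (snd c x)))" by(rule has_derivative_linear[OF transition_derivative])

lemma tangent_of_add: "c : A ==> x : fst c ==> tangent_of c x (v + w) = (%c'. tangent_of c x v c' + tangent_of c x w c')"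
proof
 fix c'
 assume c: "c : A" "x : fst c"
 show "tangent_of c x (v + w) c' = tangent_of c x v c' + tangent_of c x w c'" using linear_add[OF linear_transition[OF c(1) _ c(2)], of c'] by(simp add: tangent_of_def)
qed

lemma tangent_of_scale: "c : A ==> x : fst c ==> tangent_of c x (a *\<^sub>R v) = (%c'. a *\<^sub>R tangent_of c x v c')"
proof
 fix c'
 assume c: "c : A" "x : fst c"
 show "tangent_of c x (a *\<^sub>R v) c' = a *\<^sub>R tangent_of c x v c'" using linear_scale[OF linear_transition[OF c(1) _ c(2)], of c'] by(simp add: tangent_of_def)
qed

lemma tangent_of_eq_0: "c : A ==> x : fst c ==> tangent_of c x v = (%c'. 0) \<longleftrightarrow> v = 0"
proof
 assume c: "c : A" "x : fst c" and "tangent_of c x v = (%c'. 0)"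
 thus "v = 0" using tangent_of_chart[OF c, of v] by simp
next
 assume "c : A" "x : fst c" "v = 0"
 thus "tangent_of c x v = (%c'. 0)" using tangent_of_scale[of c x 0 0] by simp
qed

lemma ex_chart: "x : M ==> EX c:A. x : fst c" using cover by auto

lemma cotangent_linear:
 assumes "c : A" "x : fst c" "xi : cotangent_space x"
 shows "linear (%v. xi (tangent_of c x v))"
proof (rule linearI)
 fix v w a
 show "xi (tangent_of c x (v + w)) = xi (tangent_of c x v) + xi (tangent_of c x w)" unfolding tangent_of_add[OF assms(1,2)] using assms(3) tangent_of_in[OF assms(1,2)]
  unfolding cotangent_space_def by blast
 show "xi (tangent_of c x (a *\<^sub>R v)) = a *\<^sub>R xi (tangent_of c x v)"
  unfolding tangent_of_scale[OF assms(1,2)] real_scaleR_def using assms(3) tangent_of_in[OF assms(1,2)] unfolding cotangent_space_def by blast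
qed

lemma cotangent_add: "xi : cotangent_space x ==> et : cotangent_space x ==> (%X. xi X + et X) : cotangent_space x"
 and cotangent_scale: "xi : cotangent_space x ==> (%X. a * xi X) : cotangent_space x"
 and cotangent_zero: "(%X. 0) : cotangent_space x" unfolding cotangent_space_def by(auto simp: algebra_simps)

lemma cotangent_diff: "xi : cotangent_space x ==> et : cotangent_space x ==> (%X. xi X - et X) : cotangent_space x"
 using cotangent_add[of xi x "%X. -1 * et X"] cotangent_scale[of et x "-1"] by simp

end

section \<open>The Finsler norm in coordinates and its dual norm\<close>

context finsler_manifold
begin

abbreviation N where "N c p v \<equiv> F (param c p) (tangent_of c (param c p) v)"

lemma N_scale: "c : A ==> p : coords c ==> N c p (a *\<^sub>R v) = \<bar>a\<bar> * N c p v"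
proof -
 assume c: "c : A" and p: "p : coords c"
 show ?thesis unfolding tangent_of_scale[OF c param_in[OF p]] by(rule F_homogeneous[OF param_in_M[OF c p] tangent_of_in[OF c param_in[OF p]]])
qed

lemma N_nonneg: "c : A ==> p : coords c ==> 0 <= N c p v" by(intro F_nonneg param_in_M tangent_of_in param_in)

lemma continuous_on_N:
 "c : A ==> continuous_on (coords c \<times> (UNIV - {0})) (%(p, v). N c p v)" using F_smooth Ck_on_imp_continuous_on unfolding smooth_on_def by blast

text \<open>By Euler's relations for homogeneous functions, the Hessian of \<open>F^2 / 2\<close> at \<open>v\<close>
 evaluated on \<open>(v, v)\<close> is \<open>F^2 v\<close>.\<close>

lemma N_pos:
 assumes c: "c : A" and p: "p : coords c" and v: "v ~= 0"
 shows "0 < N c p v"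
proof -
 define f where "f = (%(p, v). N c p v)"
 let ?U = "coords c \<times> (UNIV - {0::'e})"
 have U: "open ?U" using chart_open[OF c] by(intro open_Times open_delete open_UNIV)
 have f2: "Ck_on (Suc (Suc 0)) ?U f" using F_smooth[OF c] unfolding smooth_on_def f_def by blast
 define G where "G z = (N c p z)^2" for z
 define g where "g j z = 2 * N c p z * fderiv f (at (p, z)) (0, j)" for j z
 have fd: "(f has_derivative fderiv f (at (p, z))) (at (p, z))" if "z ~= 0" for z by(rule Ck_on_derivative[OF f2]) (use that p in auto)
 have Nd: "((%z. N c p z) has_derivative (%w. fderiv f (at (p, z)) (0, w))) (at z)" if "z ~= 0" for z
 proof -
  have "((%z. (p, z)) has_derivative (%w. (0, w))) (at z)" by(auto intro!: derivative_eq_intros)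
  from has_derivative_compose[OF this fd[OF that]] show ?thesis by(simp add: f_def)
 qed
 have Gd: "(G has_derivative (%w. g w z)) (at z)" if "z ~= 0" for z unfolding G_def g_def using Nd[OF that] by(auto intro!: derivative_eq_intros)
 have Gg: "fderiv G (at z) w = g w z" if "z ~= 0" for z w using fun_cong[OF frechet_derivative_at[OF Gd[OF that]], of w] by simp
 have "g j differentiable (at z)" if "z ~= 0" for j z
 proof -
  have "(%q. fderiv f (at q) (0, j)) differentiable (at (p, z))" using f2 that p by auto
  moreover have "(%z. (p, z)) differentiable (at z)" unfolding differentiable_def by(rule exI, rule has_derivative_Pair[OF has_derivative_const has_derivative_ident])
  ultimately have "(%z. fderiv f (at (p, z)) (0, j)) differentiable (at z)"
   using differentiable_chain_at[of "%z. (p, z)" z "%q. fderiv f (at q) (0, j)"] by(simp add: o_def)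
  moreover have "(%z. N c p z) differentiable (at z)" using Nd[OF that] by(auto simp: differentiable_def)
  ultimately show ?thesis unfolding g_def by(intro differentiable_mult) auto
 qed
 hence gd: "(g j has_derivative fderiv (g j) (at z)) (at z)" if "z ~= 0" for j z using that frechet_derivative_works by blast
 have Gt: "G (t *\<^sub>R z) = t^2 * G z" for t z using N_scale[OF c p] by(simp add: G_def power_mult_distrib)
 have glin: "linear (%w. g w z)" if "z ~= 0" for z using Gd[OF that] by(rule has_derivative_linear)
 \<comment> \<open>Comparing two expressions for the derivative of
   \<open>G (t *\<^sub>R z) = t^2 * G z\<close> shows that the first derivatives of \<open>G\<close>
   are homogeneous of degree 1. Differentiated along the ray through \<open>v\<close> this is the
   Euler relation \<open>g1\<close>, while \<open>G1\<close> comes from the degree 2 of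
   \<open>G\<close> itself.\<close>
 have gt: "g j (t *\<^sub>R z) = t * g j z" if t: "t > 0" and z: "z ~= 0" for t j z
 proof -
  have "((%z. G (t *\<^sub>R z)) has_derivative (%w. g (t *\<^sub>R w) (t *\<^sub>R z))) (at z)"
   by(rule has_derivative_compose[OF _ Gd]) (use t z in \<open>auto intro!: derivative_eq_intros\<close>)
  moreover have "((%z. G (t *\<^sub>R z)) has_derivative (%w. t^2 * g w z)) (at z)" unfolding Gt using Gd[OF z] by(auto intro!: derivative_eq_intros)
  ultimately have "(%w. g (t *\<^sub>R w) (t *\<^sub>R z)) = (%w. t^2 * g w z)" by(rule has_derivative_unique)
  hence "g (t *\<^sub>R j) (t *\<^sub>R z) = t^2 * g j z" by(rule fun_cong)
  moreover have "g (t *\<^sub>R j) (t *\<^sub>R z) = t * g j (t *\<^sub>R z)" using linear_scale[OF glin] t z by simp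
  ultimately show ?thesis using t by(simp add: power2_eq_square)
 qed
 have ray: "((%t. h (t *\<^sub>R v)) has_derivative (%s. h' (s *\<^sub>R v))) (at 1)"
  if "(h has_derivative h') (at v)" for h h' :: "'e => real"
 proof -
  have "((%t::real. t *\<^sub>R v) has_derivative (%s. s *\<^sub>R v)) (at 1)" by(auto intro!: derivative_eq_intros)
  from has_derivative_compose[OF this, of h h'] that show ?thesis by simp
 qed
 have g1: "fderiv (g j) (at v) v = g j v" for j
 proof -
  have "((%t. t * g j v) has_derivative (%s. s * g j v)) (at 1)" by(auto intro!: derivative_eq_intros)
  hence "((%t. g j (t *\<^sub>R v)) has_derivative (%s. s * g j v)) (at 1)" by(rule has_derivative_transform_within_open[of _ _ _ _ "{0<..}"]) (use gt v in auto)
  from has_derivative_unique[OF ray[OF gd[OF v]] this]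
  have "fderiv (g j) (at v) (1 *\<^sub>R v) = 1 * g j v" by(rule fun_cong)
  thus ?thesis by simp
 qed
 have G1: "g v v = 2 * G v"
 proof -
  have "((%t. t^2 * G v) has_derivative (%s. 2 * s * G v)) (at (1::real))" by(auto intro!: derivative_eq_intros)
  hence "((%t. G (t *\<^sub>R v)) has_derivative (%s. 2 * s * G v)) (at 1)" unfolding Gt .
  from has_derivative_unique[OF ray[OF Gd[OF v]] this]
  have "g (1 *\<^sub>R v) v = 2 * 1 * G v" by(rule fun_cong)
  thus ?thesis by simp
 qed
 have expand: "(\<Sum>i\<in>Basis. (v \<bullet> i) * l i) = l v" if "linear l" for l :: "'e => real"
  using linear_sum[OF that, of "%i. (v \<bullet> i) *\<^sub>R i" Basis] linear_scale[OF that] by(simp add: euclidean_representation)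
 have D2: "fderiv (%y. fderiv G (at y) j) (at v) i = fderiv (g j) (at v) i" for i j
 proof -
  have "((%y. fderiv G (at y) j) has_derivative fderiv (g j) (at v)) (at v)"
   by(rule has_derivative_transform_within_open[OF gd[OF v], of "UNIV - {0}"]) (use v Gg in auto)
  from fun_cong[OF frechet_derivative_at[OF this], of i] show ?thesis by simp
 qed
 have "0 < (\<Sum>i\<in>Basis. \<Sum>j\<in>Basis. (v \<bullet> i) * (v \<bullet> j) *
      (1/2 * fderiv (%y. fderiv G (at y) j) (at v) i))" using F_strictly_convex[OF c p v v] unfolding G_def .
 also have "... = (\<Sum>i\<in>Basis. \<Sum>j\<in>Basis. 1/2 * (v \<bullet> j) * ((v \<bullet> i) * fderiv (g j) (at v) i))" unfolding D2 by(simp add: mult_ac)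
 also have "... = (\<Sum>j\<in>Basis. \<Sum>i\<in>Basis. 1/2 * (v \<bullet> j) * ((v \<bullet> i) * fderiv (g j) (at v) i))" by(rule sum.swap)
 also have "... = (\<Sum>j\<in>Basis. 1/2 * (v \<bullet> j) * (\<Sum>i\<in>Basis. (v \<bullet> i) * fderiv (g j) (at v) i))" by(simp add: sum_distrib_left)
 also have "... = (\<Sum>j\<in>Basis. 1/2 * (v \<bullet> j) * g j v)" using expand[OF has_derivative_linear[OF gd[OF v]]] g1 by simp
 also have "... = 1/2 * (\<Sum>j\<in>Basis. (v \<bullet> j) * g j v)" by(simp add: sum_distrib_left mult.assoc)
 also have "... = G v" using expand[OF glin[OF v]] G1 by simp
 finally have "N c p v ~= 0" by(auto simp: G_def)
 thus ?thesis using N_nonneg[OF c p, of v] by linarith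
qed

text \<open>\<open>N\<close> is continuous and positive on the compact product of \<open>C\<close>
  with the unit sphere, and homogeneity extends the bounds to all vectors. The sphere keeps away
  from the zero vector, where \<open>F\<close> is not assumed smooth.\<close>

lemma N_bounds:
 assumes c: "c : A" and C: "compact C" "C <= coords c"
 obtains a b where "0 < a" "0 < b" "!!p v. p : C ==> a * norm v <= N c p v" "!!p v. p : C ==> N c p v <= b * norm v"
proof (cases "C = {}")
 case True
 thus ?thesis using that[of 1 1] by auto
next
 case False
 let ?S = "C \<times> sphere (0::'e) 1"
 have S: "compact ?S" "?S ~= {}" using C False by(auto intro!: compact_Times simp: sphere_eq_empty)
 have cont: "continuous_on ?S (%(p, v). N c p v)" by(rule continuous_on_subset[OF continuous_on_N[OF c]]) (use C in auto)
 obtain q where q: "q : ?S" "!!r. r : ?S ==> (%(p, v). N c p v) q <= (%(p, v). N c p v) r" using continuous_attains_inf[OF S cont] by blast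
 obtain r where r: "r : ?S" "!!q. q : ?S ==> (%(p, v). N c p v) q <= (%(p, v). N c p v) r" using continuous_attains_sup[OF S cont] by blast
 have pos: "0 < (%(p, v). N c p v) q" if qS: "q : ?S" for q
 proof -
  obtain p v where pv: "q = (p, v)" "p : C" "norm v = 1" using qS by auto
  hence "v ~= 0" by auto
  thus ?thesis using N_pos[OF c subsetD[OF C(2) pv(2)], of v] pv(1) by simp
 qed
 have unit: "N c p v = norm v * N c p (v /\<^sub>R norm v)" if "p : C" "v ~= 0" for p v
  using N_scale[OF c subsetD[OF C(2) that(1)], of "norm v" "v /\<^sub>R norm v"] that(2) by simp
 have z: "N c p 0 = 0" if "p : C" for p using N_scale[OF c subsetD[OF C(2) that], of 0 0] by simp
 show ?thesis
 proof (rule that[OF pos[OF q(1)] pos[OF r(1)]])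
  fix p and v :: 'e assume p: "p : C"
  have mem: "(p, v /\<^sub>R norm v) : ?S" if "v ~= 0" using p that by simp
  show "(%(p, v). N c p v) q * norm v <= N c p v"
  proof (cases "v = 0")
   case False
   thus ?thesis using mult_left_mono[OF q(2)[OF mem[OF False]], of "norm v"] unit[OF p False] by(simp add: mult.commute)
  qed (simp add: z[OF p])
  show "N c p v <= (%(p, v). N c p v) r * norm v"
  proof (cases "v = 0")
   case False
   thus ?thesis using mult_left_mono[OF r(2)[OF mem[OF False]], of "norm v"] unit[OF p False] by(simp add: mult.commute)
  qed (simp add: z[OF p])
 qed
qed

lemma F_pos: "x : M ==> X : tangent_space x ==> X ~= (%c. 0) ==> 0 < F x X"
proof -
 assume x: "x : M" and X: "X : tangent_space x" "X ~= (%c. 0)"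
 obtain c where c: "c : A" "x : fst c" using ex_chart[OF x] by blast
 have "X = tangent_of c x (X c)" "X c ~= 0" using tangent_of_coord[OF c X(1)] tangent_of_eq_0[OF c, of "X c"] X(2) by auto
 thus ?thesis using N_pos[OF c(1) chart_in_coords[OF c(2)], of "X c"] c by simp
qed

lemma cotangent_norm_le:
 fixes l :: "'e => real"
 assumes "linear l"
 shows "\<bar>l v\<bar> <= (\<Sum>i\<in>Basis. \<bar>l i\<bar>) * norm v"
proof -
 have "l v = (\<Sum>i\<in>Basis. (v \<bullet> i) * l i)" using linear_sum[OF assms, of "%i. (v \<bullet> i) *\<^sub>R i" Basis] linear_scale[OF assms]
  by(simp add: euclidean_representation)
 also have "\<bar>...\<bar> <= (\<Sum>i\<in>Basis. \<bar>(v \<bullet> i) * l i\<bar>)" by(rule sum_abs)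
 also have "... <= (\<Sum>i\<in>Basis. norm v * \<bar>l i\<bar>)" by(intro sum_mono) (auto simp: abs_mult Basis_le_norm intro: mult_right_mono)
 finally show ?thesis by(simp add: sum_distrib_left[symmetric] mult.commute)
qed

text \<open>Without this bound the real-valued supremum in \<open>co_finsler\<close> would be an
  unspecified number; it follows from comparability of \<open>F x\<close> with the Euclidean
  norm.\<close>

lemma co_finsler_bdd:
 assumes x: "x : M" and xi: "xi : cotangent_space x"
 shows "bdd_above ((%X. xi X / F x X) ` (tangent_space x - {%c. 0}))"
proof -
 obtain c where c: "c : A" "x : fst c" using ex_chart[OF x] by blast
 obtain a b where a: "0 < a" "!!p v. p : {snd c x} ==> a * norm v <= N c p v"
  by(rule N_bounds[OF c(1), of "{snd c x}"]) (use chart_in_coords[OF c(2)] in \<open>auto intro: that\<close>)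
 have lin: "linear (%v. xi (tangent_of c x v))" by(rule cotangent_linear[OF c xi])
 define K where "K = (\<Sum>i\<in>Basis. \<bar>xi (tangent_of c x i)\<bar>)"
 have K0: "K >= 0" by(simp add: K_def sum_nonneg)
 have "xi X / F x X <= K / a" if X: "X : tangent_space x - {%c. 0}" for X
 proof -
  have Xc: "X = tangent_of c x (X c)" using tangent_of_coord[OF c] X by simp
  have F: "a * norm (X c) <= F x X" using a(2)[of "snd c x" "X c"] c Xc by simp
  have "xi X <= K * norm (X c)" using cotangent_norm_le[OF lin, of "X c"] Xc by(simp add: K_def)
  also have "... <= (K / a) * F x X" using mult_left_mono[OF F, of "K / a"] K0 a(1) by simp
  finally show ?thesis using F_pos[OF x] X by(simp add: divide_le_eq)
 qed
 thus ?thesis by(intro bdd_aboveI2) auto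
qed

lemma tangent_space_nontrivial: "x : M ==> tangent_space x - {%c. 0} ~= {}"
proof -
 assume "x : M"
 then obtain c where c: "c : A" "x : fst c" using ex_chart by blast
 obtain i :: 'e where "i : Basis" using nonempty_Basis by blast
 hence "tangent_of c x i ~= (%c. 0)" using tangent_of_eq_0[OF c] nonzero_Basis by blast
 thus ?thesis using tangent_of_in[OF c] by blast
qed

lemma tangent_scale: "X : tangent_space x ==> x : M ==> (%c. a *\<^sub>R X c) : tangent_space x"
proof -
 assume X: "X : tangent_space x" and "x : M"
 then obtain c where c: "c : A" "x : fst c" using ex_chart by blast
 show ?thesis using tangent_of_in[OF c, of "a *\<^sub>R X c"] tangent_of_coord[OF c X] by(simp add: tangent_of_scale[OF c])
qed

lemma F_zero: "x : M ==> F x (%c. 0) = 0"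
proof -
 assume x: "x : M"
 obtain X where X: "X : tangent_space x" using tangent_space_nontrivial[OF x] by blast
 show ?thesis using F_homogeneous[OF x X, of 0] by simp
qed

lemma cotangent_zero_vector: "x : M ==> xi : cotangent_space x ==> xi (%c. 0) = 0"
proof -
 assume x: "x : M" and xi: "xi : cotangent_space x"
 obtain X where X: "X : tangent_space x" using tangent_space_nontrivial[OF x] by blast
 have "xi (%c. 0 *\<^sub>R X c) = 0 * xi X" using xi X unfolding cotangent_space_def by blast
 thus ?thesis by simp
qed

lemma co_finsler_ge:
 assumes x: "x : M" and xi: "xi : cotangent_space x" and X: "X : tangent_space x"
 shows "xi X <= co_finsler x xi * F x X"
proof (cases "X = (%c. 0)")
 case True
 thus ?thesis using F_zero[OF x] cotangent_zero_vector[OF x xi] by simp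
next
 case False
 hence "xi X / F x X <= co_finsler x xi" unfolding co_finsler_def using X co_finsler_bdd[OF x xi] by(intro cSUP_upper) auto
 thus ?thesis using F_pos[OF x X False] by(simp add: divide_le_eq)
qed

lemma co_finsler_abs_ge:
 assumes x: "x : M" and xi: "xi : cotangent_space x" and X: "X : tangent_space x"
 shows "\<bar>xi X\<bar> <= co_finsler x xi * F x X"
proof -
 have "xi (%c. (-1) *\<^sub>R X c) = (-1) * xi X" using xi X unfolding cotangent_space_def by blast
 thus ?thesis using co_finsler_ge[OF x xi X] co_finsler_ge[OF x xi tangent_scale[OF X x, of "-1"]]
   F_homogeneous[OF x X, of "-1"] by auto
qed

lemma co_finsler_le:
 assumes x: "x : M" and "!!X. X : tangent_space x ==> xi X <= K * F x X"
 shows "co_finsler x xi <= K" unfolding co_finsler_def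
proof (rule cSUP_least[OF tangent_space_nontrivial[OF x]])
 fix X assume X: "X : tangent_space x - {%c. 0}"
 hence "0 < F x X" using F_pos[OF x] by blast
 thus "xi X / F x X <= K" using assms(2)[of X] X by(simp add: divide_le_eq)
qed

lemma co_finsler_cong: "(!!X. X : tangent_space x ==> xi X = et X) ==> co_finsler x xi = co_finsler x et" unfolding co_finsler_def by(intro SUP_cong) auto

lemma co_finsler_nonneg:
 assumes x: "x : M" and xi: "xi : cotangent_space x"
 shows "0 <= co_finsler x xi"
proof -
 obtain X where X: "X : tangent_space x" "X ~= (%c. 0)" using tangent_space_nontrivial[OF x] by blast
 have "0 <= co_finsler x xi * F x X" using co_finsler_abs_ge[OF x xi X(1)] by linarith
 thus ?thesis using F_pos[OF x X] by(simp add: zero_le_mult_iff)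
qed

lemma co_finsler_triangle:
 assumes x: "x : M" and "xi : cotangent_space x" "et : cotangent_space x"
 shows "co_finsler x (%X. xi X + et X) <= co_finsler x xi + co_finsler x et"
proof (rule co_finsler_le[OF x])
 fix X assume X: "X : tangent_space x"
 show "xi X + et X <= (co_finsler x xi + co_finsler x et) * F x X" unfolding distrib_right by(intro add_mono co_finsler_ge[OF x] assms X)
qed

lemma co_finsler_scale_le:
 assumes x: "x : M" and "xi : cotangent_space x"
 shows "co_finsler x (%X. a * xi X) <= \<bar>a\<bar> * co_finsler x xi"
proof (rule co_finsler_le[OF x])
 fix X assume X: "X : tangent_space x"
 have "a * xi X <= \<bar>a\<bar> * \<bar>xi X\<bar>" by(metis abs_ge_self abs_mult)
 also have "... <= \<bar>a\<bar> * (co_finsler x xi * F x X)" by(intro mult_left_mono co_finsler_abs_ge assms X) auto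
 finally show "a * xi X <= \<bar>a\<bar> * co_finsler x xi * F x X" by(simp add: mult.assoc)
qed

lemma co_finsler_scale:
 assumes x: "x : M" and xi: "xi : cotangent_space x"
 shows "co_finsler x (%X. a * xi X) = \<bar>a\<bar> * co_finsler x xi"
proof (cases "a = 0")
 case True
 thus ?thesis using co_finsler_scale_le[OF assms, of 0] co_finsler_nonneg[OF x cotangent_zero] by auto
next
 case False
 have "co_finsler x xi <= \<bar>1/a\<bar> * co_finsler x (%X. a * xi X)" using co_finsler_scale_le[OF x cotangent_scale[OF xi, of a], of "1/a"] False by simp
 hence "\<bar>a\<bar> * co_finsler x xi <= co_finsler x (%X. a * xi X)" using False by(simp add: field_simps)
 thus ?thesis using co_finsler_scale_le[OF assms, of a] by simp
qed

text \<open>Comparability of \<open>F\<close> with the Euclidean norm passes to the dual norms. The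
  components against \<open>Basis\<close> are what weak differentiation controls, so dual norms are
  compared with these numbers.\<close>

lemma co_finsler_chart_bounds:
 assumes c: "c : A" and C: "compact C" "C <= coords c"
 obtains b where "0 < b"
  "!!p xi. p : C ==> xi : cotangent_space (param c p) ==>
    co_finsler (param c p) xi <= b * (\<Sum>i\<in>Basis. \<bar>xi (tangent_of c (param c p) i)\<bar>)"
  "!!p xi i. p : C ==> xi : cotangent_space (param c p) ==> i : Basis ==>
    \<bar>xi (tangent_of c (param c p) i)\<bar> <= b * co_finsler (param c p) xi"
proof -
 obtain a b where ab: "0 < a" "0 < b" "!!p v. p : C ==> a * norm v <= N c p v" "!!p v. p : C ==> N c p v <= b * norm v" by(rule N_bounds[OF assms]) (rule that)
 define K where "K = max b (1 / a)"
 show ?thesis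
 proof (rule that[of K])
  show "0 < K" using ab by(simp add: K_def)
 next
  fix p xi assume p: "p : C" and xi: "xi : cotangent_space (param c p)"
  let ?x = "param c p"
  have x: "?x : M" "?x : fst c" using subsetD[OF C(2) p] param_in_M[OF c] param_in[of p c] by auto
  have lin: "linear (%v. xi (tangent_of c ?x v))" by(rule cotangent_linear[OF c x(2) xi])
  let ?s = "\<Sum>i\<in>Basis. \<bar>xi (tangent_of c ?x i)\<bar>"
  have s0: "?s >= 0" by(rule sum_nonneg) auto
  show "co_finsler ?x xi <= K * ?s"
  proof (rule co_finsler_le[OF x(1)])
   fix X assume X: "X : tangent_space ?x"
   have Xc: "X = tangent_of c ?x (X c)" using tangent_of_coord[OF c x(2) X] by simp
   have "xi X <= ?s * norm (X c)" using cotangent_norm_le[OF lin, of "X c"] Xc by simp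
   also have "... <= (1 / a * ?s) * F ?x X" using mult_left_mono[OF ab(3)[OF p, of "X c"], of "1 / a * ?s"] s0 ab(1) Xc by simp
   also have "... <= (K * ?s) * F ?x X" using s0 F_nonneg[OF x(1) X] by(intro mult_right_mono) (auto simp: K_def)
   finally show "xi X <= K * ?s * F ?x X" .
  qed
  fix i :: 'e assume i: "i : Basis"
  have "\<bar>xi (tangent_of c ?x i)\<bar> <= co_finsler ?x xi * N c p i" by(rule co_finsler_abs_ge[OF x(1) xi tangent_of_in[OF c x(2)]])
  also have "... <= co_finsler ?x xi * b" using ab(4)[OF p, of i] i co_finsler_nonneg[OF x(1) xi] by(intro mult_left_mono) auto
  also have "... <= K * co_finsler ?x xi" using co_finsler_nonneg[OF x(1) xi] by(simp add: K_def mult.commute mult_right_mono)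
  finally show "\<bar>xi (tangent_of c ?x i)\<bar> <= K * co_finsler ?x xi" .
 qed
qed

end

section \<open>The Finsler distance and Hausdorff measure\<close>

context smooth_manifold
begin

lemma curve_open_preimage:
 assumes "continuous_map (top_of_set {0..1}) T ga" "openin T G"
 shows "open {t:{0<..<1::real}. ga t : G}"
proof -
 have "openin (top_of_set {0..1}) {t : topspace (top_of_set {0..1}). ga t : G}" by(rule openin_continuous_map_preimage[OF assms])
 then obtain O' where O': "open O'" "{t:{0..1}. ga t : G} = {0..1} Int O'" by(auto simp: openin_open)
 have "{t:{0<..<1::real}. ga t : G} = {0<..<1} Int O'"
 proof (intro set_eqI iffI)
  fix t assume "t : {t:{0<..<1::real}. ga t : G}"
  hence "t : {t:{0..1}. ga t : G}" "t : {0<..<1}" by auto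
  thus "t : {0<..<1} Int O'" using O'(2) by blast
 next
  fix t assume t: "t : {0<..<1} Int O'"
  hence "t : {0..1} Int O'" by auto
  hence "t : {t:{0..1}. ga t : G}" using O'(2) by blast
  thus "t : {t:{0<..<1::real}. ga t : G}" using t by auto
 qed
 thus ?thesis using open_Int[OF open_greaterThanLessThan O'(1)] by metis
qed

lemma curve_chart_derivative:
 assumes "(snd c \<circ> ga) C1_differentiable_on ({t:{0..1}. ga t : fst c} - S)"
  and t: "t : {0<..<1::real}" "t \<notin> S" "ga t : fst c"
 shows "((snd c \<circ> ga) has_vector_derivative vector_derivative (snd c \<circ> ga) (at t)) (at t)"
proof -
 obtain D where "ALL x:{t:{0..1}. ga t : fst c} - S. ((snd c \<circ> ga) has_vector_derivative D x) (at x)" using assms(1) unfolding C1_differentiable_on_def by blast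
 hence "((snd c \<circ> ga) has_vector_derivative D t) (at t)" using t by auto
 thus ?thesis using vector_derivative_at by force
qed

text \<open>The velocity is defined by its coordinates in all charts at once; the chain rule for a
  transition map shows that one chart determines it. Interior times only, because the derivative in
  \<open>velocity\<close> is two-sided.\<close>

lemma velocity_eq:
 assumes ga: "continuous_map (top_of_set {0..1}) T ga" and t: "t : {0<..<1}"
  and c: "c : A" "ga t : fst c" and d: "((snd c \<circ> ga) has_vector_derivative w) (at t)"
 shows "velocity ga t = tangent_of c (ga t) w"
proof
 fix c'
 show "velocity ga t c' = tangent_of c (ga t) w c'"
 proof (cases "c' : A & ga t : fst c'")
  case True
  let ?L = "fderiv (snd c' \<circ> param c) (at (snd c (ga t)))"
  have td: "(snd c' \<circ> param c has_derivative ?L) (at ((snd c \<circ> ga) t))" using transition_derivative[OF c(1) _ c(2)] True by simp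
  have "((snd c' \<circ> param c) \<circ> (snd c \<circ> ga) has_derivative ?L \<circ> (%h. h *\<^sub>R w)) (at t)"
   by(rule diff_chain_at[OF d[unfolded has_vector_derivative_def] td])
  hence "((snd c' \<circ> ga) has_derivative ?L \<circ> (%h. h *\<^sub>R w)) (at t)"
   by(rule has_derivative_transform_within_open[OF _ curve_open_preimage[OF ga chart_domain[OF c(1)]]])
    (use t c in auto)
  hence "((snd c' \<circ> ga) has_vector_derivative ?L w) (at t)"
   using linear_scale[OF linear_transition[OF c(1) _ c(2)]] True by(simp add: has_vector_derivative_def o_def)
  thus ?thesis using True by(simp add: velocity_def tangent_of_def vector_derivative_at)
 next
  case False
  thus ?thesis unfolding velocity_def tangent_of_def by(simp only: if_False)
 qed
qed

definition extend0 :: "('m, 'e) chart => ('e => real) => 'm => real" where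
 "extend0 c h x = (if x : fst c then h (snd c x) else 0)"

text \<open>Near the edge of the chart domain the extension is zero: the image of the closed ball is
  compact, hence closed in the Hausdorff space, and its complement is open.\<close>

lemma continuous_map_extend0:
 assumes c: "c : A" and B: "cball p0 r <= coords c" and h: "continuous_on UNIV h" "!!p. p \<notin> ball p0 r ==> h p = 0"
 shows "continuous_map T euclideanreal (extend0 c h)" unfolding continuous_map_def
proof (intro conjI allI impI)
 fix U :: "real set" assume "openin euclideanreal U"
 hence U: "open U" by simp
 have o1: "openin T (param c ` {p : coords c. h p : U})"
 proof (rule openin_param_image[OF c])
  have "open (h -` U)" using h(1) U continuous_on_open_vimage[of UNIV h] by auto
  moreover have "{p : coords c. h p : U} = coords c Int h -` U" by auto
  ultimately show "open {p : coords c. h p : U}" using chart_open[OF c] by auto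
 qed auto
 have o2: "openin T (M - param c ` cball p0 r)" using closedin_param_image[OF c compact_cball B] by(auto simp: closedin_def)
 have i1: "x : param c ` {p : coords c. h p : U} \<longleftrightarrow> x : fst c & h (snd c x) : U" for x
  using param_image_iff[OF c, of "{p : coords c. h p : U}" x] chart_in_coords[of x c] by auto
 have i2: "x : param c ` cball p0 r \<longleftrightarrow> x : fst c & snd c x : cball p0 r" for x by(rule param_image_iff[OF c B])
 have cb: "p \<notin> cball p0 r ==> h p = 0" for p using h(2)[of p] by auto
 show "openin T {x : M. extend0 c h x : U}"
 proof (cases "0 : U")
  case True
  have "{x : M. extend0 c h x : U} = param c ` {p : coords c. h p : U} Un (M - param c ` cball p0 r)"
  proof (intro set_eqI iffI)
   fix x assume "x : {x : M. extend0 c h x : U}"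
   thus "x : param c ` {p : coords c. h p : U} Un (M - param c ` cball p0 r)" unfolding Un_iff Diff_iff i1 i2 by(auto simp: extend0_def split: if_splits)
  next
   fix x assume "x : param c ` {p : coords c. h p : U} Un (M - param c ` cball p0 r)"
   hence "(x : fst c & h (snd c x) : U) \<or> (x : M & ~ (x : fst c & snd c x : cball p0 r))" unfolding Un_iff Diff_iff i1 i2 .
   thus "x : {x : M. extend0 c h x : U}" using True cb[of "snd c x"] chart_subset[OF c] by(auto simp: extend0_def)
  qed
  thus ?thesis using o1 o2 by auto
 next
  case False
  have "{x : M. extend0 c h x : U} = param c ` {p : coords c. h p : U}" using False i1 chart_subset[OF c] by(auto simp: extend0_def)
  thus ?thesis using o1 by simp
 qed
qed simp

end

context finsler_manifold
begin

text \<open>Along a curve the derivative of the extended function is at most \<open>C\<close> times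
  the Finsler speed, wherever the curve runs: off the image of the closed ball the function is
  locally zero. This is how the distance, an infimum over curves that may leave the chart, gets a
  lower bound.\<close>

lemma finsler_dist_Lipschitz:
 fixes h :: "'e => real"
 assumes c: "c : A" and cb: "cball p0 r <= coords c"
  and hd: "!!p. (h has_derivative h' p) (at p)"
  and hB: "!!p v. p : cball p0 r ==> \<bar>h' p v\<bar> <= B * norm v" and B: "0 <= B"
  and h0: "!!p. p \<notin> ball p0 r ==> h p = 0"
 obtains C where "0 < C" "!!x y. ennreal \<bar>extend0 c h x - extend0 c h y\<bar> <= ennreal C * finsler_dist x y"
proof -
 obtain a where a: "0 < a" "!!p v. p : cball p0 r ==> a * norm v <= N c p v" by(rule N_bounds[OF c compact_cball cb]) (rule that)
 \<comment> \<open>The summand 1 makes \<open>C\<close> positive when \<open>B = 0\<close>.\<close>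
 define C where "C = (B + 1) / a"
 have C: "0 < C" using a B by(simp add: C_def)
 have ch: "continuous_on UNIV h" using has_derivative_continuous[OF hd] by(simp add: continuous_on_eq_continuous_within)
 note cont = continuous_map_extend0[OF c cb ch h0]
 have h'0: "h' p v = 0" if "p \<notin> cball p0 r" for p v
 proof -
  have "((%p. 0) has_derivative (%v. 0)) (at p)" by simp
  hence "(h has_derivative (%v. 0)) (at p)" by(rule has_derivative_transform_within_open[of _ _ _ _ "- cball p0 r"]) (use that h0 in auto)
  from fun_cong[OF has_derivative_unique[OF hd this]] show ?thesis .
 qed
 have main: "ennreal \<bar>extend0 c h (ga 1) - extend0 c h (ga 0)\<bar> <= ennreal C * (\<integral>\<^sup>+t\<in>{0..1}. ennreal (F (ga t) (velocity ga t)) \<partial>lborel)"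
  if "piecewise_C1_curve ga" for ga
 proof -
  obtain S where S: "finite S" "!!c. c : A ==> (snd c \<circ> ga) C1_differentiable_on ({t:{0..1}. ga t : fst c} - S)"
   and ga: "continuous_map (top_of_set {0..1}) T ga" using \<open>piecewise_C1_curve ga\<close> unfolding piecewise_C1_curve_def by blast
  have gaM: "ga t : M" if "t : {0..1}" for t using ga that by(auto simp: continuous_map_def)
  define g where "g t = (if ga t : fst c then h' (snd c (ga t)) (vector_derivative (snd c \<circ> ga) (at t)) else 0)" for t
  have der: "((%t. extend0 c h (ga t)) has_vector_derivative g t) (at t)" if t: "t : {0<..<1} - S" for t
  proof (cases "ga t : fst c")
   case True
   let ?w = "vector_derivative (snd c \<circ> ga) (at t)"
   have d: "((snd c \<circ> ga) has_vector_derivative ?w) (at t)" by(rule curve_chart_derivative[OF S(2)[OF c]]) (use t True in auto)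
   have "(h \<circ> (snd c \<circ> ga) has_derivative h' ((snd c \<circ> ga) t) \<circ> (%s. s *\<^sub>R ?w)) (at t)"
    by(rule diff_chain_at[OF d[unfolded has_vector_derivative_def] hd])
   hence "((%t. extend0 c h (ga t)) has_derivative h' ((snd c \<circ> ga) t) \<circ> (%s. s *\<^sub>R ?w)) (at t)"
    by(rule has_derivative_transform_within_open[OF _ curve_open_preimage[OF ga chart_domain[OF c]]])
     (use t True in \<open>auto simp: extend0_def\<close>)
   thus ?thesis using True linear_scale[OF has_derivative_linear[OF hd]] by(simp add: has_vector_derivative_def o_def g_def)
  next
   case False
   have op: "openin T (M - param c ` cball p0 r)" using closedin_param_image[OF c compact_cball cb] by(auto simp: closedin_def)
   have notin: "ga t : M - param c ` cball p0 r" using gaM[of t] t False param_image_iff[OF c cb, of "ga t"] by auto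
   have z: "extend0 c h x = 0" if "x : M - param c ` cball p0 r" for x using that param_image_iff[OF c cb, of x] h0[of "snd c x"] by(auto simp: extend0_def)
   have "((%t. 0) has_derivative (%s. s *\<^sub>R 0)) (at t)" by simp
   hence "((%t. extend0 c h (ga t)) has_derivative (%s. s *\<^sub>R 0)) (at t)" by(rule has_derivative_transform_within_open[OF _ curve_open_preimage[OF ga op]])
     (use t notin z in auto)
   thus ?thesis using False by(simp add: has_vector_derivative_def g_def)
  qed
  have bound: "\<bar>g t\<bar> / C <= F (ga t) (velocity ga t)" if t: "t : {0<..<1} - S" for t
  proof -
   have xM: "ga t : M" using gaM t by auto
   show ?thesis
   proof (cases "ga t : param c ` cball p0 r")
    case True
    hence x: "ga t : fst c" "snd c (ga t) : cball p0 r" using param_image_iff[OF c cb] by auto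
    let ?w = "vector_derivative (snd c \<circ> ga) (at t)"
    have d: "((snd c \<circ> ga) has_vector_derivative ?w) (at t)" by(rule curve_chart_derivative[OF S(2)[OF c]]) (use t x in auto)
    have v: "velocity ga t = tangent_of c (ga t) ?w" by(rule velocity_eq[OF ga _ c x(1) d]) (use t in auto)
    have "\<bar>g t\<bar> <= B * norm ?w" using hB[OF x(2)] x(1) by(simp add: g_def)
    also have "... <= (B + 1) * norm ?w" by(intro mult_right_mono) auto
    also have "... = C * (a * norm ?w)" using a by(simp add: C_def)
    also have "... <= C * F (ga t) (velocity ga t)" using a(2)[OF x(2), of ?w] C v x(1) c by(intro mult_left_mono) auto
    finally show ?thesis using C by(simp add: divide_le_eq mult.commute)
   next
    case False
    hence "g t = 0" using param_image_iff[OF c cb, of "ga t"] h'0 by(auto simp: g_def)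
    moreover have "velocity ga t : tangent_space (ga t)"
    proof -
     obtain c' where c': "c' : A" "ga t : fst c'" using ex_chart[OF xM] by blast
     have d: "((snd c' \<circ> ga) has_vector_derivative vector_derivative (snd c' \<circ> ga) (at t)) (at t)"
      by(rule curve_chart_derivative[OF S(2)[OF c'(1)]]) (use t c' in auto)
     have "velocity ga t = tangent_of c' (ga t) (vector_derivative (snd c' \<circ> ga) (at t))" by(rule velocity_eq[OF ga _ c' d]) (use t in auto)
     thus ?thesis using tangent_of_in[OF c'] by simp
    qed
    ultimately show ?thesis using F_nonneg[OF xM] by simp
   qed
  qed
  have cc: "continuous_on {0..1} (%t. extend0 c h (ga t))" using continuous_map_compose[OF ga cont] by(simp add: o_def continuous_map_iff_continuous)
  \<comment> \<open>The derivative exists off a finite set, and absolute integrability of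
    \<open>g\<close> is not known at this point; the gauge integral gives the fundamental theorem
    under these conditions.\<close>
  have int: "(g has_integral (extend0 c h (ga 1) - extend0 c h (ga 0))) {0..1}" by(rule fundamental_theorem_of_calculus_interior_strong[OF S(1) _ der cc]) auto
  let ?J = "\<integral>\<^sup>+t\<in>{0..1}. ennreal (F (ga t) (velocity ga t)) \<partial>lborel"
  have gm: "g : borel_measurable (lebesgue_on {0..1})" using int by(intro integrable_imp_measurable) (auto simp: integrable_on_def)
  have "negligible (S Un {0, 1})" using S(1) by(intro negligible_finite) auto
  hence "AE t in lebesgue. t \<notin> S Un {0, 1}" by(intro AE_not_in) (simp add: negligible_iff_null_sets)
  hence "(\<integral>\<^sup>+t. ennreal (\<bar>g t\<bar> / C) * indicator {0..1} t \<partial>lebesgue) <=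
    (\<integral>\<^sup>+t. ennreal (F (ga t) (velocity ga t)) * indicator {0..1} t \<partial>lebesgue)" by(intro nn_integral_mono_AE, eventually_elim)
    (use bound in \<open>auto simp: indicator_def intro!: ennreal_leI\<close>)
  \<comment> \<open>The derivative \<open>g\<close> is known to be measurable only for the completed
    sigma-algebra; integrals of nonnegative functions do not change under completion.\<close>
  also have "... = ?J" by(rule nn_integral_completion)
  finally have J: "(\<integral>\<^sup>+t. ennreal (\<bar>g t\<bar> / C) * indicator {0..1} t \<partial>lebesgue) <= ?J" .
  have "(\<integral>\<^sup>+t. ennreal \<bar>g t\<bar> \<partial>lebesgue_on {0..1}) = (\<integral>\<^sup>+t. ennreal C * ennreal (\<bar>g t\<bar> / C) \<partial>lebesgue_on {0..1})"
   using C by(intro nn_integral_cong) (simp add: ennreal_mult[symmetric])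
  also have "... = ennreal C * (\<integral>\<^sup>+t. ennreal (\<bar>g t\<bar> / C) \<partial>lebesgue_on {0..1})" using gm by(intro nn_integral_cmult) auto
  also have "(\<integral>\<^sup>+t. ennreal (\<bar>g t\<bar> / C) \<partial>lebesgue_on {0..1}) = (\<integral>\<^sup>+t. ennreal (\<bar>g t\<bar> / C) * indicator {0..1} t \<partial>lebesgue)"
   by(rule nn_integral_restrict_space) auto
  finally have gJ: "(\<integral>\<^sup>+t. ennreal \<bar>g t\<bar> \<partial>lebesgue_on {0..1}) <= ennreal C * ?J" using J by(simp add: mult_left_mono)
  \<comment> \<open>Either \<open>g\<close> is absolutely integrable and its Lebesgue and gauge
    integrals agree, or the length of the curve is infinite and the claim is void.\<close>
  show ?thesis
  proof (cases "(\<integral>\<^sup>+t. ennreal \<bar>g t\<bar> \<partial>lebesgue_on {0..1}) < \<infinity>")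
   case True
   hence gi: "integrable (lebesgue_on {0..1}) g" using gm by(intro integrableI_bounded) auto
   have "integral\<^sup>L (lebesgue_on {0..1}) g = extend0 c h (ga 1) - extend0 c h (ga 0)" using lebesgue_integral_eq_integral[OF gi] integral_unique[OF int] by simp
   thus ?thesis using order_trans[OF integral_norm_bound_ennreal[OF gi]] gJ by simp
  next
   case False
   hence "ennreal C * ?J = \<infinity>" using gJ by(simp add: top.extremum_unique not_less)
   thus ?thesis by simp
  qed
 qed
 have "ennreal \<bar>extend0 c h x - extend0 c h y\<bar> <= ennreal C * finsler_dist x y" for x y
 proof -
  have "ennreal (\<bar>extend0 c h x - extend0 c h y\<bar> / C) <= finsler_dist x y" unfolding finsler_dist_def
  proof (rule INF_greatest, clarify)
   fix ga :: "real => 'm" assume ga: "piecewise_C1_curve ga"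
   have "ennreal (1 / C) * ennreal \<bar>extend0 c h (ga 1) - extend0 c h (ga 0)\<bar> <=
     ennreal (1 / C) * (ennreal C * (\<integral>\<^sup>+t\<in>{0..1}. ennreal (F (ga t) (velocity ga t)) \<partial>lborel))" by(intro mult_left_mono main ga) auto
   thus "ennreal (\<bar>extend0 c h (ga 0) - extend0 c h (ga 1)\<bar> / C) <=
     (\<integral>\<^sup>+t\<in>{0..1}. ennreal (F (ga t) (velocity ga t)) \<partial>lborel)"
    using C by(simp add: mult.assoc[symmetric] ennreal_mult[symmetric] abs_minus_commute)
  qed
  hence "ennreal C * ennreal (\<bar>extend0 c h x - extend0 c h y\<bar> / C) <= ennreal C * finsler_dist x y" by(rule mult_left_mono) auto
  thus ?thesis using C by(simp add: ennreal_mult[symmetric])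
 qed
 with C show ?thesis by(rule that)
qed

text \<open>The straight segment in the chart is an admissible curve of constant coordinate velocity
  \<open>q - p\<close>; convexity of \<open>K\<close> keeps the bound on \<open>N\<close> valid
  along it.\<close>

lemma finsler_dist_chart_le:
 assumes c: "c : A" and K: "convex K" "K <= coords c" and b: "!!p v. p : K ==> N c p v <= b * norm v"
  and p: "p : K" and q: "q : K"
 shows "finsler_dist (param c p) (param c q) <= ennreal (b * norm (p - q))"
proof -
 define l where "l t = p + t *\<^sub>R (q - p)" for t :: real
 define ga where "ga t = param c (l t)" for t
 have lK: "l t : K" if "t : {0..1}" for t using convexD[OF K(1) p q, of "1 - t" t] that by(simp add: l_def algebra_simps)
 have lc: "l t : coords c" if "t : {0..1}" for t using lK[OF that] K(2) by auto
 have cl: "continuous_on S l" for S unfolding l_def by(intro continuous_intros)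
 have "continuous_map (top_of_set {0..1}) (top_of_set (coords c)) l" using cl lc by(auto simp: continuous_map_in_subtopology continuous_map_iff_continuous)
 from continuous_map_compose[OF this continuous_map_param[OF c]]
 have cont: "continuous_map (top_of_set {0..1}) T ga" by(simp add: o_def ga_def[abs_def])
 let ?D = "%c' t. fderiv (snd c' \<circ> param c) (at (l t)) (q - p)"
 have in_dom: "l t : snd c ` (fst c Int fst c')" if "t : {0..1}" "ga t : fst c'" for t c' using lc[OF that(1)] that(2) param_in[of "l t" c] chart_param[of "l t" c]
  by(intro image_eqI[of _ _ "ga t"]) (auto simp: ga_def)
 have der: "((snd c' \<circ> ga) has_vector_derivative ?D c' t) (at t)" if "c' : A" "t : {0..1}" "ga t : fst c'" for c' t
 proof -
  have d: "(snd c' \<circ> param c has_derivative fderiv (snd c' \<circ> param c) (at (l t))) (at (l t))"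
   by(rule Ck_on_derivative[OF transition_C1[OF c that(1)] in_dom[OF that(2,3)]])
  have "(l has_derivative (%s. s *\<^sub>R (q - p))) (at t)" unfolding l_def by(auto intro!: derivative_eq_intros)
  from diff_chain_at[OF this d] show ?thesis using linear_scale[OF has_derivative_linear[OF d]] by(simp add: has_vector_derivative_def o_def ga_def[abs_def])
 qed
 have pw: "piecewise_C1_curve ga" unfolding piecewise_C1_curve_def
 proof (intro conjI cont exI[of _ "{0, 1::real}"] ballI)
  fix c' assume c': "c' : A"
  show "(snd c' \<circ> ga) C1_differentiable_on ({t : {0..1}. ga t : fst c'} - {0, 1})" unfolding C1_differentiable_on_def
  proof (intro exI[of _ "?D c'"] conjI ballI)
   show "continuous_on ({t : {0..1}. ga t : fst c'} - {0, 1}) (?D c')"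
   proof (rule continuous_on_compose2[OF _ cl])
    show "continuous_on (snd c ` (fst c Int fst c')) (%p'. fderiv (snd c' \<circ> param c) (at p') (q - p))" using transition_C1[OF c c'] by simp
   qed (use in_dom in auto)
  qed (use der[OF c'] in auto)
 qed simp
 have vel: "F (ga t) (velocity ga t) <= b * norm (p - q)" if t: "t : {0<..<1}" for t
 proof -
  have t': "t : {0..1}" using t by auto
  have "velocity ga t = tangent_of c (ga t) (q - p)"
  proof
   fix c'
   show "velocity ga t c' = tangent_of c (ga t) (q - p) c'"
   proof (cases "c' : A & ga t : fst c'")
    case True
    hence "vector_derivative (snd c' \<circ> ga) (at t) = ?D c' t" using vector_derivative_at[OF der[OF _ t']] by blast
    moreover have "snd c (ga t) = l t" using lc[OF t'] by(simp add: ga_def)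
    ultimately show ?thesis using True by(simp add: velocity_def tangent_of_def)
   next
    case False
    thus ?thesis unfolding velocity_def tangent_of_def by(simp only: if_False)
   qed
  qed
  hence "F (ga t) (velocity ga t) = N c (l t) (q - p)" by(simp add: ga_def)
  thus ?thesis using b[OF lK[OF t'], of "q - p"] by(simp add: norm_minus_commute)
 qed
 have "finsler_dist (param c p) (param c q) <= (\<integral>\<^sup>+t\<in>{0..1}. ennreal (F (ga t) (velocity ga t)) \<partial>lborel)" unfolding finsler_dist_def
 proof (rule INF_lower, intro CollectI conjI pw)
  show "ga 0 = param c p" "ga 1 = param c q" by(simp_all add: ga_def l_def)
 qed
 also have "... <= (\<integral>\<^sup>+t. ennreal (b * norm (p - q)) * indicator {0..1::real} t \<partial>lborel)"
 proof (rule nn_integral_mono_AE)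
  have "AE t in lborel. t \<notin> {0, 1::real}" by(intro AE_not_in) (auto simp: finite_imp_null_set_lborel)
  thus "AE t in lborel. ennreal (F (ga t) (velocity ga t)) * indicator {0..1} t <=
    ennreal (b * norm (p - q)) * indicator {0..1} t" by eventually_elim (use vel in \<open>auto simp: indicator_def intro!: ennreal_leI\<close>)
 qed
 also have "... = ennreal (b * norm (p - q))" by(subst nn_integral_cmult_indicator) auto
 finally show ?thesis .
qed

end

section \<open>The Hausdorff outer measure and Caratheodory's criterion\<close>

lemma hausdorff_content_antimono: "de <= de' ==> hausdorff_content M \<rho> d de' E <= hausdorff_content M \<rho> d de E"
 unfolding hausdorff_content_def by(rule INF_superset_mono) (auto intro: order_trans)

lemma ediam_ge: "x : S ==> y : S ==> \<rho> x y <= ediam \<rho> S" unfolding ediam_def by(meson SUP_upper2 order_refl SUP_upper)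

lemma ediam_empty [simp]: "ediam \<rho> {} = 0" by(simp add: ediam_def bot_ennreal)

lemma hausdorff_outer_mono: "E <= E' ==> hausdorff_outer M \<rho> d E <= hausdorff_outer M \<rho> d E'"
 unfolding hausdorff_outer_def by(intro SUP_mono') (rule hausdorff_content_mono)

lemma hausdorff_outer_UN:
 fixes B :: "nat => 'm set"
 shows "hausdorff_outer M \<rho> d (\<Union>i. B i) <= (\<Sum>i. hausdorff_outer M \<rho> d (B i))" unfolding hausdorff_outer_def
 by(rule SUP_least, rule order_trans[OF hausdorff_content_UN]) (auto intro!: suminf_le SUP_upper)

lemma hausdorff_outer_empty: "d >= 1 ==> hausdorff_outer M \<rho> d {} = 0"
 unfolding hausdorff_outer_def by(intro antisym SUP_least) (simp_all add: hausdorff_content_empty)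

lemma hausdorff_outer_Un:
 assumes "d >= 1"
 shows "hausdorff_outer M \<rho> d (P Un Q) <= hausdorff_outer M \<rho> d P + hausdorff_outer M \<rho> d Q"
proof -
 let ?B = "%i::nat. if i = 0 then P else if i = 1 then Q else {}"
 have "P Un Q = (\<Union>i. ?B i)" by(auto split: if_splits)
 hence "hausdorff_outer M \<rho> d (P Un Q) <= (\<Sum>i. hausdorff_outer M \<rho> d (?B i))" using hausdorff_outer_UN[of M \<rho> d ?B] by simp
 also have "... = (\<Sum>i\<in>{0,1}. hausdorff_outer M \<rho> d (?B i))" by(rule suminf_finite) (auto simp: hausdorff_outer_empty[OF assms])
 finally show ?thesis by simp
qed

text \<open>Sets on which \<open>\<kappa>\<close> differs by at least \<open>et\<close> are at
  positive distance, since \<open>\<kappa>\<close> is Lipschitz; a set of small diameter then meets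
  at most one of them, so a cover of the union splits into covers of the parts. The Lipschitz
  function takes the place of metric axioms for \<open>\<rho>\<close>.\<close>

lemma hausdorff_outer_separated:
 fixes \<kappa> :: "'m => real"
 assumes d: "d >= 1" and L: "!!x y. ennreal \<bar>\<kappa> x - \<kappa> y\<bar> <= ennreal C * \<rho> x y" and C: "0 < C"
  and sep: "!!x y. x : P ==> y : Q ==> et <= \<kappa> x - \<kappa> y" and et: "0 < et"
 shows "hausdorff_outer M \<rho> d P + hausdorff_outer M \<rho> d Q <= hausdorff_outer M \<rho> d (P Un Q)"
proof -
 \<comment> \<open>On a set of diameter at most \<open>de0\<close> the oscillation of
   \<open>\<kappa>\<close> is at most \<open>et / 2\<close>.\<close>
 define de0 where "de0 = et / (2 * C)"
 let ?w = "%S. ennreal (unit_ball_vol (real d)) * (ediam \<rho> S / 2) ^ d"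
 let ?h = "hausdorff_content M \<rho> d"
 have de0: "0 < de0" using et C by(simp add: de0_def)
 have add: "?h de P + ?h de Q <= ?h de (P Un Q)" if de: "de <= ennreal de0" for de unfolding hausdorff_content_def[of M \<rho> d de "P Un Q"]
 proof (rule INF_greatest, clarify)
  fix S :: "nat => 'm set" assume S: "ALL n. S n <= M & ediam \<rho> (S n) <= de" and cov: "P Un Q <= (\<Union>n. S n)"
  have ex: "~ (S n Int P ~= {} & S n Int Q ~= {})" for n
  proof
   assume "S n Int P ~= {} & S n Int Q ~= {}"
   then obtain x y where x: "x : S n" "x : P" and y: "y : S n" "y : Q" by blast
   have "ennreal et <= ennreal \<bar>\<kappa> x - \<kappa> y\<bar>" using sep[OF x(2) y(2)] by(intro ennreal_leI) auto
   also have "... <= ennreal C * \<rho> x y" by(rule L)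
   also have "... <= ennreal C * ennreal de0" using order_trans[OF ediam_ge[OF x(1) y(1), of \<rho>] order_trans[OF S[rule_format, THEN conjunct2] de]]
    by(intro mult_left_mono) auto
   also have "... = ennreal (et / 2)" using C et by(simp add: ennreal_mult[symmetric] de0_def)
   finally show False using et by(simp add: ennreal_le_iff)
  qed
  define SP SQ where "SP n = (if S n Int P ~= {} then S n else {})" and "SQ n = (if S n Int Q ~= {} then S n else {})" for n
  have "?h de P <= (\<Sum>n. ?w (SP n))" unfolding hausdorff_content_def
  proof (rule INF_lower, intro CollectI conjI allI)
   show "P <= (\<Union>n. SP n)"
   proof
    fix x assume "x : P"
    then obtain n where "x : S n" using cov by blast
    thus "x : (\<Union>n. SP n)" using \<open>x : P\<close> by(intro UN_I[of n]) (auto simp: SP_def)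
   qed
  qed (use S in \<open>auto simp: SP_def\<close>)
  moreover have "?h de Q <= (\<Sum>n. ?w (SQ n))" unfolding hausdorff_content_def
  proof (rule INF_lower, intro CollectI conjI allI)
   show "Q <= (\<Union>n. SQ n)"
   proof
    fix x assume "x : Q"
    then obtain n where "x : S n" using cov by blast
    thus "x : (\<Union>n. SQ n)" using \<open>x : Q\<close> by(intro UN_I[of n]) (auto simp: SQ_def)
   qed
  qed (use S in \<open>auto simp: SQ_def\<close>)
  ultimately have "?h de P + ?h de Q <= (\<Sum>n. ?w (SP n)) + (\<Sum>n. ?w (SQ n))" by(rule add_mono)
  also have "... = (\<Sum>n. ?w (SP n) + ?w (SQ n))" by(rule suminf_add) auto
  also have "... <= (\<Sum>n. ?w (S n))"
  proof (intro suminf_le allI)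
   fix n
   have "0 < d" using d by simp
   thus "?w (SP n) + ?w (SQ n) <= ?w (S n)" using ex[of n] unfolding SP_def SQ_def by(cases "S n Int P = {}"; cases "S n Int Q = {}") (simp_all add: zero_power)
  qed auto
  finally show "?h de P + ?h de Q <= (\<Sum>n. ?w (S n))" .
 qed
 have "?h de1 P + ?h de2 Q <= hausdorff_outer M \<rho> d (P Un Q)" if "de1 : {0<..}" "de2 : {0<..}" for de1 de2
 proof -
  define de where "de = min (min de1 de2) (ennreal de0)"
  have "?h de1 P + ?h de2 Q <= ?h de P + ?h de Q" by(intro add_mono hausdorff_content_antimono) (auto simp: de_def min.coboundedI1 min.coboundedI2)
  also have "... <= ?h de (P Un Q)" by(rule add) (simp add: de_def)
  also have "... <= hausdorff_outer M \<rho> d (P Un Q)" unfolding hausdorff_outer_def using that de0 by(intro SUP_upper) (auto simp: de_def)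
  finally show ?thesis .
 qed
 hence sup1: "(SUP de1\<in>{0<..}. ?h de1 P + ?h de2 Q) <= hausdorff_outer M \<rho> d (P Un Q)" if "de2 : {0<..}" for de2 using that by(intro SUP_least) auto
 have "(1::ennreal) : {0<..}" by simp
 hence ne: "{0<..} ~= ({} :: ennreal set)" by blast
 have "hausdorff_outer M \<rho> d P + ?h de2 Q <= hausdorff_outer M \<rho> d (P Un Q)" if "de2 : {0<..}" for de2
  using sup1[OF that] unfolding ennreal_SUP_add_left[OF ne] hausdorff_outer_def[of M \<rho> d P] .
 hence "(SUP de2\<in>{0<..}. hausdorff_outer M \<rho> d P + ?h de2 Q) <= hausdorff_outer M \<rho> d (P Un Q)" by(intro SUP_least) auto
 thus ?thesis unfolding ennreal_SUP_add_right[OF ne, symmetric] hausdorff_outer_def[of M \<rho> d Q] .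
qed

text \<open>Caratheodory's argument. The set is exhausted by the parts \<open>An n\<close> where
  \<open>\<kappa>\<close> exceeds \<open>a n\<close>; the remainder is a union of thin shells
  \<open>Rn k\<close>, and shells whose indices have equal parity are mutually separated, so that
  their outer measures sum to at most that of \<open>E\<close>. A convergent series has small
  tails.\<close>

lemma hausdorff_superlevel_measurable:
 fixes \<kappa> :: "'m => real"
 assumes d: "d >= 1" and L: "!!x y. ennreal \<bar>\<kappa> x - \<kappa> y\<bar> <= ennreal C * \<rho> x y" and C: "0 < C"
 shows "{x:M. 0 < \<kappa> x} : sets (hausdorff_measure M \<rho> d)"
proof -
 let ?O = "hausdorff_outer M \<rho> d" and ?G = "{x:M. 0 < \<kappa> x}"
 note sepd = hausdorff_outer_separated[where \<kappa>=\<kappa>, OF d L C]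
 have le: "?O (?G Int E) + ?O ((M - ?G) Int E) <= ?O E" if E: "E <= M" for E
 proof (cases "?O E = \<infinity>")
  case False
  define a where "a k = 1 / real (Suc k)" for k
  have a: "0 < a k" "a (Suc k) < a k" for k by(auto simp: a_def field_simps)
  have adec: "a j <= a i" if "i <= j" for i j using that by(auto simp: a_def field_simps)
  define An where "An n = {x:E. a n < \<kappa> x}" for n
  define Rn where "Rn k = {x:E. a (Suc k) < \<kappa> x & \<kappa> x <= a k}" for k
  have part: "?O (An n) + ?O ((M - ?G) Int E) <= ?O E" for n
  proof -
   have "?O (An n) + ?O ((M - ?G) Int E) <= ?O (An n Un (M - ?G) Int E)" using a(1)[of n] by(intro sepd[where et="a n"]) (auto simp: An_def not_less)
   also have "... <= ?O E" by(rule hausdorff_outer_mono) (auto simp: An_def)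
   finally show ?thesis .
  qed
  \<comment> \<open>The indices \<open>2 * i + j\<close> skip every second shell; the gap between
    neighbours is at least the width of the omitted shell.\<close>
  have alt: "(\<Sum>i<n. ?O (Rn (2 * i + j))) <= ?O (\<Union>i<n. Rn (2 * i + j))" for n j
  proof (induction n)
   case (Suc n)
   have "(\<Sum>i<Suc n. ?O (Rn (2 * i + j))) <= ?O (\<Union>i<n. Rn (2 * i + j)) + ?O (Rn (2 * n + j))" using Suc by(simp add: add_right_mono)
   also have "... <= ?O ((\<Union>i<n. Rn (2 * i + j)) Un Rn (2 * n + j))"
   proof (cases "n = 0")
    case True
    thus ?thesis by(simp add: hausdorff_outer_empty[OF d])
   next
    case False
    show ?thesis
    proof (rule sepd)
     fix x y assume "x : (\<Union>i<n. Rn (2 * i + j))" and y: "y : Rn (2 * n + j)"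
     then obtain i where i: "i < n" "x : Rn (2 * i + j)" by blast
     have "a (2 * n + j - 1) <= a (Suc (2 * i + j))" using i(1) by(intro adec) auto
     thus "a (2 * n + j - 1) - a (2 * n + j) <= \<kappa> x - \<kappa> y" using i(2) y by(auto simp: Rn_def)
    next
     show "0 < a (2 * n + j - 1) - a (2 * n + j)" using a(2)[of "2 * n + j - 1"] False by auto
    qed
   qed
   also have "(\<Union>i<n. Rn (2 * i + j)) Un Rn (2 * n + j) = (\<Union>i<Suc n. Rn (2 * i + j))" by(auto simp: lessThan_Suc)
   finally show ?case .
  qed simp
  have half: "(\<Sum>i<n. ?O (Rn (2 * i + j))) <= ?O E" for n j by(rule order_trans[OF alt hausdorff_outer_mono]) (auto simp: Rn_def)
  have "(\<Sum>k<2 * n. ?O (Rn k)) <= ?O E + ?O E" for n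
  proof -
   have "(\<Sum>k<2 * n. ?O (Rn k)) = (\<Sum>i<n. ?O (Rn (2 * i + 0))) + (\<Sum>i<n. ?O (Rn (2 * i + 1)))" by(induction n) (auto simp: algebra_simps)
   thus ?thesis using half[of 0 n] half[of 1 n] by(simp add: add_mono)
  qed
  hence "(\<Sum>k. ?O (Rn k)) <= ?O E + ?O E"
  proof (intro suminf_le_const allI)
   fix n
   assume *: "!!n. (\<Sum>k<2 * n. ?O (Rn k)) <= ?O E + ?O E"
   have "(\<Sum>k<n. ?O (Rn k)) <= (\<Sum>k<2 * n. ?O (Rn k))" by(intro sum_mono2) auto
   thus "(\<Sum>k<n. ?O (Rn k)) <= ?O E + ?O E" using * order_trans by blast
  qed auto
  also have "... < \<infinity>" using False by(simp add: top.not_eq_extremum)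
  finally have fin: "(\<Sum>k. ?O (Rn k)) < \<infinity>" .
  define r where "r k = enn2real (?O (Rn k))" for k
  have r: "?O (Rn k) = ennreal (r k)" "0 <= r k" for k using ennreal_suminf_lessD[OF fin, of k] by(auto simp: r_def)
  have sr: "summable r" by(rule summable_suminf_not_top[OF r(2)]) (use fin[unfolded r(1)] in simp)
  show ?thesis
  proof (rule ennreal_le_epsilon)
   fix e :: real assume e: "0 < e"
   obtain n where n: "norm (\<Sum>i. r (i + n)) < e" using suminf_exist_split[OF e sr] by blast
   have sub: "?G Int E <= An n Un (\<Union>i. Rn (i + n))"
   proof
    fix x assume x: "x : ?G Int E"
    show "x : An n Un (\<Union>i. Rn (i + n))"
    proof (cases "a n < \<kappa> x")
     case True thus ?thesis using x by(auto simp: An_def)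
    next
     case False
     have "EX k. a k < \<kappa> x" using reals_Archimedean[of "\<kappa> x"] x by(auto simp: a_def inverse_eq_divide)
     \<comment> \<open>The first level below \<open>\<kappa> x\<close> locates the shell of
       \<open>x\<close>.\<close>
     define k where "k = (LEAST k. a k < \<kappa> x)"
     have k: "a k < \<kappa> x" unfolding k_def using \<open>EX k. a k < \<kappa> x\<close> by(rule LeastI_ex)
     have "k > n" using k False adec[of k n] by(cases "k <= n") auto
     then obtain j where j: "k = Suc (j + n)" using less_imp_Suc_add[of n k] by(auto simp: add.commute)
     have "~ a (j + n) < \<kappa> x" using not_less_Least[of "j + n" "%k. a k < \<kappa> x"] j by(auto simp: k_def)
     hence "x : Rn (j + n)" using k j x by(auto simp: Rn_def)
     thus ?thesis by blast
    qed
   qed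
   have "?O (?G Int E) <= ?O (An n) + ?O (\<Union>i. Rn (i + n))" by(rule order_trans[OF hausdorff_outer_mono[OF sub] hausdorff_outer_Un[OF d]])
   also have "?O (\<Union>i. Rn (i + n)) <= (\<Sum>i. ?O (Rn (i + n)))" by(rule hausdorff_outer_UN)
   also have "... = ennreal (\<Sum>i. r (i + n))" unfolding r(1) using sr r(2) by(intro suminf_ennreal2) (auto simp: summable_iff_shift)
   also have "... <= ennreal e" using n by(intro ennreal_leI) auto
   finally have "?O (?G Int E) + ?O ((M - ?G) Int E) <= (?O (An n) + ennreal e) + ?O ((M - ?G) Int E)" by(simp add: add_right_mono add_left_mono)
   also have "... = (?O (An n) + ?O ((M - ?G) Int E)) + ennreal e" by(simp add: ac_simps)
   also have "... <= ?O E + ennreal e" by(intro add_right_mono part)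
   finally show "?O (?G Int E) + ?O ((M - ?G) Int E) <= ?O E + ennreal e" .
  qed
 qed simp
 have ge: "?O E <= ?O (?G Int E) + ?O ((M - ?G) Int E)" if "E <= M" for E by(rule order_trans[OF hausdorff_outer_mono hausdorff_outer_Un[OF d]]) (use that in auto)
 show ?thesis unfolding sets_hausdorff_measure[OF d] lambda_system_def using le ge by(auto intro: antisym)
qed

text \<open>Every null set of the outer measure satisfies Caratheodory's condition, so the measure
  is complete. This later puts chart images of Lebesgue null sets, and sets of zero capacity, into
  its sigma-algebra.\<close>

lemma hausdorff_null_sets:
 assumes d: "d >= 1" and "E <= M" "hausdorff_outer M \<rho> d E = 0"
 shows "E : null_sets (hausdorff_measure M \<rho> d)"
proof -
 let ?O = "hausdorff_outer M \<rho> d"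
 have "?O (E Int X) + ?O ((M - E) Int X) = ?O X" if "X <= M" for X
 proof (rule antisym)
  have "?O (E Int X) <= ?O E" by(rule hausdorff_outer_mono) auto
  hence "?O (E Int X) = 0" using assms(3) by simp
  moreover have "?O ((M - E) Int X) <= ?O X" by(rule hausdorff_outer_mono) auto
  ultimately show "?O (E Int X) + ?O ((M - E) Int X) <= ?O X" by simp
  show "?O X <= ?O (E Int X) + ?O ((M - E) Int X)" by(rule order_trans[OF hausdorff_outer_mono hausdorff_outer_Un[OF d]]) (use that in auto)
 qed
 hence "E : sets (hausdorff_measure M \<rho> d)" unfolding sets_hausdorff_measure[OF d] lambda_system_def using assms(2) by auto
 thus ?thesis using emeasure_hausdorff_measure[OF d, of E M \<rho>] assms(3) by(intro null_setsI) auto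
qed

section \<open>Comparison with Lebesgue measure\<close>

lemma max0_square_deriv: "((%t::real. (max 0 t)^2) has_real_derivative 2 * max 0 t) (at t)"
proof -
 consider "t < 0" | "t = 0" | "t > 0" by linarith
 thus ?thesis
 proof cases
  case 1
  have "((%t. 0) has_real_derivative 0) (at t)" by simp
  hence "((%t::real. (max 0 t)^2) has_real_derivative 0) (at t)" by(rule has_field_derivative_transform_within_open[of _ _ _ "{..<0}"]) (use 1 in auto)
  thus ?thesis using 1 by simp
 next
  case 2
  have "((%h::real. (max 0 h)^2 / h) \<longlongrightarrow> 0) (at 0)"
  proof (rule Lim_null_comparison[where g="%h. \<bar>h\<bar>"])
   show "\<forall>\<^sub>F h in at 0. norm ((max 0 h)^2 / h) <= \<bar>h::real\<bar>" by(rule always_eventually) (auto simp: max_def power2_eq_square)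
   show "((%h::real. \<bar>h\<bar>) \<longlongrightarrow> 0) (at 0)" by(auto intro!: tendsto_eq_intros)
  qed
  thus ?thesis using 2 by(simp add: has_field_derivative_iff)
 next
  case 3
  have "((%t. t^2) has_real_derivative 2 * t) (at t)" by(auto intro!: derivative_eq_intros)
  hence "((%t::real. (max 0 t)^2) has_real_derivative 2 * t) (at t)" by(rule has_field_derivative_transform_within_open[of _ _ _ "{0<..}"]) (use 3 in auto)
  thus ?thesis using 3 by simp
 qed
qed

text \<open>A cut-off of class C1, enough for Lipschitz bounds, with an explicit derivative and an
  explicit lower bound on smaller balls.\<close>

definition C1_bump :: "'e::euclidean_space => real => 'e => real" where
 "C1_bump p0 r p = (max 0 (r^2 - (norm (p - p0))^2))^2"

lemma C1_bump_deriv: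
 "(C1_bump p0 r has_derivative (%v. 2 * max 0 (r^2 - (norm (p - p0))^2) * (- 2 * ((p - p0) \<bullet> v)))) (at p)"
proof -
 have "((%p. r^2 - (norm (p - p0))^2) has_derivative (%v. - 2 * ((p - p0) \<bullet> v))) (at p)"
  unfolding power2_norm_eq_inner by(auto intro!: derivative_eq_intros simp: inner_commute)
 from has_derivative_compose[OF this max0_square_deriv[unfolded has_field_derivative_def]]
 show ?thesis by(simp add: C1_bump_def[abs_def])
qed

lemma C1_bump_zero: "0 < r ==> p \<notin> ball p0 r ==> C1_bump p0 r p = 0"
proof -
 assume "0 < r" "p \<notin> ball p0 r"
 hence "r <= norm (p - p0)" by(simp add: dist_norm norm_minus_commute)
 hence "r^2 <= (norm (p - p0))^2" using \<open>0 < r\<close> by(intro power_mono) auto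
 thus ?thesis by(simp add: C1_bump_def)
qed

lemma C1_bump_ge: "0 <= s ==> norm (p - p0) <= s ==> s <= r ==> (r^2 - s^2)^2 <= C1_bump p0 r p" unfolding C1_bump_def
 by(rule power_mono) (auto intro: power_mono simp: le_max_iff_disj)

lemma C1_bump_le: "C1_bump p0 r p <= (r^2)^2" unfolding C1_bump_def by(rule power_mono) auto

context finsler_manifold
begin

abbreviation mu where "mu \<equiv> BH_measure"
abbreviation nrm where "nrm \<equiv> L2_norm mu"
abbreviation L2F where "L2F \<equiv> L2_space mu"
abbreviation outer where "outer \<equiv> hausdorff_outer M finsler_dist DIM('e)"

lemma DIM_ge_1: "DIM('e) >= 1" using DIM_positive[where 'a='e] by linarith

lemma space_BH: "space mu = M" unfolding BH_measure_def by(rule space_hausdorff_measure[OF DIM_ge_1])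

lemma emeasure_BH: "E : sets mu ==> emeasure mu E = outer E" unfolding BH_measure_def by(rule emeasure_hausdorff_measure[OF DIM_ge_1])

lemma null_sets_BH: "E <= M ==> outer E = 0 ==> E : null_sets mu" unfolding BH_measure_def by(rule hausdorff_null_sets[OF DIM_ge_1])

text \<open>The affine factor allows two uses: \<open>b0 = 1\<close>, \<open>w = 0\<close> gives the
  cut-off itself, \<open>b0 = 0\<close> with a basis vector for \<open>w\<close> gives a cut-off
  coordinate function.\<close>

lemma bump_Lipschitz:
 assumes c: "c : A" and r: "0 < r" and cb: "cball p0 r <= coords c"
 obtains C where "0 < C"
  "!!x y. ennreal \<bar>extend0 c (%p. (b0 + p \<bullet> w) * C1_bump p0 r p) x - extend0 c (%p. (b0 + p \<bullet> w) * C1_bump p0 r p) y\<bar>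
    <= ennreal C * finsler_dist x y"
proof -
 define k' where "k' p v = 2 * max 0 (r^2 - (norm (p - p0))^2) * (- 2 * ((p - p0) \<bullet> v))" for p v :: 'e
 define R where "R = \<bar>b0\<bar> + (norm p0 + r) * norm w"
 define B where "B = R * (2 * r^2 * (2 * r)) + norm w * (r^2)^2"
 have R0: "0 <= R" using r by(simp add: R_def)
 have B0: "0 <= B" using r R0 by(simp add: B_def)
 have d: "((%p. (b0 + p \<bullet> w) * C1_bump p0 r p) has_derivative (%v. (b0 + p \<bullet> w) * k' p v + (v \<bullet> w) * C1_bump p0 r p)) (at p)" for p
  unfolding k'_def by(rule has_derivative_mult[OF _ C1_bump_deriv]) (auto intro!: derivative_eq_intros)
 have bd: "\<bar>(b0 + p \<bullet> w) * k' p v + (v \<bullet> w) * C1_bump p0 r p\<bar> <= B * norm v" if p: "p : cball p0 r" for p v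
 proof -
  have pr: "norm (p - p0) <= r" using p by(simp add: dist_norm norm_minus_commute)
  have np: "norm p <= norm p0 + r" using norm_triangle_ineq[of "p - p0" p0] pr by simp
  have "\<bar>b0 + p \<bullet> w\<bar> <= \<bar>b0\<bar> + norm p * norm w" using Cauchy_Schwarz_ineq2[of p w] by linarith
  also have "... <= R" unfolding R_def using np by(intro add_left_mono mult_right_mono) auto
  finally have 1: "\<bar>b0 + p \<bullet> w\<bar> <= R" .
  have "\<bar>(p - p0) \<bullet> v\<bar> <= norm (p - p0) * norm v" by(rule Cauchy_Schwarz_ineq2)
  also have "... <= r * norm v" using pr by(intro mult_right_mono) auto
  finally have "\<bar>- 2 * ((p - p0) \<bullet> v)\<bar> <= 2 * r * norm v" by(simp add: abs_mult)
  moreover have "\<bar>2 * max 0 (r^2 - (norm (p - p0))^2)\<bar> <= 2 * r^2" by auto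
  ultimately have 2: "\<bar>k' p v\<bar> <= 2 * r^2 * (2 * r * norm v)" unfolding k'_def abs_mult[of "2 * max 0 (r^2 - (norm (p - p0))^2)"] by(intro mult_mono) auto
  have "\<bar>(b0 + p \<bullet> w) * k' p v\<bar> <= R * (2 * r^2 * (2 * r * norm v))" unfolding abs_mult using 1 2 R0 by(intro mult_mono) auto
  moreover have "\<bar>(v \<bullet> w) * C1_bump p0 r p\<bar> <= (norm v * norm w) * (r^2)^2" unfolding abs_mult using Cauchy_Schwarz_ineq2[of v w] C1_bump_le[of p0 r p]
   by(intro mult_mono) (auto simp: C1_bump_def)
  ultimately show ?thesis unfolding B_def by(simp add: algebra_simps abs_le_iff)
 qed
 show ?thesis by(rule finsler_dist_Lipschitz[OF c cb d bd B0]) (use C1_bump_zero[OF r] that in auto)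
qed

text \<open>The image of the ball is the positivity set of the Lipschitz cut-off, so Caratheodory's
  criterion applies.\<close>

lemma param_ball_measurable:
 assumes c: "c : A" and r: "0 < r" and cb: "cball p0 r <= coords c"
 shows "param c ` ball p0 r : sets mu"
proof -
 obtain C where C: "0 < C" "!!x y. ennreal \<bar>extend0 c (%p. (1 + p \<bullet> 0) * C1_bump p0 r p) x -
   extend0 c (%p. (1 + p \<bullet> 0) * C1_bump p0 r p) y\<bar> <= ennreal C * finsler_dist x y" by(rule bump_Lipschitz[OF assms, of 1 0]) (rule that)
 have "{x:M. 0 < extend0 c (%p. (1 + p \<bullet> 0) * C1_bump p0 r p) x} : sets mu" unfolding BH_measure_def by(rule hausdorff_superlevel_measurable[OF DIM_ge_1 C(2,1)])
 moreover have "{x:M. 0 < extend0 c (%p. (1 + p \<bullet> 0) * C1_bump p0 r p) x} = param c ` ball p0 r"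
 proof (intro set_eqI)
  fix x
  have bs: "ball p0 r <= coords c" using cb by auto
  have pos: "0 < C1_bump p0 r p \<longleftrightarrow> p : ball p0 r" for p
  proof
   assume "p : ball p0 r"
   hence "norm (p - p0) < r" by(simp add: dist_norm norm_minus_commute)
   hence "(norm (p - p0))^2 < r^2" by(intro power_strict_mono) auto
   thus "0 < C1_bump p0 r p" by(simp add: C1_bump_def)
  qed (use C1_bump_zero[OF r, of p p0] in force)
  show "x : {x:M. 0 < extend0 c (%p. (1 + p \<bullet> 0) * C1_bump p0 r p) x} \<longleftrightarrow> x : param c ` ball p0 r"
   unfolding param_image_iff[OF c bs] using pos[of "snd c x"] chart_subset[OF c] by(auto simp: extend0_def)
 qed
 ultimately show ?thesis by simp
qed

text \<open>Lindelof's theorem writes the open set as a countable union of balls whose closures lie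
  inside it.\<close>

lemma param_open_measurable:
 assumes c: "c : A" and U: "open U" "U <= coords c"
 shows "param c ` U : sets mu"
proof -
 let ?\<B> = "{ball p r | p r. 0 < r & cball p r <= U}"
 have "U <= \<Union>?\<B>"
 proof
  fix p assume "p : U"
  then obtain r where "0 < r" "cball p r <= U" using U(1) open_contains_cball by blast
  hence "ball p r : ?\<B>" "p : ball p r" by auto
  thus "p : \<Union>?\<B>" by blast
 qed
 moreover have "\<Union>?\<B> <= U" using ball_subset_cball by fastforce
 ultimately have "\<Union>?\<B> = U" by blast
 moreover obtain \<D> where \<D>: "\<D> <= ?\<B>" "countable \<D>" "\<Union>\<D> = \<Union>?\<B>" by(rule Lindelof[of ?\<B>]) auto
 ultimately have "U = \<Union>\<D>" by simp
 hence "param c ` U = (\<Union>X\<in>\<D>. param c ` X)" by(simp add: image_Union)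
 moreover have "param c ` X : sets mu" if "X : \<D>" for X
 proof -
  obtain p r where "X = ball p r" "0 < r" "cball p r <= U" using \<D>(1) \<open>X : \<D>\<close> by blast
  thus ?thesis using param_ball_measurable[OF c, of r p] U(2) by auto
 qed
 ultimately show ?thesis using \<D>(2) by auto
qed

lemma chart_domain_measurable: "c : A ==> fst c : sets mu"
proof -
 assume c: "c : A"
 have "x : param c ` coords c \<longleftrightarrow> x : fst c" for x using param_image_iff[OF c order_refl, of x] chart_in_coords[of x c] by blast
 hence "param c ` coords c = fst c" by(rule set_eqI)
 thus ?thesis using param_open_measurable[OF c chart_open[OF c]] by simp
qed

text \<open>The chart, restricted to its domain, is Borel measurable because preimages of open sets
  are images of open sets under \<open>param c\<close>.\<close>

lemma param_borel_measurable:
 assumes c: "c : A" and E: "E : sets borel" "E <= coords c"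
 shows "param c ` E : sets mu"
proof -
 have fc: "fst c Int space mu : sets mu" using chart_domain_measurable[OF c] by auto
 have sp: "space (restrict_space mu (fst c)) = fst c" using chart_subset[OF c] by(auto simp: space_restrict_space space_BH)
 have "snd c : borel_measurable (restrict_space mu (fst c))"
 proof (rule borel_measurableI)
  fix U :: "'e set" assume "open U"
  have "snd c -` U Int fst c = param c ` (U Int coords c)" using param_image_iff[OF c, of "U Int coords c"] chart_in_coords[of _ c] by auto
  moreover have "param c ` (U Int coords c) : sets mu" by(rule param_open_measurable[OF c]) (use \<open>open U\<close> chart_open[OF c] in auto)
  ultimately show "snd c -` U Int space (restrict_space mu (fst c)) : sets (restrict_space mu (fst c))" unfolding sp using sets_restrict_space_iff[OF fc] by auto
 qed
 from measurable_sets[OF this E(1)] have "snd c -` E Int fst c : sets mu" unfolding sp using sets_restrict_space_iff[OF fc] by auto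
 moreover have "snd c -` E Int fst c = param c ` E" using param_image_iff[OF c E(2)] by auto
 ultimately show ?thesis by simp
qed

text \<open>Cut-off coordinate functions and the cut-off itself are Lipschitz for the Finsler
  distance on all of \<open>M\<close>. On the half ball the cut-off \<open>k\<close> is at least a
  positive constant \<open>\<kappa>\<close>, so coordinate differences can be recovered from the
  differences of these functions.\<close>

lemma chart_dist_lower:
 assumes c: "c : A" and r: "0 < r" and cb: "cball p0 r <= coords c"
 obtains K where "0 < K" "!!p q. p : ball p0 (r/2) ==> q : ball p0 (r/2) ==>
  ennreal (norm (p - q)) <= ennreal K * finsler_dist (param c p) (param c q)"
proof -
 \<comment> \<open>The constants depend on \<open>b0\<close> and \<open>w\<close>; choosing them as
   a function \<open>C\<close> of both makes them available for all coordinates at once.\<close>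
 define lip where "lip b0 w C \<longleftrightarrow> 0 < C & (ALL x y. ennreal \<bar>extend0 c (%p. (b0 + p \<bullet> w) * C1_bump p0 r p) x -
   extend0 c (%p. (b0 + p \<bullet> w) * C1_bump p0 r p) y\<bar> <= ennreal C * finsler_dist x y)" for b0 w C
 have "EX C. lip b0 w C" for b0 w unfolding lip_def by(rule bump_Lipschitz[OF assms, of b0 w]) blast
 hence "lip b0 w (SOME C. lip b0 w C)" for b0 w by(rule someI_ex)
 then obtain C where "!!b0 w. lip b0 w (C b0 w)" by(rule that[of "%b0 w. SOME C. lip b0 w C"])
 hence C: "0 < C b0 w" "ennreal \<bar>extend0 c (%p. (b0 + p \<bullet> w) * C1_bump p0 r p) x -
   extend0 c (%p. (b0 + p \<bullet> w) * C1_bump p0 r p) y\<bar> <= ennreal (C b0 w) * finsler_dist x y" for b0 w x y unfolding lip_def by blast+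
 define k where "k = C1_bump p0 r"
 define R where "R = norm p0 + r"
 define \<kappa> where "\<kappa> = (r^2 - (r/2)^2)^2"
 have "(r/2)^2 < r^2" using r by(intro power_strict_mono) auto
 hence \<kappa>: "0 < \<kappa>" by(simp add: \<kappa>_def)
 have R: "0 < R" using r by(simp add: R_def add_nonneg_pos)
 define K where "K = (\<Sum>i\<in>(Basis::'e set). (C 0 i + R * C 1 0) / \<kappa>)"
 have K: "0 < K" unfolding K_def using C(1) R \<kappa> by(intro sum_pos) (auto intro!: divide_pos_pos add_pos_pos)
 have "ennreal (norm (p - q)) <= ennreal K * finsler_dist (param c p) (param c q)"
  if p: "p : ball p0 (r/2)" and q: "q : ball p0 (r/2)" for p q
 proof (cases "finsler_dist (param c p) (param c q) = \<infinity>")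
  case True
  thus ?thesis using K by(simp add: ennreal_mult_eq_top_iff)
 next
  case False
  then obtain \<rho> where \<rho>: "finsler_dist (param c p) (param c q) = ennreal \<rho>" "0 <= \<rho>" by(cases "finsler_dist (param c p) (param c q)") auto
  have pq: "p : coords c" "q : coords c" using p q cb r by(auto simp: subset_iff)
  have ext: "extend0 c h (param c p) = h p" "extend0 c h (param c q) = h q" for h using param_in[OF pq(1)] param_in[OF pq(2)] pq by(simp_all add: extend0_def)
  have L: "\<bar>(b0 + p \<bullet> w) * k p - (b0 + q \<bullet> w) * k q\<bar> <= C b0 w * \<rho>" for b0 w
   using C(2)[of b0 w "param c p" "param c q"] C(1)[of b0 w] \<rho> unfolding ext k_def by(simp add: ennreal_mult[symmetric] ennreal_le_iff less_imp_le)
  have kp: "\<kappa> <= k p" unfolding \<kappa>_def k_def using p r by(intro C1_bump_ge) (auto simp: dist_norm norm_minus_commute)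
  have "\<bar>(p - q) \<bullet> i\<bar> <= (C 0 i + R * C 1 0) / \<kappa> * \<rho>" if i: "i : Basis" for i
  proof -
   have "norm q <= R" using q norm_triangle_ineq[of "q - p0" p0] r by(auto simp: R_def dist_norm norm_minus_commute)
   hence qi: "\<bar>q \<bullet> i\<bar> <= R" using Basis_le_norm[OF i, of q] by simp
   \<comment> \<open>A product rule for differences: the coordinate difference times
     \<open>k p\<close> is a difference of cut-off coordinates plus a multiple of a difference of
     cut-offs.\<close>
   have "(p \<bullet> i - q \<bullet> i) * k p = ((0 + p \<bullet> i) * k p - (0 + q \<bullet> i) * k q) + (q \<bullet> i) * ((1 + q \<bullet> 0) * k q - (1 + p \<bullet> 0) * k p)"
    by(simp add: algebra_simps)
   moreover have "\<bar>(q \<bullet> i) * ((1 + q \<bullet> 0) * k q - (1 + p \<bullet> 0) * k p)\<bar> <= R * (C 1 0 * \<rho>)"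
   proof -
    have "\<bar>(1 + q \<bullet> 0) * k q - (1 + p \<bullet> 0) * k p\<bar> <= C 1 0 * \<rho>" by(subst abs_minus_commute) (rule L)
    thus ?thesis unfolding abs_mult[of "q \<bullet> i"] using R by(intro mult_mono qi) auto
   qed
   ultimately have "\<bar>(p \<bullet> i - q \<bullet> i) * k p\<bar> <= C 0 i * \<rho> + R * (C 1 0 * \<rho>)"
    using L[of 0 i] abs_triangle_ineq[of "(0 + p \<bullet> i) * k p - (0 + q \<bullet> i) * k q"
      "(q \<bullet> i) * ((1 + q \<bullet> 0) * k q - (1 + p \<bullet> 0) * k p)"] by linarith
   moreover have "\<kappa> * \<bar>p \<bullet> i - q \<bullet> i\<bar> <= \<bar>(p \<bullet> i - q \<bullet> i) * k p\<bar>"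
    using kp \<kappa> mult_right_mono[OF kp, of "\<bar>p \<bullet> i - q \<bullet> i\<bar>"] by(simp add: abs_mult mult.commute)
   ultimately have "\<kappa> * \<bar>(p - q) \<bullet> i\<bar> <= (C 0 i + R * C 1 0) * \<rho>" by(simp add: inner_diff_left algebra_simps)
   thus ?thesis using \<kappa> by(simp add: field_simps)
  qed
  hence "norm (p - q) <= K * \<rho>" using norm_le_l1[of "p - q"] sum_mono[of Basis "%i. \<bar>(p - q) \<bullet> i\<bar>" "%i. (C 0 i + R * C 1 0) / \<kappa> * \<rho>"]
   by(auto simp: K_def sum_distrib_right)
  thus ?thesis using \<rho> K by(simp add: ennreal_mult[symmetric] ennreal_leI)
 qed
 with K show ?thesis by(rule that)
qed

text \<open>If a covering set has Finsler diameter D, its part of \<open>E\<close> lies in a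
  Euclidean ball of radius \<open>K1 * D\<close>, whose volume is 2 * K1 to the dimension times the
  weight in the Hausdorff sum; the 2 comes from passing between diameter and radius. The content at
  scale 1 is enough, being at most the outer measure.\<close>

lemma lebesgue_le_outer_ball:
 assumes c: "c : A" and r: "0 < r" and cb: "cball p0 r <= coords c"
 obtains K where "0 < K" "!!E. E <= ball p0 (r/2) ==> outer_measure_of lebesgue E <= ennreal K * outer (param c ` E)"
proof -
 obtain K1 where K1: "0 < K1" "!!p q. p : ball p0 (r/2) ==> q : ball p0 (r/2) ==>
  ennreal (norm (p - q)) <= ennreal K1 * finsler_dist (param c p) (param c q)" by(rule chart_dist_lower[OF assms]) (rule that)
 let ?d = "DIM('e)"
 define K where "K = (2 * K1) ^ ?d"
 have K: "0 < K" using K1 by(simp add: K_def)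
 let ?w = "%S. ennreal (unit_ball_vol (real ?d)) * (ediam finsler_dist S / 2) ^ ?d"
 have "outer_measure_of lebesgue E <= ennreal K * outer (param c ` E)" if E: "E <= ball p0 (r/2)" for E
 proof -
  have cov: "ennreal (1/K) * outer_measure_of lebesgue E <= (\<Sum>n. ?w (S n))"
   if S: "ALL n. S n <= M & ediam finsler_dist (S n) <= 1" and ES: "param c ` E <= (\<Union>n. S n)" for S
  proof -
   define En where "En n = {p:E. param c p : S n}" for n
   define D where "D n = enn2real (ediam finsler_dist (S n))" for n
   \<comment> \<open>The bound 1 on the diameters makes them finite, so that they can serve as
     radii.\<close>
   have D: "ediam finsler_dist (S n) = ennreal (D n)" "0 <= D n" for n
    using le_less_trans[OF S[rule_format, of n, THEN conjunct2] ennreal_one_less_top] by(auto simp: D_def)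
   define B where "B n = (if En n = {} then {} else cball (SOME p. p : En n) (K1 * D n))" for n
   have EB: "En n <= B n" for n
   proof
    fix p assume p: "p : En n"
    define q where "q = (SOME p. p : En n)"
    have q: "q : En n" unfolding q_def using p by(rule someI)
    have "ennreal (norm (q - p)) <= ennreal K1 * finsler_dist (param c q) (param c p)" using p q E by(intro K1) (auto simp: En_def)
    also have "... <= ennreal K1 * ennreal (D n)" using ediam_ge[of "param c q" "S n" "param c p" finsler_dist] p q D by(intro mult_left_mono) (auto simp: En_def)
    finally have "norm (q - p) <= K1 * D n" using K1 D(2)[of n] by(simp add: ennreal_mult[symmetric] ennreal_le_iff)
    thus "p : B n" using p by(auto simp: B_def q_def[symmetric] dist_norm)
   qed
   have Bw: "emeasure lebesgue (B n) <= ennreal K * ?w (S n)" for n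
   proof (cases "En n = {}")
    case False
    have "emeasure lebesgue (B n) = ennreal (unit_ball_vol (real ?d) * (K1 * D n) ^ ?d)" using False K1 D(2)[of n] by(simp add: B_def emeasure_cball)
    also have "unit_ball_vol (real ?d) * (K1 * D n) ^ ?d = K * (unit_ball_vol (real ?d) * (D n / 2) ^ ?d)" by(simp add: K_def power_mult_distrib power_divide)
    also have "ennreal ... = ennreal K * ?w (S n)"
     using K D(2)[of n] by(simp add: D(1) ennreal_mult divide_ennreal ennreal_power ennreal_numeral[symmetric] del: ennreal_numeral)
    finally show ?thesis by simp
   qed (simp add: B_def)
   have Bs: "B n : sets lebesgue" for n by(auto simp: B_def)
   have "E <= (\<Union>n. En n)" using ES by(auto simp: En_def)
   hence EB': "E <= (\<Union>n. B n)" using EB by blast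
   have "outer_measure_of lebesgue E <= emeasure lebesgue (\<Union>n. B n)" unfolding outer_measure_of_def using EB' Bs by(intro INF_lower) auto
   also have "... <= (\<Sum>n. emeasure lebesgue (B n))" using Bs by(intro emeasure_subadditive_countably) auto
   also have "... <= (\<Sum>n. ennreal K * ?w (S n))" using Bw by(intro suminf_le) auto
   also have "... = ennreal K * (\<Sum>n. ?w (S n))" by simp
   finally have "ennreal (1/K) * outer_measure_of lebesgue E <= ennreal (1/K) * (ennreal K * (\<Sum>n. ?w (S n)))" by(rule mult_left_mono) auto
   thus ?thesis using K by(simp add: mult.assoc[symmetric] ennreal_mult[symmetric])
  qed
  have "ennreal (1/K) * outer_measure_of lebesgue E <= hausdorff_content M finsler_dist ?d 1 (param c ` E)"
   unfolding hausdorff_content_def using cov by(intro INF_greatest) blast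
  also have "... <= outer (param c ` E)" unfolding hausdorff_outer_def by(intro SUP_upper) auto
  finally have "ennreal K * (ennreal (1/K) * outer_measure_of lebesgue E) <= ennreal K * outer (param c ` E)" by(rule mult_left_mono) auto
  thus ?thesis using K by(simp add: mult.assoc[symmetric] ennreal_mult[symmetric])
 qed
 with K show ?thesis by(rule that)
qed

text \<open>Compactness: having such a constant passes to finite unions, and balls of half an
  admissible radius cover \<open>C\<close>. The outer Lebesgue measure appears because
  \<open>E\<close> is an arbitrary set.\<close>

lemma lebesgue_le_outer:
 assumes c: "c : A" and C: "compact C" "C <= coords c"
 obtains K where "0 < K" "!!E. E <= C ==> outer_measure_of lebesgue E <= ennreal K * outer (param c ` E)"
proof -
 define good where "good X \<longleftrightarrow> (EX K>0. ALL E<=X. outer_measure_of lebesgue E <= ennreal K * outer (param c ` E))" for X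
 have gU: "good (X Un Y)" if gX: "good X" and gY: "good Y" for X Y
 proof -
  obtain K L where K: "K > 0" "ALL E<=X. outer_measure_of lebesgue E <= ennreal K * outer (param c ` E)"
   and L: "L > 0" "ALL E<=Y. outer_measure_of lebesgue E <= ennreal L * outer (param c ` E)" using gX gY unfolding good_def by blast
  have "outer_measure_of lebesgue E <= ennreal (K + L) * outer (param c ` E)" if "E <= X Un Y" for E
  proof -
   obtain P where P: "P : sets lebesgue" "E Int X <= P" "outer_measure_of lebesgue (E Int X) = emeasure lebesgue P"
    using outer_measure_of_attain[of "E Int X" lebesgue] by auto
   obtain Q where Q: "Q : sets lebesgue" "E Int Y <= Q" "outer_measure_of lebesgue (E Int Y) = emeasure lebesgue Q"
    using outer_measure_of_attain[of "E Int Y" lebesgue] by auto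
   have "E <= P Un Q" using P(2) Q(2) that by blast
   hence "outer_measure_of lebesgue E <= emeasure lebesgue (P Un Q)" unfolding outer_measure_of_def using P(1) Q(1) by(intro INF_lower) auto
   also have "... <= emeasure lebesgue P + emeasure lebesgue Q" using P(1) Q(1) by(rule emeasure_subadditive)
   also have "... <= ennreal K * outer (param c ` (E Int X)) + ennreal L * outer (param c ` (E Int Y))"
    using K(2) L(2) unfolding P(3)[symmetric] Q(3)[symmetric] by(intro add_mono) auto
   also have "... <= ennreal K * outer (param c ` E) + ennreal L * outer (param c ` E)" by(intro add_mono mult_left_mono hausdorff_outer_mono) auto
   also have "... = ennreal (K + L) * outer (param c ` E)" using K(1) L(1) by(simp add: distrib_right)
   finally show ?thesis .
  qed
  thus ?thesis unfolding good_def using K(1) L(1) by(intro exI[of _ "K + L"]) auto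
 qed
 have g0: "good {}" unfolding good_def by(intro exI[of _ 1]) simp
 have gF: "good (\<Union>\<F>)" if "finite \<F>" "!!X. X : \<F> ==> good X" for \<F> using that
 proof (induction \<F> rule: finite_induct)
  case (insert X \<F>)
  thus ?case using gU[of X "\<Union>\<F>"] by simp
 qed (simp add: g0)
 have "EX r>0. cball p r <= coords c" if "p : C" for p using chart_open[OF c] C(2) that open_contains_cball by blast
 then obtain r where r: "!!p. p : C ==> r p > 0 & cball p (r p) <= coords c" by metis
 have "C <= (\<Union>p\<in>C. ball p (r p / 2))" using r by force
 then obtain C' where C': "C' <= C" "finite C'" "C <= (\<Union>p\<in>C'. ball p (r p / 2))" using compactE_image[OF C(1), of C "%p. ball p (r p / 2)"] by blast
 have "good (ball p (r p / 2))" if "p : C" for p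
 proof -
  have rp: "0 < r p" "cball p (r p) <= coords c" using r[OF that] by auto
  show ?thesis unfolding good_def by(rule lebesgue_le_outer_ball[OF c rp]) blast
 qed
 hence "good (\<Union>((%p. ball p (r p / 2)) ` C'))" using C' by(intro gF) auto
 hence "good C" unfolding good_def using C'(3) by(meson order_trans)
 thus ?thesis unfolding good_def using that by blast
qed

end

section \<open>Upper bound by Lebesgue measure, null sets and integrals in charts\<close>

context finsler_manifold
begin

lemma ediam_param_cube:
 assumes c: "c : A" and K: "cbox u v <= coords c" and b: "!!p w. p : cbox u v ==> N c p w <= b * norm w" "0 <= b"
  and s: "!!i. i : Basis ==> v \<bullet> i - u \<bullet> i = s"
 shows "ediam finsler_dist (param c ` cbox u v) <= ennreal (b * (real DIM('e) * s))" unfolding ediam_def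
proof (intro SUP_least; clarify)
 fix p q assume pq: "p : cbox u v" "q : cbox u v"
 have "\<bar>(p - q) \<bullet> i\<bar> <= s" if "i : Basis" for i
 proof -
  have "u \<bullet> i <= p \<bullet> i" "p \<bullet> i <= v \<bullet> i" "u \<bullet> i <= q \<bullet> i" "q \<bullet> i <= v \<bullet> i"
   using pq that unfolding mem_box by blast+
  thus ?thesis using s[OF that] by(simp add: inner_diff_left abs_le_iff)
 qed
 hence "(\<Sum>i\<in>Basis. \<bar>(p - q) \<bullet> i\<bar>) <= real DIM('e) * s" using sum_bounded_above[of Basis "%i. \<bar>(p - q) \<bullet> i\<bar>" s] by simp
 hence "norm (p - q) <= real DIM('e) * s" using norm_le_l1[of "p - q"] by linarith
 hence "b * norm (p - q) <= b * (real DIM('e) * s)" using b(2) by(rule mult_left_mono)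
 thus "finsler_dist (param c p) (param c q) <= ennreal (b * (real DIM('e) * s))"
  using finsler_dist_chart_le[OF c convex_box(1) K b(1) pq] ennreal_leI order_trans by blast
qed

text \<open>An open set \<open>U\<close> of nearly the same measure is chosen around
  \<open>E\<close>, and a gauge yields non-overlapping dyadic cubes inside \<open>U\<close>, of
  small Finsler diameter, that cover \<open>E\<close>. A cube of side s has Finsler diameter at most
  a multiple of s, so its weight is at most \<open>b1\<close> times its volume, and the volumes add
  up to at most that of \<open>U\<close>.\<close>

lemma outer_le_lebesgue:
 assumes c: "c : A" and C: "compact C" "C <= coords c"
 obtains b where "0 < b" "!!E. E <= C ==> E : sets lebesgue ==> outer (param c ` E) <= ennreal b * emeasure lebesgue E"
proof -
 let ?d = "DIM('e)"
 obtain \<epsilon> where \<epsilon>: "0 < \<epsilon>" "(\<Union>x\<in>C. cball x \<epsilon>) <= coords c"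
  by(rule compact_subset_open_imp_cball_epsilon_subset[OF C(1) chart_open[OF c] C(2)]) (rule that)
 \<comment> \<open>Cubes may stick out of \<open>C\<close>; the bound on \<open>N\<close> is taken
   on a compact neighbourhood, written as a sum of sets to have its compactness at hand.\<close>
 define C' where "C' = {x + y | x y. x : C & y : cball 0 \<epsilon>}"
 have C'eq: "C' = (\<Union>x\<in>C. cball x \<epsilon>)"
 proof (intro set_eqI iffI)
  fix z assume "z : C'"
  then obtain x y where "x : C" "norm y <= \<epsilon>" "z = x + y" by(auto simp: C'_def)
  thus "z : (\<Union>x\<in>C. cball x \<epsilon>)" by(intro UN_I[of x]) (auto simp: dist_norm)
 next
  fix z assume "z : (\<Union>x\<in>C. cball x \<epsilon>)"
  then obtain x where "x : C" "dist x z <= \<epsilon>" by auto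
  thus "z : C'" unfolding C'_def by(intro CollectI exI[of _ x] exI[of _ "z - x"]) (auto simp: dist_norm norm_minus_commute)
 qed
 have "compact C'" unfolding C'_def by(rule compact_sums[OF C(1) compact_cball])
 moreover have "C' <= coords c" using \<epsilon>(2) unfolding C'eq .
 ultimately have C': "compact C'" "C' <= coords c" .
 obtain b0 where b0: "0 < b0" "!!p v. p : C' ==> N c p v <= b0 * norm v" by(rule N_bounds[OF c C']) (rule that)
 obtain R where R: "0 < R" "!!x. x : C ==> norm x <= R" using compact_imp_bounded[OF C(1)] by(auto simp: bounded_pos)
 \<comment> \<open>A cube of side s has Finsler diameter at most \<open>b0 * DIM('e) * s\<close>,
   the Euclidean norm being estimated by the sum of the coordinates; \<open>b1\<close> is the
   resulting weight for s = 1.\<close>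
 define b1 where "b1 = unit_ball_vol (real ?d) * (b0 * real ?d / 2) ^ ?d"
 have b1: "0 < b1" unfolding b1_def using b0 DIM_positive[where 'a='e] by(intro mult_pos_pos zero_less_power divide_pos_pos unit_ball_vol_pos) auto
 let ?w = "%S. ennreal (unit_ball_vol (real ?d)) * (ediam finsler_dist S / 2) ^ ?d"
 have "hausdorff_content M finsler_dist ?d de (param c ` E) <= ennreal b1 * (emeasure lebesgue E + ennreal et)"
  if E: "E <= C" "E : sets lebesgue" and de: "0 < de" and et: "0 < et" for E de et
 proof -
  \<comment> \<open>The scale \<open>de\<close> may be infinite; a positive real number below it is
    used instead.\<close>
  obtain de1 where de1: "0 < de1" "ennreal de1 <= de"
  proof (cases de)
   case (real r) thus ?thesis using de that[of r] by auto
  next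
   case top thus ?thesis using that[of 1] by simp
  qed
  define \<rho> where "\<rho> = min \<epsilon> (de1 / (2 * b0))"
  have \<rho>: "0 < \<rho>" "\<rho> <= \<epsilon>" "b0 * (2 * \<rho>) <= de1" using \<epsilon> de1 b0 by(auto simp: \<rho>_def min_def field_simps)
  obtain U where U: "open U" "E <= U" "emeasure lebesgue (U - E) < ennreal et" "U - E : lmeasurable" using sets_lebesgue_outer_open[OF E(2) et] by metis
  \<comment> \<open>The gauge forces each cube into \<open>U\<close> and into a ball of radius
    \<open>\<rho>\<close> around a point of \<open>E\<close>.\<close>
  define g where "g x = (if x : E then ball x \<rho> Int U else ball x \<rho>)" for x
  have g: "gauge g" unfolding gauge_def g_def using \<rho>(1) U(1,2) by auto
  let ?a = "- R *\<^sub>R One :: 'e" and ?b = "R *\<^sub>R One :: 'e"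
  have ab: "?a \<bullet> i = - R" "?b \<bullet> i = R" if "i : Basis" for i using that by simp_all
  have box: "E <= cbox ?a ?b"
  proof
   fix x assume "x : E"
   hence "norm x <= R" using E(1) R(2) by blast
   hence "- R <= x \<bullet> i & x \<bullet> i <= R" if "i : Basis" for i using Basis_le_norm[OF that, of x] by linarith
   thus "x : cbox ?a ?b" unfolding mem_box using ab by simp
  qed
  have ne: "box ?a ?b ~= {}" unfolding box_ne_empty using R(1) ab by auto
  obtain \<D> where \<D>: "countable \<D>" "\<Union>\<D> <= cbox ?a ?b"
   "!!K. K : \<D> ==> interior K ~= {} & (EX c d. K = cbox c d)"
   "pairwise (%A B. interior A Int interior B = {}) \<D>"
   "!!K. K : \<D> ==> EX x : E Int K. K <= g x"
   "!!u v. cbox u v : \<D> ==> EX n. ALL i : Basis. v \<bullet> i - u \<bullet> i = (?b \<bullet> i - ?a \<bullet> i) / 2^n"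
   "E <= \<Union>\<D>" by(rule covering_lemma[OF box ne g]) (rule that)
  have KU: "K <= U" and Kw: "?w (param c ` K) <= ennreal b1 * emeasure lborel (interior K)"
   and Kde: "ediam finsler_dist (param c ` K) <= de" and KC: "K <= coords c" if K: "K : \<D>" for K
  proof -
   obtain x where x: "x : E" "x : K" "K <= g x" using \<D>(5)[OF K] by blast
   obtain u v where uv1: "K = cbox u v" using \<D>(3)[OF K] by blast
   have "box u v ~= {}" using \<D>(3)[OF K] unfolding uv1 interior_cbox by blast
   with uv1 have uv: "K = cbox u v" "box u v ~= {}" .
   obtain n where n: "ALL i : Basis. v \<bullet> i - u \<bullet> i = (?b \<bullet> i - ?a \<bullet> i) / 2^n" using \<D>(6) K uv by blast
   define s where "s = 2 * R / 2 ^ n"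
   have s: "v \<bullet> i - u \<bullet> i = s" if "i : Basis" for i using n that ab[OF that] by(simp add: s_def)
   have s0: "0 < s" using R by(simp add: s_def)
   have Kg: "K <= ball x \<rho>" "K <= U" using x by(auto simp: g_def)
   show "K <= U" by(rule Kg)
   have "ball x \<rho> <= cball x \<epsilon>" using \<rho>(2) by auto
   hence KC': "K <= C'" using Kg(1) x(1) E(1) unfolding C'eq by blast
   thus KC: "K <= coords c" using C'(2) by blast
   have bK: "N c p w <= b0 * norm w" if "p : cbox u v" for p w using b0(2) KC' uv(1) that by blast
   have ed: "ediam finsler_dist (param c ` K) <= ennreal (b0 * (real ?d * s))" unfolding uv(1) by(rule ediam_param_cube[OF c _ bK]) (use KC uv(1) b0(1) s in auto)
   have "finsler_dist (param c p) (param c q) <= de" if pq: "p : K" "q : K" for p q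
   proof -
    have "dist x p < \<rho>" "dist x q < \<rho>" using pq Kg(1) by auto
    hence "norm (p - q) <= 2 * \<rho>" using dist_triangle3[of p q x] by(simp add: dist_norm)
    hence "b0 * norm (p - q) <= b0 * (2 * \<rho>)" using b0(1) by(intro mult_left_mono) auto
    hence "ennreal (b0 * norm (p - q)) <= de" using order_trans[OF ennreal_leI de1(2)] \<rho>(3) by simp
    moreover have "finsler_dist (param c p) (param c q) <= ennreal (b0 * norm (p - q))" by(rule finsler_dist_chart_le[OF c convex_box(1) _ bK]) (use pq KC uv(1) in auto)
    ultimately show ?thesis by simp
   qed
   thus "ediam finsler_dist (param c ` K) <= de" unfolding ediam_def by(intro SUP_least) auto
   have "emeasure lborel (interior K) = ennreal (s ^ ?d)"
   proof -
    have "u \<bullet> i <= v \<bullet> i" if "i : Basis" for i using s[OF that] s0 by simp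
    hence "emeasure lborel (box u v) = ennreal (\<Prod>i\<in>Basis. (v - u) \<bullet> i)" by(subst emeasure_lborel_box) auto
    also have "(\<Prod>i\<in>Basis. (v - u) \<bullet> i) = (\<Prod>i\<in>(Basis::'e set). s)" using s by(intro prod.cong) (auto simp: inner_diff_left)
    finally show ?thesis using uv(1) by simp
   qed
   moreover have "?w (param c ` K) <= ennreal (b1 * s ^ ?d)"
   proof -
    have "?w (param c ` K) <= ennreal (unit_ball_vol (real ?d)) * (ennreal (b0 * (real ?d * s)) / 2) ^ ?d"
     by(intro mult_left_mono power_mono divide_right_mono_ennreal ed) auto
    also have "... = ennreal (unit_ball_vol (real ?d)) * ennreal ((b0 * (real ?d * s) / 2) ^ ?d)"
     using b0 s0 divide_ennreal[of "b0 * (real ?d * s)" 2] by(simp add: ennreal_power)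
    also have "... = ennreal (unit_ball_vol (real ?d) * (b0 * (real ?d * s) / 2) ^ ?d)" using b0 s0 by(simp add: ennreal_mult)
    also have "unit_ball_vol (real ?d) * (b0 * (real ?d * s) / 2) ^ ?d = b1 * s ^ ?d" by(simp add: b1_def power_mult_distrib power_divide)
    finally show ?thesis .
   qed
   ultimately show "?w (param c ` K) <= ennreal b1 * emeasure lborel (interior K)" using b1 s0 by(simp add: ennreal_mult)
  qed
  \<comment> \<open>The family of cubes may be finite, so the covering sequence is padded with empty
    sets, whose weight is 0.\<close>
  define J where "J n = (if n : to_nat_on \<D> ` \<D> then from_nat_into \<D> n else {})" for n
  have J: "J n = {} \<or> J n : \<D>" for n using \<D>(1) by(auto simp: J_def)
  have JU: "EX n. J n = K" if "K : \<D>" for K using that \<D>(1) by(intro exI[of _ "to_nat_on \<D> K"]) (simp add: J_def)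
  have Jdisj: "disjoint_family (%n. interior (J n))" unfolding disjoint_family_on_def
  proof (intro ballI impI)
   fix i j :: nat assume "i ~= j"
   show "interior (J i) Int interior (J j) = {}"
   proof (cases "i : to_nat_on \<D> ` \<D> & j : to_nat_on \<D> ` \<D>")
    case True
    hence "J i : \<D>" "J j : \<D>" "to_nat_on \<D> (J i) = i" "to_nat_on \<D> (J j) = j" using \<D>(1) by(auto simp: J_def)
    hence "J i ~= J j" using \<open>i ~= j\<close> by auto
    thus ?thesis using \<D>(4) \<open>J i : \<D>\<close> \<open>J j : \<D>\<close> unfolding pairwise_def by blast
   next
    case False
    hence "J i = {} \<or> J j = {}" unfolding J_def by presburger
    thus ?thesis by auto
   qed
  qed
  have z: "?w (param c ` {}) = 0" using DIM_positive[where 'a='e] by(simp add: zero_power)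
  have "hausdorff_content M finsler_dist ?d de (param c ` E) <= (\<Sum>n. ?w (param c ` J n))" unfolding hausdorff_content_def
  proof (rule INF_lower, intro CollectI conjI allI)
   fix n
   show "param c ` J n <= M" using J[of n] KC[of "J n"] param_in_M[OF c] by blast
   show "ediam finsler_dist (param c ` J n) <= de" using J[of n] Kde[of "J n"] by auto
   show "param c ` E <= (\<Union>n. param c ` J n)"
   proof
    fix y assume "y : param c ` E"
    then obtain p where p: "p : E" "y = param c p" by blast
    obtain K where K: "K : \<D>" "p : K" using \<D>(7) p(1) by blast
    obtain n where "J n = K" using JU[OF K(1)] by blast
    thus "y : (\<Union>n. param c ` J n)" using K(2) p(2) by blast
   qed
  qed
  also have "... <= (\<Sum>n. ennreal b1 * emeasure lborel (interior (J n)))"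
  proof (intro suminf_le)
   show "?w (param c ` J n) <= ennreal b1 * emeasure lborel (interior (J n))" for n using J[of n] Kw[of "J n"] z by(metis zero_le)
  qed auto
  also have "... = ennreal b1 * (\<Sum>n. emeasure lborel (interior (J n)))" by simp
  also have "(\<Sum>n. emeasure lborel (interior (J n))) = emeasure lborel (\<Union>n. interior (J n))" using Jdisj by(intro suminf_emeasure) auto
  also have "... <= emeasure lborel U"
  proof (rule emeasure_mono)
   have "interior (J n) <= U" for n using J[of n] KU[of "J n"] interior_subset[of "J n"] by auto
   thus "(\<Union>n. interior (J n)) <= U" by blast
  qed (use U(1) in auto)
  also have "emeasure lborel U = emeasure lebesgue U" using U(1) by simp
  also have "... <= emeasure lebesgue E + ennreal et"
  proof -
   have "emeasure lebesgue U = emeasure lebesgue (E Un (U - E))" using U(2) by(simp add: Un_absorb1)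
   also have "... <= emeasure lebesgue E + emeasure lebesgue (U - E)" using E(2) U(4) by(intro emeasure_subadditive) auto
   also have "... <= emeasure lebesgue E + ennreal et" using U(3) by(intro add_left_mono) auto
   finally show ?thesis .
  qed
  finally show ?thesis by(simp add: mult_left_mono)
 qed
 note est = this
 have "outer (param c ` E) <= ennreal b1 * emeasure lebesgue E" if E: "E <= C" "E : sets lebesgue" for E unfolding hausdorff_outer_def
 proof (rule SUP_least)
  fix de :: ennreal assume de: "de : {0<..}"
  show "hausdorff_content M finsler_dist ?d de (param c ` E) <= ennreal b1 * emeasure lebesgue E"
  proof (rule ennreal_le_epsilon)
   fix e :: real assume "0 < e"
   hence "hausdorff_content M finsler_dist ?d de (param c ` E) <= ennreal b1 * (emeasure lebesgue E + ennreal (e / b1))" using E de b1 by(intro est) auto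
   also have "... = ennreal b1 * emeasure lebesgue E + ennreal e" using b1 \<open>0 < e\<close> by(simp add: distrib_left ennreal_mult[symmetric])
   finally show "hausdorff_content M finsler_dist ?d de (param c ` E) <= ennreal b1 * emeasure lebesgue E + ennreal e" .
  qed
 qed
 with b1 show ?thesis by(rule that)
qed

lemma coords_exhaustion:
 assumes "c : A"
 obtains K :: "nat => 'e set" where "!!n. compact (K n)" "!!n. K n <= coords c" "(\<Union>n. K n) = coords c"
 using open_Union_compact_subsets[OF chart_open[OF assms]] that by metis

text \<open>The comparison constant is available on compact sets, hence the exhaustion of the
  coordinate domain.\<close>

lemma param_null:
 assumes c: "c : A" and E: "E <= coords c" "E : null_sets lebesgue"
 shows "param c ` E : null_sets mu"
proof -
 obtain K :: "nat => 'e set" where K: "!!n. compact (K n)" "!!n. K n <= coords c" "(\<Union>n. K n) = coords c" by(rule coords_exhaustion[OF c]) (rule that)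
 have "param c ` (E Int K n) : null_sets mu" for n
 proof (rule null_sets_BH)
  obtain b where b: "!!E. E <= K n ==> E : sets lebesgue ==> outer (param c ` E) <= ennreal b * emeasure lebesgue E" by(rule outer_le_lebesgue[OF c K(1,2)]) (rule that)
  have "E Int K n : null_sets lebesgue" using E(2) K(1)[of n] by(intro null_set_Int2 fmeasurableD[OF lmeasurable_compact])
  thus "outer (param c ` (E Int K n)) = 0" using b[of "E Int K n"] by(auto simp: null_sets_def)
  show "param c ` (E Int K n) <= M" using param_in_M[OF c] E(1) by blast
 qed
 hence "(\<Union>n. param c ` (E Int K n)) : null_sets mu" by(rule null_sets_UN)
 moreover have "(\<Union>n. param c ` (E Int K n)) = param c ` E" using K(3) E(1) by blast
 ultimately show ?thesis by simp
qed

text \<open>A Lebesgue set is a Borel set together with part of a null set; the Borel part is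
  handled by measurability of the chart, the rest by completeness of \<open>mu\<close>.\<close>

lemma param_lebesgue_measurable:
 assumes c: "c : A" and E: "E <= coords c" "E : sets lebesgue"
 shows "param c ` E : sets mu"
proof -
 obtain S P P' where S: "E = S Un P" "P <= P'" "P' : null_sets lborel" "S : sets lborel" using sets_completionE[OF E(2)] by metis
 have "param c ` S : sets mu" using S E(1) by(intro param_borel_measurable[OF c]) auto
 moreover have "P : null_sets lebesgue" using null_sets_completion_subset[OF S(2) null_sets_completionI[OF S(3)]] .
 hence "param c ` P : sets mu" using param_null[OF c, of P] S(1) E(1) by auto
 ultimately show ?thesis unfolding S(1) image_Un by(rule sets.Un)
qed

lemma chart_null_iff:
 assumes c: "c : A" and E: "E <= coords c" "outer (param c ` E) = 0"
 shows "E : null_sets lebesgue"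
proof -
 obtain K :: "nat => 'e set" where K: "!!n. compact (K n)" "!!n. K n <= coords c" "(\<Union>n. K n) = coords c" by(rule coords_exhaustion[OF c]) (rule that)
 have "E Int K n : null_sets lebesgue" for n
 proof -
  obtain L where L: "!!E. E <= K n ==> outer_measure_of lebesgue E <= ennreal L * outer (param c ` E)" by(rule lebesgue_le_outer[OF c K(1,2)]) (rule that)
  have "outer (param c ` (E Int K n)) <= 0" unfolding E(2)[symmetric] by(rule hausdorff_outer_mono) auto
  hence "outer_measure_of lebesgue (E Int K n) <= 0" using L[of "E Int K n"] by auto
  moreover obtain B where "B : sets lebesgue" "E Int K n <= B" "outer_measure_of lebesgue (E Int K n) = emeasure lebesgue B"
   using outer_measure_of_attain[of "E Int K n" lebesgue] by auto
  ultimately have "B : null_sets lebesgue" "E Int K n <= B" by(auto simp: null_sets_def)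
  thus ?thesis using completion.complete2 by blast
 qed
 hence "(\<Union>n. E Int K n) : null_sets lebesgue" by(rule null_sets_UN)
 moreover have "(\<Union>n. E Int K n) = E" using K(3) E(1) by blast
 ultimately show ?thesis by simp
qed

text \<open>The failure set of \<open>P\<close> need not be measurable, so its smallness is
  expressed by the outer measure, which pulls back to a Lebesgue null set.\<close>

lemma AE_chart:
 assumes c: "c : A" and P: "AE x in mu. P x"
 shows "AE p in lebesgue. p : coords c --> P (param c p)"
proof -
 obtain Z where Z: "Z : null_sets mu" "{x:space mu. ~ P x} <= Z" using P by(auto elim!: AE_E intro: null_setsI)
 have "outer Z = 0" using Z(1) emeasure_BH[of Z] by(auto simp: null_sets_def)
 hence "outer {x:M. ~ P x} <= 0" using hausdorff_outer_mono[OF Z(2), of M finsler_dist "DIM('e)"] by(simp add: space_BH)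
 hence o: "outer {x:M. ~ P x} = 0" by simp
 let ?E = "{p:coords c. ~ P (param c p)}"
 have "outer (param c ` ?E) <= outer {x:M. ~ P x}" by(rule hausdorff_outer_mono) (use param_in_M[OF c] in auto)
 hence "outer (param c ` ?E) = 0" using o by simp
 hence "?E : null_sets lebesgue" by(intro chart_null_iff[OF c]) auto
 hence "AE p in lebesgue. p \<notin> ?E" by(rule AE_not_in)
 thus ?thesis by eventually_elim auto
qed

text \<open>The image \<open>\<nu>\<close> of \<open>mu\<close> under the chart lies between two
  multiples of Lebesgue measure on \<open>K\<close>, by the two comparisons of set functions;
  monotonicity of the integral in the measure does the rest.\<close>

lemma chart_nn_integral_bounds:
 assumes c: "c : A" and K: "compact K" "K <= coords c"
 obtains a b where "0 < a" "0 < b"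
  "!!f :: 'm => ennreal. (%p. f (param c p)) : borel_measurable (lebesgue_on K) ==>
    (\<integral>\<^sup>+p. f (param c p) \<partial>lebesgue_on K) <= ennreal a * (\<integral>\<^sup>+x\<in>param c ` K. f x \<partial>mu)"
  "!!f :: 'm => ennreal. (%p. f (param c p)) : borel_measurable (lebesgue_on K) ==>
    (\<integral>\<^sup>+x\<in>param c ` K. f x \<partial>mu) <= ennreal b * (\<integral>\<^sup>+p. f (param c p) \<partial>lebesgue_on K)"
proof -
 obtain a where a: "0 < a" "!!E. E <= K ==> outer_measure_of lebesgue E <= ennreal a * outer (param c ` E)" by(rule lebesgue_le_outer[OF assms]) (rule that)
 obtain b where b: "0 < b" "!!E. E <= K ==> E : sets lebesgue ==> outer (param c ` E) <= ennreal b * emeasure lebesgue E" by(rule outer_le_lebesgue[OF assms]) (rule that)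
 have Kl: "K : sets lebesgue" using K(1) by(simp add: compact_imp_closed lmeasurable_compact fmeasurableD)
 let ?Y = "param c ` K"
 have Y: "?Y : sets mu" by(rule param_lebesgue_measurable[OF c K(2) Kl])
 hence YM: "?Y <= M" using sets.sets_into_space space_BH by blast
 have spY: "space (restrict_space mu ?Y) = ?Y" using YM by(auto simp: space_restrict_space space_BH)
 have setsY: "E : sets (restrict_space mu ?Y) \<longleftrightarrow> E : sets mu & E <= ?Y" for E using sets_restrict_space_iff[of ?Y mu E] Y by auto
 have pre: "snd c -` E Int ?Y = param c ` E" if "E <= K" for E using param_image_iff[OF c K(2)] param_image_iff[OF c, of E] that K(2) by blast
 have setsK: "E : sets (lebesgue_on K) \<longleftrightarrow> E : sets lebesgue & E <= K" for E using sets_restrict_space_iff[of K lebesgue E] Kl by auto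
 have imE: "param c ` E : sets mu" if "E : sets (lebesgue_on K)" for E using that K(2) unfolding setsK by(intro param_lebesgue_measurable[OF c]) auto
 have meas: "snd c : measurable (restrict_space mu ?Y) (lebesgue_on K)"
 proof (rule measurableI)
  show "snd c x : space (lebesgue_on K)" if "x : space (restrict_space mu ?Y)" for x using that param_image_iff[OF c K(2), of x] unfolding spY by simp
  show "snd c -` E Int space (restrict_space mu ?Y) : sets (restrict_space mu ?Y)" if "E : sets (lebesgue_on K)" for E
   using imE[OF that] that pre[of E] unfolding spY setsY setsK by auto
 qed
 define \<nu> where "\<nu> = distr (restrict_space mu ?Y) (lebesgue_on K) (snd c)"
 have s\<nu>: "sets \<nu> = sets (lebesgue_on K)" by(simp add: \<nu>_def)
 have e\<nu>: "emeasure \<nu> E = outer (param c ` E)" if "E : sets (lebesgue_on K)" for E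
 proof -
  have "emeasure \<nu> E = emeasure (restrict_space mu ?Y) (param c ` E)"
   unfolding \<nu>_def using that pre[of E] setsK[of E] by(subst emeasure_distr[OF meas that]) (simp add: spY)
  also have "... = emeasure mu (param c ` E)" using that setsK[of E] Y by(intro emeasure_restrict_space) (simp_all only: sets.Int_space_eq2, blast)
  finally show ?thesis using emeasure_BH[OF imE[OF that]] by simp
 qed
 have eK: "emeasure (lebesgue_on K) E = emeasure lebesgue E" if "E : sets (lebesgue_on K)" for E using that setsK[of E] Kl by(intro emeasure_restrict_space) auto
 have int: "(\<integral>\<^sup>+p. f (param c p) \<partial>\<nu>) = (\<integral>\<^sup>+x\<in>?Y. f x \<partial>mu)"
  if "(%p. f (param c p)) : borel_measurable (lebesgue_on K)" for f :: "'m => ennreal"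
 proof -
  have "(\<integral>\<^sup>+p. f (param c p) \<partial>\<nu>) = (\<integral>\<^sup>+x. f (param c (snd c x)) \<partial>restrict_space mu ?Y)"
   unfolding \<nu>_def by(rule nn_integral_distr[OF meas]) (use that in simp)
  also have "... = (\<integral>\<^sup>+x. f x \<partial>restrict_space mu ?Y)"
   by(rule nn_integral_cong) (use param_image_iff[OF c K(2)] c in \<open>auto simp: spY\<close>)
  also have "... = (\<integral>\<^sup>+x\<in>?Y. f x \<partial>mu)" using Y by(intro nn_integral_restrict_space) auto
  finally show ?thesis .
 qed
 show ?thesis
 proof (rule that[OF a(1) b(1)])
  fix f :: "'m => ennreal" assume f: "(%p. f (param c p)) : borel_measurable (lebesgue_on K)"
  have f\<nu>: "(%p. f (param c p)) : borel_measurable \<nu>" using f s\<nu> by(simp cong: measurable_cong_sets)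
  have "lebesgue_on K <= scale_measure (ennreal a) \<nu>"
  proof (subst le_measure)
   show "ALL E:sets (lebesgue_on K). emeasure (lebesgue_on K) E <= emeasure (scale_measure (ennreal a) \<nu>) E"
   proof
    fix E assume E: "E : sets (lebesgue_on K)"
    have "emeasure (lebesgue_on K) E = outer_measure_of lebesgue E" using eK[OF E] outer_measure_of_eq[of E lebesgue] setsK[of E] E by simp
    also have "... <= ennreal a * outer (param c ` E)" using setsK[of E] E by(intro a(2)) simp
    also have "... = emeasure (scale_measure (ennreal a) \<nu>) E" using e\<nu>[OF E] by simp
    finally show "emeasure (lebesgue_on K) E <= emeasure (scale_measure (ennreal a) \<nu>) E" .
   qed
  qed (simp add: s\<nu>)
  hence "(\<integral>\<^sup>+p. f (param c p) \<partial>lebesgue_on K) <= (\<integral>\<^sup>+p. f (param c p) \<partial>scale_measure (ennreal a) \<nu>)"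
   by(intro nn_integral_mono_measure) (simp_all add: s\<nu>)
  thus "(\<integral>\<^sup>+p. f (param c p) \<partial>lebesgue_on K) <= ennreal a * (\<integral>\<^sup>+x\<in>?Y. f x \<partial>mu)"
   using nn_integral_scale_measure[OF f\<nu>] int[OF f] by simp
  have "\<nu> <= scale_measure (ennreal b) (lebesgue_on K)"
  proof (subst le_measure)
   show "ALL E:sets \<nu>. emeasure \<nu> E <= emeasure (scale_measure (ennreal b) (lebesgue_on K)) E" unfolding s\<nu>
   proof
    fix E assume E: "E : sets (lebesgue_on K)"
    have "emeasure \<nu> E <= ennreal b * emeasure lebesgue E" unfolding e\<nu>[OF E] using setsK[of E] E by(intro b(2)) simp_all
    also have "... = emeasure (scale_measure (ennreal b) (lebesgue_on K)) E" unfolding emeasure_scale_measure eK[OF E] ..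
    finally show "emeasure \<nu> E <= emeasure (scale_measure (ennreal b) (lebesgue_on K)) E" .
   qed
  qed (simp add: s\<nu>)
  hence "(\<integral>\<^sup>+p. f (param c p) \<partial>\<nu>) <= (\<integral>\<^sup>+p. f (param c p) \<partial>scale_measure (ennreal b) (lebesgue_on K))"
   by(intro nn_integral_mono_measure) (simp_all add: s\<nu>)
  thus "(\<integral>\<^sup>+x\<in>?Y. f x \<partial>mu) <= ennreal b * (\<integral>\<^sup>+p. f (param c p) \<partial>lebesgue_on K)"
   using nn_integral_scale_measure[OF f] int[OF f] by simp
 qed
qed

end

section \<open>Compact manifolds and their finite covers by coordinate boxes\<close>

locale compact_finsler = finsler_manifold T A F
 for T :: "'m topology" and A :: "('m, 'e::euclidean_space) chart set" and F +
 assumes compact: "compact_space T"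
begin

definition is_pieces :: "(('m, 'e) chart \<times> 'e \<times> 'e) set => bool" where
 "is_pieces P \<longleftrightarrow> finite P & (ALL (c, a, b):P. c : A & cbox a b <= coords c) & M <= (\<Union>(c, a, b)\<in>P. param c ` cbox a b)"

text \<open>One finite cover by closed coordinate boxes, fixed by choice so that all constants and
  the form \<open>ref_energy\<close> refer to the same boxes. Overlaps are allowed and cost only
  constants.\<close>

definition pieces :: "(('m, 'e) chart \<times> 'e \<times> 'e) set" where
 "pieces = (SOME P. is_pieces P)"

lemma is_pieces_pieces: "is_pieces pieces"
proof -
 let ?Q = "{(c, a, b). c : A & cbox a b <= coords c}"
 let ?O = "%(c, a, b). param c ` box a b"
 have op: "openin T (?O q)" if "q : ?Q" for q using that box_subset_cbox by(auto intro!: openin_param_image)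
 have cov: "M <= \<Union>(?O ` ?Q)"
 proof
  fix x assume "x : M"
  then obtain c where c: "c : A" "x : fst c" using ex_chart by blast
  obtain a b where ab: "snd c x : box a b" "cbox a b <= coords c" by(rule open_contains_cbox[OF chart_open[OF c(1)] chart_in_coords[OF c(2)]]) (rule that)
  have "x : param c ` box a b" using ab(1) c by(intro image_eqI[of _ _ "snd c x"]) simp_all
  thus "x : \<Union>(?O ` ?Q)" using c(1) ab(2) by(intro UN_I[of "(c, a, b)"]) simp_all
 qed
 have cM: "compactin T M" using compact by(simp add: compact_space_def)
 have "EX \<F>. finite \<F> & \<F> <= ?O ` ?Q & M <= \<Union>\<F>" by(rule compactinD[OF cM _ cov]) (use op in blast)
 then obtain \<F> where \<F>: "finite \<F>" "\<F> <= ?O ` ?Q" "M <= \<Union>\<F>" by(elim exE conjE)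
 obtain P where P: "P <= ?Q" "finite P" "\<F> = ?O ` P" using finite_subset_image[OF \<F>(1,2)] by blast
 have "is_pieces P" unfolding is_pieces_def
 proof (intro conjI)
  show "M <= (\<Union>(c, a, b)\<in>P. param c ` cbox a b)"
  proof
   fix x assume "x : M"
   then obtain q where "q : P" "x : ?O q" using \<F>(3) P(3) by blast
   moreover obtain c a b where "q = (c, a, b)" by(cases q)
   ultimately show "x : (\<Union>(c, a, b)\<in>P. param c ` cbox a b)" using box_subset_cbox[of a b] by(intro UN_I[of q]) auto
  qed
 qed (use P in auto)
 thus ?thesis unfolding pieces_def by(rule someI)
qed

lemma finite_pieces: "finite pieces" using is_pieces_pieces by(simp add: is_pieces_def)

lemma pieces_chart: "(c, a, b) : pieces ==> c : A" and pieces_cbox: "(c, a, b) : pieces ==> cbox a b <= coords c" using is_pieces_pieces by(auto simp: is_pieces_def)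

lemma pieces_cover: "x : M ==> EX c a b. (c, a, b) : pieces & x : fst c & snd c x : cbox a b"
proof -
 assume "x : M"
 then obtain q where q: "q : pieces" "x : (%(c, a, b). param c ` cbox a b) q" using is_pieces_pieces unfolding is_pieces_def by blast
 obtain c a b where "q = (c, a, b)" by(cases q)
 hence "(c, a, b) : pieces" "x : param c ` cbox a b" using q by simp_all
 thus ?thesis using param_image_iff[OF pieces_chart[of c a b] pieces_cbox[of c a b], of x] by blast
qed

lemma M_eq_pieces: "M = (\<Union>(c, a, b)\<in>pieces. param c ` cbox a b)"
proof
 show "M <= (\<Union>(c, a, b)\<in>pieces. param c ` cbox a b)" using is_pieces_pieces by(simp add: is_pieces_def)
 show "(\<Union>(c, a, b)\<in>pieces. param c ` cbox a b) <= M"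
 proof clarify
  fix c a b p assume "(c, a, b) : pieces" "p : cbox a b"
  thus "param c p : M" using pieces_chart pieces_cbox param_in_M by blast
 qed
qed

lemma openin_measurable: "openin T G ==> G : sets mu"
proof -
 assume G: "openin T G"
 have "G = (\<Union>(c, a, b)\<in>pieces. param c ` snd c ` (G Int fst c))"
 proof (intro set_eqI iffI)
  fix x assume x: "x : G"
  hence "x : M" using openin_subset[OF G] by blast
  then obtain c a b where q: "(c, a, b) : pieces" "x : fst c" using pieces_cover by blast
  have "x : param c ` snd c ` (G Int fst c)" using x q pieces_chart[OF q(1)] by(intro image_eqI[of x _ "snd c x"]) auto
  thus "x : (\<Union>(c, a, b)\<in>pieces. param c ` snd c ` (G Int fst c))" using q(1) by blast
 next
  fix x assume "x : (\<Union>(c, a, b)\<in>pieces. param c ` snd c ` (G Int fst c))"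
  then obtain c a b y where "(c, a, b) : pieces" "y : G" "y : fst c" "x = param c (snd c y)" by auto
  thus "x : G" using pieces_chart[of c a b] by simp
 qed
 moreover have "(%(c, a, b). param c ` snd c ` (G Int fst c)) q : sets mu" if "q : pieces" for q
 proof -
  obtain c a b where q: "q = (c, a, b)" by(cases q)
  hence "(c, a, b) : pieces" using \<open>q : pieces\<close> by simp
  hence c: "c : A" by(rule pieces_chart)
  have "param c ` snd c ` (G Int fst c) : sets mu" by(rule param_open_measurable[OF c open_chart_image[OF c G]]) (auto simp: coords_def)
  thus ?thesis unfolding q by simp
 qed
 hence "(\<Union>(c, a, b)\<in>pieces. param c ` snd c ` (G Int fst c)) : sets mu" by(rule sets.finite_UN[OF finite_pieces])
 ultimately show ?thesis by simp
qed

lemma emeasure_BH_finite: "emeasure mu M < \<infinity>"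
proof -
 have "emeasure mu (param c ` cbox a b) < \<infinity> & param c ` cbox a b : sets mu" if q: "(c, a, b) : pieces" for c a b
 proof -
  note c = pieces_chart[OF q] and K = pieces_cbox[OF q]
  obtain b' where b': "!!E. E <= cbox a b ==> E : sets lebesgue ==> outer (param c ` E) <= ennreal b' * emeasure lebesgue E"
   by(rule outer_le_lebesgue[OF c compact_cbox K]) (rule that)
  have s: "param c ` cbox a b : sets mu" by(rule param_lebesgue_measurable[OF c K]) simp
  have "emeasure mu (param c ` cbox a b) <= ennreal b' * emeasure lebesgue (cbox a b)" using b'[of "cbox a b"] emeasure_BH[OF s] by simp
  also have "... < \<infinity>" using emeasure_lborel_cbox_finite[of a b] by(simp add: ennreal_mult_less_top)
  finally show ?thesis using s by simp
 qed
 hence *: "emeasure mu ((%(c, a, b). param c ` cbox a b) q) < \<infinity> & (%(c, a, b). param c ` cbox a b) q : sets mu" if "q : pieces" for q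
  using that by(cases q) auto
 have "emeasure mu M <= (\<Sum>q\<in>pieces. emeasure mu ((%(c, a, b). param c ` cbox a b) q))"
  by(subst M_eq_pieces, rule emeasure_subadditive_finite) (use finite_pieces * in auto)
 also have "... < \<infinity>" using * finite_pieces by(simp add: ennreal_sum_less_top)
 finally show ?thesis .
qed

lemma finite_measure_BH: "finite_measure mu" using emeasure_BH_finite by(intro finite_measureI) (simp add: space_BH)

text \<open>Measurability of the coordinate expressions for Lebesgue measure. Weak differentials
  provide this form, integrals in charts require it, and it implies measurability for
  \<open>mu\<close>.\<close>

definition chart_measurable :: "('m => 'b::topological_space) => bool" where
 "chart_measurable f \<longleftrightarrow> (ALL c:A. (%p. f (param c p)) : borel_measurable (lebesgue_on (coords c)))"

lemma chart_measurableD: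
 "chart_measurable f ==> c : A ==> (%p. f (param c p)) : borel_measurable (lebesgue_on (coords c))" by(simp add: chart_measurable_def)

lemma chart_measurable_on:
 assumes "chart_measurable f" "c : A" "K <= coords c"
 shows "(%p. f (param c p)) : borel_measurable (lebesgue_on K)" using measurable_restrict_mono[OF chart_measurableD[OF assms(1,2)] assms(3)] .

lemma coords_lebesgue: "c : A ==> coords c : sets lebesgue" using chart_open by auto

lemma chart_measurable_BH:
 fixes f :: "'m => 'b::topological_space"
 assumes f: "chart_measurable f"
 shows "f : borel_measurable mu"
proof (rule borel_measurableI)
 fix U :: "'b set" assume U: "open U"
 let ?E = "%c. (%p. f (param c p)) -` U Int coords c"
 have E: "param c ` (?E c) : sets mu" if c: "c : A" for c
 proof (rule param_lebesgue_measurable[OF c])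
  have "(%p. f (param c p)) -` U Int space (lebesgue_on (coords c)) : sets (lebesgue_on (coords c))" using measurable_sets[OF chart_measurableD[OF f c]] U by auto
  thus "?E c : sets lebesgue" using sets_restrict_space_iff[of "coords c" lebesgue] coords_lebesgue[OF c] by simp
 qed auto
 have "f -` U Int space mu = (\<Union>c\<in>fst ` pieces. param c ` (?E c))"
 proof (intro set_eqI iffI)
  fix x assume x: "x : f -` U Int space mu"
  hence "x : M" by(simp add: space_BH)
  then obtain c a b where q: "(c, a, b) : pieces" "x : fst c" using pieces_cover by blast
  have "x : param c ` (?E c)" using x q pieces_chart[OF q(1)] chart_in_coords[OF q(2)] by(intro image_eqI[of x _ "snd c x"]) auto
  moreover have "c : fst ` pieces" using q(1) by force
  ultimately show "x : (\<Union>c\<in>fst ` pieces. param c ` (?E c))" by blast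
 next
  fix x assume "x : (\<Union>c\<in>fst ` pieces. param c ` (?E c))"
  then obtain c where c: "c : fst ` pieces" "x : param c ` (?E c)" by blast
  then obtain p where "p : coords c" "f (param c p) : U" "x = param c p" by blast
  moreover have "c : A" using c(1) pieces_chart by auto
  ultimately show "x : f -` U Int space mu" using param_in_M[of c p] by(simp add: space_BH)
 qed
 moreover have "(\<Union>c\<in>fst ` pieces. param c ` (?E c)) : sets mu" using finite_pieces pieces_chart by(intro sets.finite_UN E) auto
 ultimately show "f -` U Int space mu : sets mu" by simp
qed

text \<open>Converse direction to \<open>AE_chart\<close>: chart images of Lebesgue null sets are
  null, and finitely many boxes cover \<open>M\<close>.\<close>

lemma AE_from_pieces:
 assumes "!!c a b. (c, a, b) : pieces ==> AE p in lebesgue. p : cbox a b --> P (param c p)"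
 shows "AE x in mu. P x"
proof -
 define E :: "('m, 'e) chart \<times> 'e \<times> 'e => 'm set"
  where "E = (%(c, a, b). param c ` {p:cbox a b. ~ P (param c p)})"
 have "E q : null_sets mu" if q: "q : pieces" for q
 proof -
  obtain c a b where qq: "q = (c, a, b)" by(cases q)
  hence q': "(c, a, b) : pieces" using q by simp
  obtain Z where Z: "{p:space lebesgue. ~ (p : cbox a b --> P (param c p))} <= Z" "emeasure lebesgue Z = 0" "Z : sets lebesgue" using AE_E[OF assms[OF q']] by blast
  have ZN: "Z : null_sets lebesgue" using Z(2,3) by(rule null_setsI)
  have "{p:cbox a b. ~ P (param c p)} <= Z" using Z(1) by auto
  hence "{p:cbox a b. ~ P (param c p)} : null_sets lebesgue" using ZN null_sets_completion_subset by blast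
  moreover have "{p:cbox a b. ~ P (param c p)} <= coords c" using pieces_cbox[OF q'] by blast
  ultimately show ?thesis unfolding E_def qq using param_null[OF pieces_chart[OF q']] by simp
 qed
 hence "(\<Union>q\<in>pieces. E q) : null_sets mu" using finite_pieces by(intro null_sets_UN') (auto intro: countable_finite)
 hence ae: "AE x in mu. x \<notin> (\<Union>q\<in>pieces. E q)" by(rule AE_not_in)
 have imp: "x \<notin> (\<Union>q\<in>pieces. E q) ==> P x" if "x : M" for x
 proof -
  assume nx: "x \<notin> (\<Union>q\<in>pieces. E q)"
  obtain c a b where q: "(c, a, b) : pieces" "x : fst c" "snd c x : cbox a b" using pieces_cover[OF \<open>x : M\<close>] by blast
  have "x \<notin> E (c, a, b)" using nx q(1) by blast
  hence "x \<notin> param c ` {p:cbox a b. ~ P (param c p)}" unfolding E_def by simp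
  moreover have "x = param c (snd c x)" using pieces_chart[OF q(1)] q(2) by simp
  ultimately show "P x" using q(3) by(metis (mono_tags, lifting) image_eqI mem_Collect_eq)
 qed
 have "AE x in mu. x \<notin> (\<Union>q\<in>pieces. E q) --> P x" by(rule AE_I2, unfold space_BH) (blast intro: imp)
 with ae show ?thesis by(rule AE_mp)
qed

text \<open>Overlaps of the boxes are counted several times, hence an inequality; one constant
  dominates those of all boxes.\<close>

lemma nn_integral_le_pieces:
 obtains b where "0 < b" "!!f :: 'm => ennreal. chart_measurable f ==>
  (\<integral>\<^sup>+x. f x \<partial>mu) <= ennreal b * (\<Sum>(c, a, b)\<in>pieces. \<integral>\<^sup>+p. f (param c p) \<partial>lebesgue_on (cbox a b))"
proof -
 define good where "good q B \<longleftrightarrow> 0 < B & (ALL f :: 'm => ennreal. chart_measurable f -->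
   (\<integral>\<^sup>+x\<in>param (fst q) ` cbox (fst (snd q)) (snd (snd q)). f x \<partial>mu) <=
    ennreal B * (\<integral>\<^sup>+p. f (param (fst q) p) \<partial>lebesgue_on (cbox (fst (snd q)) (snd (snd q)))))"
  for q :: "('m, 'e) chart \<times> 'e \<times> 'e" and B
 have ex: "EX B. good q B" if "q : pieces" for q
 proof -
  obtain c a b where qq: "q = (c, a, b)" by(cases q)
  hence q': "(c, a, b) : pieces" using that by simp
  note c = pieces_chart[OF q'] and K = pieces_cbox[OF q']
  show ?thesis unfolding qq good_def by(rule chart_nn_integral_bounds[OF c compact_cbox K]) (use chart_measurable_on[OF _ c K] in auto)
 qed
 obtain B where "ALL q:pieces. good q (B q)" using bchoice[of pieces good] ex by blast
 hence B: "0 < B q" "!!f. chart_measurable f ==>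
   (\<integral>\<^sup>+x\<in>param (fst q) ` cbox (fst (snd q)) (snd (snd q)). f x \<partial>mu) <=
    ennreal (B q) * (\<integral>\<^sup>+p. f (param (fst q) p) \<partial>lebesgue_on (cbox (fst (snd q)) (snd (snd q))))" if "q : pieces" for q
  using that unfolding good_def by blast+
 define b where "b = 1 + (\<Sum>q\<in>pieces. B q)"
 have b: "0 < b" "B q <= b" if "q : pieces" for q using B(1) sum_nonneg[of pieces B] member_le_sum[OF that, of B] finite_pieces by(auto simp: b_def less_imp_le)
 have b0: "0 < b" using sum_nonneg[of pieces B] B(1) by(auto simp: b_def less_imp_le)
 have "(\<integral>\<^sup>+x. f x \<partial>mu) <= ennreal b * (\<Sum>(c, a, b)\<in>pieces. \<integral>\<^sup>+p. f (param c p) \<partial>lebesgue_on (cbox a b))"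
  if f: "chart_measurable f" for f :: "'m => ennreal"
 proof -
  let ?Y = "%q. param (fst q) ` cbox (fst (snd q)) (snd (snd q))"
  have Y: "?Y q : sets mu" if "q : pieces" for q using that pieces_chart[of "fst q" "fst (snd q)" "snd (snd q)"] pieces_cbox[of "fst q" "fst (snd q)" "snd (snd q)"]
   by(intro param_lebesgue_measurable) auto
  have fm: "f : borel_measurable mu" by(rule chart_measurable_BH[OF f])
  have "(\<integral>\<^sup>+x. f x \<partial>mu) <= (\<integral>\<^sup>+x. (\<Sum>q\<in>pieces. f x * indicator (?Y q) x) \<partial>mu)"
  proof (rule nn_integral_mono)
   fix x assume "x : space mu"
   hence "x : M" by(simp add: space_BH)
   then obtain c a b where q: "(c, a, b) : pieces" "x : fst c" "snd c x : cbox a b" using pieces_cover by blast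
   have "x : param c ` cbox a b" using param_image_iff[OF pieces_chart[OF q(1)] pieces_cbox[OF q(1)], of x] q by simp
   hence "f x = f x * indicator (?Y (c, a, b)) x" by simp
   also have "... <= (\<Sum>q\<in>pieces. f x * indicator (?Y q) x)" by(rule member_le_sum[OF q(1)]) (use finite_pieces in auto)
   finally show "f x <= (\<Sum>q\<in>pieces. f x * indicator (?Y q) x)" .
  qed
  also have "... = (\<Sum>q\<in>pieces. \<integral>\<^sup>+x\<in>?Y q. f x \<partial>mu)" using fm Y by(intro nn_integral_sum) auto
  also have "... <= (\<Sum>q\<in>pieces. ennreal b * (\<integral>\<^sup>+p. f (param (fst q) p) \<partial>lebesgue_on (cbox (fst (snd q)) (snd (snd q)))))"
  proof (rule sum_mono)
   fix q assume q: "q : pieces"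
   show "(\<integral>\<^sup>+x\<in>?Y q. f x \<partial>mu) <= ennreal b * (\<integral>\<^sup>+p. f (param (fst q) p) \<partial>lebesgue_on (cbox (fst (snd q)) (snd (snd q))))"
    by(rule order_trans[OF B(2)[OF q f]]) (use b(2)[OF q] in \<open>auto intro!: mult_right_mono ennreal_leI\<close>)
  qed
  finally show ?thesis by(simp add: sum_distrib_left case_prod_unfold)
 qed
 with b0 show ?thesis by(rule that)
qed

end

section \<open>Weak differentials\<close>

definition locally_integrable :: "'e::euclidean_space set => ('e => real) => bool" where
 "locally_integrable V g \<longleftrightarrow> (ALL C. compact C & C <= V --> set_integrable lebesgue C g)"

lemma locally_integrable_measurable:
 assumes V: "open V" and g: "locally_integrable V g"
 shows "g : borel_measurable (lebesgue_on V)"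
proof (rule borel_measurableI)
 fix U :: "real set" assume U: "open U"
 obtain K :: "nat => 'a set" where K: "!!n. compact (K n)" "!!n. K n <= V" "(\<Union>n. K n) = V" using open_Union_compact_subsets[OF V] by metis
 have "g -` U Int K n : sets lebesgue" for n
 proof -
  have "(%x. indicator (K n) x *\<^sub>R g x) : borel_measurable lebesgue" using g K(1,2) unfolding locally_integrable_def set_integrable_def by blast
  from measurable_sets[OF this, of U] U have "(%x. indicator (K n) x *\<^sub>R g x) -` U : sets lebesgue" by simp
  moreover have "K n : sets lebesgue" using K(1) by(intro fmeasurableD lmeasurable_compact)
  ultimately have "(%x. indicator (K n) x *\<^sub>R g x) -` U Int K n : sets lebesgue" by(rule sets.Int)
  moreover have "(%x. indicator (K n) x *\<^sub>R g x) -` U Int K n = g -` U Int K n" by auto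
  ultimately show ?thesis by simp
 qed
 hence "(\<Union>n. g -` U Int K n) : sets lebesgue" by(intro sets.countable_UN) auto
 moreover have "(\<Union>n. g -` U Int K n) = g -` U Int V" using K(3) by blast
 moreover have "V : sets lebesgue" using V by auto
 ultimately show "g -` U Int space (lebesgue_on V) : sets (lebesgue_on V)" using sets_restrict_space_iff[of V lebesgue "g -` U Int V"] by simp
qed

lemma locally_integrable_bound:
 assumes V: "open V" and h: "h : borel_measurable (lebesgue_on V)" and g: "locally_integrable V g"
  and le: "AE p in lebesgue. p : V --> \<bar>h p\<bar> <= B * \<bar>g p\<bar>"
 shows "locally_integrable V h" unfolding locally_integrable_def
proof (intro allI impI, elim conjE)
 fix C assume C: "compact C" "C <= V"
 have Cl: "C : sets lebesgue" using C(1) by(intro fmeasurableD lmeasurable_compact)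
 have gi: "integrable lebesgue (%x. indicator C x *\<^sub>R g x)" using g C unfolding locally_integrable_def set_integrable_def by blast
 have "h : borel_measurable (lebesgue_on C)" using measurable_restrict_mono[OF h C(2)] .
 hence hm: "(%x. indicator C x *\<^sub>R h x) : borel_measurable lebesgue" using Cl by(subst (asm) borel_measurable_restrict_space_iff) auto
 show "set_integrable lebesgue C h" unfolding set_integrable_def
 proof (rule Bochner_Integration.integrable_bound[OF integrable_mult_right[OF gi, of B] hm])
  show "AE x in lebesgue. norm (indicator C x *\<^sub>R h x) <= norm (B * (indicator C x *\<^sub>R g x))" using le
  proof eventually_elim
   case (elim x)
   show ?case
   proof (cases "x : C")
    case True
    hence "\<bar>h x\<bar> <= B * \<bar>g x\<bar>" using elim C(2) by blast
    also have "... <= \<bar>B * g x\<bar>" by(simp add: abs_mult mult_right_mono)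
    finally show ?thesis using True by simp
   qed simp
  qed
 qed
qed

lemma locally_integrable_add:
 assumes "locally_integrable V g" "locally_integrable V h"
 shows "locally_integrable V (%p. a * g p + b * h p)" using assms unfolding locally_integrable_def by(auto intro!: set_integral_add set_integrable_mult_right)

lemma locally_integrable_continuous:
 assumes "continuous_on V g"
 shows "locally_integrable V g" unfolding locally_integrable_def
proof (intro allI impI, elim conjE)
 fix C assume C: "compact C" "C <= V"
 have i: "integrable lborel (%x. indicator C x *\<^sub>R g x)" using C continuous_on_subset[OF assms] by(intro borel_integrable_compact) auto
 thus "set_integrable lebesgue C g" unfolding set_integrable_def using integrable_completion[OF borel_measurable_integrable[OF i]] by blast
qed

lemma locally_integrable_times_test:
 assumes V: "open V" and g: "locally_integrable V g" and h: "continuous_on UNIV h"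
  and K: "compact K" "K <= V" "!!p. p \<notin> K ==> h p = 0"
 shows "set_integrable lebesgue V (%p. g p * h p)"
proof -
 obtain B where B: "!!p. p : K ==> \<bar>h p\<bar> <= B" using compact_imp_bounded[OF compact_continuous_image[OF continuous_on_subset[OF h subset_UNIV] K(1)]]
  by(auto simp: bounded_iff)
 have gi: "integrable lebesgue (%x. indicator K x *\<^sub>R g x)" using g K unfolding locally_integrable_def set_integrable_def by blast
 have hm: "h : borel_measurable lebesgue" using h by(intro measurable_completion) (simp add: borel_measurable_continuous_onI)
 have eq: "indicator V p *\<^sub>R (g p * h p) = (indicator K p *\<^sub>R g p) * h p" for p using K(2,3) by(auto simp: indicator_def)
 show ?thesis unfolding set_integrable_def eq
 proof (rule Bochner_Integration.integrable_bound[OF integrable_mult_left[OF gi, of B]])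
  show "(%x. indicator K x *\<^sub>R g x * h x) : borel_measurable lebesgue" using borel_measurable_integrable[OF gi] hm by(rule borel_measurable_times)
  show "AE x in lebesgue. norm (indicator K x *\<^sub>R g x * h x) <= norm (indicator K x *\<^sub>R g x * B)"
  proof (rule AE_I2)
   fix x
   show "norm (indicator K x *\<^sub>R g x * h x) <= norm (indicator K x *\<^sub>R g x * B)"
   proof (cases "x : K")
    case True
    hence "\<bar>h x\<bar> <= \<bar>B\<bar>" using B[of x] by linarith
    thus ?thesis using True by(simp add: abs_mult mult_left_mono)
   qed simp
  qed
 qed
qed

lemma test_function_facts:
 assumes "ps : test_functions V"
 obtains K where "compact K" "K <= V" "!!p. p \<notin> K ==> ps p = 0" "!!p i. p \<notin> K ==> fderiv ps (at p) i = 0"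
  "continuous_on UNIV ps" "!!i. continuous_on UNIV (%p. fderiv ps (at p) i)"
proof (rule that[of "closure {p. ps p ~= 0}"])
 let ?K = "closure {p. ps p ~= 0}"
 show "compact ?K" "?K <= V" using assms by(auto simp: test_functions_def)
 show z: "ps p = 0" if "p \<notin> ?K" for p using that closure_subset[of "{p. ps p ~= 0}"] by auto
 have "Ck_on (Suc 0) UNIV ps" using assms unfolding test_functions_def smooth_on_def by blast
 thus "continuous_on UNIV ps" "continuous_on UNIV (%p. fderiv ps (at p) i)" for i using Ck_on_imp_continuous_on[of "Suc 0" UNIV ps] by simp_all
 show "fderiv ps (at p) i = 0" if "p \<notin> ?K" for p i
 proof -
  have "((%p. 0) has_derivative (%v. 0)) (at p)" by simp
  hence "(ps has_derivative (%v. 0)) (at p)"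
  proof (rule has_derivative_transform_within_open[of _ _ _ _ "- ?K"])
   show "open (- ?K)" by(rule open_Compl) (rule closed_closure)
   show "p : - ?K" unfolding Compl_iff using that .
   show "0 = ps x" if "x : - ?K" for x by(rule sym, rule z) (rule that[unfolded Compl_iff])
  qed
  from fun_cong[OF frechet_derivative_at[OF this, symmetric]] show ?thesis .
 qed
qed

section \<open>Linearity and uniqueness of weak differentials, measurability of the gradient
  norm\<close>

context compact_finsler
begin

abbreviation "wd == weak_differential"
abbreviation "FH == finite_H_norm"
abbreviation comp where "comp c om i p \<equiv> om (param c p) (tangent_of c (param c p) i)"

lemma weak_differentialD:
 assumes "wd u om"
 shows "x : M ==> om x : cotangent_space x"
  and "c : A ==> locally_integrable (coords c) (%p. u (param c p))"
  and "c : A ==> i : Basis ==> locally_integrable (coords c) (comp c om i)"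
  and "c : A ==> i : Basis ==> ps : test_functions (coords c) ==>
    (LINT p:coords c|lebesgue. u (param c p) * fderiv ps (at p) i) = - (LINT p:coords c|lebesgue. comp c om i p * ps p)"
 using assms unfolding weak_differential_def locally_integrable_def by blast+

lemma weak_differentialI:
 assumes "!!x. x : M ==> om x : cotangent_space x"
  and "!!c. c : A ==> locally_integrable (coords c) (%p. u (param c p))"
  and "!!c i. c : A ==> i : Basis ==> locally_integrable (coords c) (comp c om i)"
  and "!!c i ps. c : A ==> i : Basis ==> ps : test_functions (coords c) ==>
    (LINT p:coords c|lebesgue. u (param c p) * fderiv ps (at p) i) = - (LINT p:coords c|lebesgue. comp c om i p * ps p)"
 shows "wd u om" unfolding weak_differential_def
proof (intro conjI ballI allI impI)
 fix c C i assume c: "c : A" and i: "(i :: 'e) : Basis"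
 show "set_integrable lebesgue C (comp c om i)" if "compact C & C <= coords c" using assms(3)[OF c i] that unfolding locally_integrable_def by blast
next
 fix c C assume c: "c : A"
 show "set_integrable lebesgue C (%p. u (param c p))" if "compact C & C <= coords c" using assms(2)[OF c] that unfolding locally_integrable_def by blast
qed (use assms(1,4) in simp_all)

lemma weak_differential_measurable:
 assumes "wd u om"
 shows "chart_measurable u" "c : A ==> i : Basis ==> comp c om i : borel_measurable (lebesgue_on (coords c))"
proof -
 show "chart_measurable u" unfolding chart_measurable_def
 proof
  fix c assume c: "c : A"
  show "(%p. u (param c p)) : borel_measurable (lebesgue_on (coords c))" by(rule locally_integrable_measurable[OF chart_open[OF c] weak_differentialD(2)[OF assms c]])
 qed
 show "comp c om i : borel_measurable (lebesgue_on (coords c))" if "c : A" "i : Basis"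
  by(rule locally_integrable_measurable[OF chart_open[OF that(1)] weak_differentialD(3)[OF assms that]])
qed

lemma weak_differential_lincomb:
 assumes u: "wd u om" and v: "wd v et"
 shows "wd (%x. a * u x + b * v x) (%x X. a * om x X + b * et x X)"
proof (rule weak_differentialI)
 show "(%X. a * om x X + b * et x X) : cotangent_space x" if "x : M" for x
  using weak_differentialD(1)[OF u that] weak_differentialD(1)[OF v that] by(intro cotangent_add cotangent_scale)
next
 fix c assume c: "c : A"
 show "locally_integrable (coords c) (%p. a * u (param c p) + b * v (param c p))"
  by(rule locally_integrable_add[OF weak_differentialD(2)[OF u c] weak_differentialD(2)[OF v c]])
 fix i :: 'e assume i: "i : Basis"
 show "locally_integrable (coords c) (%p. a * comp c om i p + b * comp c et i p)"
  by(rule locally_integrable_add[OF weak_differentialD(3)[OF u c i] weak_differentialD(3)[OF v c i]])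
 fix ps assume ps: "ps : test_functions (coords c)"
 obtain K where K: "compact K" "K <= coords c" "!!p. p \<notin> K ==> ps p = 0" "!!p i. p \<notin> K ==> fderiv ps (at p) i = 0"
  "continuous_on UNIV ps" "!!i. continuous_on UNIV (%p. fderiv ps (at p) i)" by(rule test_function_facts[OF ps]) (rule that)
 note I1 = locally_integrable_times_test[OF chart_open[OF c] _ K(6) K(1,2,4), of _ i]
 note I2 = locally_integrable_times_test[OF chart_open[OF c] _ K(5) K(1,2,3)]
 have sp: "(LINT p:coords c|lebesgue. (a * g p + b * h p) * k p) =
   a * (LINT p:coords c|lebesgue. g p * k p) + b * (LINT p:coords c|lebesgue. h p * k p)"
  if "set_integrable lebesgue (coords c) (%p. g p * k p)" "set_integrable lebesgue (coords c) (%p. h p * k p)" for g h k :: "'e => real"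
 proof -
  have "(a * g p + b * h p) * k p = a * (g p * k p) + b * (h p * k p)" for p by(simp add: algebra_simps)
  thus ?thesis using that by(simp add: set_integral_add(2))
 qed
 show "(LINT p:coords c|lebesgue. (a * u (param c p) + b * v (param c p)) * fderiv ps (at p) i) =
   - (LINT p:coords c|lebesgue. (a * comp c om i p + b * comp c et i p) * ps p)" using sp[of "%p. u (param c p)" "%p. fderiv ps (at p) i" "%p. v (param c p)",
    OF I1[OF weak_differentialD(2)[OF u c]] I1[OF weak_differentialD(2)[OF v c]]]
   sp[of "comp c om i" ps "comp c et i",
    OF I2[OF weak_differentialD(3)[OF u c i]] I2[OF weak_differentialD(3)[OF v c i]]]
   weak_differentialD(4)[OF u c i ps] weak_differentialD(4)[OF v c i ps] by simp
qed

text \<open>In every chart the components of the difference are orthogonal to all test functions,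
  hence zero almost everywhere by the fundamental lemma; linearity extends this from basis vectors
  to all tangent vectors. Equality is claimed on \<open>tangent_space x\<close> only, as members of
  \<open>cotangent_space x\<close> are unconstrained elsewhere.\<close>

lemma weak_differential_unique:
 assumes u: "wd u om" and v: "wd v et" and uv: "AE x in mu. u x = v x"
 shows "AE x in mu. ALL X:tangent_space x. om x X = et x X"
proof (rule AE_from_pieces)
 fix c a b assume q: "(c, a, b) : pieces"
 note c = pieces_chart[OF q]
 have w: "wd (%x. 1 * u x + (-1) * v x) (%x X. 1 * om x X + (-1) * et x X)" by(rule weak_differential_lincomb[OF u v])
 have uvc: "AE p in lebesgue. p : coords c --> u (param c p) = v (param c p)" by(rule AE_chart[OF c uv])
 have "AE p in lebesgue. p : coords c --> comp c (%x X. 1 * om x X + (-1) * et x X) i p = 0" if i: "i : Basis" for i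
 proof (rule fundamental_lemma_calculus_of_variations[OF chart_open[OF c]])
  show "set_integrable lebesgue C (comp c (%x X. 1 * om x X + (-1) * et x X) i)" if "compact C" "C <= coords c" for C
   using weak_differentialD(3)[OF w c i] that unfolding locally_integrable_def by blast
  fix ps assume ps: "ps : test_functions (coords c)"
  have "AE p in lebesgue. indicator (coords c) p *\<^sub>R ((1 * u (param c p) + (-1) * v (param c p)) * fderiv ps (at p) i) = 0"
   using uvc by eventually_elim (auto simp: indicator_def)
  hence "(LINT p:coords c|lebesgue. (1 * u (param c p) + (-1) * v (param c p)) * fderiv ps (at p) i) = 0" unfolding set_lebesgue_integral_def by(rule integral_eq_zero_AE)
  thus "(LINT p:coords c|lebesgue. comp c (%x X. 1 * om x X + (-1) * et x X) i p * ps p) = 0" using weak_differentialD(4)[OF w c i ps] by simp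
 qed
 hence "AE p in lebesgue. ALL i:Basis. p : coords c --> comp c (%x X. 1 * om x X + (-1) * et x X) i p = 0" by(intro AE_finite_allI) auto
 thus "AE p in lebesgue. p : cbox a b --> (ALL X:tangent_space (param c p). om (param c p) X = et (param c p) X)"
 proof eventually_elim
  case (elim p)
  show ?case
  proof (intro impI ballI)
   fix X assume p: "p : cbox a b" and X: "X : tangent_space (param c p)"
   have pc: "p : coords c" using pieces_cbox[OF q] p by blast
   note x = param_in[OF pc] and xM = param_in_M[OF c pc]
   have l: "linear (%v. om (param c p) (tangent_of c (param c p) v))" "linear (%v. et (param c p) (tangent_of c (param c p) v))"
    using cotangent_linear[OF c x] weak_differentialD(1)[OF u xM] weak_differentialD(1)[OF v xM] by blast+
   have "om (param c p) (tangent_of c (param c p) i) = et (param c p) (tangent_of c (param c p) i)" if "i : Basis" for i using elim that pc by auto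
   hence "om (param c p) (tangent_of c (param c p) (X c)) = et (param c p) (tangent_of c (param c p) (X c))"
    using linear_eq_on_span[OF l, of Basis "X c"] by(simp add: span_Basis)
   thus "om (param c p) X = et (param c p) X" using tangent_of_coord[OF c x X] by simp
  qed
 qed
qed

text \<open>Frees \<open>D\<close> from the choice in its definition: almost everywhere, any weak
  differential may be used.\<close>

lemma D_eq_co_finsler:
 assumes "wd u om"
 shows "AE x in mu. D u x = co_finsler x (om x)"
proof -
 have "wd u (SOME om. wd u om)" by(rule someI[of "wd u", OF assms])
 from weak_differential_unique[OF this assms] show ?thesis unfolding D_def by(rule AE_mp) (auto intro!: AE_I2 co_finsler_cong)
qed

text \<open>The supremum over all tangent vectors reduces to the nonzero vectors of a countable
  dense set of coordinate vectors, because the quotient is continuous in the vector away from 0;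
  each quotient is measurable in the point.\<close>

lemma co_finsler_chart_measurable:
 assumes u: "wd u om"
 shows "chart_measurable (%x. co_finsler x (om x))" unfolding chart_measurable_def
proof
 fix c assume c: "c : A"
 obtain Q :: "'e set" where Q: "countable Q" "!!X. open X ==> X ~= {} ==> EX d:Q. d : X" by(rule countable_dense_setE) (rule that)
 define r where "r v p = (\<Sum>i\<in>Basis. (v \<bullet> i) * comp c om i p) / N c p v" for v p
 have lin: "comp c om v p = (\<Sum>i\<in>Basis. (v \<bullet> i) * comp c om i p)" if p: "p : coords c" for v p
 proof -
  have l: "linear (%v. comp c om v p)" by(rule cotangent_linear[OF c param_in[OF p] weak_differentialD(1)[OF u param_in_M[OF c p]]])
  show ?thesis using linear_sum[OF l, of "%i. (v \<bullet> i) *\<^sub>R i" Basis] linear_scale[OF l] by(simp add: euclidean_representation)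
 qed
 have r_meas: "r v : borel_measurable (lebesgue_on (coords c))" if "v ~= 0" for v
 proof -
  have "continuous_on (coords c) (%p. N c p v)" by(rule continuous_on_compose2[OF continuous_on_N[OF c], of _ "%p. (p, v)", simplified])
    (use that in \<open>auto intro!: continuous_intros\<close>)
  hence "(%p. N c p v) : borel_measurable (lebesgue_on (coords c))" by(rule continuous_imp_measurable_on_sets_lebesgue[OF _ coords_lebesgue[OF c]])
  thus ?thesis unfolding r_def using weak_differential_measurable(2)[OF u c] by(intro borel_measurable_divide borel_measurable_sum borel_measurable_times) auto
 qed
 have iff: "t < co_finsler (param c p) (om (param c p)) \<longleftrightarrow> (EX v:Q - {0}. t < r v p)" if p: "p : coords c" for p t
 proof -
  let ?x = "param c p"
  note x = param_in[OF p] and xM = param_in_M[OF c p]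
  have "t < co_finsler ?x (om ?x) \<longleftrightarrow> (EX X:tangent_space ?x - {%c. 0}. t < om ?x X / F ?x X)" unfolding co_finsler_def
   by(rule less_cSUP_iff[OF tangent_space_nontrivial[OF xM] co_finsler_bdd[OF xM weak_differentialD(1)[OF u xM]]])
  also have "... \<longleftrightarrow> (EX v:-{0}. t < r v p)"
  proof
   assume "EX X:tangent_space ?x - {%c. 0}. t < om ?x X / F ?x X"
   then obtain X where X: "X : tangent_space ?x" "X ~= (%c. 0)" "t < om ?x X / F ?x X" by blast
   have "tangent_of c ?x (X c) = X" by(rule tangent_of_coord[OF c x X(1)])
   moreover hence "X c ~= 0" using tangent_of_eq_0[OF c x, of "X c"] X(2) by auto
   ultimately show "EX v:-{0}. t < r v p" using X(3) lin[OF p, of "X c"] by(intro bexI[of _ "X c"]) (auto simp: r_def)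
  next
   assume "EX v:-{0}. t < r v p"
   then obtain v where v: "v ~= 0" "t < r v p" by auto
   hence "tangent_of c ?x v : tangent_space ?x - {%c. 0}" using tangent_of_in[OF c x] tangent_of_eq_0[OF c x, of v] by blast
   moreover have "t < om ?x (tangent_of c ?x v) / F ?x (tangent_of c ?x v)" using v(2) lin[OF p, of v] by(simp add: r_def)
   ultimately show "EX X:tangent_space ?x - {%c. 0}. t < om ?x X / F ?x X" by blast
  qed
  also have "... \<longleftrightarrow> (EX v:Q - {0}. t < r v p)"
  proof
   assume "EX v:-{0}. t < r v p"
   then obtain v where v: "v : -{0}" "t < r v p" by blast
   have cN: "continuous_on (-{0}) (%v. N c p v)" by(rule continuous_on_compose2[OF continuous_on_N[OF c], of _ "%v. (p, v)", simplified])
     (use p in \<open>auto intro!: continuous_intros\<close>)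
   have nz: "N c p v ~= 0" if "v : -{0}" for v using N_pos[OF c p, of v] that by simp
   have cr: "continuous_on (-{0}) (%v. r v p)" unfolding r_def using nz by(intro continuous_intros cN) auto
   have "openin (top_of_set (-{0})) ((-{0}) Int (%v. r v p) -` {t<..})" by(rule continuous_openin_preimage_gen[OF cr]) auto
   moreover have "open (-{0::'e})" by auto
   ultimately have "open ((-{0}) Int (%v. r v p) -` {t<..})" using openin_open_trans by blast
   moreover have "v : (-{0}) Int (%v. r v p) -` {t<..}" using v by auto
   ultimately obtain d where "d : Q" "d : (-{0}) Int (%v. r v p) -` {t<..}" using Q(2) by blast
   thus "EX v:Q - {0}. t < r v p" by blast
  qed blast
  finally show ?thesis .
 qed
 show "(%p. co_finsler (param c p) (om (param c p))) : borel_measurable (lebesgue_on (coords c))" unfolding borel_measurable_iff_greater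
 proof
  fix t :: real
  have "{p : space (lebesgue_on (coords c)). t < co_finsler (param c p) (om (param c p))} =
    (\<Union>v\<in>Q - {0}. {p : space (lebesgue_on (coords c)). t < r v p})" using iff by auto
  moreover have "... : sets (lebesgue_on (coords c))"
  proof (rule sets.countable_UN'')
   show "countable (Q - {0})" using Q(1) by auto
   show "{p : space (lebesgue_on (coords c)). t < r v p} : sets (lebesgue_on (coords c))" if "v : Q - {0}" for v
    using r_meas[of v] that unfolding borel_measurable_iff_greater by blast
  qed
  ultimately show "{p : space (lebesgue_on (coords c)). t < co_finsler (param c p) (om (param c p))} : sets (lebesgue_on (coords c))" by simp
 qed
qed

lemma D_measurable:
 assumes "wd u om"
 shows "chart_measurable (D u)" "D u : borel_measurable mu"
proof -
 have "wd u (SOME om. wd u om)" by(rule someI[of "wd u", OF assms])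
 from co_finsler_chart_measurable[OF this] show "chart_measurable (D u)" unfolding D_def .
 thus "D u : borel_measurable mu" by(rule chart_measurable_BH)
qed

lemma D_nonneg: "wd u om ==> x : M ==> 0 <= D u x" unfolding D_def by(intro co_finsler_nonneg weak_differentialD(1)[of u] someI[of "wd u"])

text \<open>Members of \<open>H\<close> are functions, and limits are known up to null sets; this
  lets a limit be altered on a null set without losing its weak differential.\<close>

lemma weak_differential_cong_AE:
 assumes u: "wd u om" and uv: "AE x in mu. u x = v x"
 shows "wd v om"
proof (rule weak_differentialI)
 fix c assume c: "c : A"
 have ae: "AE p in lebesgue. p : coords c --> u (param c p) = v (param c p)" by(rule AE_chart[OF c uv])
 have ae': "AE p in lebesgue. indicator (coords c) p *\<^sub>R u (param c p) = indicator (coords c) p *\<^sub>R v (param c p)"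
  using ae by eventually_elim (auto simp: indicator_def)
 have "(%p. indicator (coords c) p *\<^sub>R u (param c p)) : borel_measurable lebesgue"
  using chart_measurableD[OF weak_differential_measurable(1)[OF u] c] coords_lebesgue[OF c] by(subst (asm) borel_measurable_restrict_space_iff) auto
 from borel_measurable_AE[OF this ae'] have vm: "(%p. v (param c p)) : borel_measurable (lebesgue_on (coords c))"
  using coords_lebesgue[OF c] by(subst borel_measurable_restrict_space_iff) auto
 show "locally_integrable (coords c) (%p. v (param c p))"
 proof (rule locally_integrable_bound[OF chart_open[OF c] vm weak_differentialD(2)[OF u c], of 1])
  show "AE p in lebesgue. p : coords c --> \<bar>v (param c p)\<bar> <= 1 * \<bar>u (param c p)\<bar>" using ae by eventually_elim auto
 qed
 fix i :: 'e and ps assume i: "i : Basis" and ps: "ps : test_functions (coords c)"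
 have psm: "(%p. fderiv ps (at p) i) : borel_measurable lebesgue"
 proof -
  have "continuous_on UNIV (%p. fderiv ps (at p) i)" by(rule test_function_facts[OF ps])
  thus ?thesis by(intro measurable_completion) (simp add: borel_measurable_continuous_onI)
 qed
 have "(LINT p:coords c|lebesgue. v (param c p) * fderiv ps (at p) i) =
   (LINT p:coords c|lebesgue. u (param c p) * fderiv ps (at p) i)" unfolding set_lebesgue_integral_def
 proof (rule integral_cong_AE)
  show "(%p. indicator (coords c) p *\<^sub>R (v (param c p) * fderiv ps (at p) i)) : borel_measurable lebesgue"
   using borel_measurable_times[OF borel_measurable_AE[OF \<open>(%p. indicator (coords c) p *\<^sub>R u (param c p)) : borel_measurable lebesgue\<close> ae'] psm]
   by(simp add: mult.assoc)
  show "(%p. indicator (coords c) p *\<^sub>R (u (param c p) * fderiv ps (at p) i)) : borel_measurable lebesgue"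
   using borel_measurable_times[OF \<open>(%p. indicator (coords c) p *\<^sub>R u (param c p)) : borel_measurable lebesgue\<close> psm] by(simp add: mult.assoc)
  show "AE p in lebesgue. indicator (coords c) p *\<^sub>R (v (param c p) * fderiv ps (at p) i) =
    indicator (coords c) p *\<^sub>R (u (param c p) * fderiv ps (at p) i)" using ae by eventually_elim (auto simp: indicator_def)
 qed
 thus "(LINT p:coords c|lebesgue. v (param c p) * fderiv ps (at p) i) = - (LINT p:coords c|lebesgue. comp c om i p * ps p)"
  using weak_differentialD(4)[OF u c i ps] by simp
qed (use weak_differentialD[OF u] in auto)

end

section \<open>The space H\<close>

context compact_finsler
begin

abbreviation "Cinf \<equiv> smooth_compact_support"

text \<open>The classical differential, computed in an arbitrarily chosen chart; the transformation
  rule of tangent vectors makes it independent of that choice.\<close>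

definition smooth_diff :: "('m => real) => 'm => ('m, 'e) tangent => real" where
 "smooth_diff s x X = (let c = (SOME c. c : A & x : fst c) in
   fderiv (s \<circ> param c) (at (snd c x)) (X c))"

lemma Cinf_Ck: "s : Cinf ==> c : A ==> Ck_on n (coords c) (s \<circ> param c)" by(simp add: smooth_compact_support_def smooth_on_def)

lemma Cinf_derivative:
 "s : Cinf ==> c : A ==> p : coords c ==> (s \<circ> param c has_derivative fderiv (s \<circ> param c) (at p)) (at p)"
 by(rule Ck_on_derivative[OF Cinf_Ck[of s c "Suc 0"]])

text \<open>On a compact manifold every closed set is compact, so smoothness in the charts is all
  that \<open>smooth_compact_support\<close> demands.\<close>

lemma CinfI: "(!!c. c : A ==> smooth_on (coords c) (%p. s (param c p))) ==> s : Cinf"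
 using closedin_compact_space[OF compact closedin_closure_of] by(simp add: smooth_compact_support_def o_def)

lemma CinfD: "s : Cinf ==> c : A ==> smooth_on (coords c) (%p. s (param c p))" by(simp add: smooth_compact_support_def o_def)

lemma smooth_diff_eq:
 assumes s: "s : Cinf" and c: "c : A" "x : fst c" and X: "X : tangent_space x"
 shows "smooth_diff s x X = fderiv (s \<circ> param c) (at (snd c x)) (X c)"
proof -
 define c' where "c' = (SOME c. c : A & x : fst c)"
 have c': "c' : A" "x : fst c'" using someI[of "%c. c : A & x : fst c" c] c by(auto simp: c'_def)
 have d: "(s \<circ> param c') differentiable (at (snd c' x))" using Cinf_derivative[OF s c'(1) chart_in_coords[OF c'(2)]] unfolding differentiable_def by blast
 have "fderiv (s \<circ> param c) (at (snd c x)) (X c) =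
   fderiv (s \<circ> param c') (at (snd c' x)) (fderiv (snd c' \<circ> param c) (at (snd c x)) (X c))"
  by(rule fun_cong[OF frechet_derivative_at[OF change_of_chart[OF c(1) c'(1) c(2) c'(2) d], symmetric]])
 also have "fderiv (snd c' \<circ> param c) (at (snd c x)) (X c) = X c'"
 proof -
  have "X c' = fderiv (snd c' \<circ> param c) (at (snd c x)) (X c)" using X c c' unfolding tangent_space_def by blast
  thus ?thesis by(rule sym)
 qed
 finally show ?thesis unfolding smooth_diff_def Let_def c'_def[symmetric] by(rule sym)
qed

lemma smooth_diff_chart:
 assumes s: "s : Cinf" and c: "c : A" "p : coords c"
 shows "comp c (smooth_diff s) i p = fderiv (s \<circ> param c) (at p) i" using smooth_diff_eq[OF s c(1) param_in[OF c(2)] tangent_of_in[OF c(1) param_in[OF c(2)]], of i]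
  tangent_of_chart[OF c(1) param_in[OF c(2)], of i] chart_param[OF c(2)] by simp

lemma smooth_diff_cotangent:
 assumes s: "s : Cinf" and x: "x : M"
 shows "smooth_diff s x : cotangent_space x"
proof -
 obtain c where c: "c : A" "x : fst c" using ex_chart[OF x] by blast
 let ?L = "fderiv (s \<circ> param c) (at (snd c x))"
 have l: "linear ?L" using Cinf_derivative[OF s c(1) chart_in_coords[OF c(2)]] by(rule has_derivative_linear)
 have add: "(%c'. X c' + Y c') : tangent_space x" if X: "X : tangent_space x" and Y: "Y : tangent_space x" for X Y
 proof -
  have "tangent_of c x (X c + Y c) = (%c'. X c' + Y c')" unfolding tangent_of_add[OF c] tangent_of_coord[OF c X] tangent_of_coord[OF c Y] ..
  thus ?thesis using tangent_of_in[OF c, of "X c + Y c"] by simp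
 qed
 show ?thesis unfolding cotangent_space_def
 proof (intro CollectI conjI ballI allI)
  fix X Y assume X: "X : tangent_space x" and Y: "Y : tangent_space x"
  show "smooth_diff s x (%c. X c + Y c) = smooth_diff s x X + smooth_diff s x Y"
   using smooth_diff_eq[OF s c X] smooth_diff_eq[OF s c Y] smooth_diff_eq[OF s c add[OF X Y]] linear_add[OF l] by simp
 next
  fix a X assume X: "X : tangent_space x"
  show "smooth_diff s x (%c. a *\<^sub>R X c) = a * smooth_diff s x X"
   using smooth_diff_eq[OF s c X] smooth_diff_eq[OF s c tangent_scale[OF X x]] linear_scale[OF l] by simp
 qed
qed

lemma smooth_weak_differential:
 assumes s: "s : Cinf"
 shows "wd s (smooth_diff s)"
proof (rule weak_differentialI[OF smooth_diff_cotangent[OF s]])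
 fix c assume c: "c : A"
 have C1: "Ck_on (Suc 0) (coords c) (s \<circ> param c)" by(rule Cinf_Ck[OF s c])
 show "locally_integrable (coords c) (%p. s (param c p))" using Ck_on_imp_continuous_on[OF C1] by(intro locally_integrable_continuous) (simp add: o_def)
 fix i :: 'e assume i: "i : Basis"
 have "continuous_on (coords c) (%p. fderiv (s \<circ> param c) (at p) i)" using C1 by simp
 hence "continuous_on (coords c) (comp c (smooth_diff s) i)" by(rule continuous_on_eq) (simp add: smooth_diff_chart[OF s c])
 thus "locally_integrable (coords c) (comp c (smooth_diff s) i)" by(rule locally_integrable_continuous)
 fix ps assume ps: "ps : test_functions (coords c)"
 have "(LINT p:coords c|lebesgue. comp c (smooth_diff s) i p * ps p) =
   (LINT p:coords c|lebesgue. fderiv (s \<circ> param c) (at p) i * ps p)" unfolding set_lebesgue_integral_def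
  by(rule Bochner_Integration.integral_cong[OF refl]) (simp add: indicator_def smooth_diff_chart[OF s c])
 thus "(LINT p:coords c|lebesgue. s (param c p) * fderiv ps (at p) i) =
   - (LINT p:coords c|lebesgue. comp c (smooth_diff s) i p * ps p)" using integration_by_parts_test_function[OF chart_open[OF c] C1 ps, of i] by simp
qed

lemma Cinf_lincomb: "s : Cinf ==> t : Cinf ==> (%x. a * s x + b * t x) : Cinf"
proof (rule CinfI)
 fix c assume s: "s : Cinf" and t: "t : Cinf" and c: "c : A"
 show "smooth_on (coords c) (%p. a * s (param c p) + b * t (param c p))"
  by(rule smooth_on_add[OF chart_open[OF c] smooth_on_mult[OF chart_open[OF c] smooth_on_const CinfD[OF s c]]
     smooth_on_mult[OF chart_open[OF c] smooth_on_const CinfD[OF t c]]])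
qed

lemma Cinf_compose: "s : Cinf ==> smooth_on UNIV \<phi> ==> (%x. \<phi> (s x)) : Cinf"
proof (rule CinfI)
 fix c assume s: "s : Cinf" and \<phi>: "smooth_on UNIV \<phi>" and c: "c : A"
 show "smooth_on (coords c) (%p. \<phi> (s (param c p)))" by(rule smooth_on_compose_real[OF chart_open[OF c] \<phi> CinfD[OF s c]])
qed

lemma Cinf_const: "(%x. a) : Cinf" by(intro CinfI smooth_on_const)

lemma smooth_diff_compose:
 assumes s: "s : Cinf" and \<phi>: "smooth_on UNIV \<phi>" "!!t. (\<phi> has_real_derivative \<phi>' t) (at t)"
  and x: "x : M" and X: "X : tangent_space x"
 shows "smooth_diff (%x. \<phi> (s x)) x X = \<phi>' (s x) * smooth_diff s x X"
proof -
 obtain c where c: "c : A" "x : fst c" using ex_chart[OF x] by blast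
 have d: "(s \<circ> param c has_derivative fderiv (s \<circ> param c) (at (snd c x))) (at (snd c x))" by(rule Cinf_derivative[OF s c(1) chart_in_coords[OF c(2)]])
 have "(\<phi> has_derivative times (\<phi>' ((s \<circ> param c) (snd c x)))) (at ((s \<circ> param c) (snd c x)))" using \<phi>(2) unfolding has_field_derivative_def .
 moreover have e: "(s \<circ> param c) (snd c x) = s x" using c by simp
 ultimately have "(\<phi> has_derivative times (\<phi>' (s x))) (at ((s \<circ> param c) (snd c x)))" by(simp only:)
 from diff_chain_at[OF d this]
 have "(\<phi> \<circ> (s \<circ> param c) has_derivative times (\<phi>' (s x)) \<circ> fderiv (s \<circ> param c) (at (snd c x))) (at (snd c x))" .
 moreover have "\<phi> \<circ> (s \<circ> param c) = (%x. \<phi> (s x)) \<circ> param c" by(simp add: fun_eq_iff)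
 ultimately have "((%x. \<phi> (s x)) \<circ> param c has_derivative times (\<phi>' (s x)) \<circ> fderiv (s \<circ> param c) (at (snd c x))) (at (snd c x))" by simp
 from fun_cong[OF frechet_derivative_at[OF this], of "X c"]
 have "fderiv ((%x. \<phi> (s x)) \<circ> param c) (at (snd c x)) (X c) = \<phi>' (s x) * fderiv (s \<circ> param c) (at (snd c x)) (X c)" by simp
 thus ?thesis using smooth_diff_eq[OF s c X] smooth_diff_eq[OF Cinf_compose[OF s \<phi>(1)] c X] by simp
qed

lemma D_compose_smooth:
 assumes s: "s : Cinf" and \<phi>: "smooth_on UNIV \<phi>" "!!t. (\<phi> has_real_derivative \<phi>' t) (at t)"
 shows "AE x in mu. D (%x. \<phi> (s x)) x = \<bar>\<phi>' (s x)\<bar> * D s x"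
proof -
 have eq: "co_finsler x (smooth_diff (%x. \<phi> (s x)) x) = \<bar>\<phi>' (s x)\<bar> * co_finsler x (smooth_diff s x)" if x: "x : M" for x
 proof -
  have "co_finsler x (smooth_diff (%x. \<phi> (s x)) x) = co_finsler x (%X. \<phi>' (s x) * smooth_diff s x X)"
   by(rule co_finsler_cong) (rule smooth_diff_compose[OF s \<phi> x])
  thus ?thesis using co_finsler_scale[OF x smooth_diff_cotangent[OF s x]] by simp
 qed
 have "AE x in mu. x : M" using AE_space[of mu] by(simp add: space_BH)
 thus ?thesis using D_eq_co_finsler[OF smooth_weak_differential[OF s]]
   D_eq_co_finsler[OF smooth_weak_differential[OF Cinf_compose[OF s \<phi>(1)]]] by eventually_elim (simp add: eq)
qed

lemma bounded_on_M:
 fixes f :: "'m => real"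
 assumes "!!c a b. (c, a, b) : pieces ==> EX B. ALL p:cbox a b. \<bar>f (param c p)\<bar> <= B"
 obtains B where "!!x. x : M ==> \<bar>f x\<bar> <= B"
proof -
 have "EX B. ALL p:cbox (fst (snd q)) (snd (snd q)). \<bar>f (param (fst q) p)\<bar> <= B" if "q : pieces" for q
  using assms[of "fst q" "fst (snd q)" "snd (snd q)"] that by simp
 then obtain B where B: "!!q p. q : pieces ==> p : cbox (fst (snd q)) (snd (snd q)) ==> \<bar>f (param (fst q) p)\<bar> <= B q"
  using bchoice[of pieces "%q B. ALL p:cbox (fst (snd q)) (snd (snd q)). \<bar>f (param (fst q) p)\<bar> <= B"] by blast
 have "\<bar>f x\<bar> <= (\<Sum>q\<in>pieces. \<bar>B q\<bar>)" if x: "x : M" for x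
 proof -
  obtain c a b where q: "(c, a, b) : pieces" "x : fst c" "snd c x : cbox a b" using pieces_cover[OF x] by blast
  have "\<bar>f x\<bar> <= B (c, a, b)" using B[OF q(1), of "snd c x"] q pieces_chart[OF q(1)] by simp
  also have "... <= \<bar>B (c, a, b)\<bar>" by simp
  also have "... <= (\<Sum>q\<in>pieces. \<bar>B q\<bar>)" by(rule member_le_sum[OF q(1)]) (use finite_pieces in auto)
  finally show ?thesis .
 qed
 thus ?thesis by(rule that)
qed

lemma Cinf_L2:
 assumes s: "s : Cinf"
 shows "s : L2F" "D s : L2F"
proof -
 note w = smooth_weak_differential[OF s]
 have bdd: "EX B. ALL p:cbox a b. \<bar>g p\<bar> <= B" if "(c, a, b) : pieces" "continuous_on (coords c) g" for c a b and g :: "'e => real"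
  using compact_imp_bounded[OF compact_continuous_image[OF continuous_on_subset[OF that(2) pieces_cbox[OF that(1)]] compact_cbox]] by(auto simp: bounded_iff)
 obtain B where B: "!!x. x : M ==> \<bar>s x\<bar> <= B"
 proof (rule bounded_on_M[of s])
  fix c a b assume q: "(c, a, b) : pieces"
  show "EX B. ALL p:cbox a b. \<bar>s (param c p)\<bar> <= B" using bdd[OF q Ck_on_imp_continuous_on[OF Cinf_Ck[OF s pieces_chart[OF q], of 0]]] by simp
 qed (rule that)
 show "s : L2F"
 proof (rule L2_space_mono(1)[OF L2_const[OF finite_measure_BH, of B]])
  show "s : borel_measurable mu" by(rule chart_measurable_BH[OF weak_differential_measurable(1)[OF w]])
  show "AE x in mu. \<bar>s x\<bar> <= \<bar>B\<bar>" by(rule AE_I2) (use B in \<open>force simp: space_BH\<close>)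
 qed
 obtain B' where B': "!!x. x : M ==> \<bar>co_finsler x (smooth_diff s x)\<bar> <= B'"
 proof (rule bounded_on_M[of "%x. co_finsler x (smooth_diff s x)"])
  fix c a b assume q: "(c, a, b) : pieces"
  note c = pieces_chart[OF q] and K = pieces_cbox[OF q]
  obtain k where k: "0 < k" "!!p xi. p : cbox a b ==> xi : cotangent_space (param c p) ==>
    co_finsler (param c p) xi <= k * (\<Sum>i\<in>Basis. \<bar>xi (tangent_of c (param c p) i)\<bar>)" by(rule co_finsler_chart_bounds[OF c compact_cbox K]) (rule that)
  have "continuous_on (coords c) (%p. k * (\<Sum>i\<in>Basis. \<bar>fderiv (s \<circ> param c) (at p) i\<bar>))"
   using Cinf_Ck[OF s c, of "Suc 0"] by(auto intro!: continuous_intros)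
  from bdd[OF q this] obtain B where B: "ALL p:cbox a b. \<bar>k * (\<Sum>i\<in>Basis. \<bar>fderiv (s \<circ> param c) (at p) i\<bar>)\<bar> <= B" by blast
  show "EX B. ALL p:cbox a b. \<bar>co_finsler (param c p) (smooth_diff s (param c p))\<bar> <= B"
  proof (intro exI ballI)
   fix p assume p: "p : cbox a b"
   hence pc: "p : coords c" using K by blast
   note ct = smooth_diff_cotangent[OF s param_in_M[OF c pc]]
   have "co_finsler (param c p) (smooth_diff s (param c p)) <= k * (\<Sum>i\<in>Basis. \<bar>fderiv (s \<circ> param c) (at p) i\<bar>)"
    using k(2)[OF p ct] smooth_diff_chart[OF s c pc] by simp
   thus "\<bar>co_finsler (param c p) (smooth_diff s (param c p))\<bar> <= B" using B p co_finsler_nonneg[OF param_in_M[OF c pc] ct] by force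
  qed
 qed (rule that)
 show "D s : L2F"
 proof (rule L2_space_mono(1)[OF L2_const[OF finite_measure_BH, of B']])
  show "D s : borel_measurable mu" by(rule D_measurable[OF w])
  have "AE x in mu. x : M" using AE_space[of mu] by(simp add: space_BH)
  thus "AE x in mu. \<bar>D s x\<bar> <= \<bar>B'\<bar>" using D_eq_co_finsler[OF w] by eventually_elim (use B' in force)
 qed
qed

lemma Cinf_finite_H_norm: "s : Cinf ==> s : FH" unfolding finite_H_norm_def using Cinf_L2 smooth_weak_differential by blast

lemma finite_H_normD:
 assumes "u : FH"
 obtains om where "wd u om" "u : L2F" "D u : L2F" using assms unfolding finite_H_norm_def by blast

lemma FH_L2: "u : FH ==> u : L2F" "u : FH ==> D u : L2F" by(auto simp: finite_H_norm_def)

lemma D_lincomb_le: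
 assumes u: "wd u om" and v: "wd v et"
 shows "AE x in mu. D (%x. a * u x + b * v x) x <= \<bar>a\<bar> * D u x + \<bar>b\<bar> * D v x"
proof -
 have "AE x in mu. x : M" using AE_space[of mu] by(simp add: space_BH)
 thus ?thesis using D_eq_co_finsler[OF u] D_eq_co_finsler[OF v] D_eq_co_finsler[OF weak_differential_lincomb[OF u v, of a b]]
 proof eventually_elim
  case (elim x)
  note c = weak_differentialD(1)[OF u elim(1)] weak_differentialD(1)[OF v elim(1)]
  show ?case using co_finsler_triangle[OF elim(1) cotangent_scale[OF c(1), of a] cotangent_scale[OF c(2), of b]]
    co_finsler_scale[OF elim(1) c(1), of a] co_finsler_scale[OF elim(1) c(2), of b] elim by simp
 qed
qed

lemma FH_lincomb:
 assumes u: "u : FH" and v: "v : FH"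
 shows "(%x. a * u x + b * v x) : FH"
  "nrm (D (%x. a * u x + b * v x)) <= \<bar>a\<bar> * nrm (D u) + \<bar>b\<bar> * nrm (D v)"
proof -
 obtain om where w: "wd u om" by(rule finite_H_normD[OF u])
 obtain et where e: "wd v et" by(rule finite_H_normD[OF v])
 note lc = weak_differential_lincomb[OF w e, of a b]
 have Lu: "(%x. \<bar>a\<bar> * D u x) : L2F" and Lv: "(%x. \<bar>b\<bar> * D v x) : L2F" using FH_L2[OF u] FH_L2[OF v] by(auto intro: L2_space_cmult)
 have "AE x in mu. x : M" using AE_space[of mu] by(simp add: space_BH)
 hence le: "AE x in mu. \<bar>D (%x. a * u x + b * v x) x\<bar> <= \<bar>\<bar>a\<bar> * D u x + \<bar>b\<bar> * D v x\<bar>"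
  using D_lincomb_le[OF w e, of a b] by eventually_elim (use D_nonneg[OF lc] in force)
 note m = L2_space_mono[OF L2_space_add[OF Lu Lv] D_measurable(2)[OF lc] le]
 show "(%x. a * u x + b * v x) : FH" unfolding finite_H_norm_def using m(1) lc FH_L2[OF u] FH_L2[OF v] by(auto intro: L2_space_add L2_space_cmult)
 show "nrm (D (%x. a * u x + b * v x)) <= \<bar>a\<bar> * nrm (D u) + \<bar>b\<bar> * nrm (D v)"
  using m(2) L2_norm_triangle[OF Lu Lv] L2_norm_cmult[of mu "\<bar>a\<bar>"] L2_norm_cmult[of mu "\<bar>b\<bar>"] by simp
qed

lemma FH_diff:
 assumes "u : FH" "v : FH"
 shows "(%x. u x - v x) : FH"
  "nrm (D (%x. u x - v x)) <= nrm (D u) + nrm (D v)" using FH_lincomb[OF assms, of 1 "-1"] by simp_all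

lemma H_norm_nonneg [simp]: "0 <= H_norm u" by(simp add: H_norm_def)

lemma H_norm_power2: "(H_norm u)^2 = (nrm u)^2 + (nrm (D u))^2" by(simp add: H_norm_def)

lemma H_norm_ge: "nrm u <= H_norm u" "nrm (D u) <= H_norm u" unfolding H_norm_def by(auto intro!: real_le_rsqrt)

lemma H_norm_le_sum: "H_norm u <= nrm u + nrm (D u)" unfolding H_norm_def by(rule sqrt_sum_squares_le_sum) auto

lemma H_norm_lincomb:
 assumes "u : FH" "v : FH"
 shows "H_norm (%x. a * u x + b * v x) <= \<bar>a\<bar> * H_norm u + \<bar>b\<bar> * H_norm v"
proof -
 let ?a = "nrm" and ?d = "%u. nrm (D u)"
 have 1: "?a (%x. a * u x + b * v x) <= \<bar>a\<bar> * ?a u + \<bar>b\<bar> * ?a v"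
  using L2_norm_triangle[OF L2_space_cmult[OF FH_L2(1)[OF assms(1)], of a] L2_space_cmult[OF FH_L2(1)[OF assms(2)], of b]] by(simp add: L2_norm_cmult)
 note 2 = FH_lincomb(2)[OF assms, of a b]
 have "H_norm (%x. a * u x + b * v x) <= sqrt ((\<bar>a\<bar> * ?a u + \<bar>b\<bar> * ?a v)^2 + (\<bar>a\<bar> * ?d u + \<bar>b\<bar> * ?d v)^2)"
  unfolding H_norm_def using 1 2 by(intro real_sqrt_le_mono add_mono power_mono) auto
 also have "... <= sqrt ((\<bar>a\<bar> * ?a u)^2 + (\<bar>a\<bar> * ?d u)^2) + sqrt ((\<bar>b\<bar> * ?a v)^2 + (\<bar>b\<bar> * ?d v)^2)"
  by(rule real_sqrt_sum_squares_triangle_ineq)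
 also have "... = \<bar>a\<bar> * H_norm u + \<bar>b\<bar> * H_norm v" unfolding H_norm_def power_mult_distrib distrib_left[symmetric] real_sqrt_mult by simp
 finally show ?thesis .
qed

lemma H_norm_triangle:
 assumes "u : FH" "v : FH" "w : FH"
 shows "H_norm (%x. u x - w x) <= H_norm (%x. u x - v x) + H_norm (%x. v x - w x)"
 using H_norm_lincomb[OF FH_diff(1)[OF assms(1,2)] FH_diff(1)[OF assms(2,3)], of 1 1] by simp

lemma H_norm_minus_le:
 assumes "u : FH" "v : FH"
 shows "H_norm (%x. u x - v x) <= H_norm u + H_norm v" using H_norm_lincomb[OF assms, of 1 "-1"] by simp

lemma H_FH: "u : H ==> u : FH" by(simp add: H_def)

lemma H_approx:
 assumes "u : H" "0 < e"
 obtains s where "s : Cinf" "H_norm (%x. u x - s x) < e"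
proof -
 obtain s where s: "!!n::nat. s n : Cinf" "(%n. H_norm (%x. u x - s n x)) ----> 0" using assms(1) unfolding H_def by blast
 have "eventually (%n. H_norm (%x. u x - s n x) < e) sequentially" using order_tendstoD(2)[OF s(2) assms(2)] .
 then obtain n where "H_norm (%x. u x - s n x) < e" by(auto simp: eventually_sequentially)
 thus ?thesis using that[OF s(1)] by blast
qed

text \<open>Closedness of \<open>H\<close>: approximants may be taken in \<open>H\<close> instead of
  among smooth functions, by halving the error.\<close>

lemma HI_approx:
 assumes u: "u : FH" and "!!e. 0 < e ==> EX s:H. H_norm (%x. u x - s x) < e"
 shows "u : H"
proof -
 have "EX s:Cinf. H_norm (%x. u x - s x) < 1 / real (Suc n)" for n
 proof -
  obtain h where h: "h : H" "H_norm (%x. u x - h x) < 1 / real (Suc n) / 2" using assms(2)[of "1 / real (Suc n) / 2"] by auto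
  obtain s where s: "s : Cinf" "H_norm (%x. h x - s x) < 1 / real (Suc n) / 2" by(rule H_approx[OF h(1), of "1 / real (Suc n) / 2"]) auto
  have "H_norm (%x. u x - s x) <= H_norm (%x. u x - h x) + H_norm (%x. h x - s x)" by(rule H_norm_triangle[OF u H_FH[OF h(1)] Cinf_finite_H_norm[OF s(1)]])
  hence "H_norm (%x. u x - s x) < 1 / real (Suc n)" using h(2) s(2) by linarith
  thus ?thesis using s(1) by blast
 qed
 then obtain s where s: "!!n. s n : Cinf" "!!n. H_norm (%x. u x - s n x) < 1 / real (Suc n)" by metis
 have "(%n. H_norm (%x. u x - s n x)) ----> 0" by(rule Lim_null_comparison[OF _ LIMSEQ_inverse_real_of_nat])
   (use s(2) in \<open>auto simp: inverse_eq_divide intro!: always_eventually less_imp_le\<close>)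
 thus ?thesis unfolding H_def using u s(1) by blast
qed

lemma H_norm_zero: "H_norm (%x. 0) = 0"
proof -
 have z: "(%x. 0) : FH" by(rule Cinf_finite_H_norm[OF Cinf_const])
 show ?thesis using H_norm_lincomb[OF z z, of 0 0] by(simp add: antisym)
qed

lemma Cinf_H: "s : Cinf ==> s : H"
proof -
 assume s: "s : Cinf"
 have "(%n::nat. H_norm (%x. s x - s x)) ----> 0" by(simp add: H_norm_zero)
 thus ?thesis unfolding H_def using Cinf_finite_H_norm[OF s] s by(intro CollectI conjI exI[of _ "%n. s"]) auto
qed

lemma H_lincomb:
 assumes u: "u : H" and v: "v : H"
 shows "(%x. a * u x + b * v x) : H"
proof (rule HI_approx)
 note FHs = H_FH[OF u] H_FH[OF v]
 show "(%x. a * u x + b * v x) : FH" by(rule FH_lincomb(1)[OF FHs])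
 fix e :: real assume e: "0 < e"
 define d where "d = e / (\<bar>a\<bar> + \<bar>b\<bar> + 1)"
 have d: "0 < d" using e by(simp add: d_def add_nonneg_pos)
 obtain s where s: "s : Cinf" "H_norm (%x. u x - s x) < d" by(rule H_approx[OF u d])
 obtain t where t: "t : Cinf" "H_norm (%x. v x - t x) < d" by(rule H_approx[OF v d])
 have "H_norm (%x. a * (u x - s x) + b * (v x - t x)) <= \<bar>a\<bar> * H_norm (%x. u x - s x) + \<bar>b\<bar> * H_norm (%x. v x - t x)"
  by(rule H_norm_lincomb[OF FH_diff(1)[OF FHs(1) Cinf_finite_H_norm[OF s(1)]] FH_diff(1)[OF FHs(2) Cinf_finite_H_norm[OF t(1)]]])
 also have "... <= \<bar>a\<bar> * d + \<bar>b\<bar> * d" using s(2) t(2) by(intro add_mono mult_left_mono) auto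
 also have "... < (\<bar>a\<bar> + \<bar>b\<bar> + 1) * d" using d by(simp add: algebra_simps)
 also have "... = e" using e by(simp add: d_def add_nonneg_eq_0_iff)
 finally have "H_norm (%x. (a * u x + b * v x) - (a * s x + b * t x)) < e" by(simp add: algebra_simps)
 thus "EX h:H. H_norm (%x. (a * u x + b * v x) - h x) < e" using Cinf_H[OF Cinf_lincomb[OF s(1) t(1), of a b]] by(rule bexI)
qed

lemma FH_cong_AE:
 assumes u: "u : FH" and uv: "AE x in mu. u x = v x"
 shows "v : FH" "AE x in mu. D v x = D u x" "H_norm v = H_norm u" "nrm (D v) = nrm (D u)"
proof -
 obtain om where w: "wd u om" by(rule finite_H_normD[OF u])
 note wv = weak_differential_cong_AE[OF w uv]
 show D: "AE x in mu. D v x = D u x" using D_eq_co_finsler[OF w] D_eq_co_finsler[OF wv] by eventually_elim simp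
 have vm: "v : borel_measurable mu" by(rule chart_measurable_BH[OF weak_differential_measurable(1)[OF wv]])
 have v: "v : L2F" by(rule L2_space_mono(1)[OF FH_L2(1)[OF u] vm]) (use uv in \<open>eventually_elim, simp\<close>)
 have Dv: "D v : L2F" by(rule L2_space_mono(1)[OF FH_L2(2)[OF u] D_measurable(2)[OF wv]]) (use D in \<open>eventually_elim, simp\<close>)
 show "v : FH" unfolding finite_H_norm_def using v Dv wv by blast
 have "nrm v = nrm u" by(rule L2_norm_cong_AE[OF _ vm L2_spaceD(1)[OF FH_L2(1)[OF u]]]) (use uv in \<open>eventually_elim, simp\<close>)
 moreover show *: "nrm (D v) = nrm (D u)"
  by(rule L2_norm_cong_AE[OF _ L2_spaceD(1)[OF Dv] L2_spaceD(1)[OF FH_L2(2)[OF u]]]) (use D in \<open>eventually_elim, simp\<close>)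
 ultimately show "H_norm v = H_norm u" by(simp add: H_norm_def)
qed

lemma H_cong_AE:
 assumes u: "u : H" and uv: "AE x in mu. u x = v x"
 shows "v : H"
proof (rule HI_approx)
 show v: "v : FH" by(rule FH_cong_AE(1)[OF H_FH[OF u] uv])
 fix e :: real assume "0 < e"
 then obtain s where s: "s : Cinf" "H_norm (%x. u x - s x) < e" by(rule H_approx[OF u])
 have "AE x in mu. u x - s x = v x - s x" using uv by eventually_elim simp
 from FH_cong_AE(3)[OF FH_diff(1)[OF H_FH[OF u] Cinf_finite_H_norm[OF s(1)]] this]
 show "EX s:H. H_norm (%x. v x - s x) < e" using s Cinf_H[OF s(1)] by(intro bexI[of _ s]) auto
qed

end

section \<open>Completeness of the space of functions with finite energy\<close>

lemma suminf_tail_tendsto_0: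
 fixes f :: "nat => real"
 assumes "summable f"
 shows "(%k. \<Sum>j. f (j + k)) ----> 0"
proof (rule LIMSEQ_I)
 fix e :: real assume "0 < e"
 thus "EX N. ALL k>=N. norm ((\<Sum>j. f (j + k)) - 0) < e" using suminf_exist_split[OF _ assms] by simp
qed

text \<open>The almost everywhere limit supplies measurability of \<open>g\<close>; the L1 rate on
  compact sets supplies its local integrability and the convergence of pairings with continuous
  functions of compact support. Functions and components of differentials are both treated by this
  statement.\<close>

lemma locally_integrable_L1_limit:
 fixes f :: "nat => 'e::euclidean_space => real"
 assumes V: "open V" and fk: "!!k. locally_integrable V (f k)"
  and lim: "AE p in lebesgue. p : V --> (%k. f k p) ----> g p"
  and rate: "!!C. compact C ==> C <= V ==> EX e. e ----> 0 & (ALL k. (\<integral>\<^sup>+p. ennreal \<bar>g p - f k p\<bar> \<partial>lebesgue_on C) <= ennreal (e k))"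
 shows "locally_integrable V g"
  and "continuous_on UNIV h ==> compact K ==> K <= V ==> (!!p. p \<notin> K ==> h p = 0) ==>
   (%k. LINT p:V|lebesgue. f k p * h p) ----> (LINT p:V|lebesgue. g p * h p)"
proof -
 have Vl: "V : sets lebesgue" using V by auto
 have fm: "(%p. indicator V p *\<^sub>R f k p) : borel_measurable lebesgue" for k
  using locally_integrable_measurable[OF V fk[of k]] Vl by(subst (asm) borel_measurable_restrict_space_iff) auto
 have "(%p. lim (%k. indicator V p *\<^sub>R f k p)) : borel_measurable lebesgue" using fm by(rule borel_measurable_lim_metric)
 moreover have "AE p in lebesgue. lim (%k. indicator V p *\<^sub>R f k p) = indicator V p *\<^sub>R g p" using lim
 proof eventually_elim
  case (elim p)
  have "(%k. indicator V p *\<^sub>R f k p) ----> indicator V p *\<^sub>R g p" using elim by(cases "p : V") simp_all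
  thus ?case by(rule limI)
 qed
 ultimately have gmV: "(%p. indicator V p *\<^sub>R g p) : borel_measurable lebesgue" by(rule borel_measurable_AE)
 hence gm: "g : borel_measurable (lebesgue_on V)" using Vl by(subst borel_measurable_restrict_space_iff) auto
 have Cl: "C : sets lebesgue" if "compact C" for C :: "'e set" using that by(intro fmeasurableD lmeasurable_compact)
 have diff: "integrable (lebesgue_on C) (%p. g p - f k p)" if C: "compact C" "C <= V" for C k
 proof -
  obtain e where e: "!!k. (\<integral>\<^sup>+p. ennreal \<bar>g p - f k p\<bar> \<partial>lebesgue_on C) <= ennreal (e k)" using rate[OF C] by blast
  have "g : borel_measurable (lebesgue_on C)" "f k : borel_measurable (lebesgue_on C)"
   using measurable_restrict_mono[OF gm C(2)] measurable_restrict_mono[OF locally_integrable_measurable[OF V fk] C(2)] by blast+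
  thus ?thesis using le_less_trans[OF e[of k], of \<infinity>] by(intro integrableI_bounded borel_measurable_diff) auto
 qed
 have fC: "integrable (lebesgue_on C) (f k)" if C: "compact C" "C <= V" for C k using fk[of k] C Cl[OF C(1)] unfolding locally_integrable_def set_integrable_def
  by(subst integrable_restrict_space) auto
 show g: "locally_integrable V g" unfolding locally_integrable_def
 proof (intro allI impI, elim conjE)
  fix C assume C: "compact C" "C <= V"
  have "integrable (lebesgue_on C) (%p. (g p - f 0 p) + f 0 p)" by(rule Bochner_Integration.integrable_add[OF diff[OF C] fC[OF C]])
  hence "integrable (lebesgue_on C) g" by simp
  thus "set_integrable lebesgue C g" unfolding set_integrable_def using Cl[OF C(1)] by(subst (asm) integrable_restrict_space) auto
 qed
 assume h: "continuous_on UNIV h" and K: "compact K" "K <= V" "!!p. p \<notin> K ==> h p = 0"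
 obtain e where e: "e ----> 0" "!!k. (\<integral>\<^sup>+p. ennreal \<bar>g p - f k p\<bar> \<partial>lebesgue_on K) <= ennreal (e k)" using rate[OF K(1,2)] by blast
 obtain B where B: "!!p. p : K ==> \<bar>h p\<bar> <= B" "0 <= B"
 proof -
  obtain B where "!!p. p : K ==> \<bar>h p\<bar> <= B" using compact_imp_bounded[OF compact_continuous_image[OF continuous_on_subset[OF h subset_UNIV] K(1)]]
   by(auto simp: bounded_iff)
  thus ?thesis using that[of "max 0 B"] by fastforce
 qed
 note I = locally_integrable_times_test[OF V _ h K]
 have bound: "\<bar>(LINT p:V|lebesgue. f k p * h p) - (LINT p:V|lebesgue. g p * h p)\<bar> <= B * \<bar>e k\<bar>" for k
 proof -
  have "(LINT p:V|lebesgue. f k p * h p) - (LINT p:V|lebesgue. g p * h p) = (LINT p:V|lebesgue. f k p * h p - g p * h p)"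
   by(rule set_integral_diff(2)[OF I[OF fk] I[OF g], symmetric])
  also have "... = (LINT p|lebesgue_on K. (f k p - g p) * h p)" unfolding set_lebesgue_integral_def using Cl[OF K(1)] K(2,3)
   by(subst integral_restrict_space) (auto intro!: Bochner_Integration.integral_cong simp: indicator_def algebra_simps)
  finally have eq: "(LINT p:V|lebesgue. f k p * h p) - (LINT p:V|lebesgue. g p * h p) = (LINT p|lebesgue_on K. (f k p - g p) * h p)" .
  have "\<bar>LINT p|lebesgue_on K. (f k p - g p) * h p\<bar> <= (LINT p|lebesgue_on K. \<bar>(f k p - g p) * h p\<bar>)" by(rule integral_abs_bound)
  also have "... <= (LINT p|lebesgue_on K. B * \<bar>g p - f k p\<bar>)"
  proof (rule integral_mono_AE')
   show "integrable (lebesgue_on K) (%p. B * \<bar>g p - f k p\<bar>)" using diff[OF K(1,2)] by auto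
   show "AE p in lebesgue_on K. \<bar>(f k p - g p) * h p\<bar> <= B * \<bar>g p - f k p\<bar>"
   proof (rule AE_I2)
    fix p assume "p : space (lebesgue_on K)"
    hence "\<bar>h p\<bar> <= B" using B(1) by simp
    thus "\<bar>(f k p - g p) * h p\<bar> <= B * \<bar>g p - f k p\<bar>"
     using mult_left_mono[of "\<bar>h p\<bar>" B "\<bar>f k p - g p\<bar>"] by(simp add: abs_mult abs_minus_commute mult.commute)
   qed
   show "AE p in lebesgue_on K. 0 <= B * \<bar>g p - f k p\<bar>" using B(2) by(intro AE_I2) auto
  qed
  also have "... = B * (LINT p|lebesgue_on K. \<bar>g p - f k p\<bar>)" by simp
  also have "... <= B * \<bar>e k\<bar>"
  proof (rule mult_left_mono[OF _ B(2)])
   have "ennreal (LINT p|lebesgue_on K. \<bar>g p - f k p\<bar>) = (\<integral>\<^sup>+p. ennreal \<bar>g p - f k p\<bar> \<partial>lebesgue_on K)"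
    using diff[OF K(1,2), of k] by(intro nn_integral_eq_integral[symmetric]) auto
   also have "... <= ennreal \<bar>e k\<bar>" using e(2)[of k] ennreal_leI[of "e k" "\<bar>e k\<bar>"] by(auto intro: order_trans)
   finally show "(LINT p|lebesgue_on K. \<bar>g p - f k p\<bar>) <= \<bar>e k\<bar>" by(simp add: ennreal_le_iff)
  qed
  finally show ?thesis unfolding eq .
 qed
 have "(%k. B * \<bar>e k\<bar>) ----> 0" using tendsto_mult_right_zero[OF tendsto_rabs_zero[OF e(1)], of B] .
 thus "(%k. LINT p:V|lebesgue. f k p * h p) ----> (LINT p:V|lebesgue. g p * h p)"
  by(rule LIM_zero_cancel[OF Lim_null_comparison[rotated]]) (simp only: real_norm_def bound eventually_True)
qed

context compact_finsler
begin

lemma tangent_add: "x : M ==> X : tangent_space x ==> Y : tangent_space x ==> (%c. X c + Y c) : tangent_space x"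
proof -
 assume x: "x : M" and X: "X : tangent_space x" and Y: "Y : tangent_space x"
 obtain c where c: "c : A" "x : fst c" using ex_chart[OF x] by blast
 have "tangent_of c x (X c + Y c) = (%c'. X c' + Y c')" unfolding tangent_of_add[OF c] tangent_of_coord[OF c X] tangent_of_coord[OF c Y] ..
 thus ?thesis using tangent_of_in[OF c, of "X c + Y c"] by simp
qed

lemma AE_M: "AE x in mu. x : M" using AE_space[of mu] by(simp add: space_BH)

lemma chart_L1_le:
 assumes c: "c : A" and C: "compact C" "C <= coords c"
 obtains a where "0 < a" "!!f :: 'm => real. chart_measurable f ==>
  (\<integral>\<^sup>+p. ennreal \<bar>f (param c p)\<bar> \<partial>lebesgue_on C) <= ennreal a * (\<integral>\<^sup>+x. ennreal \<bar>f x\<bar> \<partial>mu)"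
proof -
 obtain a where a: "0 < a" "!!f :: 'm => ennreal. (%p. f (param c p)) : borel_measurable (lebesgue_on C) ==>
    (\<integral>\<^sup>+p. f (param c p) \<partial>lebesgue_on C) <= ennreal a * (\<integral>\<^sup>+x\<in>param c ` C. f x \<partial>mu)"
  by(rule chart_nn_integral_bounds[OF assms]) (rule that)
 show ?thesis
 proof (rule that[OF a(1)])
  fix f :: "'m => real" assume f: "chart_measurable f"
  have [measurable]: "(%p. f (param c p)) : borel_measurable (lebesgue_on C)" by(rule chart_measurable_on[OF f c C(2)])
  have "(\<integral>\<^sup>+p. ennreal \<bar>f (param c p)\<bar> \<partial>lebesgue_on C) <= ennreal a * (\<integral>\<^sup>+x\<in>param c ` C. ennreal \<bar>f x\<bar> \<partial>mu)"
   by(rule a(2)) measurable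
  also have "... <= ennreal a * (\<integral>\<^sup>+x. ennreal \<bar>f x\<bar> \<partial>mu)" by(intro mult_left_mono nn_integral_mono) (auto simp: indicator_def)
  finally show "(\<integral>\<^sup>+p. ennreal \<bar>f (param c p)\<bar> \<partial>lebesgue_on C) <= ennreal a * (\<integral>\<^sup>+x. ennreal \<bar>f x\<bar> \<partial>mu)" .
 qed
qed

lemma nn_integral_abs_le_L2:
 assumes "f : L2F"
 shows "(\<integral>\<^sup>+x. ennreal \<bar>f x\<bar> \<partial>mu) <= ennreal (nrm (%x. 1) * nrm f)"
proof -
 note L = L1_le_L2[OF finite_measure_BH assms]
 have "(\<integral>\<^sup>+x. ennreal \<bar>f x\<bar> \<partial>mu) = ennreal (LINT x|mu. \<bar>f x\<bar>)" using L(1) by(intro nn_integral_eq_integral) auto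
 thus ?thesis using L(2) by(simp add: ennreal_leI)
qed

lemma chart_measurable_AE_limit:
 fixes u :: "'m => real"
 assumes g: "!!k. chart_measurable (g k)" and lim: "AE x in mu. (%k. g k x) ----> u x"
 shows "chart_measurable u" unfolding chart_measurable_def
proof
 fix c assume c: "c : A"
 have gm: "(%p. indicator (coords c) p *\<^sub>R g k (param c p)) : borel_measurable lebesgue" for k
  using chart_measurableD[OF g[of k] c] coords_lebesgue[OF c] by(subst (asm) borel_measurable_restrict_space_iff) auto
 have "(%p. lim (%k. indicator (coords c) p *\<^sub>R g k (param c p))) : borel_measurable lebesgue" using gm by(rule borel_measurable_lim_metric)
 moreover have "AE p in lebesgue. lim (%k. indicator (coords c) p *\<^sub>R g k (param c p)) = indicator (coords c) p *\<^sub>R u (param c p)" using AE_chart[OF c lim]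
 proof eventually_elim
  case (elim p)
  have "(%k. indicator (coords c) p *\<^sub>R g k (param c p)) ----> indicator (coords c) p *\<^sub>R u (param c p)" using elim by(cases "p : coords c") simp_all
  thus ?case by(rule limI)
 qed
 ultimately have "(%p. indicator (coords c) p *\<^sub>R u (param c p)) : borel_measurable lebesgue" by(rule borel_measurable_AE)
 thus "(%p. u (param c p)) : borel_measurable (lebesgue_on (coords c))" using coords_lebesgue[OF c] by(subst borel_measurable_restrict_space_iff) auto
qed

lemma weak_differential_diff:
 "wd u om ==> wd v et ==> wd (%x. u x - v x) (%x X. om x X - et x X)" using weak_differential_lincomb[of u om v et 1 "-1"] by simp

lemma co_finsler_diff_le:
 assumes x: "x : M" and "xi : cotangent_space x" "et : cotangent_space x"
 shows "\<bar>co_finsler x xi - co_finsler x et\<bar> <= co_finsler x (%X. xi X - et X)"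
proof -
 have le: "co_finsler x xi - co_finsler x et <= co_finsler x (%X. xi X - et X)"
  if "xi : cotangent_space x" "et : cotangent_space x" for xi et using co_finsler_triangle[OF x cotangent_diff[OF that] that(2)] by simp
 have "co_finsler x (%X. et X - xi X) = co_finsler x (%X. xi X - et X)" using co_finsler_scale[OF x cotangent_diff[OF assms(2,3)], of "-1"] by simp
 thus ?thesis using le[OF assms(2,3)] le[OF assms(3,2)] by simp
qed

text \<open>Along a subsequence with summable energy differences the differentials converge, tangent
  vector by tangent vector, at almost every point, because the pointwise dual norms of consecutive
  differences are summable there. The limit is a covector, the defining identities pass to the limit
  in L1 on compact sets, and Fatou's lemma yields convergence in energy.\<close>

proposition FH_complete:
 assumes h: "!!n. h n : FH" and u: "u : L2F"
  and hu: "(%n. nrm (%x. h n x - u x)) ----> 0"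
  and C: "ALL e>0. EX N. ALL m>=N. ALL n>=N. nrm (D (%x. h m x - h n x)) < e"
 shows "u : FH" "(%n. nrm (D (%x. u x - h n x))) ----> 0"
proof -
 obtain r0 :: "nat => nat" where r0: "strict_mono r0" "AE x in mu. (%n. h (r0 n) x) ----> u x" using L2_tendsto_AE_subseq[OF FH_L2(1)[OF h] u hu] by blast
 have "ALL e>0. EX N. ALL m>=N. ALL n>=N. nrm (D (%x. h (r0 m) x - h (r0 n) x)) < e"
 proof (intro allI impI)
  fix e :: real assume "0 < e"
  then obtain N where N: "!!m n. m >= N ==> n >= N ==> nrm (D (%x. h m x - h n x)) < e" using C by blast
  have "r0 n >= N" if "n >= N" for n using strict_mono_imp_increasing[OF r0(1), of n] that by simp
  thus "EX N. ALL m>=N. ALL n>=N. nrm (D (%x. h (r0 m) x - h (r0 n) x)) < e" using N by blast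
 qed
 then obtain r1 :: "nat => nat" where r1: "strict_mono r1"
  "!!k m n. m >= r1 k ==> n >= r1 k ==> nrm (D (%x. h (r0 m) x - h (r0 n) x)) < (1/2) ^ k" by(rule fast_Cauchy_subseq[where \<epsilon>="%k. (1/2) ^ k"]) auto
 define g where "g k = h (r0 (r1 k))" for k
 have gFH: "g k : FH" for k by(simp add: g_def h)
 have gu: "AE x in mu. (%k. g k x) ----> u x" using r0(2)
 proof eventually_elim
  case (elim x)
  from LIMSEQ_subseq_LIMSEQ[OF elim r1(1)] show ?case by(simp add: g_def o_def)
 qed
 have gu2: "(%k. nrm (%x. g k x - u x)) ----> 0" using LIMSEQ_subseq_LIMSEQ[OF hu strict_mono_o[OF r0(1) r1(1)]] by(simp add: g_def o_def)
 have "EX om. wd (g k) om" for k using gFH[of k] by(auto simp: finite_H_norm_def)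
 then obtain om where om: "!!k. wd (g k) (om k)" by metis
 define de where "de j = D (%x. g (Suc j) x - g j x)" for j
 have deL: "de j : L2F" for j unfolding de_def by(rule FH_L2(2)[OF FH_diff(1)[OF gFH gFH]])
 have den: "nrm (de j) <= (1/2) ^ j" for j unfolding de_def g_def using strict_monoD[OF r1(1), of j "Suc j"] by(intro less_imp_le[OF r1(2)]) auto
 have decm: "chart_measurable (de j)" for j unfolding de_def by(rule D_measurable(1)[OF weak_differential_diff[OF om om]])
 have sumd: "AE x in mu. summable (%j. \<bar>de j x\<bar>)" by(rule L2_summable_AE[OF finite_measure_BH deL den]) (simp add: summable_geometric)
 \<comment> \<open>Points where all estimates hold simultaneously; off them, a null set, the limit
   differential is put to 0, so that it is a covector at every point.\<close>
 define good where "good x \<longleftrightarrow> x : M & (ALL j. de j x = co_finsler x (%X. om (Suc j) x X - om j x X)) & summable (%j. \<bar>de j x\<bar>)" for x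
 have "AE x in mu. ALL j. de j x = co_finsler x (%X. om (Suc j) x X - om j x X)"
  unfolding AE_all_countable de_def using D_eq_co_finsler[OF weak_differential_diff[OF om om]] by blast
 hence good: "AE x in mu. good x" using AE_M sumd by eventually_elim (simp only: good_def simp_thms)
 note ct = weak_differentialD(1)[OF om]
 \<comment> \<open>Tail of the series of dual norms: a pointwise bound for the dual norm of the
   limit minus the k-th differential, with L1 norm of order \<open>(1/2) ^ k\<close>.\<close>
 define E where "E k x = (\<Sum>j. \<bar>de (j + k) x\<bar>)" for k x
 have step: "\<bar>om (k + i) x X - om k x X\<bar> <= (\<Sum>j<i. \<bar>de (j + k) x\<bar>) * F x X"
  if g: "good x" and X: "X : tangent_space x" for x X k i
 proof (induction i)
  case (Suc i)
  have xM: "x : M" using g by(simp add: good_def)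
  have "\<bar>om (Suc (k + i)) x X - om (k + i) x X\<bar> <= de (k + i) x * F x X"
   using co_finsler_abs_ge[OF xM cotangent_diff[OF ct[OF xM] ct[OF xM]] X, of "Suc (k + i)" "k + i"] g by(simp add: good_def)
  also have "... <= \<bar>de (i + k) x\<bar> * F x X" using F_nonneg[OF xM X] by(intro mult_right_mono) (auto simp: add.commute)
  finally show ?case using Suc by(simp add: distrib_right)
 qed simp
 have conv: "convergent (%k. om k x X)" if g: "good x" and X: "X : tangent_space x" for x X
 proof -
  have xM: "x : M" using g by(simp add: good_def)
  have "summable (%j. \<bar>de j x\<bar>)" using g unfolding good_def by blast
  hence "summable (%j. \<bar>de j x\<bar> * F x X)" by(rule summable_mult2)
  hence "summable (%j. om (Suc j) x X - om j x X)"
  proof (rule summable_comparison_test_ev[rotated])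
   show "\<forall>\<^sub>F j in sequentially. norm (om (Suc j) x X - om j x X) <= \<bar>de j x\<bar> * F x X"
    using step[OF g X, of _ 1] by(intro always_eventually allI) simp
  qed
  hence "convergent (%n. \<Sum>j<n. om (Suc j) x X - om j x X)" by(simp add: summable_iff_convergent)
  hence "convergent (%n. (om n x X - om 0 x X) + om 0 x X)" unfolding sum_lessThan_telescope[of "%k. om k x X"] by(intro convergent_add convergent_const)
  thus ?thesis by simp
 qed
 define om' where "om' x X = (if good x then lim (%k. om k x X) else 0)" for x X
 have lim: "(%k. om k x X) ----> om' x X" if "good x" "X : tangent_space x" for x X using conv[OF that] that(1) by(simp add: om'_def convergent_LIMSEQ_iff)
 have ct': "om' x : cotangent_space x" if xM: "x : M" for x
 proof (cases "good x")
  case g: True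
  show ?thesis unfolding cotangent_space_def
  proof (intro CollectI conjI ballI allI)
   fix X Y assume X: "X : tangent_space x" and Y: "Y : tangent_space x"
   have "om k x (%c. X c + Y c) = om k x X + om k x Y" for k using ct[OF xM, of k] X Y unfolding cotangent_space_def by blast
   hence "(%k. om k x (%c. X c + Y c)) ----> om' x X + om' x Y" using tendsto_add[OF lim[OF g X] lim[OF g Y]] by simp
   thus "om' x (%c. X c + Y c) = om' x X + om' x Y" using LIMSEQ_unique[OF lim[OF g tangent_add[OF xM X Y]]] by blast
  next
   fix a X assume X: "X : tangent_space x"
   have "om k x (%c. a *\<^sub>R X c) = a * om k x X" for k using ct[OF xM, of k] X unfolding cotangent_space_def by blast
   hence "(%k. om k x (%c. a *\<^sub>R X c)) ----> a * om' x X" using tendsto_mult[OF tendsto_const lim[OF g X]] by simp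
   thus "om' x (%c. a *\<^sub>R X c) = a * om' x X" using LIMSEQ_unique[OF lim[OF g tangent_scale[OF X xM]]] by blast
  qed
 next
  case False
  thus ?thesis using cotangent_zero[of x] by(simp add: om'_def[abs_def])
 qed
 have E_ge: "\<bar>om' x X - om k x X\<bar> <= E k x * F x X" if g: "good x" and X: "X : tangent_space x" for x X k
 proof (rule LIMSEQ_le_const2)
  have "(%i. om (i + k) x X) ----> om' x X" using lim[OF g X] by(rule LIMSEQ_ignore_initial_segment)
  thus "(%i. \<bar>om (k + i) x X - om k x X\<bar>) ----> \<bar>om' x X - om k x X\<bar>" by(intro tendsto_intros) (simp add: add.commute)
  have sm: "summable (%j. \<bar>de (j + k) x\<bar>)" using g unfolding good_def summable_iff_shift[of "%j. \<bar>de j x\<bar>" k] by blast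
  have "(\<Sum>j<i. \<bar>de (j + k) x\<bar>) <= E k x" for i unfolding E_def by(rule sum_le_suminf[OF sm]) auto
  hence "(\<Sum>j<i. \<bar>de (j + k) x\<bar>) * F x X <= E k x * F x X" for i using F_nonneg[of x X] g X by(intro mult_right_mono) (auto simp: good_def)
  thus "EX N. ALL i>=N. \<bar>om (k + i) x X - om k x X\<bar> <= E k x * F x X" using step[OF g X, of k] order_trans by blast
 qed
 have E_co: "co_finsler x (%X. om' x X - om k x X) <= E k x" if g: "good x" for x k
 proof (rule co_finsler_le)
  show "x : M" using g by(simp add: good_def)
  show "om' x X - om k x X <= E k x * F x X" if "X : tangent_space x" for X using E_ge[OF g that, of k] by linarith
 qed
 have E_cm: "chart_measurable (E k)" for k unfolding chart_measurable_def E_def using chart_measurableD[OF decm] by(auto intro!: borel_measurable_suminf)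
 let ?c1 = "nrm (%x. 1)"
 have E_L1: "(\<integral>\<^sup>+x. ennreal \<bar>E k x\<bar> \<partial>mu) <= ennreal (?c1 * (2 * (1/2) ^ k))" for k
 proof -
  have "AE x in mu. ennreal \<bar>E k x\<bar> = (\<Sum>j. ennreal \<bar>de (j + k) x\<bar>)" using sumd
  proof eventually_elim
   case (elim x)
   have sm: "summable (%j. \<bar>de (j + k) x\<bar>)" using elim summable_iff_shift[of "%j. \<bar>de j x\<bar>" k] by simp
   thus ?case unfolding E_def using suminf_nonneg[OF sm] by(subst suminf_ennreal2) auto
  qed
  hence "(\<integral>\<^sup>+x. ennreal \<bar>E k x\<bar> \<partial>mu) = (\<integral>\<^sup>+x. (\<Sum>j. ennreal \<bar>de (j + k) x\<bar>) \<partial>mu)" by(rule nn_integral_cong_AE)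
  also have "... = (\<Sum>j. \<integral>\<^sup>+x. ennreal \<bar>de (j + k) x\<bar> \<partial>mu)" using L2_spaceD(1)[OF deL] by(intro nn_integral_suminf) auto
  also have "... <= (\<Sum>j. ennreal (?c1 * (1/2) ^ (j + k)))"
  proof (intro suminf_le)
   fix j
   show "(\<integral>\<^sup>+x. ennreal \<bar>de (j + k) x\<bar> \<partial>mu) <= ennreal (?c1 * (1/2) ^ (j + k))"
    by(rule order_trans[OF nn_integral_abs_le_L2[OF deL]]) (intro ennreal_leI mult_left_mono den L2_norm_nonneg)
  qed auto
  also have "... = ennreal (?c1 * (2 * (1/2) ^ k))"
  proof (rule suminf_ennreal_eq)
   have "(%j. (1/2::real) ^ j) sums (1 / (1 - 1/2))" by(rule geometric_sums) simp
   hence "(%j. ?c1 * (1/2) ^ k * (1/2) ^ j) sums (?c1 * (1/2) ^ k * (1 / (1 - 1/2)))" by(rule sums_mult)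
   thus "(%j. ?c1 * (1/2) ^ (j + k)) sums (?c1 * (2 * (1/2) ^ k))" by(simp add: power_add mult_ac)
  qed auto
  finally show ?thesis .
 qed
 have pow0: "(%k. (1/2::real) ^ k) ----> 0" by(rule LIMSEQ_power_zero) simp
 have ucm: "chart_measurable u" by(rule chart_measurable_AE_limit[OF weak_differential_measurable(1)[OF om] gu])
 have wd: "wd u om'"
 proof (rule weak_differentialI[OF ct'])
  fix c assume c: "c : A"
  have chart_good: "AE p in lebesgue. p : coords c --> good (param c p)" by(rule AE_chart[OF c good])
  note Lu = locally_integrable_L1_limit[OF chart_open[OF c] weak_differentialD(2)[OF om c] AE_chart[OF c gu]]
  have ratu: "EX e. e ----> 0 & (ALL k. (\<integral>\<^sup>+p. ennreal \<bar>u (param c p) - g k (param c p)\<bar> \<partial>lebesgue_on C) <= ennreal (e k))"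
   if Cc: "compact C" "C <= coords c" for C
  proof -
   obtain a where a: "0 < a" "!!f :: 'm => real. chart_measurable f ==>
    (\<integral>\<^sup>+p. ennreal \<bar>f (param c p)\<bar> \<partial>lebesgue_on C) <= ennreal a * (\<integral>\<^sup>+x. ennreal \<bar>f x\<bar> \<partial>mu)"
    by(rule chart_L1_le[OF c Cc]) (rule that)
   have cm: "chart_measurable (%x. u x - g k x)" for k unfolding chart_measurable_def
    using chart_measurableD[OF ucm] chart_measurableD[OF weak_differential_measurable(1)[OF om]] by(auto intro!: borel_measurable_diff)
   have "(\<integral>\<^sup>+p. ennreal \<bar>u (param c p) - g k (param c p)\<bar> \<partial>lebesgue_on C) <= ennreal (a * (?c1 * nrm (%x. g k x - u x)))" for k
   proof -
    have "(\<integral>\<^sup>+p. ennreal \<bar>u (param c p) - g k (param c p)\<bar> \<partial>lebesgue_on C) <= ennreal a * (\<integral>\<^sup>+x. ennreal \<bar>u x - g k x\<bar> \<partial>mu)"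
     by(rule a(2)[OF cm])
    also have "... <= ennreal a * ennreal (?c1 * nrm (%x. u x - g k x))" by(intro mult_left_mono nn_integral_abs_le_L2 L2_space_diff u FH_L2(1)[OF gFH]) auto
    finally show ?thesis using a(1) by(simp add: ennreal_mult L2_norm_commute[of mu u])
   qed
   moreover have "(%k. a * (?c1 * nrm (%x. g k x - u x))) ----> a * (?c1 * 0)" by(intro tendsto_intros gu2)
   ultimately show ?thesis by(intro exI conjI) (simp, blast)
  qed
  show "locally_integrable (coords c) (%p. u (param c p))" by(rule Lu(1)[OF ratu])
  fix i :: 'e assume i: "i : Basis"
  have limi: "AE p in lebesgue. p : coords c --> (%k. comp c (om k) i p) ----> comp c om' i p"
   using chart_good by eventually_elim (use lim tangent_of_in[OF c param_in] in blast)
  note Lw = locally_integrable_L1_limit[OF chart_open[OF c] weak_differentialD(3)[OF om c i] limi]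
  have ratw: "EX e. e ----> 0 & (ALL k. (\<integral>\<^sup>+p. ennreal \<bar>comp c om' i p - comp c (om k) i p\<bar> \<partial>lebesgue_on C) <= ennreal (e k))"
   if Cc: "compact C" "C <= coords c" for C
  proof -
   obtain a where a: "0 < a" "!!f :: 'm => real. chart_measurable f ==>
    (\<integral>\<^sup>+p. ennreal \<bar>f (param c p)\<bar> \<partial>lebesgue_on C) <= ennreal a * (\<integral>\<^sup>+x. ennreal \<bar>f x\<bar> \<partial>mu)"
    by(rule chart_L1_le[OF c Cc]) (rule that)
   obtain b where b: "0 < b" "!!p xi i. p : C ==> xi : cotangent_space (param c p) ==> i : Basis ==>
     \<bar>xi (tangent_of c (param c p) i)\<bar> <= b * co_finsler (param c p) xi" by(rule co_finsler_chart_bounds[OF c Cc]) (rule that)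
   have Clb: "C : sets lebesgue" using Cc(1) by(intro fmeasurableD lmeasurable_compact)
   have "(\<integral>\<^sup>+p. ennreal \<bar>comp c om' i p - comp c (om k) i p\<bar> \<partial>lebesgue_on C) <= ennreal (a * (b * (?c1 * (2 * (1/2) ^ k))))" for k
   proof -
    have "AE p in lebesgue_on C. ennreal \<bar>comp c om' i p - comp c (om k) i p\<bar> <= ennreal \<bar>b * E k (param c p)\<bar>"
    proof -
     have "AE p in lebesgue. p : C --> \<bar>comp c om' i p - comp c (om k) i p\<bar> <= \<bar>b * E k (param c p)\<bar>" using chart_good
     proof eventually_elim
      case (elim p)
      show ?case
      proof
       assume p: "p : C"
       hence pc: "p : coords c" using Cc(2) by blast
       note xM = param_in_M[OF c pc]
       have "\<bar>comp c om' i p - comp c (om k) i p\<bar> <= b * co_finsler (param c p) (%X. om' (param c p) X - om k (param c p) X)"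
        using b(2)[OF p cotangent_diff[OF ct'[OF xM] ct[OF xM]] i] .
       also have "... <= b * E k (param c p)" using E_co elim pc b(1) by(intro mult_left_mono) auto
       finally show "\<bar>comp c om' i p - comp c (om k) i p\<bar> <= \<bar>b * E k (param c p)\<bar>" by linarith
      qed
     qed
     thus ?thesis using Clb by(subst AE_restrict_space_iff) (auto intro!: ennreal_leI elim!: eventually_mono)
    qed
    hence "(\<integral>\<^sup>+p. ennreal \<bar>comp c om' i p - comp c (om k) i p\<bar> \<partial>lebesgue_on C) <= (\<integral>\<^sup>+p. ennreal \<bar>b * E k (param c p)\<bar> \<partial>lebesgue_on C)"
     by(rule nn_integral_mono_AE)
    also have "... <= ennreal a * (\<integral>\<^sup>+x. ennreal \<bar>b * E k x\<bar> \<partial>mu)"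
     by(rule a(2)) (use chart_measurableD[OF E_cm] in \<open>auto simp: chart_measurable_def intro!: borel_measurable_times\<close>)
    also have "(\<integral>\<^sup>+x. ennreal \<bar>b * E k x\<bar> \<partial>mu) = (\<integral>\<^sup>+x. ennreal b * ennreal \<bar>E k x\<bar> \<partial>mu)"
     using b(1) by(intro nn_integral_cong) (simp add: abs_mult ennreal_mult)
    also have "... = ennreal b * (\<integral>\<^sup>+x. ennreal \<bar>E k x\<bar> \<partial>mu)" using chart_measurable_BH[OF E_cm[of k]] by(intro nn_integral_cmult) auto
    also have "ennreal a * (ennreal b * (\<integral>\<^sup>+x. ennreal \<bar>E k x\<bar> \<partial>mu)) <= ennreal a * (ennreal b * ennreal (?c1 * (2 * (1/2) ^ k)))"
     by(intro mult_left_mono E_L1) auto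
    finally show ?thesis using a(1) b(1) by(simp add: ennreal_mult)
   qed
   moreover have "(%k. a * (b * (?c1 * (2 * (1/2) ^ k)))) ----> a * (b * (?c1 * (2 * 0)))" by(intro tendsto_intros pow0)
   ultimately show ?thesis by(intro exI conjI) (simp, blast)
  qed
  show "locally_integrable (coords c) (comp c om' i)" by(rule Lw(1)[OF ratw])
  fix ps assume ps: "ps : test_functions (coords c)"
  obtain K where K: "compact K" "K <= coords c" "!!p. p \<notin> K ==> ps p = 0" "!!p i. p \<notin> K ==> fderiv ps (at p) i = 0"
   "continuous_on UNIV ps" "!!i. continuous_on UNIV (%p. fderiv ps (at p) i)" by(rule test_function_facts[OF ps]) (rule that)
  have 1: "(%k. LINT p:coords c|lebesgue. g k (param c p) * fderiv ps (at p) i) ---->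
    (LINT p:coords c|lebesgue. u (param c p) * fderiv ps (at p) i)" by(rule Lu(2)[OF ratu K(6) K(1,2,4)])
  have 2: "(%k. LINT p:coords c|lebesgue. comp c (om k) i p * ps p) ----> (LINT p:coords c|lebesgue. comp c om' i p * ps p)" by(rule Lw(2)[OF ratw K(5) K(1,2,3)])
  have "(%k. LINT p:coords c|lebesgue. g k (param c p) * fderiv ps (at p) i) ---->
    - (LINT p:coords c|lebesgue. comp c om' i p * ps p)" unfolding weak_differentialD(4)[OF om c i ps] by(rule tendsto_minus[OF 2])
  thus "(LINT p:coords c|lebesgue. u (param c p) * fderiv ps (at p) i) = - (LINT p:coords c|lebesgue. comp c om' i p * ps p)" using LIMSEQ_unique[OF 1] by blast
 qed
 \<comment> \<open>\<open>n\<close> stays fixed while the subsequence runs to its limit, so a bound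
   on the energy of \<open>g k - h n\<close> for late k becomes one for \<open>u - h n\<close>, and
   the whole sequence is reached.\<close>
 have Dlim: "D (%x. u x - h n x) : L2F & nrm (D (%x. u x - h n x)) <= e"
  if e: "!!k. k >= k0 ==> nrm (D (%x. g k x - h n x)) <= e" for n e k0
 proof -
  obtain et where et: "wd (h n) et" by(rule finite_H_normD[OF h[of n]])
  have ae1: "AE x in mu. ALL k. D (%x. g k x - h n x) x = co_finsler x (%X. om k x X - et x X)"
   unfolding AE_all_countable using D_eq_co_finsler[OF weak_differential_diff[OF om et]] by blast
  have ae: "AE x in mu. (%k. D (%x. g k x - h n x) x) ----> D (%x. u x - h n x) x" using ae1 D_eq_co_finsler[OF weak_differential_diff[OF wd et]] good
  proof eventually_elim
   case (elim x)
   have xM: "x : M" and sm: "summable (%j. \<bar>de j x\<bar>)" using elim(3) unfolding good_def by blast+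
   have b: "\<bar>co_finsler x (%X. om k x X - et x X) - co_finsler x (%X. om' x X - et x X)\<bar> <= E k x" for k
   proof -
    have "\<bar>co_finsler x (%X. om' x X - et x X) - co_finsler x (%X. om k x X - et x X)\<bar> <=
      co_finsler x (%X. (om' x X - et x X) - (om k x X - et x X))" using weak_differentialD(1)[OF et xM] by(intro co_finsler_diff_le xM cotangent_diff ct' ct)
    thus ?thesis using E_co[OF elim(3), of k] by(simp add: abs_minus_commute)
   qed
   have "(%k. E k x) ----> 0" unfolding E_def by(rule suminf_tail_tendsto_0[OF sm])
   hence "(%k. co_finsler x (%X. om k x X - et x X)) ----> co_finsler x (%X. om' x X - et x X)"
    by(rule LIM_zero_cancel[OF Lim_null_comparison[rotated]]) (simp only: real_norm_def b eventually_True)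
   thus ?case using elim(1,2) by simp
  qed
  show ?thesis using L2_Fatou[OF FH_L2(2)[OF FH_diff(1)[OF gFH h]] D_measurable(2)[OF weak_differential_diff[OF wd et]] ae, of k0 e] e by blast
 qed
 have unif: "EX N. ALL n>=N. D (%x. u x - h n x) : L2F & nrm (D (%x. u x - h n x)) <= e" if "0 < e" for e
 proof -
  obtain N where N: "!!m n. m >= N ==> n >= N ==> nrm (D (%x. h m x - h n x)) < e" using C \<open>0 < e\<close> by blast
  have mono: "r0 (r1 k) >= k" for k using strict_mono_imp_increasing[OF r0(1), of "r1 k"] strict_mono_imp_increasing[OF r1(1), of k] by simp
  have "nrm (D (%x. g k x - h n x)) <= e" if "k >= N" "n >= N" for k n unfolding g_def using that mono[of k] by(intro less_imp_le[OF N]) auto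
  thus ?thesis using Dlim by blast
 qed
 obtain n where n: "D (%x. u x - h n x) : L2F" using unif[of 1] by auto
 obtain et where et: "wd (h n) et" by(rule finite_H_normD[OF h[of n]])
 have "(%x. u x - h n x) : FH" unfolding finite_H_norm_def using n weak_differential_diff[OF wd et] L2_space_diff[OF u FH_L2(1)[OF h]] by blast
 from FH_lincomb(1)[OF this h[of n], of 1 1] show "u : FH" by simp
 show "(%n. nrm (D (%x. u x - h n x))) ----> 0"
 proof (rule LIMSEQ_I)
  fix e :: real assume "0 < e"
  then obtain N where "ALL n>=N. nrm (D (%x. u x - h n x)) <= e / 2" using unif[of "e / 2"] by auto
  thus "EX N. ALL n>=N. norm (nrm (D (%x. u x - h n x)) - 0) < e" using \<open>0 < e\<close> by(intro exI[of _ N]) force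
 qed
qed

end

section \<open>Lower semicontinuity and the chain rule\<close>

lemma L2_parallelogram:
 assumes u: "u : L2_space mu" and v: "v : L2_space mu"
 shows "(L2_norm mu (%x. 1/2 * u x + 1/2 * v x))^2 =
  ((L2_norm mu u)^2 + (L2_norm mu v)^2) / 2 - (L2_norm mu (%x. u x - v x))^2 / 4"
proof -
 note i = L2_spaceD(2)[OF u] L2_spaceD(2)[OF v] L2_spaceD(2)[OF L2_space_diff[OF u v]]
 have "(L2_norm mu (%x. 1/2 * u x + 1/2 * v x))^2 = (LINT x|mu. ((u x)^2 + (v x)^2) / 2 - (u x - v x)^2 / 4)"
  unfolding L2_norm_power2 by(rule Bochner_Integration.integral_cong) (auto simp: power2_eq_square field_simps)
 also have "... = ((L2_norm mu u)^2 + (L2_norm mu v)^2) / 2 - (L2_norm mu (%x. u x - v x))^2 / 4" unfolding L2_norm_power2 using i by simp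
 finally show ?thesis .
qed

lemma Lipschitz_from_derivative:
 fixes ps :: "real => real"
 assumes "!!t. (ps has_real_derivative ps' t) (at t)" "!!t. \<bar>ps' t\<bar> <= L"
 shows "\<bar>ps s - ps t\<bar> <= L * \<bar>s - t\<bar>" using field_differentiable_bound[of UNIV ps ps' L s t] assms by simp

lemma L2_dominated_convergence_zero:
 assumes g: "!!n. g n : borel_measurable mu" and G: "G : L2_space mu" "!!n. AE x in mu. \<bar>g n x\<bar> <= \<bar>G x\<bar>"
  and lim: "AE x in mu. (%n. g n x) ----> 0"
 shows "(%n. L2_norm mu (g n)) ----> 0"
proof -
 have "(%n. LINT x|mu. (g n x)^2) ----> (LINT x|mu. 0)"
 proof (rule integral_dominated_convergence[where w="%x. (G x)^2"])
  show "AE x in mu. (%n. (g n x)^2) ----> 0" using lim by eventually_elim (auto intro!: tendsto_eq_intros)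
  show "AE x in mu. norm ((g n x)^2) <= (G x)^2" for n using G(2)[of n] by eventually_elim (simp add: abs_le_square_iff)
 qed (use g L2_spaceD[OF G(1)] in auto)
 thus ?thesis unfolding L2_norm_def using tendsto_real_sqrt by fastforce
qed

section \<open>A quadratic form equivalent to the energy\<close>

context compact_finsler
begin

lemma differential_L2_le:
 assumes q: "(c, a, b) : pieces"
 obtains K where "0 < K"
  "!!u om i. wd u om ==> D u : L2F ==> i : Basis ==>
    comp c om i : L2_space (lebesgue_on (cbox a b)) & L2_norm (lebesgue_on (cbox a b)) (comp c om i) <= K * nrm (D u)"
proof -
 note c = pieces_chart[OF q] and C = compact_cbox[of a b] pieces_cbox[OF q]
 obtain k where k: "0 < k" "!!f :: 'm => ennreal. (%p. f (param c p)) : borel_measurable (lebesgue_on (cbox a b)) ==>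
    (\<integral>\<^sup>+p. f (param c p) \<partial>lebesgue_on (cbox a b)) <= ennreal k * (\<integral>\<^sup>+x\<in>param c ` cbox a b. f x \<partial>mu)"
  by(rule chart_nn_integral_bounds[OF c C]) (rule that)
 obtain m where m: "0 < m" "!!p xi i. p : cbox a b ==> xi : cotangent_space (param c p) ==> i : Basis ==>
    \<bar>xi (tangent_of c (param c p) i)\<bar> <= m * co_finsler (param c p) xi" by(rule co_finsler_chart_bounds[OF c C]) (rule that)
 show ?thesis
 proof (rule that[of "sqrt k * m"])
  show "0 < sqrt k * m" using k(1) m(1) by simp
  fix u om and i :: 'e assume w: "wd u om" and Du: "D u : L2F" and i: "i : Basis"
  let ?g = "%x. co_finsler x (om x)" and ?L = "lebesgue_on (cbox a b)" and ?n = "nrm (D u)"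
  have [measurable]: "(%p. ?g (param c p)) : borel_measurable ?L" by(rule chart_measurable_on[OF co_finsler_chart_measurable[OF w] c C(2)])
  have cm: "comp c om i : borel_measurable ?L" by(rule measurable_restrict_mono[OF weak_differential_measurable(2)[OF w c i] C(2)])
  have [measurable]: "D u : borel_measurable mu" using Du by(rule L2_spaceD)
  have "(\<integral>\<^sup>+p. ennreal ((comp c om i p)^2) \<partial>?L) <= (\<integral>\<^sup>+p. ennreal ((m * ?g (param c p))^2) \<partial>?L)"
  proof (intro nn_integral_mono ennreal_leI)
   fix p assume "p : space ?L"
   hence p: "p : cbox a b" by simp
   hence pc: "p : coords c" using C(2) by blast
   show "(comp c om i p)^2 <= (m * ?g (param c p))^2"
    using m(2)[OF p weak_differentialD(1)[OF w param_in_M[OF c pc]] i] by(rule abs_le_square_iff[THEN iffD1, OF order_trans[OF _ abs_ge_self]])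
  qed
  also have "... <= ennreal k * (\<integral>\<^sup>+x\<in>param c ` cbox a b. ennreal ((m * ?g x)^2) \<partial>mu)" by(rule k(2)) measurable
  also have "... <= ennreal k * (\<integral>\<^sup>+x. ennreal ((m * ?g x)^2) \<partial>mu)" by(intro mult_left_mono nn_integral_mono) (auto simp: indicator_def)
  also have "(\<integral>\<^sup>+x. ennreal ((m * ?g x)^2) \<partial>mu) = (\<integral>\<^sup>+x. ennreal ((m * D u x)^2) \<partial>mu)"
   by(rule nn_integral_cong_AE) (use D_eq_co_finsler[OF w] in \<open>eventually_elim, simp\<close>)
  also have "... = ennreal ((m * ?n)^2)" unfolding nn_integral_L2_norm[OF L2_space_cmult[OF Du]] L2_norm_cmult using m(1) by simp
  also have "ennreal k * ennreal ((m * ?n)^2) = ennreal ((sqrt k * m * ?n)^2)" using k(1) by(simp add: ennreal_mult[symmetric] power_mult_distrib)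
  finally show "comp c om i : L2_space ?L & L2_norm ?L (comp c om i) <= sqrt k * m * ?n" using L2_spaceI_nn_integral[OF cm, of "sqrt k * m * ?n"] k(1) m(1) by simp
 qed
qed

lemma differential_L2:
 assumes q: "(c, a, b) : pieces" and w: "wd u om" "D u : L2F" "i : Basis"
 shows "comp c om i : L2_space (lebesgue_on (cbox a b))" by(rule differential_L2_le[OF q]) (use w in blast)

text \<open>Sum of the Euclidean Dirichlet integrals over the boxes of the cover. It takes the
  covector field rather than the function because differentials are additive, whereas
  \<open>D\<close> goes through a choice.\<close>

definition ref_energy :: "('m => ('m, 'e) tangent => real) => real" where
 "ref_energy om = (\<Sum>(c, a, b)\<in>pieces. \<Sum>i\<in>Basis. (L2_norm (lebesgue_on (cbox a b)) (comp c om i))^2)"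

lemma ref_energy_nonneg: "0 <= ref_energy om" unfolding ref_energy_def by(intro sum_nonneg) (auto intro: sum_nonneg)

lemma ref_energy_le:
 obtains K where "0 <= K" "!!u om. wd u om ==> D u : L2F ==> ref_energy om <= K * (nrm (D u))^2"
proof -
 define good where "good q K \<longleftrightarrow> (ALL u om i. wd u om --> D u : L2F --> i : Basis -->
   L2_norm (lebesgue_on (cbox (fst (snd q)) (snd (snd q)))) (comp (fst q) om i) <= K * nrm (D u))"
  for q :: "('m, 'e) chart \<times> 'e \<times> 'e" and K
 have "EX K. good q K" if qp: "q : pieces" for q
 proof -
  obtain c a b where q: "q = (c, a, b)" by(cases q)
  obtain K where K: "!!u om i. wd u om ==> D u : L2F ==> i : Basis ==>
    comp c om i : L2_space (lebesgue_on (cbox a b)) & L2_norm (lebesgue_on (cbox a b)) (comp c om i) <= K * nrm (D u)"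
   by(rule differential_L2_le[OF qp[unfolded q]]) (rule that)
  hence "good q K" unfolding good_def q fst_conv snd_conv by blast
  thus ?thesis by blast
 qed
 then obtain K where K: "!!q. q : pieces ==> good q (K q)" using bchoice[of pieces good] by blast
 show ?thesis
 proof (rule that[of "\<Sum>q\<in>pieces. \<Sum>i\<in>(Basis :: 'e set). (K q)^2"])
  show "0 <= (\<Sum>q\<in>pieces. \<Sum>i\<in>(Basis :: 'e set). (K q)^2)" by(intro sum_nonneg) auto
  fix u om assume w: "wd u om" "D u : L2F"
  have "ref_energy om <= (\<Sum>q\<in>pieces. \<Sum>i\<in>(Basis :: 'e set). (K q * nrm (D u))^2)" unfolding ref_energy_def case_prod_beta
  proof (intro sum_mono power_mono)
   fix q and i :: 'e assume q: "q : pieces" and i: "i : Basis"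
   show "L2_norm (lebesgue_on (cbox (fst (snd q)) (snd (snd q)))) (comp (fst q) om i) <= K q * nrm (D u)" using K[OF q] w i unfolding good_def by blast
  qed auto
  thus "ref_energy om <= (\<Sum>q\<in>pieces. \<Sum>i\<in>(Basis :: 'e set). (K q)^2) * (nrm (D u))^2" by(simp add: power_mult_distrib sum_distrib_right mult.assoc)
 qed
qed

text \<open>Cauchy-Schwarz turns the square of the sum of absolute components into
  \<open>DIM('e)\<close> times the sum of squares, and the boxes cover \<open>M\<close>. The 1 added
  to the sum of the box constants keeps the factor positive.\<close>

lemma ref_energy_ge:
 obtains K where "0 < K" "!!u om. wd u om ==> D u : L2F ==> (nrm (D u))^2 <= K * ref_energy om"
proof -
 define good where "good q k \<longleftrightarrow> (ALL p:cbox (fst (snd q)) (snd (snd q)). ALL xi:cotangent_space (param (fst q) p).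
   co_finsler (param (fst q) p) xi <= k * (\<Sum>i\<in>Basis. \<bar>xi (tangent_of (fst q) (param (fst q) p) i)\<bar>))"
  for q :: "('m, 'e) chart \<times> 'e \<times> 'e" and k
 have "EX k. good q k" if "q : pieces" for q
 proof -
  obtain c a b where q: "q = (c, a, b)" by(cases q)
  note q' = that[unfolded q]
  obtain k where k: "!!p xi. p : cbox a b ==> xi : cotangent_space (param c p) ==>
    co_finsler (param c p) xi <= k * (\<Sum>i\<in>Basis. \<bar>xi (tangent_of c (param c p) i)\<bar>)"
   by(rule co_finsler_chart_bounds[OF pieces_chart[OF q'] compact_cbox pieces_cbox[OF q']]) (rule that)
  hence "good q k" unfolding good_def q fst_conv snd_conv by blast
  thus ?thesis by blast
 qed
 then obtain k where k: "!!q. q : pieces ==> good q (k q)" using bchoice[of pieces good] by blast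
 let ?S = "\<Sum>q\<in>pieces. (k q)^2 * real DIM('e)"
 obtain b where b: "0 < b" "!!f :: 'm => ennreal. chart_measurable f ==>
  (\<integral>\<^sup>+x. f x \<partial>mu) <= ennreal b * (\<Sum>(c, a, b)\<in>pieces. \<integral>\<^sup>+p. f (param c p) \<partial>lebesgue_on (cbox a b))"
  by(rule nn_integral_le_pieces) (rule that)
 show ?thesis
 proof (rule that[of "b * (?S + 1)"])
  have S: "0 <= ?S" by(intro sum_nonneg) auto
  thus "0 < b * (?S + 1)" using b(1) by(simp add: add_nonneg_pos)
  fix u om assume w: "wd u om" and Du: "D u : L2F"
  let ?g = "%x. co_finsler x (om x)"
  have piece: "(\<integral>\<^sup>+p. ennreal ((?g (param c p))^2) \<partial>lebesgue_on (cbox a b)) <=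
    ennreal ((?S + 1) * (\<Sum>i\<in>Basis. (L2_norm (lebesgue_on (cbox a b)) (comp c om i))^2))" if q: "(c, a, b) : pieces" for c a b
  proof -
   note c = pieces_chart[OF q] and C = pieces_cbox[OF q]
   let ?L = "lebesgue_on (cbox a b)"
   note L2 = differential_L2[OF q w Du]
   have "(k (c, a, b))^2 * real DIM('e) <= ?S" by(rule member_le_sum[OF q]) (auto simp: finite_pieces)
   hence "(\<integral>\<^sup>+p. ennreal ((?g (param c p))^2) \<partial>?L) <= (\<integral>\<^sup>+p. ennreal (?S + 1) * (\<Sum>i\<in>Basis. ennreal ((comp c om i p)^2)) \<partial>?L)"
   proof (intro nn_integral_mono)
    fix p assume Sk: "(k (c, a, b))^2 * real DIM('e) <= ?S" and "p : space ?L"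
    hence p: "p : cbox a b" by simp
    hence x: "param c p : M" using C param_in_M[OF c] by blast
    note ct = weak_differentialD(1)[OF w x]
    have "(?g (param c p))^2 <= (k (c, a, b) * (\<Sum>i\<in>Basis. \<bar>comp c om i p\<bar>))^2"
     using k[OF q] p ct co_finsler_nonneg[OF x ct] unfolding good_def by(intro power_mono) simp_all
    also have "... <= (k (c, a, b))^2 * (real DIM('e) * (\<Sum>i\<in>Basis. (comp c om i p)^2))"
     unfolding power_mult_distrib using sum_squared_le_sum_of_squares[of "%i. \<bar>comp c om i p\<bar>" "Basis :: 'e set"]
     by(intro mult_left_mono) (auto simp: mult.commute)
    also have "... = ((k (c, a, b))^2 * real DIM('e)) * (\<Sum>i\<in>Basis. (comp c om i p)^2)" by(simp only: mult.assoc)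
    also have "... <= (?S + 1) * (\<Sum>i\<in>Basis. (comp c om i p)^2)" using Sk by(intro mult_right_mono sum_nonneg) auto
    finally show "ennreal ((?g (param c p))^2) <= ennreal (?S + 1) * (\<Sum>i\<in>Basis. ennreal ((comp c om i p)^2))"
     using S by(simp add: sum_ennreal ennreal_mult[symmetric] sum_nonneg ennreal_leI del: ennreal_plus)
   qed
   also have "... = ennreal (?S + 1) * (\<Sum>i\<in>Basis. \<integral>\<^sup>+p. ennreal ((comp c om i p)^2) \<partial>?L)"
    using L2_spaceD(1)[OF L2] by(subst nn_integral_cmult) (auto simp: nn_integral_sum simp del: sum_ennreal)
   also have "... = ennreal ((?S + 1) * (\<Sum>i\<in>Basis. (L2_norm ?L (comp c om i))^2))"
    using S L2 by(simp add: nn_integral_L2_norm sum_ennreal ennreal_mult sum_nonneg del: ennreal_plus)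
   finally show ?thesis .
  qed
  define X where "X q = (\<Sum>i\<in>Basis. (L2_norm (lebesgue_on (cbox (fst (snd q)) (snd (snd q)))) (comp (fst q) om i))^2)" for q
  have X0: "0 <= X q" for q by(simp add: X_def sum_nonneg)
  have XR: "ref_energy om = sum X pieces" by(simp add: ref_energy_def X_def case_prod_beta)
  have "ennreal ((nrm (D u))^2) = (\<integral>\<^sup>+x. ennreal ((?g x)^2) \<partial>mu)" unfolding nn_integral_L2_norm[OF Du, symmetric]
   by(rule nn_integral_cong_AE) (use D_eq_co_finsler[OF w] in \<open>eventually_elim, simp\<close>)
  also have "... <= ennreal b * (\<Sum>(c, a, b)\<in>pieces. \<integral>\<^sup>+p. ennreal ((?g (param c p))^2) \<partial>lebesgue_on (cbox a b))"
   by(rule b(2)) (use chart_measurableD[OF co_finsler_chart_measurable[OF w]] in \<open>auto simp: chart_measurable_def\<close>)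
  also have "... <= ennreal b * (\<Sum>q\<in>pieces. ennreal ((?S + 1) * X q))" by(intro mult_left_mono sum_mono) (auto simp del: ennreal_plus simp: X_def intro!: piece)
  also have "(\<Sum>q\<in>pieces. ennreal ((?S + 1) * X q)) = ennreal ((?S + 1) * ref_energy om)"
   unfolding XR sum_distrib_left using S X0 by(intro sum_ennreal mult_nonneg_nonneg) auto
  also have "ennreal b * ennreal ((?S + 1) * ref_energy om) = ennreal (b * ((?S + 1) * ref_energy om))" using b(1) by(simp add: ennreal_mult')
  finally show "(nrm (D u))^2 <= b * (?S + 1) * ref_energy om" using b(1) S ref_energy_nonneg[of om] by(simp add: mult.assoc ennreal_le_iff)
 qed
qed

lemma ref_energy_parallelogram:
 assumes "wd u om" "D u : L2F" "wd v et" "D v : L2F"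
 shows "ref_energy (%x X. 1/2 * om x X + 1/2 * et x X) = (ref_energy om + ref_energy et) / 2 - ref_energy (%x X. om x X - et x X) / 4"
proof -
 have *: "(L2_norm (lebesgue_on (cbox a b)) (%p. 1/2 * comp c om i p + 1/2 * comp c et i p))^2 =
   ((L2_norm (lebesgue_on (cbox a b)) (comp c om i))^2 + (L2_norm (lebesgue_on (cbox a b)) (comp c et i))^2) / 2
   - (L2_norm (lebesgue_on (cbox a b)) (%p. comp c om i p - comp c et i p))^2 / 4"
  if q: "(c, a, b) : pieces" and i: "i : Basis" for c a b i by(rule L2_parallelogram[OF differential_L2[OF q assms(1,2) i] differential_L2[OF q assms(3,4) i]])
 thus ?thesis unfolding ref_energy_def sum.distrib[symmetric] sum_divide_distrib sum_subtractf[symmetric]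
  by(intro sum.cong refl) (auto simp: sum.distrib[symmetric] sum_divide_distrib sum_subtractf[symmetric] intro!: sum.cong)
qed

text \<open>The norm of \<open>D u\<close> need not be a Hilbert norm, so weak compactness is replaced by the
 parallelogram identity of the equivalent quadratic form \<open>ref_energy\<close>.\<close>

proposition H_weak_closed:
 assumes h: "!!n. v n : H" and u: "u : L2F"
  and vu: "(%n. nrm (%x. v n x - u x)) ----> 0"
  and r: "!!e. 0 < e ==> eventually (%n. nrm (D (v n)) <= r + e) sequentially"
 shows "u : H" "nrm (D u) <= r"
proof -
 let ?e = "%k. 1 / real (Suc k)"
 \<comment> \<open>Pairs of a function and a weak differential of it, at L2 distance at most 1/(k+1)
   from \<open>u\<close> and with gradient norm at most \<open>r + 1/(k+1)\<close>. The sequence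
   \<open>v\<close> shows that they are nonempty, and a selection that is Cauchy for the quadratic
   form converges to \<open>u\<close>, which inherits the bound \<open>r\<close>.\<close>
 define S where "S k = {z. fst z : H & wd (fst z) (snd z) &
   nrm (%x. fst z x - u x) <= ?e k & nrm (D (fst z)) <= r + ?e k}" for k
 define mid :: "('m => real) \<times> ('m => ('m, 'e) tangent => real) => _ => _" where
  "mid y z = (%x. 1/2 * fst y x + 1/2 * fst z x, %x X. 1/2 * snd y x X + 1/2 * snd z x X)" for y z
 define dq where "dq y z = ref_energy (%x X. snd y x X - snd z x X)"
  for y z :: "('m => real) \<times> ('m => ('m, 'e) tangent => real)"
 obtain K where K: "0 <= K" "!!u om. wd u om ==> D u : L2F ==> ref_energy om <= K * (nrm (D u))^2" by(rule ref_energy_le) (rule that)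
 obtain K' where K': "0 < K'" "!!u om. wd u om ==> D u : L2F ==> (nrm (D u))^2 <= K' * ref_energy om" by(rule ref_energy_ge) (rule that)
 have SD: "fst z : H" "wd (fst z) (snd z)" "nrm (%x. fst z x - u x) <= ?e k" "nrm (D (fst z)) <= r + ?e k"
  "D (fst z) : L2F" if "z : S k" for z k using that FH_L2(2)[OF H_FH] by(auto simp: S_def)
 have "EX h. (ALL n. h n : S n) & (ALL e>0. EX N. ALL m>=N. ALL n>=N. dq (h m) (h n) < e)"
 proof (rule midpoint_minimizing_Cauchy[where mid=mid and q="%z. ref_energy (snd z)" and B="K * (r + 1)^2"])
  fix k
  have "eventually (%n. nrm (%x. v n x - u x) < ?e k) sequentially" using order_tendstoD(2)[OF vu, of "?e k"] by simp
  hence "eventually (%n. nrm (%x. v n x - u x) <= ?e k & nrm (D (v n)) <= r + ?e k) sequentially" using r[of "?e k"] by(rule eventually_elim2) auto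
  then obtain n where n: "nrm (%x. v n x - u x) <= ?e k" "nrm (D (v n)) <= r + ?e k" by(auto simp: eventually_sequentially)
  obtain om where "wd (v n) om" by(rule finite_H_normD[OF H_FH[OF h[of n]]])
  hence "(v n, om) : S k" using n h by(simp add: S_def)
  thus "S k ~= {}" by blast
  have "?e (Suc k) <= ?e k" by(simp add: frac_le)
  thus "S (Suc k) <= S k" unfolding S_def by force
 next
  fix k y z assume y: "y : S k" and z: "z : S k"
  note y = SD[OF y] and z = SD[OF z]
  note L = L2_space_diff[OF FH_L2(1)[OF H_FH[OF y(1)]] u] L2_space_diff[OF FH_L2(1)[OF H_FH[OF z(1)]] u]
  have eq: "(%x. 1/2 * fst y x + 1/2 * fst z x - u x) = (%x. 1/2 * (fst y x - u x) + 1/2 * (fst z x - u x))" by(simp add: fun_eq_iff algebra_simps)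
  have "nrm (%x. 1/2 * fst y x + 1/2 * fst z x - u x) <= ?e k"
   unfolding eq using L2_norm_triangle[OF L2_space_cmult[OF L(1), of "1/2"] L2_space_cmult[OF L(2), of "1/2"]] y(3) z(3) by(simp only: L2_norm_cmult)
  moreover have "nrm (D (%x. 1/2 * fst y x + 1/2 * fst z x)) <= r + ?e k" using FH_lincomb(2)[OF H_FH[OF y(1)] H_FH[OF z(1)], of "1/2" "1/2"] y(4) z(4) by simp
  ultimately show "mid y z : S k" using H_lincomb[OF y(1) z(1), of "1/2" "1/2"] weak_differential_lincomb[OF y(2) z(2), of "1/2" "1/2"] by(simp add: S_def mid_def)
 next
  fix z assume z: "z : S 0"
  show "0 <= ref_energy (snd z)" by(rule ref_energy_nonneg)
  have "(nrm (D (fst z)))^2 <= (r + 1)^2" using SD(4)[OF z] by(intro power_mono) auto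
  thus "ref_energy (snd z) <= K * (r + 1)^2" using K(2)[OF SD(2,5)[OF z]] mult_left_mono[OF _ K(1)] by(meson order_trans)
  fix y assume y: "y : S 0"
  show "ref_energy (snd (mid z y)) <= (ref_energy (snd z) + ref_energy (snd y)) / 2 - dq z y / 4"
   using ref_energy_parallelogram[OF SD(2,5)[OF z] SD(2,5)[OF y]] by(simp add: mid_def dq_def)
 qed
 then obtain z where z: "!!n. z n : S n" "!!e. 0 < e ==> EX N. ALL m>=N. ALL n>=N. dq (z m) (z n) < e" by blast
 define w where "w n = fst (z n)" for n
 note zD = SD[OF z(1), folded w_def]
 have C: "ALL e>0. EX N. ALL m>=N. ALL n>=N. nrm (D (%x. w m x - w n x)) < e"
 proof (intro allI impI)
  fix e :: real assume e: "0 < e"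
  obtain N where N: "!!m n. m >= N ==> n >= N ==> dq (z m) (z n) < e^2 / K'" using z(2)[of "e^2 / K'"] e K'(1) by auto
  have "nrm (D (%x. w m x - w n x)) < e" if mn: "m >= N" "n >= N" for m n
  proof (rule power2_less_imp_less)
   have "(nrm (D (%x. w m x - w n x)))^2 <= K' * dq (z m) (z n)"
    unfolding dq_def by(rule K'(2)[OF weak_differential_diff[OF zD(2) zD(2)] FH_L2(2)[OF FH_diff(1)[OF H_FH[OF zD(1)] H_FH[OF zD(1)]]]])
   also have "... < e^2" using N[OF mn] K'(1) by(simp add: field_simps)
   finally show "(nrm (D (%x. w m x - w n x)))^2 < e^2" .
  qed (use e in simp)
  thus "EX N. ALL m>=N. ALL n>=N. nrm (D (%x. w m x - w n x)) < e" by blast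
 qed
 have e0: "?e ----> 0" using LIMSEQ_inverse_real_of_nat by(simp add: inverse_eq_divide)
 have wu: "(%n. nrm (%x. w n x - u x)) ----> 0" by(rule Lim_null_comparison[OF _ e0]) (simp only: real_norm_def abs_of_nonneg[OF L2_norm_nonneg] zD(3) eventually_True)
 note c = FH_complete[OF H_FH[OF zD(1)] u wu C]
 show "u : H"
 proof (rule HI_approx[OF c(1)])
  fix e :: real assume "0 < e"
  have "(%n. nrm (%x. u x - w n x) + nrm (D (%x. u x - w n x))) ----> 0 + 0" using wu L2_norm_commute[of mu u] by(intro tendsto_add c(2)) simp
  then obtain n where "nrm (%x. u x - w n x) + nrm (D (%x. u x - w n x)) < e"
   using order_tendstoD(2)[of _ "0 + 0" sequentially e] \<open>0 < e\<close> by(auto simp: eventually_sequentially)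
  thus "EX s:H. H_norm (%x. u x - s x) < e" using H_norm_le_sum[of "%x. u x - w n x"] zD(1)[of n] by(intro bexI[of _ "w n"]) linarith+
 qed
 show "nrm (D u) <= r"
 proof (rule LIMSEQ_le_const)
  show "(%n. r + ?e n + nrm (D (%x. u x - w n x))) ----> r" using tendsto_add[OF tendsto_add[OF tendsto_const e0] c(2), of r] by simp
  have "nrm (D u) <= r + ?e n + nrm (D (%x. u x - w n x))" for n
   using FH_lincomb(2)[OF H_FH[OF zD(1)[of n]] FH_diff(1)[OF c(1) H_FH[OF zD(1)[of n]]], of 1 1] zD(4)[of n] by simp
  thus "EX N. ALL n>=N. nrm (D u) <= r + ?e n + nrm (D (%x. u x - w n x))" by blast
 qed
qed

lemma D_diff_le:
 assumes "u : FH" "v : FH"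
 shows "AE x in mu. \<bar>D u x - D v x\<bar> <= D (%x. u x - v x) x"
proof -
 obtain om where w: "wd u om" by(rule finite_H_normD[OF assms(1)])
 obtain et where e: "wd v et" by(rule finite_H_normD[OF assms(2)])
 show ?thesis using AE_M D_eq_co_finsler[OF w] D_eq_co_finsler[OF e] D_eq_co_finsler[OF weak_differential_diff[OF w e]]
  by eventually_elim (use co_finsler_diff_le weak_differentialD(1)[OF w] weak_differentialD(1)[OF e] in simp)
qed

text \<open>For smooth approximants \<open>t n\<close> the chain rule is exact; replacing
  \<open>ps' (t n x)\<close> by \<open>ps' (u x)\<close> costs a term that vanishes by dominated
  convergence along an almost everywhere convergent subsequence. Weak closedness of \<open>H\<close>
  then gives membership together with the upper bound.\<close>

proposition H_chain:
 fixes ps :: "real => real"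
 assumes u: "u : H" and ps: "smooth_on UNIV ps" "!!t. (ps has_real_derivative ps' t) (at t)"
  and ps': "continuous_on UNIV ps'" "!!t. \<bar>ps' t\<bar> <= L"
 shows "(%x. ps (u x)) : H" "nrm (D (%x. ps (u x))) <= nrm (%x. ps' (u x) * D u x)"
proof -
 obtain s where s: "!!n::nat. s n : Cinf" "(%n. H_norm (%x. u x - s n x)) ----> 0" using u unfolding H_def by blast
 note uFH = H_FH[OF u] and sFH = Cinf_finite_H_norm[OF s(1)]
 note uL = FH_L2[OF uFH]
 have L0: "0 <= L" using ps'(2)[of 0] by linarith
 have su: "(%n. nrm (%x. s n x - u x)) ----> 0" by(rule Lim_null_comparison[OF _ s(2)], subst L2_norm_commute) (use H_norm_ge(1) in auto)
 have sD: "(%n. nrm (D (%x. u x - s n x))) ----> 0" by(rule Lim_null_comparison[OF _ s(2)]) (use H_norm_ge(2) in auto)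
 obtain r :: "nat => nat" where r: "strict_mono r" "AE x in mu. (%n. s (r n) x) ----> u x" using L2_tendsto_AE_subseq[OF FH_L2(1)[OF sFH] uL(1) su] by blast
 define t where "t n = s (r n)" for n
 have t: "t n : Cinf" "t n : FH" for n using s(1) sFH by(simp_all add: t_def)
 note tL = FH_L2[OF t(2)]
 have tu: "(%n. nrm (%x. t n x - u x)) ----> 0" "(%n. nrm (D (%x. u x - t n x))) ----> 0"
  using LIMSEQ_subseq_LIMSEQ[OF su r(1)] LIMSEQ_subseq_LIMSEQ[OF sD r(1)] by(simp_all add: t_def o_def)
 have cps: "continuous_on UNIV ps" using ps(1) unfolding smooth_on_def by(metis Ck_on.simps(1))
 note [measurable] = L2_spaceD(1)[OF uL(1)] L2_spaceD(1)[OF uL(2)] L2_spaceD(1)[OF tL(1)] L2_spaceD(1)[OF tL(2)]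
  borel_measurable_continuous_onI[OF cps] borel_measurable_continuous_onI[OF ps'(1)]
 have lip: "\<bar>ps a - ps b\<bar> <= L * \<bar>a - b\<bar>" for a b by(rule Lipschitz_from_derivative[OF ps(2) ps'(2)])
 have mult: "(%x. g x * h x) : L2F" "nrm (%x. g x * h x) <= k * nrm h"
  if "g : borel_measurable mu" "h : L2F" "!!x. \<bar>g x\<bar> <= k" for g h k
 proof -
  have "0 <= k" using that(3) by(meson abs_ge_zero order_trans)
  hence "AE x in mu. \<bar>g x * h x\<bar> <= \<bar>k * h x\<bar>" using that(3) by(auto simp: abs_mult intro!: mult_right_mono)
  note m = L2_space_mono[OF L2_space_cmult[OF that(2), of k] borel_measurable_times[OF that(1) L2_spaceD(1)[OF that(2)]] this]
  show "(%x. g x * h x) : L2F" "nrm (%x. g x * h x) <= k * nrm h" using m \<open>0 <= k\<close> by(simp_all add: L2_norm_cmult)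
 qed
 have psuL: "(%x. ps (u x)) : L2F"
 proof -
  have "(%x. ps (u x) - ps 0) : L2F" by(rule L2_space_mono(1)[OF L2_space_cmult[OF uL(1), of L]], measurable) (use lip[of _ 0] L0 in \<open>auto simp: abs_mult\<close>)
  from L2_space_add[OF this L2_const[OF finite_measure_BH, of "ps 0"]] show ?thesis by simp
 qed
 have conv: "(%n. nrm (%x. ps (t n x) - ps (u x))) ----> 0"
 proof (rule Lim_null_comparison[OF _ tendsto_mult_right_zero[OF tu(1), of L]], rule always_eventually, rule allI)
  fix n
  have "nrm (%x. ps (t n x) - ps (u x)) <= nrm (%x. L * (t n x - u x))"
   by(rule L2_space_mono(2)[OF L2_space_cmult[OF L2_space_diff[OF tL(1) uL(1)]]], measurable) (use lip L0 in \<open>auto simp: abs_mult\<close>)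
  thus "norm (nrm (%x. ps (t n x) - ps (u x))) <= L * nrm (%x. t n x - u x)" using L0 by(simp add: L2_norm_cmult)
 qed
 let ?r = "nrm (%x. ps' (u x) * D u x)" and ?b = "%n. nrm (%x. (ps' (t n x) - ps' (u x)) * D u x)"
 have two: "\<bar>ps' a - ps' b\<bar> <= 2 * L" for a b using ps'(2)[of a] ps'(2)[of b] by linarith
 have b0: "?b ----> 0"
 proof (rule L2_dominated_convergence_zero[OF _ L2_space_cmult[OF uL(2), of "2 * L"]])
  show "AE x in mu. \<bar>(ps' (t n x) - ps' (u x)) * D u x\<bar> <= \<bar>2 * L * D u x\<bar>" for n using two L0 by(auto simp: abs_mult intro!: mult_right_mono)
  show "AE x in mu. (%n. (ps' (t n x) - ps' (u x)) * D u x) ----> 0" using r(2)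
  proof eventually_elim
   case (elim x)
   have "(%n. ps' (t n x)) ----> ps' (u x)" using continuous_on_tendsto_compose[OF ps'(1) elim] by(simp add: t_def)
   thus ?case by(intro tendsto_mult_left_zero LIM_zero)
  qed
 qed measurable
 have Dv: "nrm (D (%x. ps (t n x))) <= ?r + (?b n + L * nrm (D (%x. u x - t n x)))" for n
 proof -
  have "nrm (D (%x. ps (t n x))) = nrm (%x. ps' (t n x) * D (t n) x)"
  proof (rule L2_norm_cong_AE)
   show "AE x in mu. \<bar>D (%x. ps (t n x)) x\<bar> = \<bar>ps' (t n x) * D (t n) x\<bar>"
    using D_compose_smooth[OF t(1)[of n] ps] by eventually_elim (simp add: abs_mult)
   show "D (%x. ps (t n x)) : borel_measurable mu" by(rule L2_spaceD(1)[OF FH_L2(2)[OF Cinf_finite_H_norm[OF Cinf_compose[OF t(1) ps(1)]]]])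
  qed measurable
  \<comment> \<open>The target term plus two errors, one from the coefficient and one from the
    gradient.\<close>
  also have "... = nrm (%x. ps' (u x) * D u x + ((ps' (t n x) - ps' (u x)) * D u x + ps' (t n x) * (D (t n) x - D u x)))" by(simp add: algebra_simps)
  also have "... <= ?r + nrm (%x. (ps' (t n x) - ps' (u x)) * D u x + ps' (t n x) * (D (t n) x - D u x))"
   by(intro L2_norm_triangle L2_space_add mult(1)[of _ _ L] mult(1)[of _ _ "2 * L"] uL(2) L2_space_diff tL(2) ps'(2) two) measurable
  also have "... <= ?r + (?b n + nrm (%x. ps' (t n x) * (D (t n) x - D u x)))"
   by(intro add_left_mono L2_norm_triangle mult(1)[of _ _ L] mult(1)[of _ _ "2 * L"] uL(2) L2_space_diff tL(2) ps'(2) two) measurable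
  also have "nrm (%x. ps' (t n x) * (D (t n) x - D u x)) <= L * nrm (%x. D (t n) x - D u x)" by(intro mult(2) L2_space_diff tL(2) uL(2) ps'(2)) measurable
  also have "nrm (%x. D (t n) x - D u x) <= nrm (D (%x. u x - t n x))"
  proof (rule L2_space_mono(2)[OF FH_L2(2)[OF FH_diff(1)[OF uFH t(2)]]])
   show "AE x in mu. \<bar>D (t n) x - D u x\<bar> <= \<bar>D (%x. u x - t n x) x\<bar>" using D_diff_le[OF uFH t(2)[of n]] by eventually_elim linarith
  qed measurable
  finally show ?thesis using L0 by(simp add: mult_left_mono)
 qed
 have z: "(%n. ?b n + L * nrm (D (%x. u x - t n x))) ----> 0" using tendsto_add[OF b0 tendsto_mult_right_zero[OF tu(2), of L]] by simp
 have ev: "eventually (%n. nrm (D (%x. ps (t n x))) <= ?r + e) sequentially" if "0 < e" for e using order_tendstoD(2)[OF z that]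
 proof eventually_elim
  case (elim n) thus ?case using Dv[of n] by linarith
 qed
 show "(%x. ps (u x)) : H" "nrm (D (%x. ps (u x))) <= ?r" using H_weak_closed[OF Cinf_H[OF Cinf_compose[OF t(1) ps(1)]] psuL conv ev] by blast+
qed

text \<open>The functions \<open>t - e * arctan (t / e)\<close> converge uniformly to t as e tends
  to 0, while their derivatives lie between 0 and 1 and vanish at 0. Composed with \<open>u\<close>
  they have an energy that only sees the set where \<open>u\<close> is nonzero, and weak closedness
  passes this on to \<open>u\<close>.\<close>

proposition D_local:
 assumes u: "u : H"
 shows "nrm (D u) <= nrm (%x. indicator {x. u x ~= 0} x * D u x)"
proof -
 define ps where "ps e t = t - e * arctan (1 / e * t)" for e t :: real
 define ps' where "ps' e t = 1 - inverse (1 + (1 / e * t)^2)" for e t :: real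
 let ?e = "%n. inverse (real (Suc n))" and ?r = "nrm (%x. indicator {x. u x ~= 0} x * D u x)"
 note uL = FH_L2[OF H_FH[OF u]]
 note [measurable] = L2_spaceD(1)[OF uL(1)] L2_spaceD(1)[OF uL(2)]
 have sm: "smooth_on UNIV (ps e)" for e unfolding ps_def by(intro smooth_on_diff smooth_on_mult smooth_on_const smooth_on_compose_real[OF _ smooth_on_arctan]
    smooth_on_linear bounded_linear_ident open_UNIV)
 have der: "(ps e has_real_derivative ps' e t) (at t)" if "e > 0" for e t unfolding ps_def ps'_def using that by(auto intro!: derivative_eq_intros)
 have pos: "1 <= 1 + (1 / e * t)^2" for e t :: real by simp
 have bnd: "\<bar>ps' e t\<bar> <= 1" "0 <= ps' e t" "ps' e 0 = 0" for e t
  using le_imp_inverse_le[OF pos[of e t]] order.strict_trans2[OF zero_less_one pos[of e t]] unfolding ps'_def by auto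
 have ct: "continuous_on UNIV (ps' e)" for e unfolding ps'_def using order.strict_trans2[OF zero_less_one pos] by(intro continuous_intros) (metis less_irrefl)
 have ch: "(%x. ps (?e n) (u x)) : H" "nrm (D (%x. ps (?e n) (u x))) <= nrm (%x. ps' (?e n) (u x) * D u x)" for n by(rule H_chain[OF u sm der ct bnd(1)], simp)+
 have le: "nrm (D (%x. ps (?e n) (u x))) <= ?r" for n
 proof -
  have "nrm (%x. ps' (?e n) (u x) * D u x) <= ?r"
  proof (rule L2_space_mono(2))
   show "(%x. indicator {x. u x ~= 0} x * D u x) : L2F" by(rule L2_space_mono(1)[OF uL(2)]) (auto simp: indicator_def intro!: measurable_If)
   show "(%x. ps' (?e n) (u x) * D u x) : borel_measurable mu" unfolding ps'_def by measurable
   show "AE x in mu. \<bar>ps' (?e n) (u x) * D u x\<bar> <= \<bar>indicator {x. u x ~= 0} x * D u x\<bar>"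
    using bnd(1)[of "?e n"] bnd(3)[of "?e n"] by(auto simp: indicator_def abs_mult intro!: mult_left_le_one_le)
  qed
  thus ?thesis using ch(2)[of n] by simp
 qed
 show ?thesis
 proof (rule H_weak_closed(2)[OF _ uL(1)])
  show "(%x. ps (?e n) (u x)) : H" for n by(rule ch(1))
  show "(%n. nrm (%x. ps (?e n) (u x) - u x)) ----> 0"
  proof (rule Lim_null_comparison)
   show "(%n. ?e n * nrm (%x. pi / 2)) ----> 0" by(rule tendsto_mult_left_zero[OF LIMSEQ_inverse_real_of_nat])
   have at: "\<bar>arctan y\<bar> <= pi / 2" for y using arctan_bounded[of y] by auto
   have "nrm (%x. ps (?e n) (u x) - u x) <= nrm (%x. ?e n * (pi / 2))" for n
   proof (rule L2_space_mono(2)[OF L2_const[OF finite_measure_BH]])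
    have *: "\<bar>ps e y - y\<bar> = \<bar>e\<bar> * \<bar>arctan (1 / e * y)\<bar>" for e y by(simp add: ps_def abs_mult)
    show "AE x in mu. \<bar>ps (?e n) (u x) - u x\<bar> <= \<bar>?e n * (pi / 2)\<bar>" unfolding * abs_mult by(intro AE_I2 mult_left_mono order_trans[OF at]) auto
   qed (unfold ps_def, measurable)
   thus "\<forall>\<^sub>F n in sequentially. norm (nrm (%x. ps (?e n) (u x) - u x)) <= ?e n * nrm (%x. pi / 2)"
    by(simp only: L2_norm_cmult real_norm_def abs_of_nonneg[OF L2_norm_nonneg]) simp
  qed
  show "\<forall>\<^sub>F n in sequentially. nrm (D (%x. ps (?e n) (u x))) <= ?r + e" if "0 < e" for e
   using le that by(intro always_eventually allI) (meson add_increasing2 less_imp_le)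
 qed
qed

end

section \<open>Rellich's theorem\<close>

lemma lebesgue_on_cbox_continuous:
 fixes f :: "'e::euclidean_space => real"
 assumes f: "continuous_on (cbox a b) f"
 shows "integrable (lebesgue_on (cbox a b)) f" "(LINT x|lebesgue_on (cbox a b). f x) = (LINT x:cbox a b|lborel. f x)"
proof -
 show "integrable (lebesgue_on (cbox a b)) f" by(rule continuous_imp_integrable[OF f])
 have m: "(%x. indicator (cbox a b) x *\<^sub>R f x) : borel_measurable borel" by(rule borel_measurable_continuous_on_indicator[OF _ f]) simp
 have "(LINT x|lebesgue_on (cbox a b). f x) = (LINT x|lebesgue. indicator (cbox a b) x *\<^sub>R f x)" by(rule integral_restrict_space) simp
 also have "... = (LINT x:cbox a b|lborel. f x)" unfolding set_lebesgue_integral_def using m by(intro integral_completion) simp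
 finally show "(LINT x|lebesgue_on (cbox a b). f x) = (LINT x:cbox a b|lborel. f x)" .
qed

context compact_finsler
begin

lemma Cinf_continuous_chart: "s : Cinf ==> c : A ==> continuous_on (coords c) (%p. s (param c p))" using Ck_on_imp_continuous_on[OF Cinf_Ck[of s c 0]] by(simp add: o_def)

lemma Cinf_diff: "s : Cinf ==> t : Cinf ==> (%x. s x - t x) : Cinf" using Cinf_lincomb[of s t 1 "-1"] by simp

text \<open>Poincare's inequality on the grid of each box, summed over the boxes: the cell averages
  become finitely many functionals, bounded in the L2 norm, and what they miss is a small multiple
  of the energy. The functionals are integrals in charts and are evaluated on smooth functions
  only.\<close>

lemma finite_rank_estimate:
 assumes e: "0 < e"
 obtains J :: "((('m, 'e) chart \<times> 'e \<times> 'e) \<times> 'e set) set" and \<l> :: "_ => ('m => real) => real"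
 where "finite J" "!!j. j : J ==> EX C. ALL s:Cinf. \<bar>\<l> j s\<bar> <= C * nrm s"
  "!!j s t. j : J ==> s : Cinf ==> t : Cinf ==> \<l> j (%x. s x - t x) = \<l> j s - \<l> j t"
  "!!s. s : Cinf ==> (nrm s)^2 <= (\<Sum>j\<in>J. (\<l> j s)^2) + e * (nrm (D s))^2"
proof -
 obtain B where B: "0 < B" "!!f :: 'm => ennreal. chart_measurable f ==>
  (\<integral>\<^sup>+x. f x \<partial>mu) <= ennreal B * (\<Sum>(c, a, b)\<in>pieces. \<integral>\<^sup>+p. f (param c p) \<partial>lebesgue_on (cbox a b))"
  by(rule nn_integral_le_pieces) (rule that)
 obtain K where K: "0 <= K" "!!u om. wd u om ==> D u : L2F ==> ref_energy om <= K * (nrm (D u))^2" by(rule ref_energy_le) (rule that)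
 \<comment> \<open>After multiplication by the measure comparison \<open>B\<close> and the energy
   comparison \<open>K\<close> the gradient term is at most \<open>e\<close>; the 1 avoids division
   by zero.\<close>
 define \<epsilon> where "\<epsilon> = e / (B * (K + 1))"
 have \<epsilon>: "0 < \<epsilon>" using e B(1) K(1) by(simp add: \<epsilon>_def)
 let ?K = "%q :: ('m, 'e) chart \<times> 'e \<times> 'e. cbox (fst (snd q)) (snd (snd q))"
 define good where "good q \<Q> \<longleftrightarrow> finite \<Q> & (ALL Q:\<Q>. Q : sets borel & Q <= ?K q) &
  (ALL U s. open U --> ?K q <= U --> Ck_on (Suc 0) U s --> (LINT x:?K q|lborel. (s x)^2) <=
    (\<Sum>Q\<in>\<Q>. (LINT x:Q|lborel. s x)^2 / measure lborel Q) + \<epsilon> * (LINT x:?K q|lborel. grad_sq s x))"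
  for q :: "('m, 'e) chart \<times> 'e \<times> 'e" and \<Q> :: "'e set set"
 have "EX \<Q>. good q \<Q>" for q
 proof -
  obtain c a b where q: "q = (c, a, b)" by(cases q)
  show ?thesis
  proof (rule grid_estimate[OF \<epsilon>, of a b])
   fix \<Q> :: "'e set set"
   assume "finite \<Q>" "!!Q. Q : \<Q> ==> Q : sets borel" "!!Q. Q : \<Q> ==> Q <= cbox a b"
    "!!U s. open U ==> cbox a b <= U ==> Ck_on (Suc 0) U s ==> (LINT x:cbox a b|lborel. (s x)^2) <=
     (\<Sum>Q\<in>\<Q>. (LINT x:Q|lborel. s x)^2 / measure lborel Q) + \<epsilon> * (LINT x:cbox a b|lborel. grad_sq s x)"
   hence "good q \<Q>" unfolding good_def q fst_conv snd_conv by blast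
   thus ?thesis by blast
  qed
 qed
 then obtain \<Q> where \<Q>: "!!q. good q (\<Q> q)" by metis
 define J where "J = (SIGMA q:pieces. \<Q> q)"
 define I where "I j s = (LINT x:snd j|lborel. s (param (fst (fst j)) x))" for j :: "(('m, 'e) chart \<times> 'e \<times> 'e) \<times> 'e set" and s :: "'m => real"
 \<comment> \<open>The factor makes the square of the functional equal to \<open>B\<close> times the
   squared integral over the cell divided by the measure of the cell; for a cell of measure 0 it
   vanishes by the division convention.\<close>
 define \<l> where "\<l> j s = sqrt (B / measure lborel (snd j)) * I j s" for j and s :: "'m => real"
 have cont: "continuous_on (?K q) (%p. s (param (fst q) p))" if "q : pieces" "s : Cinf" for q s
 proof -
  obtain c a b where q: "q = (c, a, b)" by(cases q)
  note qp = that(1)[unfolded q]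
  show ?thesis unfolding q fst_conv snd_conv by(rule continuous_on_subset[OF Cinf_continuous_chart[OF that(2) pieces_chart[OF qp]] pieces_cbox[OF qp]])
 qed
 have JD: "fst j : pieces" "snd j : sets borel" "snd j <= ?K (fst j)" if "j : J" for j
 proof -
  have "fst j : pieces" "snd j : \<Q> (fst j)" using that unfolding J_def by auto
  thus "fst j : pieces" "snd j : sets borel" "snd j <= ?K (fst j)" using \<Q>[of "fst j"] unfolding good_def by blast+
 qed
 have int: "set_integrable lborel (snd j) (%p. s (param (fst (fst j)) p))" if j: "j : J" and s: "s : Cinf" for j s
  by(rule set_integrable_subset[OF borel_integrable_compact[OF compact_cbox cont[OF JD(1)[OF j] s], folded set_integrable_def] _ JD(3)[OF j]])
   (simp add: JD(2)[OF j])
 have fQ: "finite (\<Q> q)" for q using \<Q>[of q] unfolding good_def by blast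
 show ?thesis
 proof (rule that[of J \<l>])
  show "finite J" unfolding J_def using finite_pieces fQ by(rule finite_SigmaI)
  fix j s t assume j: "j : J" and s: "s : Cinf" and t: "t : Cinf"
  show "\<l> j (%x. s x - t x) = \<l> j s - \<l> j t" unfolding \<l>_def I_def set_integral_diff(2)[OF int[OF j s] int[OF j t]] by(simp add: right_diff_distrib)
 next
  fix j assume j: "j : J"
  obtain c a b where q: "fst j = (c, a, b)" by(cases "fst j")
  note qp = JD(1)[OF j, unfolded q]
  note c = pieces_chart[OF qp]
  obtain m where m: "0 < m" "!!f :: 'm => real. chart_measurable f ==>
   (\<integral>\<^sup>+p. ennreal \<bar>f (param c p)\<bar> \<partial>lebesgue_on (cbox a b)) <= ennreal m * (\<integral>\<^sup>+x. ennreal \<bar>f x\<bar> \<partial>mu)"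
   by(rule chart_L1_le[OF c compact_cbox pieces_cbox[OF qp]]) (rule that)
  show "EX C. ALL s:Cinf. \<bar>\<l> j s\<bar> <= C * nrm s"
  proof (intro exI ballI)
   fix s assume s: "s : Cinf"
   have ct: "continuous_on (cbox a b) (%p. \<bar>s (param c p)\<bar>)" using cont[OF JD(1)[OF j] s] unfolding q by(auto intro: continuous_on_rabs)
   have "\<bar>I j s\<bar> <= (LINT x:snd j|lborel. \<bar>s (param c x)\<bar>)" using set_integral_norm_bound[OF int[OF j s]] unfolding I_def q by simp
   also have "... <= (LINT x:cbox a b|lborel. \<bar>s (param c x)\<bar>)" unfolding set_lebesgue_integral_def
   proof (rule integral_mono)
    show "integrable lborel (%x. indicat_real (snd j) x *\<^sub>R \<bar>s (param c x)\<bar>)"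
     using set_integrable_abs[OF int[OF j s]] unfolding set_integrable_def q by simp
    show "integrable lborel (%x. indicat_real (cbox a b) x *\<^sub>R \<bar>s (param c x)\<bar>)" by(rule borel_integrable_compact[OF compact_cbox ct])
    fix x
    show "indicat_real (snd j) x *\<^sub>R \<bar>s (param c x)\<bar> <= indicat_real (cbox a b) x *\<^sub>R \<bar>s (param c x)\<bar>"
     using JD(3)[OF j] unfolding q by(auto simp: indicator_def)
   qed
   also have "... = (LINT x|lebesgue_on (cbox a b). \<bar>s (param c x)\<bar>)" by(rule lebesgue_on_cbox_continuous(2)[OF ct, symmetric])
   finally have "ennreal \<bar>I j s\<bar> <= ennreal (LINT x|lebesgue_on (cbox a b). \<bar>s (param c x)\<bar>)" by(rule ennreal_leI)
   also have "... = (\<integral>\<^sup>+p. ennreal \<bar>s (param c p)\<bar> \<partial>lebesgue_on (cbox a b))"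
    by(rule nn_integral_eq_integral[OF lebesgue_on_cbox_continuous(1)[OF ct], symmetric]) simp
   also have "... <= ennreal m * (\<integral>\<^sup>+x. ennreal \<bar>s x\<bar> \<partial>mu)"
    by(rule m(2)[OF weak_differential_measurable(1)[OF smooth_weak_differential[OF s]]])
   also have "... <= ennreal m * ennreal (nrm (%x. 1) * nrm s)" by(intro mult_left_mono nn_integral_abs_le_L2 FH_L2(1) Cinf_finite_H_norm s) simp
   also have "... = ennreal (m * nrm (%x. 1) * nrm s)" using m(1) by(simp add: ennreal_mult mult.assoc)
   finally have le: "\<bar>I j s\<bar> <= m * nrm (%x. 1) * nrm s" using m(1) by(simp add: ennreal_le_iff)
   have "0 <= B / measure lborel (snd j)" using B(1) by simp
   thus "\<bar>\<l> j s\<bar> <= sqrt (B / measure lborel (snd j)) * m * nrm (%x. 1) * nrm s"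
    using mult_left_mono[OF le, of "sqrt (B / measure lborel (snd j))"] unfolding \<l>_def abs_mult by(simp add: mult.assoc)
  qed
 next
  fix s assume s: "s : Cinf"
  note w = smooth_weak_differential[OF s] and sL = Cinf_L2[OF s]
  have piece: "(\<integral>\<^sup>+p. ennreal ((s (param (fst q) p))^2) \<partial>lebesgue_on (?K q)) <=
    ennreal ((\<Sum>Q\<in>\<Q> q. (I (q, Q) s)^2 / measure lborel Q) +
     \<epsilon> * (\<Sum>i\<in>Basis. (L2_norm (lebesgue_on (?K q)) (comp (fst q) (smooth_diff s) i))^2))" if qp: "q : pieces" for q
  proof -
   obtain c a b where q: "q = (c, a, b)" by(cases q)
   note qp' = qp[unfolded q]
   note c = pieces_chart[OF qp'] and C = pieces_cbox[OF qp']
   have ct: "continuous_on (cbox a b) (%p. (s (param c p))^2)" using cont[OF qp s] unfolding q by(auto intro: continuous_on_power)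
   have C1: "Ck_on (Suc 0) (coords c) (s \<circ> param c)" by(rule Cinf_Ck[OF s c])
   have cd: "continuous_on (cbox a b) (%p. (fderiv (s \<circ> param c) (at p) i)^2)" for i using C1 continuous_on_subset[OF _ C] by(auto intro!: continuous_on_power)
   have "(\<integral>\<^sup>+p. ennreal ((s (param c p))^2) \<partial>lebesgue_on (cbox a b)) = ennreal (LINT x:cbox a b|lborel. ((s \<circ> param c) x)^2)"
    using nn_integral_eq_integral[OF lebesgue_on_cbox_continuous(1)[OF ct]] unfolding lebesgue_on_cbox_continuous(2)[OF ct] by simp
   also have "... <= ennreal ((\<Sum>Q\<in>\<Q> q. (LINT x:Q|lborel. (s \<circ> param c) x)^2 / measure lborel Q) + \<epsilon> * (LINT x:cbox a b|lborel. grad_sq (s \<circ> param c) x))"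
    using \<Q>[of q] chart_open[OF c] C C1 unfolding good_def q fst_conv snd_conv by(intro ennreal_leI) blast
   also have "(LINT x:cbox a b|lborel. grad_sq (s \<circ> param c) x) = (\<Sum>i\<in>Basis. (L2_norm (lebesgue_on (cbox a b)) (comp c (smooth_diff s) i))^2)"
   proof -
    have "(L2_norm (lebesgue_on (cbox a b)) (comp c (smooth_diff s) i))^2 = (LINT x:cbox a b|lborel. (fderiv (s \<circ> param c) (at x) i)^2)" for i
     unfolding L2_norm_power2 lebesgue_on_cbox_continuous(2)[OF cd, symmetric]
     using C by(intro Bochner_Integration.integral_cong refl) (auto simp: smooth_diff_chart[OF s c])
    thus ?thesis unfolding grad_sq_def set_lebesgue_integral_def scaleR_sum_right
     using borel_integrable_compact[OF compact_cbox cd] by(subst Bochner_Integration.integral_sum) auto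
   qed
   finally show ?thesis unfolding I_def q by simp
  qed
  let ?X = "%q. \<Sum>Q\<in>\<Q> q. (I (q, Q) s)^2 / measure lborel Q"
  let ?Y = "%q. \<Sum>i\<in>Basis. (L2_norm (lebesgue_on (?K q)) (comp (fst q) (smooth_diff s) i))^2"
  have nn: "0 <= ?X q" "0 <= ?Y q" for q by(auto intro!: sum_nonneg)
  have nn3: "0 <= ?X q + \<epsilon> * ?Y q" for q using nn[of q] \<epsilon> by(intro add_nonneg_nonneg mult_nonneg_nonneg) auto
  have "ennreal ((nrm s)^2) = (\<integral>\<^sup>+x. ennreal ((s x)^2) \<partial>mu)" by(rule nn_integral_L2_norm[OF sL(1), symmetric])
  also have "... <= ennreal B * (\<Sum>(c, a, b)\<in>pieces. \<integral>\<^sup>+p. ennreal ((s (param c p))^2) \<partial>lebesgue_on (cbox a b))"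
   by(rule B(2)) (use chart_measurableD[OF weak_differential_measurable(1)[OF w]] in \<open>auto simp: chart_measurable_def\<close>)
  also have "... <= ennreal B * (\<Sum>q\<in>pieces. ennreal (?X q + \<epsilon> * ?Y q))" unfolding case_prod_beta by(intro mult_left_mono sum_mono piece) auto
  also have "... = ennreal (B * (\<Sum>q\<in>pieces. ?X q + \<epsilon> * ?Y q))" using B(1) by(simp only: sum_ennreal[OF nn3] ennreal_mult'[OF less_imp_le])
  finally have "(nrm s)^2 <= B * (\<Sum>q\<in>pieces. ?X q + \<epsilon> * ?Y q)"
   using B(1) nn3 by(subst (asm) ennreal_le_iff) (auto intro!: mult_nonneg_nonneg sum_nonneg)
  also have "... = (\<Sum>q\<in>pieces. B * ?X q) + B * \<epsilon> * (\<Sum>q\<in>pieces. ?Y q)"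
   by(simp only: sum.distrib sum_distrib_left[symmetric] distrib_left mult.assoc)
  also have "(\<Sum>q\<in>pieces. ?Y q) = ref_energy (smooth_diff s)" by(simp add: ref_energy_def case_prod_beta)
  also have "(\<Sum>q\<in>pieces. B * ?X q) = (\<Sum>j\<in>J. (\<l> j s)^2)"
  proof -
   have "(\<Sum>q\<in>pieces. B * ?X q) = (\<Sum>q\<in>pieces. \<Sum>Q\<in>\<Q> q. (\<l> (q, Q) s)^2)"
    unfolding sum_distrib_left using B(1) by(intro sum.cong refl) (simp add: \<l>_def power_mult_distrib)
   also have "... = (\<Sum>(q, Q)\<in>J. (\<l> (q, Q) s)^2)" unfolding J_def by(rule sum.Sigma[OF finite_pieces]) (simp add: fQ)
   also have "... = (\<Sum>j\<in>J. (\<l> j s)^2)" by(rule sum.cong[OF refl]) (simp only: case_prod_beta prod.collapse)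
   finally show ?thesis .
  qed
  finally have main: "(nrm s)^2 <= (\<Sum>j\<in>J. (\<l> j s)^2) + B * \<epsilon> * ref_energy (smooth_diff s)" .
  have "B * \<epsilon> * ref_energy (smooth_diff s) <= B * \<epsilon> * (K * (nrm (D s))^2)" using K(2)[OF w sL(2)] B(1) \<epsilon> by(intro mult_left_mono) auto
  also have "... <= e * (nrm (D s))^2"
  proof -
   have "B * \<epsilon> * (K + 1) = e" using B(1) K(1) by(simp add: \<epsilon>_def)
   moreover have "0 <= B * \<epsilon>" using B(1) \<epsilon> by simp
   ultimately have "B * \<epsilon> * K <= e" unfolding distrib_left by linarith
   thus ?thesis using mult_right_mono[of "B * \<epsilon> * K" e "(nrm (D s))^2"] by(simp add: mult.assoc)
  qed
  finally show "(nrm s)^2 <= (\<Sum>j\<in>J. (\<l> j s)^2) + e * (nrm (D s))^2" using main by linarith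
 qed
qed

text \<open>The sequence is replaced by smooth functions at distance tending to 0. A diagonal
  subsequence makes countably many functionals converge, one finite family for each accuracy
  1/(m+1); the estimate applied to differences then shows that the subsequence is Cauchy in
  L2.\<close>

proposition Rellich:
 assumes u: "!!n. u n : H" and B: "!!n. H_norm (u n) <= B"
 shows "EX r::nat=>nat. strict_mono r & (EX v:L2F. (%n. nrm (%x. u (r n) x - v x)) ----> 0)"
proof -
 have "EX s:Cinf. H_norm (%x. u n x - s x) < inverse (real (Suc n))" for n by(rule H_approx[OF u[of n], of "inverse (real (Suc n))"]) auto
 then obtain s where s: "!!n. s n : Cinf" and su: "!!n. H_norm (%x. u n x - s n x) < inverse (real (Suc n))" by metis
 note sFH = Cinf_finite_H_norm[OF s] and uFH = H_FH[OF u]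
 have sB: "H_norm (s n) <= B + 1" for n
 proof -
  have "H_norm (s n) <= H_norm (u n) + H_norm (%x. u n x - s n x)" using H_norm_minus_le[OF uFH[of n] FH_diff(1)[OF uFH[of n] sFH[of n]]] by simp
  thus ?thesis using su[of n] B[of n] inverse_le_1_iff[of "real (Suc n)"] by linarith
 qed
 have B0: "0 <= B + 1" using sB[of 0] H_norm_nonneg order_trans by blast
 define ok where "ok e J \<l> \<longleftrightarrow> finite J & (ALL j:J. EX C. ALL s:Cinf. \<bar>\<l> j s\<bar> <= C * nrm s) &
  (ALL j:J. ALL s:Cinf. ALL t:Cinf. \<l> j (%x. s x - t x) = \<l> j s - \<l> j t) &
  (ALL s:Cinf. (nrm s)^2 <= (\<Sum>j\<in>J. (\<l> j s)^2) + e * (nrm (D s))^2)"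
  for e and J :: "((('m, 'e) chart \<times> 'e \<times> 'e) \<times> 'e set) set" and \<l> :: "_ => ('m => real) => real"
 have "EX J \<l>. ok (inverse (real (Suc m))) J \<l>" for m
 proof -
  have "0 < inverse (real (Suc m))" by simp
  thus ?thesis
  proof (rule finite_rank_estimate)
   fix J :: "((('m, 'e) chart \<times> 'e \<times> 'e) \<times> 'e set) set" and \<l> :: "_ => ('m => real) => real"
   assume "finite J" "!!j. j : J ==> EX C. ALL s:Cinf. \<bar>\<l> j s\<bar> <= C * nrm s"
    "!!j s t. j : J ==> s : Cinf ==> t : Cinf ==> \<l> j (%x. s x - t x) = \<l> j s - \<l> j t"
    "!!s. s : Cinf ==> (nrm s)^2 <= (\<Sum>j\<in>J. (\<l> j s)^2) + inverse (real (Suc m)) * (nrm (D s))^2"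
   hence "ok (inverse (real (Suc m))) J \<l>" unfolding ok_def by blast
   thus ?thesis by blast
  qed
 qed
 then obtain J \<l> where ok: "!!m. ok (inverse (real (Suc m))) (J m) (\<l> m)" by metis
 define X where "X = (SIGMA m:UNIV. J m)"
 have "countable X" unfolding X_def by(intro countable_SIGMA countableI_type) (use ok ok_def countable_finite in blast)
 have "EX C. ALL s:Cinf. \<bar>\<l> (fst z) (snd z) s\<bar> <= C * nrm s" if "z : X" for z using that ok[of "fst z"] unfolding X_def ok_def by auto
 then obtain C where C: "!!z s. z : X ==> s : Cinf ==> \<bar>\<l> (fst z) (snd z) s\<bar> <= C z * nrm s" by metis
 \<comment> \<open>Dividing by one plus the modulus of \<open>C z\<close> gives all functionals the
   common bound \<open>B + 1\<close> that the diagonal argument requires; the factor is undone for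
   each functional separately.\<close>
 define g where "g n z = \<l> (fst z) (snd z) (s n) / (1 + \<bar>C z\<bar>)" for n z
 have "norm (g n z) <= B + 1" if "z : X" for n z
 proof -
  have "\<bar>\<l> (fst z) (snd z) (s n)\<bar> <= C z * nrm (s n)" by(rule C[OF that s])
  also have "... <= (1 + \<bar>C z\<bar>) * (B + 1)" using H_norm_ge(1)[of "s n"] sB[of n] by(intro mult_mono) auto
  finally show ?thesis unfolding g_def by(simp add: field_simps)
 qed
 then obtain r :: "nat => nat" where r: "strict_mono r" "!!z. z : X ==> EX l. (%n. g (r n) z) ----> l"
  by(rule function_convergent_subsequence[OF \<open>countable X\<close>, of g "B + 1"]) (assumption | rule that)+
 have conv: "EX l. (%n. \<l> m j (s (r n))) ----> l" if "j : J m" for m j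
 proof -
  obtain l where "(%n. g (r n) (m, j)) ----> l" using r(2)[of "(m, j)"] \<open>j : J m\<close> by(auto simp: X_def)
  from tendsto_mult[OF this tendsto_const[of "1 + \<bar>C (m, j)\<bar>"]]
  show ?thesis by(auto simp: g_def add_nonneg_eq_0_iff)
 qed
 have Cs: "ALL e>0. EX N. ALL m>=N. ALL n>=N. nrm (%x. s (r m) x - s (r n) x) < e"
 proof (intro allI impI)
  fix e :: real assume e: "0 < e"
  have "(%m. inverse (real (Suc m)) * (2 * (B + 1))^2) ----> 0" by(rule tendsto_mult_left_zero[OF LIMSEQ_inverse_real_of_nat])
  then obtain m where m: "inverse (real (Suc m)) * (2 * (B + 1))^2 < e^2 / 2"
   using order_tendstoD(2)[of _ 0 sequentially "e^2 / 2"] e by(auto simp: eventually_sequentially)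
  \<comment> \<open>With this \<open>d\<close> the functionals contribute at most half of
    \<open>e^2\<close>; the 1 covers an empty family.\<close>
  define d where "d = sqrt (e^2 / (2 * (1 + real (card (J m)))))"
  have d: "0 < d" "d^2 = e^2 / (2 * (1 + real (card (J m))))" using e by(auto simp: d_def)
  have "ALL j:J m. eventually (%N. ALL k>=N. ALL n>=N. \<bar>\<l> m j (s (r k)) - \<l> m j (s (r n))\<bar> < d) sequentially"
  proof
   fix j assume "j : J m"
   then obtain l where "(%n. \<l> m j (s (r n))) ----> l" using conv by blast
   from LIMSEQ_imp_Cauchy[OF this] obtain N where "ALL k>=N. ALL n>=N. dist (\<l> m j (s (r k))) (\<l> m j (s (r n))) < d" using d(1) unfolding Cauchy_def by blast
   thus "eventually (%N. ALL k>=N. ALL n>=N. \<bar>\<l> m j (s (r k)) - \<l> m j (s (r n))\<bar> < d) sequentially"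
    by(intro eventually_sequentiallyI[of N]) (auto simp: dist_real_def)
  qed
  moreover have fin: "finite (J m)" using ok by(simp add: ok_def)
  ultimately have "eventually (%N. ALL j:J m. ALL k>=N. ALL n>=N. \<bar>\<l> m j (s (r k)) - \<l> m j (s (r n))\<bar> < d) sequentially"
   by(simp add: eventually_ball_finite_distrib)
  then obtain N where N0: "ALL N'>=N. ALL j:J m. ALL k>=N'. ALL n>=N'. \<bar>\<l> m j (s (r k)) - \<l> m j (s (r n))\<bar> < d"
   unfolding eventually_sequentially by(elim exE)
  have N: "\<bar>\<l> m j (s (r k)) - \<l> m j (s (r n))\<bar> < d" if "j : J m" "k >= N" "n >= N" for j k n by(rule N0[rule_format, OF order_refl that])
  have "nrm (%x. s (r k) x - s (r n) x) < e" if kn: "k >= N" "n >= N" for k n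
  proof (rule power2_less_imp_less)
   have 1: "(nrm (%x. s (r k) x - s (r n) x))^2 <= (\<Sum>j\<in>J m. (\<l> m j (%x. s (r k) x - s (r n) x))^2)
     + inverse (real (Suc m)) * (nrm (D (%x. s (r k) x - s (r n) x)))^2" using ok[of m] Cinf_diff[OF s s] unfolding ok_def by blast
   have 2: "(\<Sum>j\<in>J m. (\<l> m j (%x. s (r k) x - s (r n) x))^2) <= (\<Sum>j\<in>J m. d^2)"
   proof (rule sum_mono)
    fix j assume j: "j : J m"
    have "\<l> m j (%x. s (r k) x - s (r n) x) = \<l> m j (s (r k)) - \<l> m j (s (r n))" using ok[of m] s j unfolding ok_def by blast
    thus "(\<l> m j (%x. s (r k) x - s (r n) x))^2 <= d^2" using N[OF j kn] d(1) by(simp add: abs_le_square_iff[symmetric])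
   qed
   have 3: "(\<Sum>j\<in>J m. d^2) <= e^2 / 2" unfolding d(2) sum_constant
   proof -
    let ?k = "real (card (J m))"
    have "?k / (1 + ?k) <= 1" by simp
    from mult_right_mono[OF this, of "e^2 / 2"] show "?k * (e^2 / (2 * (1 + ?k))) <= e^2 / 2" by(simp add: mult.commute)
   qed
   have 4: "inverse (real (Suc m)) * (nrm (D (%x. s (r k) x - s (r n) x)))^2 <= inverse (real (Suc m)) * (2 * (B + 1))^2"
   proof (intro mult_left_mono power_mono)
    show "nrm (D (%x. s (r k) x - s (r n) x)) <= 2 * (B + 1)"
     unfolding mult_2 by(rule order_trans[OF FH_diff(2)[OF sFH sFH] add_mono[OF order_trans[OF H_norm_ge(2) sB] order_trans[OF H_norm_ge(2) sB]]])
   qed auto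
   show "(nrm (%x. s (r k) x - s (r n) x))^2 < e^2" using m 1 2 3 4 by linarith
  qed (use e in simp)
  thus "EX N. ALL m>=N. ALL n>=N. nrm (%x. s (r m) x - s (r n) x) < e" by blast
 qed
 obtain v where v: "v : L2F" "(%n. nrm (%x. s (r n) x - v x)) ----> 0" using L2_complete[OF finite_measure_BH FH_L2(1)[OF sFH] Cs] by blast
 have "(%n. nrm (%x. u (r n) x - v x)) ----> 0"
 proof (rule Lim_null_comparison)
  have "(%n. inverse (real (Suc (r n)))) ----> 0" using LIMSEQ_subseq_LIMSEQ[OF LIMSEQ_inverse_real_of_nat r(1)] by(simp add: o_def)
  from tendsto_add[OF this v(2)] show "(%n. inverse (real (Suc (r n))) + nrm (%x. s (r n) x - v x)) ----> 0" by simp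
  have "nrm (%x. u (r n) x - v x) <= inverse (real (Suc (r n))) + nrm (%x. s (r n) x - v x)" for n
   using L2_norm_triangle3[OF FH_L2(1)[OF uFH] FH_L2(1)[OF sFH] v(1), of "r n" "r n"] su[of "r n"]
    H_norm_ge(1)[of "%x. u (r n) x - s (r n) x"] by linarith
  thus "eventually (%n. norm (nrm (%x. u (r n) x - v x)) <= inverse (real (Suc (r n))) + nrm (%x. s (r n) x - v x)) sequentially"
   by(intro always_eventually allI) (simp only: real_norm_def abs_of_nonneg[OF L2_norm_nonneg])
 qed
 thus ?thesis using r(1) v(1) by blast
qed

lemma Rellich_tuple:
 fixes k :: nat
 assumes u: "!!n i. i < k ==> u n i : H" and B: "!!n i. i < k ==> H_norm (u n i) <= B"
 shows "EX r::nat=>nat. strict_mono r & (ALL i<k. EX v:L2F. (%n. nrm (%x. u (r n) i x - v x)) ----> 0)" using assms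
proof (induction k)
 case 0
 thus ?case by(intro exI[of _ id]) (simp add: strict_mono_def)
next
 case (Suc k)
 then obtain r :: "nat => nat" where r: "strict_mono r"
  "!!i. i < k ==> EX v:L2F. (%n. nrm (%x. u (r n) i x - v x)) ----> 0" by force
 obtain r' :: "nat => nat" and v where r': "strict_mono r'" "v : L2F" "(%n. nrm (%x. u (r (r' n)) k x - v x)) ----> 0"
  using Rellich[of "%n. u (r n) k" B] Suc.prems by auto
 have "EX v:L2F. (%n. nrm (%x. u ((r \<circ> r') n) i x - v x)) ----> 0" if "i < Suc k" for i
 proof (cases "i = k")
  case False
  hence "i < k" using that by simp
  then obtain v where "v : L2F" "(%n. nrm (%x. u (r n) i x - v x)) ----> 0" using r(2) by blast
  thus ?thesis using LIMSEQ_subseq_LIMSEQ[OF _ r'(1), of "%n. nrm (%x. u (r n) i x - v x)"] by(intro bexI[of _ v]) (auto simp: o_def)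
 qed (use r' in \<open>auto simp: o_def\<close>)
 thus ?case using strict_mono_o[OF r(1) r'(1)] by blast
qed

end

section \<open>Capacity and quasi-continuous functions\<close>

text \<open>A smooth stand-in for the absolute value: nonnegative, zero exactly at 0, at most the
  modulus of \<open>t\<close>, with derivative bounded by 1, so that it can be composed with members
  of \<open>H\<close>.\<close>

definition soft_abs :: "real => real" where "soft_abs t = sqrt (1 + t^2) - 1"

lemma soft_abs_nonneg: "0 <= soft_abs t" by(simp add: soft_abs_def)

lemma soft_abs_eq_0 [simp]: "soft_abs t = 0 \<longleftrightarrow> t = 0" by(simp add: soft_abs_def)

lemma soft_abs_le: "soft_abs t <= \<bar>t\<bar>"
proof -
 have "sqrt (1 + t^2) <= 1 + \<bar>t\<bar>" by(rule real_le_lsqrt) (auto simp: power2_sum)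
 thus ?thesis by(simp add: soft_abs_def)
qed

lemma soft_abs_ge_1: "2 <= \<bar>t\<bar> ==> 1 <= soft_abs t"
proof -
 assume "2 <= \<bar>t\<bar>"
 hence "2^2 <= \<bar>t\<bar>^2" by(intro power_mono) auto
 hence "2 <= sqrt (1 + t^2)" by(intro real_le_rsqrt) simp
 thus ?thesis by(simp add: soft_abs_def)
qed

lemma continuous_on_soft_abs: "continuous_on UNIV soft_abs" unfolding soft_abs_def[abs_def] by(intro continuous_intros)

context compact_finsler
begin

lemma H_soft_abs:
 assumes u: "u : H"
 shows "(%x. soft_abs (a * u x)) : H" "H_norm (%x. soft_abs (a * u x)) <= \<bar>a\<bar> * H_norm u"
proof -
 define ps' where "ps' t = a * (a * t / sqrt (1 + (a * t)^2))" for t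
 note uL = FH_L2[OF H_FH[OF u]]
 note [measurable] = L2_spaceD(1)[OF uL(1)] L2_spaceD(1)[OF uL(2)]
 have sm: "smooth_on UNIV (%t. soft_abs (a * t))" unfolding soft_abs_def
  by(intro smooth_on_diff smooth_on_const open_UNIV smooth_on_compose_real[OF open_UNIV smooth_on_sqrt_one_plus_square]
    smooth_on_mult smooth_on_linear bounded_linear_ident)
 have pos: "0 < sqrt (1 + (a * t)^2)" for t by(simp add: add_pos_nonneg)
 have der: "((%t. soft_abs (a * t)) has_real_derivative ps' t) (at t)" for t
 proof -
  have "((%t. sqrt (1 + (a * t)^2)) has_real_derivative (a * t) / sqrt (1 + (a * t)^2) * a) (at t)"
   by(rule DERIV_chain2[OF sqrt_one_plus_square_deriv]) (auto intro!: derivative_eq_intros)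
  from DERIV_diff[OF this DERIV_const[of 1]] show ?thesis by(simp add: soft_abs_def ps'_def mult.commute)
 qed
 have ct: "continuous_on UNIV ps'" unfolding ps'_def using pos by(intro continuous_intros) (metis less_irrefl)
 have bd: "\<bar>ps' t\<bar> <= \<bar>a\<bar>" for t
 proof -
  have "\<bar>a * t\<bar> <= sqrt (1 + (a * t)^2)" by(rule real_le_rsqrt) simp
  hence "\<bar>a * t / sqrt (1 + (a * t)^2)\<bar> <= 1" using pos[of t] by(simp add: abs_divide)
  from mult_left_mono[OF this, of "\<bar>a\<bar>"] show ?thesis by(simp add: ps'_def abs_mult)
 qed
 note ch = H_chain[OF u sm der ct bd]
 show "(%x. soft_abs (a * u x)) : H" by(rule ch(1))
 have "AE x in mu. \<bar>soft_abs (a * u x)\<bar> <= \<bar>a * u x\<bar>" using soft_abs_nonneg soft_abs_le by(intro AE_I2) simp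
 from L2_space_mono(2)[OF L2_space_cmult[OF uL(1)] L2_spaceD(1)[OF FH_L2(1)[OF H_FH[OF ch(1)]]] this]
 have 1: "nrm (%x. soft_abs (a * u x)) <= \<bar>a\<bar> * nrm u" by(simp add: L2_norm_cmult)
 have [measurable]: "ps' : borel_measurable borel" by(rule borel_measurable_continuous_onI[OF ct])
 have "AE x in mu. \<bar>ps' (u x) * D u x\<bar> <= \<bar>a * D u x\<bar>" unfolding abs_mult by(intro AE_I2 mult_right_mono bd) simp
 hence "nrm (%x. ps' (u x) * D u x) <= nrm (%x. a * D u x)" by(intro L2_space_mono(2)[OF L2_space_cmult[OF uL(2)]]) measurable
 hence 2: "nrm (D (%x. soft_abs (a * u x))) <= \<bar>a\<bar> * nrm (D u)" using ch(2) by(simp add: L2_norm_cmult)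
 show "H_norm (%x. soft_abs (a * u x)) <= \<bar>a\<bar> * H_norm u"
 proof (rule power2_le_imp_le)
  show "(H_norm (%x. soft_abs (a * u x)))^2 <= (\<bar>a\<bar> * H_norm u)^2"
   using power_mono[OF 1, of 2] power_mono[OF 2, of 2] by(simp add: H_norm_power2 power_mult_distrib distrib_left)
 qed simp
qed

lemma Cinf_continuous_map:
 assumes s: "s : Cinf"
 shows "continuous_map T euclideanreal s" unfolding continuous_map_def
proof (intro conjI allI impI)
 fix V :: "real set" assume V: "openin euclideanreal V"
 have "{x : M. s x : V} = (\<Union>c\<in>A. param c ` (coords c Int (%p. s (param c p)) -` V))"
 proof (intro equalityI subsetI)
  fix x assume x: "x : {x : M. s x : V}"
  then obtain c where c: "c : A" "x : fst c" using ex_chart by blast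
  have "x = param c (snd c x)" "snd c x : coords c Int (%p. s (param c p)) -` V" using x c chart_in_coords[OF c(2)] by simp_all
  thus "x : (\<Union>c\<in>A. param c ` (coords c Int (%p. s (param c p)) -` V))" using c(1) by blast
 qed (use param_in_M in auto)
 moreover have "openin T (param c ` (coords c Int (%p. s (param c p)) -` V))" if c: "c : A" for c
  using continuous_open_preimage[OF Cinf_continuous_chart[OF s c] chart_open[OF c]] V by(intro openin_param_image[OF c]) auto
 ultimately show "openin T {x : M. s x : V}" by auto
qed simp

lemma cap_le:
 assumes "u : H" "!!x. x : M ==> 0 <= u x" "openin T G" "E <= G" "!!x. x : G ==> 1 <= u x"
 shows "cap E <= ennreal ((H_norm u)^2)" unfolding cap_def using assms by(intro INF_lower) auto

lemma cap_lessD: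
 assumes "cap E < e"
 obtains u G where "u : H" "!!x. x : M ==> 0 <= u x" "openin T G" "E <= G" "!!x. x : G ==> 1 <= u x" "ennreal ((H_norm u)^2) < e"
 using assms unfolding cap_def INF_less_iff by auto

lemma H_zero: "(%x. 0) : H" by(rule Cinf_H[OF Cinf_const])

lemma cap_empty [simp]: "cap {} = 0" using cap_le[of "%x. 0" "{}" "{}"] H_zero by(simp add: H_norm_zero)

text \<open>A competitor for the capacity is at least 1 on an open set containing \<open>E\<close>,
  so the measure of that open set is at most its squared norm. Working with the outer measure
  reaches arbitrary subsets \<open>E'\<close>.\<close>

lemma cap_0_null_sets:
 assumes "cap E = 0" "E' <= E" "E' <= M"
 shows "E' : null_sets mu"
proof (rule null_sets_BH[OF assms(3)])
 have "outer E' <= ennreal e" if e: "0 < e" for e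
 proof -
  have "cap E < ennreal e" using assms(1) e by simp
  then obtain u G where u: "u : H" and G: "openin T G" "E <= G" "!!x. x : G ==> 1 <= u x" and le: "ennreal ((H_norm u)^2) < ennreal e" by(rule cap_lessD) (rule that)
  note uL = FH_L2(1)[OF H_FH[OF u]]
  have "outer E' <= outer G" using assms(2) G(2) by(intro hausdorff_outer_mono) blast
  also have "... = emeasure mu G" by(rule emeasure_BH[OF openin_measurable[OF G(1)], symmetric])
  also have "... = (\<integral>\<^sup>+x. indicator G x \<partial>mu)" using openin_measurable[OF G(1)] by simp
  also have "... <= (\<integral>\<^sup>+x. ennreal ((u x)^2) \<partial>mu)" using G(3) by(intro nn_integral_mono) (auto simp: indicator_def intro!: one_le_power)
  also have "... = ennreal ((nrm u)^2)" by(rule nn_integral_L2_norm[OF uL])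
  also have "... <= ennreal ((H_norm u)^2)" by(intro ennreal_leI power_mono H_norm_ge) simp
  finally show ?thesis using le by simp
 qed
 hence "outer E' <= 0 + ennreal e" if "0 < e" for e using that by simp
 hence "outer E' <= 0" by(rule ennreal_le_epsilon)
 thus "outer E' = 0" by simp
qed

lemma cap_Un_le:
 assumes "cap E < ennreal d" "cap E' < ennreal d" "0 < d"
 shows "cap (E Un E') <= ennreal (4 * d)"
proof -
 obtain u G where u: "u : H" "!!x. x : M ==> 0 <= u x" "openin T G" "E <= G" "!!x. x : G ==> 1 <= u x" "ennreal ((H_norm u)^2) < ennreal d"
  by(rule cap_lessD[OF assms(1)]) (rule that)
 obtain v G' where v: "v : H" "!!x. x : M ==> 0 <= v x" "openin T G'" "E' <= G'" "!!x. x : G' ==> 1 <= v x" "ennreal ((H_norm v)^2) < ennreal d"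
  by(rule cap_lessD[OF assms(2)]) (rule that)
 let ?w = "%x. 1 * u x + 1 * v x"
 have "cap (E Un E') <= ennreal ((H_norm ?w)^2)"
 proof (rule cap_le[OF H_lincomb[OF u(1) v(1)]])
  show "openin T (G Un G')" "E Un E' <= G Un G'" using u v by auto
  show "0 <= ?w x" if "x : M" for x using u(2) v(2) that by simp
  fix x assume x: "x : G Un G'"
  hence "x : M" using openin_subset[OF u(3)] openin_subset[OF v(3)] by blast
  thus "1 <= ?w x" using x u(2)[of x] v(2)[of x] u(5)[of x] v(5)[of x] by auto
 qed
 also have "... <= ennreal (4 * d)"
 proof (rule ennreal_leI)
  have "(H_norm ?w)^2 <= (H_norm u + H_norm v)^2" using H_norm_lincomb[OF H_FH[OF u(1)] H_FH[OF v(1)], of 1 1] by(intro power_mono) auto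
  also have "... <= 2 * (H_norm u)^2 + 2 * (H_norm v)^2" using sum_squares_bound[of "H_norm u" "H_norm v"] by(simp add: power2_sum)
  also have "... <= 4 * d" using u(6) v(6) assms(3) by(simp add: ennreal_less_iff)
  finally show "(H_norm ?w)^2 <= 4 * d" .
 qed
 finally show ?thesis .
qed

text \<open>The sum of the \<open>w n\<close> is a competitor for the union. It lies in
  \<open>H\<close> because the partial sums have bounded energy and converge in L2; both parts of
  its norm are at most the sum of \<open>b\<close>, whence the factor 2.\<close>

lemma cap_UN_le:
 assumes w: "!!n::nat. w n : H" "!!n x. x : M ==> 0 <= w n x" "!!n. H_norm (w n) <= b n" "summable b"
  and U: "!!n. openin T (U n)" "!!n x. x : U n ==> 1 <= w n x"
 shows "cap (\<Union>n. U n) <= ennreal ((2 * suminf b)^2)"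
proof -
 have b0: "0 <= b n" for n using order_trans[OF H_norm_nonneg w(3)] .
 \<comment> \<open>Capacity asks for values at least 1 at every point of a neighbourhood, so at
   points of divergence, a null set, the value is set to 1.\<close>
 define W where "W x = (if summable (%n. w n x) then \<Sum>n. w n x else 1)" for x
 define S where "S m i x = (\<Sum>j<i. w (j + m) x)" for m i x
 have S: "S m i : H & H_norm (S m i) <= (\<Sum>j<i. b (j + m))" for m i
 proof (induction i)
  case 0
  thus ?case unfolding S_def using H_zero by(simp add: H_norm_zero)
 next
  case (Suc i)
  have eq: "S m (Suc i) = (%x. 1 * S m i x + 1 * w (i + m) x)" by(simp add: S_def fun_eq_iff)
  show ?case unfolding eq using H_lincomb[of "S m i" "w (i + m)" 1 1] H_norm_lincomb[of "S m i" "w (i + m)" 1 1] Suc w(1)[of "i + m"] w(3)[of "i + m"] H_FH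
   by(auto intro: order_trans)
 qed
 have tail: "(\<Sum>j<i. b (j + m)) <= (\<Sum>j. b (j + m))" for i m by(rule sum_le_suminf[OF summable_ignore_initial_segment[OF w(4)]]) (simp_all add: b0)
 have "AE x in mu. summable (%n. \<bar>w n x\<bar>)" by(rule L2_summable_AE[OF finite_measure_BH FH_L2(1)[OF H_FH[OF w(1)]] order_trans[OF H_norm_ge(1) w(3)] w(4)])
 hence lim: "AE x in mu. (%i. S m i x) ----> W x - S 0 m x" for m
 proof eventually_elim
  case (elim x)
  have sm: "summable (%n. w n x)" by(rule summable_rabs_cancel[OF elim])
  hence "(%i. S m i x) ----> (\<Sum>j. w (j + m) x)" unfolding S_def by(intro summable_LIMSEQ summable_ignore_initial_segment)
  moreover have "(\<Sum>j. w (j + m) x) = W x - S 0 m x" using suminf_split_initial_segment[OF sm, of m] sm by(simp add: W_def S_def)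
  ultimately show ?case by simp
 qed
 have "chart_measurable W"
 proof (rule chart_measurable_AE_limit)
  show "chart_measurable (S 0 i)" for i by(rule finite_H_normD[OF H_FH[OF conjunct1[OF S[of 0 i]]]]) (rule weak_differential_measurable(1))
  show "AE x in mu. (%i. S 0 i x) ----> W x" using lim[of 0] by(simp add: S_def)
 qed
 hence Wm: "W : borel_measurable mu" by(rule chart_measurable_BH)
 have SL: "S m i : L2F" for m i by(rule FH_L2(1)[OF H_FH[OF conjunct1[OF S]]])
 have F: "(%x. W x - S 0 m x) : L2F & nrm (%x. W x - S 0 m x) <= (\<Sum>j. b (j + m))" for m
 proof -
  have le: "nrm (S m i) <= (\<Sum>j. b (j + m))" for i using H_norm_ge(1)[of "S m i"] S[of m i] tail[of m i] by linarith
  show ?thesis by(intro conjI) (rule L2_Fatou[OF SL borel_measurable_diff[OF Wm L2_spaceD(1)[OF SL]] lim le])+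
 qed
 have W2: "W : L2F" "nrm W <= suminf b" using F[of 0] by(simp_all add: S_def)
 have conv: "(%m. nrm (%x. S 0 m x - W x)) ----> 0"
 proof (rule Lim_null_comparison[OF always_eventually suminf_tail_tendsto_0[OF w(4)]], rule allI)
  fix m show "norm (nrm (%x. S 0 m x - W x)) <= (\<Sum>j. b (j + m))" using F[of m] by(simp add: L2_norm_commute[of mu "S 0 m"])
 qed
 have Db: "eventually (%m. nrm (D (S 0 m)) <= suminf b + e) sequentially" if "0 < e" for e
 proof (intro always_eventually allI)
  fix m show "nrm (D (S 0 m)) <= suminf b + e" using H_norm_ge(2)[of "S 0 m"] conjunct2[OF S[of 0 m]] tail[of 0 m] \<open>0 < e\<close> by(simp only: add_0_right)
 qed
 have WH: "W : H" "nrm (D W) <= suminf b" by(rule H_weak_closed[OF conjunct1[OF S] W2(1) conv Db], assumption)+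
 have "cap (\<Union>n. U n) <= ennreal ((H_norm W)^2)"
 proof (rule cap_le[OF WH(1)])
  show "0 <= W x" if "x : M" for x unfolding W_def using w(2)[OF that] by(auto intro: suminf_nonneg)
  show "openin T (\<Union>n. U n)" using U(1) by auto
  fix x assume "x : (\<Union>n. U n)"
  then obtain n where n: "x : U n" by blast
  hence "x : M" using openin_subset[OF U(1)] by blast
  show "1 <= W x"
  proof (cases "summable (%n. w n x)")
   case True
   have "(\<Sum>n\<in>{n}. w n x) <= (\<Sum>n. w n x)" by(rule sum_le_suminf[OF True]) (use w(2)[OF \<open>x : M\<close>] in auto)
   thus ?thesis using True U(2)[OF n] by(simp add: W_def)
  qed (simp add: W_def)
 qed (rule subset_refl)
 also have "... <= ennreal ((2 * suminf b)^2)" using H_norm_le_sum[of W] W2(2) WH(2) by(intro ennreal_leI power_mono) auto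
 finally show ?thesis .
qed

lemma quasi_continuous_lincomb:
 assumes "quasi_continuous u" "quasi_continuous v"
 shows "quasi_continuous (%x. a * u x + b * v x)" unfolding quasi_continuous_def
proof (intro allI impI)
 fix e :: ennreal assume e: "0 < e"
 \<comment> \<open>The union of the two exceptional sets has capacity at most \<open>4 * d\<close>;
   asking for \<open>5 * d\<close> leaves room for a strict inequality.\<close>
 obtain d where d: "0 < d" "ennreal (5 * d) <= e"
 proof (cases "e = top")
  case True
  thus ?thesis using that[of 1] by simp
 next
  case False
  then obtain r where "e = ennreal r" "0 < r" using e by(cases e) auto
  thus ?thesis using that[of "r / 5"] by simp
 qed
 have d0: "0 < ennreal d" using d by simp
 obtain G where G: "openin T G" "cap G < ennreal d" "continuous_map (subtopology T (M - G)) euclideanreal u" using assms(1) d0 unfolding quasi_continuous_def by blast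
 obtain G' where G': "openin T G'" "cap G' < ennreal d" "continuous_map (subtopology T (M - G')) euclideanreal v"
  using assms(2) d0 unfolding quasi_continuous_def by blast
 have "cap (G Un G') <= ennreal (4 * d)" by(rule cap_Un_le[OF G(2) G'(2) d(1)])
 also have "... < ennreal (5 * d)" using d by(simp add: ennreal_less_iff)
 finally have "cap (G Un G') < e" using d(2) by simp
 moreover have "continuous_map (subtopology T (M - (G Un G'))) euclideanreal (%x. a * u x + b * v x)"
  by(intro continuous_map_add continuous_map_real_mult_left continuous_map_from_subtopology_mono[OF G(3)]
    continuous_map_from_subtopology_mono[OF G'(3)]) blast+
 ultimately show "EX G. openin T G & cap G < e & continuous_map (subtopology T (M - G)) euclideanreal (%x. a * u x + b * v x)"
  using G(1) G'(1) by(intro exI[of _ "G Un G'"]) auto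
qed

lemma H_qc_lincomb: "u : H_qc ==> v : H_qc ==> (%x. a * u x + b * v x) : H_qc" unfolding H_qc_def using H_lincomb quasi_continuous_lincomb by blast

lemma H_qc_zero: "(%x. 0) : H_qc"
proof -
 have "quasi_continuous (%x. 0)" unfolding quasi_continuous_def by(intro allI impI exI[of _ "{}"]) simp
 thus ?thesis using H_zero by(simp add: H_qc_def)
qed

lemma H_qc_sum: "(!!i. i < k ==> u i : H_qc) ==> (%x. \<Sum>i<(k::nat). u i x) : H_qc"
proof (induction k)
 case (Suc k)
 thus ?case using H_qc_lincomb[of "%x. \<Sum>i<k. u i x" "u k" 1 1] by simp
qed (simp add: H_qc_zero)

lemma H_qc_soft_abs: "u : H_qc ==> (%x. soft_abs (u x)) : H_qc"
proof -
 assume u: "u : H_qc"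
 have "quasi_continuous (%x. soft_abs (u x))" unfolding quasi_continuous_def
 proof (intro allI impI)
  fix e :: ennreal assume "0 < e"
  then obtain G where G: "openin T G" "cap G < e" "continuous_map (subtopology T (M - G)) euclideanreal u" using u unfolding H_qc_def quasi_continuous_def by blast
  have "continuous_map euclideanreal euclideanreal soft_abs" using continuous_on_soft_abs by simp
  from continuous_map_compose[OF G(3) this]
  show "EX G. openin T G & cap G < e & continuous_map (subtopology T (M - G)) euclideanreal (%x. soft_abs (u x))" using G(1,2) by(intro exI[of _ G]) (simp add: o_def)
 qed
 moreover have "(%x. soft_abs (u x)) : H" using H_soft_abs(1)[of u 1] u by(simp add: H_qc_def)
 ultimately show ?thesis by(simp add: H_qc_def)
qed

text \<open>Consecutive smooth approximants differ by more than \<open>(1/2) ^ n\<close> only on an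
  open set \<open>U n\<close>, and the competitors for these sets have summable norms. Off the union
  of the late \<open>U n\<close>, an open set of small capacity, the approximants converge
  uniformly, so their pointwise limit is continuous there.\<close>

proposition ex_quasi_continuous_representative:
 assumes u: "u : H"
 obtains v where "v : H_qc" "AE x in mu. v x = u x"
proof -
 have "EX s:Cinf. H_norm (%x. u x - s x) < (1/8) ^ n" for n :: nat by(rule H_approx[OF u, of "(1/8) ^ n"]) auto
 then obtain s where s: "!!n. s n : Cinf" and su: "!!n. H_norm (%x. u x - s n x) < (1/8) ^ n" by metis
 note uFH = H_FH[OF u] and sFH = Cinf_finite_H_norm[OF s]
 define d where "d n x = s (Suc n) x - s n x" for n x
 have dH: "d n : Cinf" for n unfolding d_def by(rule Cinf_diff[OF s s])
 have dn: "H_norm (d n) <= 2 * (1/8) ^ n" for n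
 proof -
  have "H_norm (d n) <= H_norm (%x. u x - s n x) + H_norm (%x. u x - s (Suc n) x)"
   using H_norm_minus_le[OF FH_diff(1)[OF uFH sFH[of n]] FH_diff(1)[OF uFH sFH[of "Suc n"]]] by(simp add: d_def[abs_def])
  moreover have "(1/8 :: real) ^ Suc n <= (1/8) ^ n" by simp
  ultimately show ?thesis using su[of n] su[of "Suc n"] by linarith
 qed
 \<comment> \<open>On \<open>U n\<close> the argument of \<open>soft_abs\<close> has modulus at
   least 2, so \<open>w n\<close> is at least 1 there. Its norm is at most
   \<open>2 * 2 ^ n * (2 * (1/8) ^ n)\<close>, which is \<open>b n\<close>; this explains the rate
   1/8.\<close>
 define w where "w n x = soft_abs (2 * 2 ^ n * d n x)" for n x
 define U where "U n = {x : M. \<bar>d n x\<bar> > (1/2) ^ n}" for n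
 define b where "b n = 4 * (1/4 :: real) ^ n" for n :: nat
 have w: "w n : H" "H_norm (w n) <= b n" for n
 proof -
  show "w n : H" unfolding w_def by(rule H_soft_abs(1)[OF Cinf_H[OF dH]])
  have "H_norm (w n) <= 2 * 2 ^ n * H_norm (d n)" using H_soft_abs(2)[OF Cinf_H[OF dH], of "2 * 2 ^ n" n] by(simp add: w_def[abs_def])
  also have "... <= 2 * 2 ^ n * (2 * (1/8) ^ n)" by(intro mult_left_mono dn) simp
  also have "... = b n" by(simp add: b_def power_mult_distrib[symmetric] mult_ac)
  finally show "H_norm (w n) <= b n" .
 qed
 have U: "openin T (U n)" for n
 proof -
  have "openin T {x : M. d n x : {y. \<bar>y\<bar> > (1/2) ^ n}}" by(rule openin_continuous_map_preimage[OF Cinf_continuous_map[OF dH]])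
    (auto intro!: open_Collect_less continuous_intros)
  thus ?thesis by(simp add: U_def)
 qed
 have wU: "1 <= w n x" if "x : U n" for n x
 proof -
  have "2 ^ n * (1/2) ^ n <= 2 ^ n * \<bar>d n x\<bar>" using that by(intro mult_left_mono) (auto simp: U_def)
  hence "1 <= 2 ^ n * \<bar>d n x\<bar>" by(simp add: power_mult_distrib[symmetric])
  thus ?thesis unfolding w_def by(intro soft_abs_ge_1) (simp add: abs_mult)
 qed
 define G where "G m = (\<Union>n. U (n + m))" for m
 have bs: "summable b" unfolding b_def by(intro summable_mult summable_geometric) simp
 have capG: "cap (G m) <= ennreal ((2 * (\<Sum>j. b (j + m)))^2)" for m unfolding G_def
 proof (rule cap_UN_le[of "%n. w (n + m)"])
  show "0 <= w (n + m) x" for n x by(simp add: w_def soft_abs_nonneg)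
  show "summable (%j. b (j + m))" by(rule summable_ignore_initial_segment[OF bs])
 qed (rule w U wU, assumption?)+
 define v where "v x = lim (%n. s n x)" for x
 have "AE x in mu. summable (%n. \<bar>d n x\<bar>)" by(rule L2_summable_AE[OF finite_measure_BH FH_L2(1)[OF Cinf_finite_H_norm[OF dH]] order_trans[OF H_norm_ge(1) dn]])
   (intro summable_mult summable_geometric, simp)
 hence cv: "AE x in mu. (%n. s n x) ----> v x"
 proof eventually_elim
  case (elim x)
  hence "convergent (%n. \<Sum>k<n. d k x)" using summable_rabs_cancel by(simp add: summable_iff_convergent[symmetric])
  hence "convergent (%n. (s n x - s 0 x) + s 0 x)" unfolding d_def sum_lessThan_telescope[of "%k. s k x"] by(intro convergent_add convergent_const)
  thus ?case by(simp add: v_def convergent_LIMSEQ_iff)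
 qed
 have sL: "(%n. nrm (%x. s n x - u x)) ----> 0"
 proof (rule Lim_null_comparison[OF always_eventually], rule allI)
  show "(%n. (1/8 :: real) ^ n) ----> 0" by(rule LIMSEQ_power_zero) simp
  fix n show "norm (nrm (%x. s n x - u x)) <= (1/8) ^ n" using su[of n] H_norm_ge(1)[of "%x. u x - s n x"] by(simp add: L2_norm_commute[of mu "s n"])
 qed
 obtain r :: "nat => nat" where r: "strict_mono r" "AE x in mu. (%n. s (r n) x) ----> u x" using L2_tendsto_AE_subseq[OF FH_L2(1)[OF sFH] FH_L2(1)[OF uFH] sL] by blast
 have vu: "AE x in mu. u x = v x" using cv r(2)
 proof eventually_elim
  case (elim x)
  from LIMSEQ_subseq_LIMSEQ[OF elim(1) r(1)] have "(%n. s (r n) x) ----> v x" by(simp add: o_def)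
  from LIMSEQ_unique[OF elim(2) this] show ?case .
 qed
 have ctG: "continuous_map (subtopology T (M - G m)) euclideanreal v" for m
 proof -
  let ?X = "subtopology T (M - G m)"
  \<comment> \<open>Off \<open>G m\<close> the increments from index \<open>m\<close> on are at most
    the corresponding powers of 1/2; the geometric tail is the uniform bound.\<close>
  have rate: "\<bar>s n x - v x\<bar> <= 2 * (1/2) ^ n" if x: "x : M - G m" and n: "m <= n" for x n
  proof -
   have dk: "\<bar>d (n + j) x\<bar> <= (1/2) ^ (n + j)" for j
   proof -
    have "x \<notin> U ((n + j - m) + m)" using x unfolding G_def by blast
    thus ?thesis using x n by(simp add: U_def)
   qed
   have g: "(%j. (1/2 :: real) ^ (n + j)) sums (2 * (1/2) ^ n)" using sums_mult[OF geometric_sums[of "1/2 :: real"], of "(1/2) ^ n"] by(simp add: power_add mult.commute)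
   have sm: "summable (%j. \<bar>d (n + j) x\<bar>)" by(rule summable_comparison_test'[OF sums_summable[OF g], of 0]) (simp add: dk)
   have "(%k. \<Sum>j<k. d (n + j) x) ----> (\<Sum>j. d (n + j) x)" by(rule summable_LIMSEQ[OF summable_rabs_cancel[OF sm]])
   moreover have "(\<Sum>j<k. d (n + j) x) = s (n + k) x - s n x" for k unfolding d_def using sum_lessThan_telescope[of "%j. s (n + j) x" k] by simp
   ultimately have "(%k. (s (n + k) x - s n x) + s n x) ----> (\<Sum>j. d (n + j) x) + s n x" by(intro tendsto_add tendsto_const) simp
   hence "(%k. s (k + n) x) ----> (\<Sum>j. d (n + j) x) + s n x" by(simp add: add.commute)
   hence "(%k. s k x) ----> (\<Sum>j. d (n + j) x) + s n x" by(rule LIMSEQ_offset)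
   hence "v x = (\<Sum>j. d (n + j) x) + s n x" unfolding v_def by(rule limI)
   moreover have "\<bar>\<Sum>j. d (n + j) x\<bar> <= (\<Sum>j. \<bar>d (n + j) x\<bar>)" by(rule summable_rabs[OF sm])
   moreover have "(\<Sum>j. \<bar>d (n + j) x\<bar>) <= 2 * (1/2) ^ n" using suminf_le[OF dk sm sums_summable[OF g]] sums_unique[OF g] by simp
   ultimately show ?thesis by simp
  qed
  have "continuous_map ?X Met_TC.mtopology v"
  proof (rule Met_TC.continuous_map_uniform_limit[where F=sequentially and f=s])
   show "\<forall>\<^sub>F n in sequentially. continuous_map ?X Met_TC.mtopology (s n)" using continuous_map_from_subtopology[OF Cinf_continuous_map[OF s]] by simp
   fix e :: real assume e: "0 < e"
   have "(%n. 2 * (1/2 :: real) ^ n) ----> 0" by(rule tendsto_mult_right_zero, rule LIMSEQ_power_zero) simp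
   from order_tendstoD(2)[OF this e] eventually_ge_at_top[of m]
   show "\<forall>\<^sub>F n in sequentially. ALL x:topspace ?X. v x : UNIV & dist (s n x) (v x) < e"
   proof eventually_elim
    case (elim n)
    thus ?case using rate[OF _ elim(2)] by(fastforce simp: dist_real_def)
   qed
  qed simp
  thus ?thesis by simp
 qed
 have "quasi_continuous v" unfolding quasi_continuous_def
 proof (intro allI impI)
  fix e :: ennreal assume e: "0 < e"
  have "(%m. ennreal ((2 * (\<Sum>j. b (j + m)))^2)) ----> ennreal ((2 * 0)^2)" by(intro tendsto_ennrealI tendsto_intros suminf_tail_tendsto_0 bs)
  hence "eventually (%m. ennreal ((2 * (\<Sum>j. b (j + m)))^2) < e) sequentially" using e by(intro order_tendstoD(2)) simp_all
  then obtain m where "ennreal ((2 * (\<Sum>j. b (j + m)))^2) < e" by(auto simp: eventually_sequentially)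
  hence "cap (G m) < e" using capG[of m] by simp
  moreover have "openin T (G m)" unfolding G_def using U by auto
  ultimately show "EX G. openin T G & cap G < e & continuous_map (subtopology T (M - G)) euclideanreal v" using ctG[of m] by blast
 qed
 hence "v : H_qc" using H_cong_AE[OF u vu] by(simp add: H_qc_def)
 moreover have "AE x in mu. v x = u x" using vu by eventually_elim simp
 ultimately show ?thesis by(rule that)
qed

text \<open>The set differs from a superlevel set of a measurable function by sets of zero capacity,
  which are null.\<close>

lemma quasi_open_measurable:
 assumes "quasi_open Om"
 shows "Om : sets mu"
proof -
 obtain u where u: "u : H_qc" and c: "cap ((Om - {x:M. 0 < u x}) Un ({x:M. 0 < u x} - Om)) = 0" and sub: "Om <= M" using assms unfolding quasi_open_def by blast
 let ?P = "{x:M. 0 < u x}"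
 have [measurable]: "u : borel_measurable mu" using u L2_spaceD(1)[OF FH_L2(1)[OF H_FH]] by(simp add: H_qc_def)
 have "{x:space mu. 0 < u x} : sets mu" by measurable
 moreover have "Om - ?P : sets mu" "?P - Om : sets mu" using cap_0_null_sets[OF c, of "Om - ?P"] cap_0_null_sets[OF c, of "?P - Om"] sub by auto
 ultimately have "(?P - (?P - Om)) Un (Om - ?P) : sets mu" by(auto simp: space_BH)
 moreover have "(?P - (?P - Om)) Un (Om - ?P) = Om" by blast
 ultimately show ?thesis by simp
qed

lemma H0_AE:
 assumes "u : H0 Om"
 shows "AE x in mu. x \<notin> Om --> u x = 0"
proof -
 have "{x:M. u x ~= 0} - Om : null_sets mu" using assms by(intro cap_0_null_sets) (auto simp: H0_def)
 from AE_not_in[OF this] AE_M show ?thesis by eventually_elim blast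
qed

end

section \<open>Existence of optimal domains\<close>

lemma L2_norm_sum_le:
 assumes "!!i. i < (k::nat) ==> u i : L2_space mu"
 shows "L2_norm mu (%x. \<Sum>i<k. u i x) <= (\<Sum>i<k. L2_norm mu (u i))" using assms
proof (induction k)
 case 0
 thus ?case by(simp add: L2_norm_def)
next
 case (Suc k)
 thus ?case using L2_norm_triangle[OF L2_space_sum[of "{..<k}" u mu], of "u k"] by simp
qed

lemma L2_inner_sum:
 assumes "!!i. i < (k::nat) ==> u i : L2_space mu" "v : L2_space mu"
 shows "(LINT x|mu. (\<Sum>i<k. a i * u i x) * v x) = (\<Sum>i<k. a i * (LINT x|mu. u i x * v x))"
proof -
 have "(LINT x|mu. (\<Sum>i<k. a i * u i x) * v x) = (LINT x|mu. (\<Sum>i<k. a i * (u i x * v x)))" by(simp add: sum_distrib_right mult.assoc)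
 also have "... = (\<Sum>i<k. LINT x|mu. a i * (u i x * v x))" using L2_product_integrable[OF assms] by(intro Bochner_Integration.integral_sum) auto
 finally show ?thesis by simp
qed

definition orthonormal :: "'m measure => nat => (nat => 'm => real) => bool" where
 "orthonormal mu k e \<longleftrightarrow> (ALL i<k. e i : L2_space mu) &
   (ALL i<k. ALL j<k. (LINT x|mu. e i x * e j x) = (if i = j then 1 else 0))"

lemma orthonormal_coeff:
 assumes "orthonormal mu k e" "j < k"
 shows "(LINT x|mu. (\<Sum>i<k. a i * e i x) * e j x) = a j"
proof -
 have "(LINT x|mu. (\<Sum>i<k. a i * e i x) * e j x) = (\<Sum>i<k. a i * (LINT x|mu. e i x * e j x))" using assms by(intro L2_inner_sum) (auto simp: orthonormal_def)
 also have "... = (\<Sum>i<k. if i = j then a i else 0)" using assms by(intro sum.cong refl) (auto simp: orthonormal_def)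
 finally show ?thesis using assms(2) by simp
qed

lemma orthonormal_L2_norm:
 assumes "orthonormal mu k e"
 shows "(L2_norm mu (%x. \<Sum>i<k. a i * e i x))^2 = (\<Sum>i<k. (a i)^2)"
proof -
 have e: "e i : L2_space mu" if "i < k" for i using assms that by(simp add: orthonormal_def)
 have "(L2_norm mu (%x. \<Sum>i<k. a i * e i x))^2 = (LINT x|mu. (\<Sum>j<k. a j * e j x) * (\<Sum>i<k. a i * e i x))"
  unfolding L2_norm_power2 by(simp only: power2_eq_square)
 also have "... = (\<Sum>j<k. a j * (LINT x|mu. e j x * (\<Sum>i<k. a i * e i x)))" using e by(intro L2_inner_sum L2_space_sum L2_space_cmult) auto
 also have "... = (\<Sum>j<k. a j * a j)" using orthonormal_coeff[OF assms, of _ a] by(intro sum.cong refl) (simp add: mult.commute)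
 finally show ?thesis by(simp add: power2_eq_square)
qed

text \<open>The orthonormal functions are given by coefficients in the original family, so that they
  lie in its span as functions and not just up to null sets. Independence modulo null sets enters
  for the new vector: its coefficient at \<open>b m\<close> is 1, so it is not almost everywhere
  zero.\<close>

lemma Gram_Schmidt:
 assumes b: "!!j. j < k ==> b j : L2_space mu"
  and ind: "!!a. (AE x in mu. (\<Sum>j<k. a j * b j x) = 0) ==> ALL j<k. a j = 0"
 shows "EX C :: nat => nat => real. orthonormal mu k (%i x. \<Sum>j<k. C i j * b j x)"
proof -
 have "m <= k ==> EX C :: nat => nat => real. (ALL i<m. ALL j>=m. C i j = 0) & orthonormal mu m (%i x. \<Sum>j<k. C i j * b j x)" for m
 proof (induction m)
  case 0
  show ?case by(simp add: orthonormal_def)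
 next
  case (Suc m)
  then obtain C where C: "!!i j. i < m ==> m <= j ==> C i j = 0" "orthonormal mu m (%i x. \<Sum>j<k. C i j * b j x)" by auto
  define e where "e = (%i x. \<Sum>j<k. C i j * b j x)"
  note on = C(2)[folded e_def]
  have m: "m < k" using Suc.prems by simp
  define t where "t i = (LINT x|mu. b m x * e i x)" for i
  \<comment> \<open>Coefficients of \<open>b m\<close> minus its projection on the previous
    functions. The vanishing of \<open>C i j\<close> for \<open>j >= m\<close> in the induction
    hypothesis keeps the entry at \<open>m\<close> equal to 1.\<close>
  define \<alpha> where "\<alpha> j = (if j = m then 1 else 0) - (\<Sum>i<m. t i * C i j)" for j
  define y where "y x = (\<Sum>j<k. \<alpha> j * b j x)" for x
  have eL: "e i : L2_space mu" if "i < m" for i using on that by(simp add: orthonormal_def)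
  have y: "y = (%x. b m x - (\<Sum>i<m. t i * e i x))"
  proof
   fix x
   have "y x = (\<Sum>j<k. (if j = m then b j x else 0)) - (\<Sum>j<k. (\<Sum>i<m. t i * C i j) * b j x)"
    unfolding y_def \<alpha>_def left_diff_distrib sum_subtractf by(intro arg_cong2[where f=minus] sum.cong) auto
   also have "(\<Sum>j<k. (\<Sum>i<m. t i * C i j) * b j x) = (\<Sum>i<m. t i * e i x)"
    unfolding e_def sum_distrib_left sum_distrib_right by(subst sum.swap) (simp add: mult.assoc)
   finally show "y x = b m x - (\<Sum>i<m. t i * e i x)" using m by simp
  qed
  have yL: "y : L2_space mu" unfolding y_def by(intro L2_space_sum L2_space_cmult b) simp
  have orth: "(LINT x|mu. y x * e i x) = 0" if i: "i < m" for i
  proof -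
   have "(LINT x|mu. y x * e i x) = (LINT x|mu. b m x * e i x - (\<Sum>i<m. t i * e i x) * e i x)" unfolding y by(simp add: left_diff_distrib)
   also have "... = t i - (LINT x|mu. (\<Sum>i<m. t i * e i x) * e i x)" unfolding t_def[of i] using b[OF m] eL i
    by(intro Bochner_Integration.integral_diff L2_product_integrable L2_space_sum L2_space_cmult) auto
   finally show ?thesis using orthonormal_coeff[OF on i, of t] by simp
  qed
  have \<alpha>m: "\<alpha> m = 1" "!!j. Suc m <= j ==> \<alpha> j = 0" using C(1) by(auto simp: \<alpha>_def)
  have "L2_norm mu y ~= 0"
  proof
   assume "L2_norm mu y = 0"
   hence "(LINT x|mu. (y x)^2) = 0" by(simp add: L2_norm_def)
   hence "AE x in mu. (y x)^2 = 0" using integral_nonneg_eq_0_iff_AE[OF L2_spaceD(2)[OF yL]] by simp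
   hence "AE x in mu. (\<Sum>j<k. \<alpha> j * b j x) = 0" by eventually_elim (simp add: y_def)
   thus False using ind[of \<alpha>] m \<alpha>m(1) by auto
  qed
  hence n: "0 < L2_norm mu y" using L2_norm_nonneg[of mu y] by linarith
  define C' where "C' i j = (if i = m then 1 / L2_norm mu y * \<alpha> j else C i j)" for i j
  define e' where "e' = (%i x. \<Sum>j<k. C' i j * b j x)"
  have e': "e' m = (%x. 1 / L2_norm mu y * y x)" "!!i. i < m ==> e' i = e i" by(auto simp: e'_def C'_def y_def e_def sum_distrib_left mult.assoc fun_eq_iff)
  have yy: "(LINT x|mu. y x * y x) = (L2_norm mu y)^2" unfolding L2_norm_power2 by(simp only: power2_eq_square)
  have mm: "(LINT x|mu. e' m x * e' m x) = 1"
  proof -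
   have "(LINT x|mu. e' m x * e' m x) = (LINT x|mu. (1 / L2_norm mu y)^2 * (y x * y x))" unfolding e'(1) by(simp add: power2_eq_square mult_ac)
   also have "... = 1" using n by(simp add: yy power_divide)
   finally show ?thesis .
  qed
  have mi: "(LINT x|mu. e' m x * e' i x) = 0" if "i < m" for i unfolding e'(1) e'(2)[OF that] using orth[OF that] by(simp add: mult.assoc)
  have im: "(LINT x|mu. e' i x * e' m x) = 0" if "i < m" for i using mi[OF that] by(simp add: mult.commute)
  have "orthonormal mu (Suc m) e'" unfolding orthonormal_def
  proof (intro conjI allI impI)
   fix i assume "i < Suc m"
   show "e' i : L2_space mu" unfolding e'_def by(intro L2_space_sum L2_space_cmult b) simp
  next
   fix i j assume "i < Suc m" "j < Suc m"
   then consider "i < m" "j < m" | "i = m" "j < m" | "i < m" "j = m" | "i = m" "j = m" by linarith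
   thus "(LINT x|mu. e' i x * e' j x) = (if i = j then 1 else 0)"
   proof cases
    case 1
    thus ?thesis using on unfolding orthonormal_def e'(2)[OF 1(1)] e'(2)[OF 1(2)] by blast
   qed (use mm mi im in auto)
  qed
  moreover have "ALL i<Suc m. ALL j>=Suc m. C' i j = 0" using C(1) \<alpha>m(2) by(auto simp: C'_def less_Suc_eq)
  ultimately show ?case unfolding e'_def by blast
 qed
 from this[OF order_refl] show ?thesis by blast
qed

section \<open>Limits of minimising sequences of domains\<close>

context compact_finsler
begin

text \<open>The variational bounds come as squares of norms; subadditivity of the square root
  converts their error terms.\<close>

lemma H_weak_closed_square:
 assumes v: "!!n. v n : H" "u : L2F" "(%n. nrm (%x. v n x - u x)) ----> 0"
  and R: "!!e. 0 < e ==> eventually (%n. (nrm (D (v n)))^2 <= R + e) sequentially"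
 shows "u : H" "(nrm (D u))^2 <= R"
proof -
 have "0 <= R + e" if e: "0 < e" for e
 proof -
  obtain n where "(nrm (D (v n)))^2 <= R + e" using R[OF e] by(auto simp: eventually_sequentially)
  thus ?thesis using zero_le_power2 order_trans by blast
 qed
 hence R0: "0 <= R" by(rule field_le_epsilon)
 have ev: "eventually (%n. nrm (D (v n)) <= sqrt R + e) sequentially" if e: "0 < e" for e
 proof -
  have "0 < e^2" using e by simp
  from R[OF this] show ?thesis
  proof eventually_elim
   case (elim n)
   have "nrm (D (v n)) <= sqrt (R + e^2)" using elim by(rule real_le_rsqrt)
   also have "... <= sqrt R + e" using sqrt_add_le_add_sqrt[OF R0, of "e^2"] e by simp
   finally show ?case .
  qed
 qed
 show "u : H" by(rule H_weak_closed(1)[OF v ev]) assumption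
 have "nrm (D u) <= sqrt R" by(rule H_weak_closed(2)[OF v ev]) assumption
 from power_mono[OF this, of 2] R0 show "(nrm (D u))^2 <= R" by simp
qed

lemma H0_H: "u : H0 Om ==> u : H" and H0_FH: "u : H0 Om ==> u : FH" using H_FH by(auto simp: H0_def H_qc_def)

text \<open>The functionals integrate over the domain, the analysis over \<open>M\<close>. For
  \<open>u\<close> the two agree because it vanishes almost everywhere off the domain; for the
  gradient \<open>D_local\<close> gives one inequality between the norms, the other being
  monotonicity.\<close>

lemma H0_integrals:
 assumes Om: "Om : sets mu" and u: "u : H0 Om"
 shows "(LINT x:Om|mu. (u x)^2) = (nrm u)^2" "(LINT x:Om|mu. (D u x)^2) = (nrm (D u))^2"
  "f : borel_measurable mu ==> (LINT x:Om|mu. u x * f x) = (LINT x|mu. u x * f x)"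
proof -
 note uL = FH_L2[OF H0_FH[OF u]]
 note [measurable] = Om L2_spaceD(1)[OF uL(1)] L2_spaceD(1)[OF uL(2)]
 show "(LINT x:Om|mu. (u x)^2) = (nrm u)^2" unfolding L2_norm_power2 set_lebesgue_integral_def
 proof (rule integral_cong_AE)
  show "AE x in mu. indicat_real Om x *\<^sub>R (u x)^2 = (u x)^2" using H0_AE[OF u] by eventually_elim (auto simp: indicator_def)
 qed measurable
 show "(LINT x:Om|mu. u x * f x) = (LINT x|mu. u x * f x)" if [measurable]: "f : borel_measurable mu" unfolding set_lebesgue_integral_def
 proof (rule integral_cong_AE)
  show "AE x in mu. indicat_real Om x *\<^sub>R (u x * f x) = u x * f x" using H0_AE[OF u] by eventually_elim (auto simp: indicator_def)
 qed measurable
 have L: "(%x. indicat_real Om x * D u x) : L2F" by(rule L2_space_mono(1)[OF uL(2)], measurable) (auto simp: indicator_def)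
 have "nrm (%x. indicator {x. u x ~= 0} x * D u x) <= nrm (%x. indicat_real Om x * D u x)"
 proof (rule L2_space_mono(2)[OF L])
  show "(%x. indicator {x. u x ~= 0} x * D u x) : borel_measurable mu" by(auto simp: indicator_def intro!: measurable_If)
  show "AE x in mu. \<bar>indicator {x. u x ~= 0} x * D u x\<bar> <= \<bar>indicat_real Om x * D u x\<bar>"
   using H0_AE[OF u] by eventually_elim (auto simp: indicator_def)
 qed
 hence "nrm (D u) <= nrm (%x. indicat_real Om x * D u x)" using D_local[OF H0_H[OF u]] by simp
 moreover have "nrm (%x. indicat_real Om x * D u x) <= nrm (D u)" by(rule L2_space_mono(2)[OF uL(2)], measurable) (auto simp: indicator_def)
 ultimately have "nrm (%x. indicat_real Om x * D u x) = nrm (D u)" by simp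
 moreover have "(nrm (%x. indicat_real Om x * D u x))^2 = (LINT x:Om|mu. (D u x)^2)" unfolding L2_norm_power2 set_lebesgue_integral_def
  by(rule Bochner_Integration.integral_cong) (auto simp: indicator_def)
 ultimately show "(LINT x:Om|mu. (D u x)^2) = (nrm (D u))^2" by simp
qed

lemma admissible_measurable: "admissible c Om ==> Om : sets mu" using quasi_open_measurable by(simp add: admissible_def)

lemma admissible_empty: "admissible c {}"
proof -
 have "quasi_open {}" unfolding quasi_open_def by(intro conjI bexI[OF _ H_qc_zero]) auto
 thus ?thesis by(simp add: admissible_def)
qed

lemma H0I: "u : H_qc ==> (!!x. x : M ==> u x ~= 0 ==> x : Om) ==> u : H0 Om"
proof -
 assume u: "u : H_qc" and "!!x. x : M ==> u x ~= 0 ==> x : Om"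
 hence "{x:M. u x ~= 0} - Om = {}" by blast
 hence "cap ({x:M. u x ~= 0} - Om) = 0" by(simp only: cap_empty)
 thus ?thesis using u unfolding H0_def by blast
qed

text \<open>The limit domain is the union of the supports of the limit functions: almost everywhere
 convergence puts almost every point of it in all but finitely many of the given domains.\<close>

proposition limit_domain:
 fixes k :: nat
 assumes Om: "!!n. admissible c (Om n)" and u: "!!n i. i < k ==> u n i : H0 (Om n)"
  and B: "!!n i. i < k ==> H_norm (u n i) <= B"
 obtains r v G where "strict_mono (r :: nat => nat)" "admissible c G"
  "!!i. i < k ==> v i : H_qc" "!!i x. i < k ==> x : M ==> v i x ~= 0 ==> x : G"
  "!!i. i < k ==> (%n. nrm (%x. u (r n) i x - v i x)) ----> 0"
proof -
 have uH: "u n i : H" if "i < k" for n i using H0_H[OF u[OF that]] .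
 obtain r :: "nat => nat" where r: "strict_mono r" "!!i. i < k ==> EX v:L2F. (%n. nrm (%x. u (r n) i x - v x)) ----> 0" using Rellich_tuple[of k u B, OF uH B] by blast
 have "EX v. v : H_qc & (%n. nrm (%x. u (r n) i x - v x)) ----> 0" if i: "i < k" for i
 proof -
  obtain e where e: "e : L2F" "(%n. nrm (%x. u (r n) i x - e x)) ----> 0" using r(2)[OF i] by blast
  have ev: "eventually (%n. nrm (D (u (r n) i)) <= B + d) sequentially" if "0 < d" for d
  proof (intro always_eventually allI)
   fix n show "nrm (D (u (r n) i)) <= B + d" using H_norm_ge(2)[of "u (r n) i"] B[OF i, of "r n"] \<open>0 < d\<close> by linarith
  qed
  have "e : H" by(rule H_weak_closed(1)[OF uH[OF i] e ev]) assumption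
  then obtain v where v: "v : H_qc" "AE x in mu. v x = e x" by(rule ex_quasi_continuous_representative)
  have vL: "v : L2F" using v(1) FH_L2(1)[OF H_FH] by(simp add: H_qc_def)
  have "nrm (%x. u (r n) i x - v x) = nrm (%x. u (r n) i x - e x)" for n
  proof (rule L2_norm_cong_AE)
   show "AE x in mu. \<bar>u (r n) i x - v x\<bar> = \<bar>u (r n) i x - e x\<bar>" using v(2) by eventually_elim simp
  qed (rule L2_spaceD(1)[OF L2_space_diff[OF FH_L2(1)[OF H_FH[OF uH[OF i]]]]], rule vL e)+
  thus ?thesis using v(1) e(2) by(intro exI[of _ v]) simp
 qed
 then obtain v where v: "!!i. i < k ==> v i : H_qc" "!!i. i < k ==> (%n. nrm (%x. u (r n) i x - v i x)) ----> 0" by metis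
 have vL: "v i : L2F" if "i < k" for i using v(1)[OF that] FH_L2(1)[OF H_FH] by(simp add: H_qc_def)
 have uL: "u n i : L2F" if "i < k" for n i using FH_L2(1)[OF H_FH[OF uH[OF that]]] .
 \<comment> \<open>A single function in \<open>H_qc\<close> that is positive exactly where some
   \<open>v i\<close> is nonzero: one function has to witness that \<open>G\<close> is
   quasi-open.\<close>
 define w where "w x = (\<Sum>i<k. soft_abs (v i x))" for x
 define G where "G = {x:M. 0 < w x}"
 have wq: "w : H_qc" unfolding w_def by(rule H_qc_sum) (rule H_qc_soft_abs[OF v(1)])
 have qo: "quasi_open G" unfolding quasi_open_def using wq by(intro conjI bexI[of _ w]) (auto simp: G_def)
 have pos: "0 < w x \<longleftrightarrow> (EX i<k. v i x ~= 0)" for x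
 proof -
  have "w x = 0 \<longleftrightarrow> (ALL i<k. v i x = 0)" unfolding w_def by(subst sum_nonneg_eq_0_iff) (auto simp: soft_abs_nonneg)
  moreover have "0 <= w x" unfolding w_def by(intro sum_nonneg soft_abs_nonneg)
  ultimately show ?thesis by(auto simp: less_le)
 qed
 \<comment> \<open>Summing the errors yields one almost everywhere convergent subsequence for all
   components together.\<close>
 define z where "z n x = (\<Sum>i<k. \<bar>u (r n) i x - v i x\<bar>)" for n x
 have absL: "(%x. \<bar>u (r n) i x - v i x\<bar>) : L2F" if "i < k" for n i by(rule L2_space_mono(1)[OF L2_space_diff[OF uL[OF that] vL[OF that]]])
   (use L2_spaceD(1)[OF L2_space_diff[OF uL[OF that] vL[OF that]]] in auto)
 have "(%n. nrm (%x. z n x - 0)) ----> 0"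
 proof (rule Lim_null_comparison[OF always_eventually], rule allI)
  have "(%n. \<Sum>i<k. nrm (%x. u (r n) i x - v i x)) ----> (\<Sum>i<k. 0)" by(intro tendsto_sum v(2)) simp
  thus "(%n. \<Sum>i<k. nrm (%x. u (r n) i x - v i x)) ----> 0" by simp
  fix n
  have "nrm (%x. \<bar>u (r n) i x - v i x\<bar>) = nrm (%x. u (r n) i x - v i x)" for i by(simp add: L2_norm_def)
  thus "norm (nrm (%x. z n x - 0)) <= (\<Sum>i<k. nrm (%x. u (r n) i x - v i x))"
   using L2_norm_sum_le[of k "%i x. \<bar>u (r n) i x - v i x\<bar>" mu] absL[of _ n] by(simp add: z_def)
 qed
 moreover have "z n : L2F" for n unfolding z_def by(rule L2_space_sum) (use absL in auto)
 ultimately obtain q :: "nat => nat" where q: "AE x in mu. (%n. z (q n) x) ----> 0" using L2_tendsto_AE_subseq[of z mu "%x. 0"] by auto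
 have "AE x in mu. ALL n. ALL i:{..<k}. x \<notin> Om n --> u n i x = 0" unfolding AE_all_countable using H0_AE[OF u] by(intro allI AE_finite_allI) auto
 \<comment> \<open>Prepares Fatou's lemma for indicators: at a point of \<open>G\<close> some
   \<open>v i\<close> is nonzero, hence so are the approximating functions eventually, which puts
   the point into their domains.\<close>
 hence "AE x in mu. indicator G x <= liminf (%n. indicator (Om (r (q n))) x :: ennreal)" using q
 proof eventually_elim
  case (elim x)
  show ?case
  proof (cases "x : G")
   case True
   then obtain i where i: "i < k" "v i x ~= 0" using pos by(auto simp: G_def)
   have "eventually (%n. z (q n) x < \<bar>v i x\<bar>) sequentially" using order_tendstoD(2)[OF elim(2)] i(2) by simp
   hence "eventually (%n. 1 <= (indicator (Om (r (q n))) x :: ennreal)) sequentially"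
   proof eventually_elim
    case e: (elim n)
    have "\<bar>u (r (q n)) i x - v i x\<bar> <= z (q n) x" unfolding z_def by(rule member_le_sum) (use i in auto)
    hence "u (r (q n)) i x ~= 0" using e by auto
    hence "x : Om (r (q n))" using elim(1) i(1) by auto
    thus ?case by simp
   qed
   thus ?thesis using True by(intro order_trans[OF _ Liminf_bounded]) (auto simp: indicator_def)
  qed simp
 qed
 hence "(\<integral>\<^sup>+x. indicator G x \<partial>mu) <= (\<integral>\<^sup>+x. liminf (%n. indicator (Om (r (q n))) x) \<partial>mu)" by(rule nn_integral_mono_AE)
 also have "... <= liminf (%n. \<integral>\<^sup>+x. indicator (Om (r (q n))) x \<partial>mu)" using admissible_measurable[OF Om] by(intro nn_integral_liminf) auto
 also have "... <= liminf (%n. ennreal c)" using Om admissible_measurable[OF Om] by(intro Liminf_mono always_eventually) (auto simp: admissible_def)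
 finally have "emeasure mu G <= ennreal c" using quasi_open_measurable[OF qo] by(simp add: Liminf_const)
 hence "admissible c G" using qo by(simp add: admissible_def)
 thus ?thesis by(rule that[OF r(1) _ v(1) _ v(2)]) (auto simp: G_def pos)
qed

lemma span_tendsto:
 fixes k :: nat
 assumes "!!n i. i < k ==> u n i : L2F" "!!i. i < k ==> v i : L2F"
  and "!!i. i < k ==> (%n. nrm (%x. u n i x - v i x)) ----> 0"
 shows "(%n. nrm (%x. (\<Sum>i<k. a i * u n i x) - (\<Sum>i<k. a i * v i x))) ----> 0"
proof (rule Lim_null_comparison[OF always_eventually], rule allI)
 have "(%n. \<Sum>i<k. \<bar>a i\<bar> * nrm (%x. u n i x - v i x)) ----> (\<Sum>i<k. 0)" by(intro tendsto_sum tendsto_mult_right_zero assms(3)) simp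
 thus "(%n. \<Sum>i<k. \<bar>a i\<bar> * nrm (%x. u n i x - v i x)) ----> 0" by simp
 fix n
 have eq: "(%x. (\<Sum>i<k. a i * u n i x) - (\<Sum>i<k. a i * v i x)) = (%x. \<Sum>i<k. a i * (u n i x - v i x))" by(simp add: sum_subtractf right_diff_distrib)
 have "nrm (%x. \<Sum>i<k. a i * (u n i x - v i x)) <= (\<Sum>i<k. nrm (%x. a i * (u n i x - v i x)))" by(intro L2_norm_sum_le L2_space_cmult L2_space_diff assms)
 thus "norm (nrm (%x. (\<Sum>i<k. a i * u n i x) - (\<Sum>i<k. a i * v i x))) <= (\<Sum>i<k. \<bar>a i\<bar> * nrm (%x. u n i x - v i x))"
  unfolding eq L2_norm_cmult by simp
qed

text \<open>A certificate for an eigenvalue at most \<open>L\<close>: an L2 orthonormal basis of a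
  test space on whose unit sphere the energy is at most \<open>L\<close>. Being a finite tuple of
  functions, it is an object to which compactness applies.\<close>

definition frame :: "nat => real => 'm set => (nat => 'm => real) => bool" where
 "frame k L Om e \<longleftrightarrow> orthonormal mu k e & (ALL i<k. e i : H_qc) & (ALL a. (%x. \<Sum>i<k. a i * e i x) : H0 Om) &
   (ALL a. (\<Sum>i<k. (a i)^2) = 1 --> (nrm (D (%x. \<Sum>i<k. a i * e i x)))^2 <= L)"

lemma sum_unit: "i < k ==> (\<Sum>j<k. (if j = i then 1 else 0) * g j) = (g i :: real)" for k :: nat
 by(subst sum.cong[where h="%j. if j = i then g j else 0", OF refl]) auto

lemma frameD:
 assumes "frame k L Om e" "i < k"
 shows "e i : H0 Om" "(nrm (D (e i)))^2 <= L" "nrm (e i) = 1"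
proof -
 define a where "a j = (if j = i then 1 else (0 :: real))" for j
 have e: "(%x. \<Sum>j<k. a j * e j x) = e i" using sum_unit[OF assms(2)] by(simp add: a_def fun_eq_iff)
 have s: "(\<Sum>j<k. (a j)^2) = 1" using sum_unit[OF assms(2), of a] by(simp add: a_def power2_eq_square)
 have "(%x. \<Sum>j<k. a j * e j x) : H0 Om" using assms(1) unfolding frame_def by blast
 thus "e i : H0 Om" by(simp only: e)
 have "(nrm (D (%x. \<Sum>j<k. a j * e j x)))^2 <= L" using assms(1) s unfolding frame_def by blast
 thus "(nrm (D (e i)))^2 <= L" by(simp only: e)
 have "(nrm (e i))^2 = (LINT x|mu. e i x * e i x)" unfolding L2_norm_power2 by(simp only: power2_eq_square)
 also have "... = 1" using assms by(simp add: frame_def orthonormal_def)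
 finally have "(nrm (e i))^2 = 1" .
 thus "nrm (e i) = 1" using L2_norm_nonneg[of mu "e i"] by(simp add: power2_eq_1_iff)
qed

lemma frame_mono:
 assumes e: "frame k L Om e" and "L <= L'"
 shows "frame k L' Om e"
proof -
 have "(nrm (D (%x. \<Sum>i<k. a i * e i x)))^2 <= L'" if "(\<Sum>i<k. (a i)^2) = 1" for a
 proof (rule order_trans[OF _ assms(2)])
  show "(nrm (D (%x. \<Sum>i<k. a i * e i x)))^2 <= L" using e that unfolding frame_def by blast
 qed
 thus ?thesis using e unfolding frame_def by blast
qed

text \<open>Gram-Schmidt inside an almost optimal subspace. The strict inequality provides that
  subspace, since the infimum may fail to be attained.\<close>

lemma frame_of_eigenvalue:
 assumes Om: "Om : sets mu" and "eigenvalue k Om < ereal L"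
 obtains e where "frame k L Om e"
proof -
 obtain K where K: "K <= H0 Om" "subspace_mod_AE mu k K"
  and lt: "(SUP u \<in> {u : K. (LINT x:Om|mu. (u x)^2) = 1}. ereal (LINT x:Om|mu. (D u x)^2)) < ereal L" using assms(2) unfolding eigenvalue_def INF_less_iff by blast
 obtain b where b: "!!i. i < k ==> b i : K" "!!a. (AE x in mu. (\<Sum>i<k. a i * b i x) = 0) ==> ALL i<k. a i = 0" using K(2) unfolding subspace_mod_AE_def by blast
 have z: "(%x. 0) : K" and add: "!!u v. u : K ==> v : K ==> (%x. u x + v x) : K" and sc: "!!a u. u : K ==> (%x. a * u x) : K"
  using K(2) unfolding subspace_mod_AE_def by blast+
 have span: "(%x. \<Sum>i<m. a i * g i x) : K" if "!!i. i < m ==> g i : K" for a g and m :: nat using that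
 proof (induction m)
  case (Suc m)
  thus ?case using add[OF _ sc, of "%x. \<Sum>i<m. a i * g i x" "g m" "a m"] by simp
 qed (simp add: z)
 obtain C :: "nat => nat => real" where C: "orthonormal mu k (%i x. \<Sum>j<k. C i j * b j x)" using Gram_Schmidt[of k b mu] b FH_L2(1)[OF H0_FH] K(1) by blast
 define e where "e = (%i x. \<Sum>j<k. C i j * b j x)"
 note on = C[folded e_def]
 have eK: "e i : K" for i unfolding e_def by(rule span[OF b(1)])
 have sK: "(%x. \<Sum>i<k. a i * e i x) : K" for a by(rule span[OF eK])
 show ?thesis
 proof (rule that[of e], unfold frame_def, intro conjI allI impI on)
  show "e i : H_qc" for i using eK K(1) by(auto simp: H0_def)
  show h: "(%x. \<Sum>i<k. a i * e i x) : H0 Om" for a using sK K(1) by blast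
  fix a :: "nat => real" assume a: "(\<Sum>i<k. (a i)^2) = 1"
  let ?u = "%x. \<Sum>i<k. a i * e i x"
  have "?u : {u : K. (LINT x:Om|mu. (u x)^2) = 1}" using sK H0_integrals(1)[OF Om h] orthonormal_L2_norm[OF on, of a] a by simp
  from SUP_upper[OF this, of "%u. ereal (LINT x:Om|mu. (D u x)^2)"] lt
  have "ereal (LINT x:Om|mu. (D ?u x)^2) < ereal L" by(rule le_less_trans)
  thus "(nrm (D ?u))^2 <= L" unfolding H0_integrals(2)[OF Om h] by simp
 qed
qed

text \<open>The span of the frame is a competitor; by orthonormality its elements of norm 1 have
  coefficients of square sum 1.\<close>

lemma eigenvalue_le_frame:
 assumes Om: "Om : sets mu" and e: "frame k L Om e"
 shows "eigenvalue k Om <= ereal L"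
proof -
 have on: "orthonormal mu k e" and h: "!!a. (%x. \<Sum>i<k. a i * e i x) : H0 Om"
  and L: "!!a. (\<Sum>i<k. (a i)^2) = 1 ==> (nrm (D (%x. \<Sum>i<k. a i * e i x)))^2 <= L" using e unfolding frame_def by blast+
 define K where "K = range (%a x. \<Sum>i<k. a i * e i x)"
 have inK: "(%x. \<Sum>i<k. a i * e i x) : K" for a by(simp add: K_def)
 have "subspace_mod_AE mu k K" unfolding subspace_mod_AE_def
 proof (intro conjI ballI allI)
  show "(%x. 0) : K" using inK[of "%i. 0"] by simp
 next
  fix u v assume "u : K" "v : K"
  then obtain a a' where "u = (%x. \<Sum>i<k. a i * e i x)" "v = (%x. \<Sum>i<k. a' i * e i x)" unfolding K_def by blast
  thus "(%x. u x + v x) : K" using inK[of "%i. a i + a' i"] by(simp add: distrib_right sum.distrib)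
 next
  fix t u assume "u : K"
  then obtain a where "u = (%x. \<Sum>i<k. a i * e i x)" unfolding K_def by blast
  thus "(%x. t * u x) : K" using inK[of "%i. t * a i"] by(simp add: sum_distrib_left mult.assoc)
 next
  have 1: "ALL i<k. e i : K"
  proof (intro allI impI)
   fix i assume i: "i < k"
   show "e i : K" using inK[of "%j. if j = i then 1 else 0"] unfolding sum_unit[OF i] .
  qed
  have 2: "a j = 0" if ae: "AE x in mu. (\<Sum>i<k. a i * e i x) = 0" and j: "j < k" for a j
  proof -
   have "AE x in mu. (\<Sum>i<k. a i * e i x) * e j x = 0" using ae by eventually_elim simp
   hence "(LINT x|mu. (\<Sum>i<k. a i * e i x) * e j x) = 0" by(rule integral_eq_zero_AE)
   thus ?thesis using orthonormal_coeff[OF on j, of a] by simp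
  qed
  have 3: "EX a. AE x in mu. u x = (\<Sum>i<k. a i * e i x)" if "u : K" for u using that unfolding K_def by auto
  show "EX b. (ALL i<k. b i : K) & (ALL a. (AE x in mu. (\<Sum>i<k. a i * b i x) = 0) --> (ALL i<k. a i = 0)) &
    (ALL u:K. EX a. AE x in mu. u x = (\<Sum>i<k. a i * b i x))" using 1 2 3 by(intro exI[of _ e]) blast
 qed
 moreover have "K <= H0 Om" using h by(auto simp: K_def)
 ultimately have "eigenvalue k Om <= (SUP u \<in> {u : K. (LINT x:Om|mu. (u x)^2) = 1}. ereal (LINT x:Om|mu. (D u x)^2))"
  unfolding eigenvalue_def by(intro INF_lower) simp
 also have "... <= ereal L"
 proof (rule SUP_least)
  fix u assume "u : {u : K. (LINT x:Om|mu. (u x)^2) = 1}"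
  then obtain a where u: "u = (%x. \<Sum>i<k. a i * e i x)" and 1: "(LINT x:Om|mu. (u x)^2) = 1" unfolding K_def by blast
  have "(\<Sum>i<k. (a i)^2) = 1" using 1 H0_integrals(1)[OF Om h] orthonormal_L2_norm[OF on, of a] unfolding u by simp
  from L[OF this] show "ereal (LINT x:Om|mu. (D u x)^2) <= ereal L" unfolding u H0_integrals(2)[OF Om h] by simp
 qed
 finally show ?thesis .
qed

proposition min_eigenvalue:
 assumes k: "k >= 1"
 shows "EX Om. admissible c Om & (ALL Om'. admissible c Om' --> eigenvalue k Om <= eigenvalue k Om')"
proof -
 define S where "S = {L. EX Om e. admissible c Om & frame k L Om e}"
 have inS: "L : S" if "admissible c Om" "eigenvalue k Om < ereal L" for L Om
  using frame_of_eigenvalue[OF admissible_measurable[OF that(1)] that(2)] that(1) unfolding S_def by blast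
 show ?thesis
 proof (cases "S = {}")
  \<comment> \<open>No admissible domain carries a frame, so every eigenvalue is infinite and the
    empty set is a minimiser.\<close>
  case True
  have "eigenvalue k Om' = \<infinity>" if "admissible c Om'" for Om' using inS[OF that] True by(intro ereal_top) (meson empty_iff not_le)
  thus ?thesis using admissible_empty[of c] by(intro exI[of _ "{}"]) auto
 next
  case False
  have S0: "0 <= L" if LS: "L : S" for L
  proof -
   obtain Om e where fr: "frame k L Om e" using LS by(auto simp: S_def)
   have "0 < k" using k by simp
   from order_trans[OF zero_le_power2 frameD(2)[OF fr this]] show ?thesis .
  qed
  have bdd: "bdd_below S" using S0 by(rule bdd_belowI)
  define l where "l = Inf S"
  let ?d = "%n. inverse (real (Suc n))"
  have "EX Om e. admissible c Om & frame k (l + ?d n) Om e" for n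
  proof -
   have "Inf S < l + ?d n" by(simp add: l_def)
   then obtain L where L: "L : S" "L < l + ?d n" using cInf_less_iff[OF False bdd] by blast
   then obtain Om e where "admissible c Om" "frame k L Om e" by(auto simp: S_def)
   moreover have "frame k (l + ?d n) Om e" using frame_mono[OF \<open>frame k L Om e\<close>] L(2) by simp
   ultimately show ?thesis by blast
  qed
  then obtain Om u where Om: "!!n. admissible c (Om n)" and u: "!!n. frame k (l + ?d n) (Om n) (u n)" by metis
  have bd: "H_norm (u n i) <= sqrt (1 + (l + 1))" if "i < k" for n i
  proof -
   have "?d n <= 1" by(simp add: inverse_le_1_iff)
   hence "(nrm (D (u n i)))^2 <= l + 1" using frameD(2)[OF u[of n] that] by linarith
   thus ?thesis unfolding H_norm_def frameD(3)[OF u that] by(intro real_sqrt_le_mono) simp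
  qed
  obtain r :: "nat => nat" and v G where r: "strict_mono r" and G: "admissible c G" and v: "!!i. i < k ==> v i : H_qc"
   "!!i x. i < k ==> x : M ==> v i x ~= 0 ==> x : G"
   "!!i. i < k ==> (%n. nrm (%x. u (r n) i x - v i x)) ----> 0" by(rule limit_domain[OF Om frameD(1)[OF u] bd]) (assumption | rule that)+
  have uL: "u n i : L2F" if "i < k" for n i using u[of n] that by(simp add: frame_def orthonormal_def)
  have vL: "v i : L2F" if "i < k" for i using v(1)[OF that] FH_L2(1)[OF H_FH] by(simp add: H_qc_def)
  have "frame k l G v" unfolding frame_def
  proof (intro conjI allI impI)
   show "orthonormal mu k v" unfolding orthonormal_def
   proof (intro conjI allI impI vL)
    fix i j assume i: "i < k" and j: "j < k"
    have lim: "(%n. LINT x|mu. u (r n) i x * u (r n) j x) ----> (LINT x|mu. v i x * v j x)"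
     by(rule L2_inner_tendsto[OF uL[OF i] uL[OF j] vL[OF i] vL[OF j] v(3)[OF i] v(3)[OF j]])
    have eq: "(LINT x|mu. u (r n) i x * u (r n) j x) = (if i = j then 1 else 0)" for n using u[of "r n"] i j unfolding frame_def orthonormal_def by blast
    show "(LINT x|mu. v i x * v j x) = (if i = j then 1 else 0)" by(rule LIMSEQ_unique[OF lim[unfolded eq] tendsto_const])
   qed
   show "v i : H_qc" if "i < k" for i by(rule v(1)[OF that])
   fix a :: "nat => real"
   have "(%x. a i * v i x) : H_qc" if "i < k" for i using H_qc_lincomb[OF v(1)[OF that] H_qc_zero, of "a i" 0] by simp
   hence "(%x. \<Sum>i<k. a i * v i x) : H_qc" by(rule H_qc_sum)
   thus "(%x. \<Sum>i<k. a i * v i x) : H0 G"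
   proof (rule H0I)
    fix x assume "x : M" "(\<Sum>i<k. a i * v i x) ~= 0"
    then obtain i where "i : {..<k}" "a i * v i x ~= 0" by(elim sum.not_neutral_contains_not_neutral)
    hence "i < k" "v i x ~= 0" by auto
    thus "x : G" using v(2) \<open>x : M\<close> by blast
   qed
   assume a: "(\<Sum>i<k. (a i)^2) = 1"
   show "(nrm (D (%x. \<Sum>i<k. a i * v i x)))^2 <= l"
   proof (rule H_weak_closed_square(2))
    show "(%x. \<Sum>i<k. a i * u (r n) i x) : H" for n using u[of "r n"] H0_H unfolding frame_def by blast
    show "(%x. \<Sum>i<k. a i * v i x) : L2F" by(intro L2_space_sum L2_space_cmult vL) simp
    show "(%n. nrm (%x. (\<Sum>i<k. a i * u (r n) i x) - (\<Sum>i<k. a i * v i x))) ----> 0" by(rule span_tendsto[OF uL vL v(3)])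
    fix e :: real assume e: "0 < e"
    have "(%n. ?d (r n)) ----> 0" using LIMSEQ_subseq_LIMSEQ[OF LIMSEQ_inverse_real_of_nat r] by(simp add: o_def)
    from order_tendstoD(2)[OF this e]
    show "eventually (%n. (nrm (D (%x. \<Sum>i<k. a i * u (r n) i x)))^2 <= l + e) sequentially"
    proof eventually_elim
     case (elim n)
     have "(nrm (D (%x. \<Sum>i<k. a i * u (r n) i x)))^2 <= l + ?d (r n)" using u[of "r n"] a unfolding frame_def by blast
     thus ?case using elim by linarith
    qed
   qed
  qed
  hence le: "eigenvalue k G <= ereal l" by(rule eigenvalue_le_frame[OF admissible_measurable[OF G]])
  \<comment> \<open>A domain with eigenvalue below \<open>l\<close> would, for a real number
    strictly in between, carry a frame with a bound below the infimum.\<close>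
  have ge: "ereal l <= eigenvalue k Om'" if "admissible c Om'" for Om'
  proof (rule ccontr)
   assume "~ ereal l <= eigenvalue k Om'"
   hence "eigenvalue k Om' < ereal l" by simp
   from ereal_dense2[OF this] obtain L where L: "eigenvalue k Om' < ereal L" "ereal L < ereal l" by(elim exE conjE)
   have "l <= L" unfolding l_def by(rule cInf_lower[OF inS[OF \<open>admissible c Om'\<close> L(1)] bdd])
   thus False using L(2) by simp
  qed
  show ?thesis by(intro exI[of _ G] conjI allI impI G order_trans[OF le ge])
 qed
qed

proposition min_dirichlet_energy:
 assumes f: "f : L2F"
 shows "EX Om. admissible c Om & (ALL Om'. admissible c Om' --> dirichlet_energy f Om <= dirichlet_energy f Om')"
proof -
 let ?n = "nrm"
 define J where "J u = 1/2 * (?n (D u))^2 + 1/2 * (?n u)^2 - (LINT x|mu. u x * f x)" for u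
 have DE: "dirichlet_energy f Om = (INF u \<in> H0 Om. ereal (J u))" if "admissible c Om" for Om unfolding dirichlet_energy_def J_def
  using H0_integrals(3)[OF admissible_measurable[OF that] _ L2_spaceD(1)[OF f]] H0_integrals(1,2)[OF admissible_measurable[OF that]] by(intro INF_cong) auto
 have CS: "(LINT x|mu. u x * f x) <= ?n u * ?n f" if "u : H0 Om" for u Om using L2_Cauchy_Schwarz[OF FH_L2(1)[OF H0_FH[OF that]] f] by linarith
 have J_ge: "- 1/2 * (?n f)^2 <= J u" if "u : H0 Om" for u Om
 proof -
  have "?n u * ?n f <= 1/2 * (?n u)^2 + 1/2 * (?n f)^2" using sum_squares_bound[of "?n u" "?n f"] by simp
  moreover have "0 <= (?n (D u))^2" by simp
  ultimately show ?thesis using CS[OF that] unfolding J_def by linarith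
 qed
 \<comment> \<open>Coercivity: the linear term is absorbed by Young's inequality, so a bound on
   \<open>J\<close> bounds the norm of \<open>H\<close>.\<close>
 have H_bd: "(H_norm u)^2 <= 4 * J u + 4 * (?n f)^2" if "u : H0 Om" for u Om
 proof -
  have "2 * (?n u * ?n f) <= 1/2 * (?n u)^2 + 2 * (?n f)^2" using sum_squares_bound[of "?n u / 2" "?n f"] by(simp add: power_divide)
  moreover have "0 <= (?n (D u))^2" by simp
  moreover have "4 * J u = 2 * (?n (D u))^2 + 2 * (?n u)^2 - 4 * (LINT x|mu. u x * f x)" by(simp add: J_def)
  ultimately show ?thesis using CS[OF that] unfolding H_norm_power2 by linarith
 qed
 define S where "S = {J u | u Om. admissible c Om & u : H0 Om}"
 have "(%x. 0) : H0 {}" by(rule H0I[OF H_qc_zero]) simp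
 hence ne: "S ~= {}" unfolding S_def using admissible_empty by blast
 have bdd: "bdd_below S" unfolding S_def by(intro bdd_belowI[of _ "- 1/2 * (?n f)^2"]) (use J_ge in auto)
 define l where "l = Inf S"
 let ?d = "%n. inverse (real (Suc n))"
 have "EX Om u. admissible c Om & u : H0 Om & J u < l + ?d n" for n
 proof -
  have "Inf S < l + ?d n" by(simp add: l_def)
  then obtain t where "t : S" "t < l + ?d n" using cInf_less_iff[OF ne bdd] by blast
  thus ?thesis unfolding S_def by blast
 qed
 then obtain Om u where Om: "!!n. admissible c (Om n)" and u: "!!n. u n : H0 (Om n)" and Ju: "!!n. J (u n) < l + ?d n" by metis
 let ?B = "4 * l + 4 + 4 * (?n f)^2"
 have B: "H_norm (u n) <= sqrt ?B" for n
 proof (rule real_le_rsqrt)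
  have "?d n <= 1" by(simp add: inverse_le_1_iff)
  thus "(H_norm (u n))^2 <= ?B" using H_bd[OF u[of n]] Ju[of n] by linarith
 qed
 obtain r :: "nat => nat" and w :: "nat => 'm => real" and G where r: "strict_mono r" and G: "admissible c G" and w: "!!i. i < 1 ==> w i : H_qc"
   "!!i x. i < 1 ==> x : M ==> w i x ~= 0 ==> x : G"
   "!!i. i < 1 ==> (%n. ?n (%x. u (r n) x - w i x)) ----> 0" by(rule limit_domain[of c Om 1 "%n i. u n" "sqrt ?B", OF Om u B]) (rule that)
 define v where "v = w 0"
 have v: "v : H0 G" unfolding v_def using w(2)[of 0] by(intro H0I[OF w(1)]) auto
 have uv: "(%n. ?n (%x. u (r n) x - v x)) ----> 0" unfolding v_def by(rule w(3)) simp
 note uL = FH_L2(1)[OF H0_FH[OF u]] and vL = FH_L2(1)[OF H0_FH[OF v]]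
 \<comment> \<open>The bound on the squared gradient norm that is equivalent to
   \<open>J v <= l\<close>. That norm is only lower semicontinuous, while the two other terms of
   \<open>J\<close> converge along the sequence, so the bound on \<open>J (u n)\<close> can be
   solved for it.\<close>
 define R where "R = 2 * l - (?n v)^2 + 2 * (LINT x|mu. v x * f x)"
 have "(?n (D v))^2 <= R"
 proof (rule H_weak_closed_square(2)[OF H0_H[OF u] vL uv])
  fix e :: real assume e: "0 < e"
  have ff: "(%n. ?n (%x. f x - f x)) ----> 0" by(simp add: L2_norm_def)
  have "(%n. ?d (r n)) ----> 0" using LIMSEQ_subseq_LIMSEQ[OF LIMSEQ_inverse_real_of_nat r] by(simp add: o_def)
  hence "(%n. 2 * l + 2 * ?d (r n) - (?n (u (r n)))^2 + 2 * (LINT x|mu. u (r n) x * f x)) ----> 2 * l + 2 * 0 - (?n v)^2 + 2 * (LINT x|mu. v x * f x)"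
   by(intro tendsto_add tendsto_diff tendsto_mult tendsto_const tendsto_power L2_norm_tendsto[OF uL vL uv] L2_inner_tendsto[OF uL f vL f uv ff])
  from order_tendstoD(2)[OF this, of "R + e"] e
  have "eventually (%n. 2 * l + 2 * ?d (r n) - (?n (u (r n)))^2 + 2 * (LINT x|mu. u (r n) x * f x) < R + e) sequentially" by(simp add: R_def)
  thus "eventually (%n. (?n (D (u (r n))))^2 <= R + e) sequentially"
  proof eventually_elim
   case (elim n)
   thus ?case using Ju[of "r n"] unfolding J_def by linarith
  qed
 qed
 hence Jv: "J v <= l" unfolding J_def R_def by linarith
 have "dirichlet_energy f G <= ereal (J v)" unfolding DE[OF G] by(rule INF_lower[OF v])
 also have "... <= ereal l" using Jv by simp
 finally have le: "dirichlet_energy f G <= ereal l" .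
 have ge: "ereal l <= dirichlet_energy f Om'" if Om': "admissible c Om'" for Om' unfolding DE[OF Om']
 proof (rule INF_greatest)
  fix u assume "u : H0 Om'"
  hence "J u : S" using Om' unfolding S_def by blast
  thus "ereal l <= ereal (J u)" unfolding l_def using bdd by(simp add: cInf_lower)
 qed
 show ?thesis by(intro exI[of _ G] conjI allI impI G order_trans[OF le ge])
qed

end

theorem theorem2p6:
  fixes T :: "'m topology"
    and A :: "('m, 'e::euclidean_space) chart set"
    and F :: "'m \<Rightarrow> ('m, 'e) tangent \<Rightarrow> real"
    and k :: nat and c :: real and f :: "'m \<Rightarrow> real"
  assumes "finsler_manifold T A F"
    and "compact_space T"
    and "k \<ge> 1"
    and "0 < c"
    and "ennreal c \<le> emeasure (finsler_manifold.BH_measure T A F) (topspace T)"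
    and "f \<in> L2_space (finsler_manifold.BH_measure T A F)"
  shows "(\<exists>\<Omega>. finsler_manifold.admissible T A F c \<Omega> \<and>
            (\<forall>\<Omega>'. finsler_manifold.admissible T A F c \<Omega>' \<longrightarrow>
               finsler_manifold.eigenvalue T A F k \<Omega> \<le> finsler_manifold.eigenvalue T A F k \<Omega>')) \<and>
         (\<exists>\<Omega>. finsler_manifold.admissible T A F c \<Omega> \<and>
            (\<forall>\<Omega>'. finsler_manifold.admissible T A F c \<Omega>' \<longrightarrow>
               finsler_manifold.dirichlet_energy T A F f \<Omega> \<le>
               finsler_manifold.dirichlet_energy T A F f \<Omega>'))"
proof -
  interpret compact_finsler T A F
    by (rule compact_finsler.intro[OF assms(1) compact_finsler_axioms.intro[OF assms(2)]])
  show ?thesis using min_eigenvalue[OF assms(3), of c] min_dirichlet_energy[OF assms(6), of c] by (rule conjI)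
qed

end
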